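(* Let $\Gamma$ be a compact connected metric graph, let $\kappa\in L_\infty(\Gamma)$ satisfy $\operatorname{ess\,inf}_\Gamma\kappa\ge\kappa_0>0$, and let $a:\Gamma\to\mathbb R$ be Lipschitz and positive. Let $L_0$ be the operator on $L_2(\Gamma)$ acting on each edge by $(L_0u)_e=-(a_eu_e')'+\kappa_e^2u_e$ with Kirchhoff vertex conditions, i.e. with domain $$D(L_0)=\Big\{u\in\widetilde H^2(\Gamma): u\in C(\Gamma),\ \sum_{e\in\mathcal E_v}\partial_eu(v)=0\ \ \forall v\in\mathcal V\Big\}.$$ Let $0<\beta\le2$ with $\beta\ne\frac32$. Then $\dot H^{1/2}_{L_0}(\Gamma)\cong H^{1/2}(\Gamma)$ and $$\dot H^\beta_{L_0}(\Gamma)\cong\begin{cases}H^\beta(\Gamma)\cong\widetilde H^\beta(\Gamma), & 0<\beta<\frac12,\\ H^\beta(\Gamma)\cong\widetilde H^\beta(\Gamma)\cap C(\Gamma), & \frac12<\beta<\frac32,\\ H^\beta(\Gamma)\cap K^\beta(\Gamma)\cong\widetilde H^\beta(\Gamma)\cap C(\Gamma)\cap K^\beta(\Gamma), & \frac32<\beta\le2,\end{cases}$$ where the isomorphisms displayed inside the cases are part of the statement and $$K^\beta(\Gamma)=\Big\{u\in\widetilde H^\beta(\Gamma):\ \forall v\in\mathcal V,\ \sum_{e\in\mathcal E_v}\partial_eu(v)=0\Big\}.$$ Furthermore, if $\beta>\frac12$ and $\widetilde\beta:=\beta-\frac12$ when $\beta\le1$, $\widetilde\beta:=\frac12$ when $\beta>1$,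 then $\dot H^\beta_{L_0}(\Gamma)\hookrightarrow C^{0,\widetilde\beta}(\Gamma)$.
   Context: A compact metric graph $\Gamma$ consists of a finite vertex set $\mathcal V$ and a finite edge set $\mathcal E$ (loops and multiple edges allowed); each edge $e$ is identified with $[0,l_e]$, $0<l_e<\infty$; $d$ is the shortest-path metric. $\mathcal E_v$ is the set of edges incident to $v$ (a loop at $v$ counted twice). $u_e$ is the restriction of $u$ to $e$. $\partial_eu(v)$ is the derivative of $u$ along $e$ at $v$ in the direction away from $v$ ($u_e'(0)$ if $v$ sits at $0$, $-u_e'(l_e)$ if $v$ sits at $l_e$), understood as a trace. Spaces: $L_2(\Gamma)=\bigoplus_eL_2(e)$; $C(\Gamma)$ is the space of continuous functions on $\Gamma$; for $r\in\mathbb N$, $\widetilde H^r(\Gamma)=\bigoplus_eH^r(e)$ with $\|u\|^2=\sum_e\|u_e\|^2_{H^r(e)}$, and $\widetilde H^r_C(\Gamma)=\widetilde H^r(\Gamma)\cap C(\Gamma)$ with the same norm; $H^1(\Gamma)=\widetilde H^1_C(\Gamma)$, $H^2(\Gamma)=\widetilde H^2_C(\Gamma)$. For Hilbert spaces $H_1\subset H_0$ and $0<\theta<1$, $(H_0,H_1)_\theta$ is the real ($K$-method, exponent 2) interpolation space, with norm (up to a constant) $\big(\int_0^\infty t^{-2\theta-1}K(t,\phi)^2dt\big)^{1/2}$, $K(t,\phi)^2=\inf\{\|\phi_0\|_{H_0}^2+t^2\|\phi_1\|_{H_1}^2:\phi=\phi_0+\phi_1\}$. For $0<s<1$: $H^s(\Gamma)=(L_2(\Gamma),H^1(\Gamma))_s$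 and $\widetilde H^s(\Gamma)=(L_2(\Gamma),\widetilde H^1(\Gamma))_s$. For $1<s<2$: $H^s(\Gamma)=(H^1(\Gamma),\widetilde H^2_C(\Gamma))_{s-1}$ and $\widetilde H^s(\Gamma)=(\widetilde H^1(\Gamma),\widetilde H^2(\Gamma))_{s-1}$. Intersections with $C(\Gamma)$ or $K^\beta(\Gamma)$ carry the norm of $H^\beta(\Gamma)$, respectively $\widetilde H^\beta(\Gamma)$. $L_0$ is self-adjoint and positive definite with compact inverse; with orthonormal eigenbasis $\{e_k\}$ and eigenvalues $\lambda_k$, $\dot H^s_{L_0}(\Gamma)=\{u\in L_2(\Gamma):\|u\|^2_{\dot H^s_{L_0}}=\sum_k\lambda_k^s(u,e_k)^2<\infty\}$ for $s\ge0$. $C^{0,\gamma}(\Gamma)$ is the space of functions with finite norm $\sup|\phi|+\sup_{x\ne y}|\phi(x)-\phi(y)|/d(x,y)^\gamma$. $E\hookrightarrow F$ means $E\subset F$ with $\|f\|_F\le C\|f\|_E$; $E\cong F$ means $E\hookrightarrow F\hookrightarrow E$ (equal as sets with equivalent norms). *)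

theory Defs
  imports "HOL-Analysis.Analysis"
begin

text \<open>
  Elements of function spaces are represented by functions, and all spaces below are closed under
  almost everywhere equality, with norms that do not distinguish functions that agree almost
  everywhere. In particular \<open>u \<in> cont_space G\<close> means that \<open>u\<close> has a continuous representative.
\<close>

section \<open>Compact metric graphs\<close>

record ('v, 'e) metric_graph =
  verts :: "'v set"
  edges :: "'e set"
  src :: "'e \<Rightarrow> 'v"   (* the vertex at the end 0 of the interval [0, len e] *)
  tgt :: "'e \<Rightarrow> 'v"   (* the vertex at the end len e *)
  len :: "'e \<Rightarrow> real"

definition compact_metric_graph :: "('v, 'e) metric_graph \<Rightarrow> bool" where
  "compact_metric_graph G \<longleftrightarrow> finite (verts G) \<and> finite (edges G) \<and>
     (\<forall>e\<in>edges G. src G e \<in> verts G \<and> tgt G e \<in> verts G \<and> 0 < len G e)"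

datatype ('v, 'e) point = Vertex 'v | Interior 'e real

definition points :: "('v, 'e) metric_graph \<Rightarrow> ('v, 'e) point set" where
  "points G = Vertex ` verts G \<union> {Interior e x | e x. e \<in> edges G \<and> 0 < x \<and> x < len G e}"

text \<open>The point of the graph with coordinate \<open>x \<in> [0, len e]\<close> on the edge \<open>e\<close>.\<close>

definition edge_point :: "('v, 'e) metric_graph \<Rightarrow> 'e \<Rightarrow> real \<Rightarrow> ('v, 'e) point" where
  "edge_point G e x =
     (if x = 0 then Vertex (src G e) else if x = len G e then Vertex (tgt G e) else Interior e x)"

definition restr :: "('v, 'e) metric_graph \<Rightarrow> (('v, 'e) point \<Rightarrow> real) \<Rightarrow> 'e \<Rightarrow> real \<Rightarrow> real" where
  "restr G u e = (\<lambda>x. u (edge_point G e x))"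

text \<open>
  A path is a list of segments \<open>(e, x, y)\<close>, each running along the edge \<open>e\<close> from the coordinate
  \<open>x\<close> to the coordinate \<open>y\<close>.
\<close>

fun is_path :: "('v, 'e) metric_graph \<Rightarrow> ('v, 'e) point \<Rightarrow> ('e \<times> real \<times> real) list \<Rightarrow>
    ('v, 'e) point \<Rightarrow> bool" where
  "is_path G p [] q \<longleftrightarrow> p = q"
| "is_path G p ((e, x, y) # s) q \<longleftrightarrow>
     e \<in> edges G \<and> x \<in> {0..len G e} \<and> y \<in> {0..len G e} \<and> p = edge_point G e x \<and>
     is_path G (edge_point G e y) s q"

definition path_length :: "('e \<times> real \<times> real) list \<Rightarrow> real" where
  "path_length s = (\<Sum>(e, x, y)\<leftarrow>s. \<bar>x - y\<bar>)"

definition connected_graph :: "('v, 'e) metric_graph \<Rightarrow> bool" where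
  "connected_graph G \<longleftrightarrow> (\<forall>p\<in>points G. \<forall>q\<in>points G. \<exists>s. is_path G p s q)"

definition gdist :: "('v, 'e) metric_graph \<Rightarrow> ('v, 'e) point \<Rightarrow> ('v, 'e) point \<Rightarrow> real" where
  "gdist G p q = Inf {path_length s | s. is_path G p s q}"

definition continuous_on_graph :: "('v, 'e) metric_graph \<Rightarrow> (('v, 'e) point \<Rightarrow> real) \<Rightarrow> bool" where
  "continuous_on_graph G u \<longleftrightarrow> (\<forall>p\<in>points G. \<forall>\<epsilon>>0. \<exists>\<delta>>0. \<forall>q\<in>points G.
     gdist G p q < \<delta> \<longrightarrow> \<bar>u q - u p\<bar> < \<epsilon>)"

definition lipschitz_on_graph :: "('v, 'e) metric_graph \<Rightarrow> (('v, 'e) point \<Rightarrow> real) \<Rightarrow> bool" where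
  "lipschitz_on_graph G u \<longleftrightarrow>
     (\<exists>L. \<forall>p\<in>points G. \<forall>q\<in>points G. \<bar>u p - u q\<bar> \<le> L * gdist G p q)"

definition ae_on_graph :: "('v, 'e) metric_graph \<Rightarrow> (('v, 'e) point \<Rightarrow> bool) \<Rightarrow> bool" where
  "ae_on_graph G P \<longleftrightarrow> (\<forall>e\<in>edges G. AE x in lebesgue_on {0..len G e}. P (edge_point G e x))"

definition Linf :: "('v, 'e) metric_graph \<Rightarrow> (('v, 'e) point \<Rightarrow> real) set" where
  "Linf G = {u. (\<forall>e\<in>edges G. restr G u e \<in> borel_measurable (lebesgue_on {0..len G e})) \<and>
     (\<exists>B. ae_on_graph G (\<lambda>p. \<bar>u p\<bar> \<le> B))}"

section \<open>Normed function spaces, embeddings and real interpolation\<close>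

record 'a function_space =
  fs_carrier :: "'a set"
  fs_norm :: "'a \<Rightarrow> real"

definition embeds :: "'a function_space \<Rightarrow> 'a function_space \<Rightarrow> bool" (infix "\<hookrightarrow>" 50) where
  "E \<hookrightarrow> F \<longleftrightarrow> fs_carrier E \<subseteq> fs_carrier F \<and>
     (\<exists>C. \<forall>u\<in>fs_carrier E. fs_norm F u \<le> C * fs_norm E u)"

definition fs_iso :: "'a function_space \<Rightarrow> 'a function_space \<Rightarrow> bool" (infix "\<cong>" 50) where
  "E \<cong> F \<longleftrightarrow> E \<hookrightarrow> F \<and> F \<hookrightarrow> E"

definition fs_inter :: "'a function_space \<Rightarrow> 'a set \<Rightarrow> 'a function_space" (infixl "\<sqinter>\<^sub>s" 65) where
  "E \<sqinter>\<^sub>s S = \<lparr>fs_carrier = fs_carrier E \<inter> S, fs_norm = fs_norm E\<rparr>"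

text \<open>
  The square of the K-functional. Since the spaces are closed under almost everywhere equality,
  pointwise decompositions \<open>\<phi> = \<phi>0 + \<phi>1\<close> give the same infimum as decompositions that hold
  almost everywhere.
\<close>

definition K_sq :: "('p \<Rightarrow> real) function_space \<Rightarrow> ('p \<Rightarrow> real) function_space \<Rightarrow>
    real \<Rightarrow> ('p \<Rightarrow> real) \<Rightarrow> real" where
  "K_sq H0 H1 t \<phi> = Inf {(fs_norm H0 \<phi>0)\<^sup>2 + t\<^sup>2 * (fs_norm H1 \<phi>1)\<^sup>2 | \<phi>0 \<phi>1.
     \<phi>0 \<in> fs_carrier H0 \<and> \<phi>1 \<in> fs_carrier H1 \<and> \<phi> = (\<lambda>p. \<phi>0 p + \<phi>1 p)}"

definition interp_sq :: "('p \<Rightarrow> real) function_space \<Rightarrow> ('p \<Rightarrow> real) function_space \<Rightarrow>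
    real \<Rightarrow> ('p \<Rightarrow> real) \<Rightarrow> ennreal" where
  "interp_sq H0 H1 \<theta> \<phi> =
     (\<integral>\<^sup>+ t\<in>{0<..}. ennreal (t powr (- 2 * \<theta> - 1) * K_sq H0 H1 t \<phi>) \<partial>lborel)"

text \<open>The interpolation space \<open>(H0, H1)\<^sub>\<theta>\<close> for \<open>H1 \<subseteq> H0\<close>, so that \<open>H0 + H1 = H0\<close>.\<close>

definition interp :: "('p \<Rightarrow> real) function_space \<Rightarrow> ('p \<Rightarrow> real) function_space \<Rightarrow>
    real \<Rightarrow> ('p \<Rightarrow> real) function_space" where
  "interp H0 H1 \<theta> = \<lparr>fs_carrier = {\<phi> \<in> fs_carrier H0. interp_sq H0 H1 \<theta> \<phi> < \<infinity>},
     fs_norm = (\<lambda>\<phi>. sqrt (enn2real (interp_sq H0 H1 \<theta> \<phi>)))\<rparr>"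

section \<open>Sobolev spaces on an interval\<close>

definition L2_int :: "real \<Rightarrow> (real \<Rightarrow> real) set" where
  "L2_int l = {f \<in> borel_measurable (lebesgue_on {0..l}).
     integrable (lebesgue_on {0..l}) (\<lambda>x. (f x)\<^sup>2)}"

text \<open>Weak derivatives on \<open>(0, l)\<close>, with the test functions \<open>\<phi>\<close> ranging over \<open>C\<^sub>c\<^sup>1((0, l))\<close>.\<close>

definition weak_deriv :: "real \<Rightarrow> (real \<Rightarrow> real) \<Rightarrow> (real \<Rightarrow> real) \<Rightarrow> bool" where
  "weak_deriv l f g \<longleftrightarrow> (\<forall>\<phi> \<phi>'. (\<forall>x. (\<phi> has_real_derivative \<phi>' x) (at x)) \<and>
       continuous_on UNIV \<phi>' \<and> (\<exists>c d. 0 < c \<and> d < l \<and> (\<forall>x. x \<notin> {c..d} \<longrightarrow> \<phi> x = 0)) \<longrightarrow>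
     (LINT x|lebesgue_on {0..l}. f x * \<phi>' x) = - (LINT x|lebesgue_on {0..l}. g x * \<phi> x))"

fun sobolev_int :: "real \<Rightarrow> nat \<Rightarrow> (real \<Rightarrow> real) set" where
  "sobolev_int l 0 = L2_int l"
| "sobolev_int l (Suc r) = {f \<in> L2_int l. \<exists>g\<in>sobolev_int l r. weak_deriv l f g}"

text \<open>The weak derivative is determined up to a null set; \<open>wderiv\<close> picks a representative.\<close>

definition wderiv :: "real \<Rightarrow> (real \<Rightarrow> real) \<Rightarrow> real \<Rightarrow> real" where
  "wderiv l f = (SOME g. g \<in> L2_int l \<and> weak_deriv l f g)"

definition sobolev_int_sq :: "real \<Rightarrow> nat \<Rightarrow> (real \<Rightarrow> real) \<Rightarrow> real" where
  "sobolev_int_sq l r f = (\<Sum>j\<le>r. LINT x|lebesgue_on {0..l}. (((wderiv l ^^ j) f) x)\<^sup>2)"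

text \<open>The value at the endpoint \<open>c\<close> of the continuous representative of \<open>f\<close>.\<close>

definition trace_int :: "real \<Rightarrow> (real \<Rightarrow> real) \<Rightarrow> real \<Rightarrow> real" where
  "trace_int l f c = (THE y. \<exists>h. continuous_on {0..l} h \<and>
     (AE x in lebesgue_on {0..l}. f x = h x) \<and> y = h c)"

section \<open>Function spaces on a metric graph\<close>

definition L2_inner :: "('v, 'e) metric_graph \<Rightarrow> (('v, 'e) point \<Rightarrow> real) \<Rightarrow>
    (('v, 'e) point \<Rightarrow> real) \<Rightarrow> real" where
  "L2_inner G u w = (\<Sum>e\<in>edges G. LINT x|lebesgue_on {0..len G e}. restr G u e x * restr G w e x)"

definition L2_space :: "('v, 'e) metric_graph \<Rightarrow> (('v, 'e) point \<Rightarrow> real) function_space" where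
  "L2_space G = \<lparr>fs_carrier = {u. \<forall>e\<in>edges G. restr G u e \<in> L2_int (len G e)},
     fs_norm = (\<lambda>u. sqrt (L2_inner G u u))\<rparr>"

definition cont_space :: "('v, 'e) metric_graph \<Rightarrow> (('v, 'e) point \<Rightarrow> real) set" where
  "cont_space G = {u. \<exists>f. continuous_on_graph G f \<and> ae_on_graph G (\<lambda>p. u p = f p)}"

text \<open>The decoupled space \<open>\<Oplus>\<^sub>e H\<^sup>r(e)\<close> for an integer \<open>r\<close>.\<close>

definition Htilde_int :: "('v, 'e) metric_graph \<Rightarrow> nat \<Rightarrow> (('v, 'e) point \<Rightarrow> real) function_space"
  where
  "Htilde_int G r = \<lparr>fs_carrier = {u. \<forall>e\<in>edges G. restr G u e \<in> sobolev_int (len G e) r},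
     fs_norm = (\<lambda>u. sqrt (\<Sum>e\<in>edges G. sobolev_int_sq (len G e) r (restr G u e)))\<rparr>"

text \<open>
  The scales \<open>H\<^sup>s\<close> and its decoupled version. They are meaningful for \<open>0 < s \<le> 2\<close> only; the values
  for other \<open>s\<close> are junk.
\<close>

definition Htilde :: "('v, 'e) metric_graph \<Rightarrow> real \<Rightarrow> (('v, 'e) point \<Rightarrow> real) function_space" where
  "Htilde G s =
     (if s = 1 then Htilde_int G 1
      else if s = 2 then Htilde_int G 2
      else if s < 1 then interp (L2_space G) (Htilde_int G 1) s
      else interp (Htilde_int G 1) (Htilde_int G 2) (s - 1))"

definition Hs :: "('v, 'e) metric_graph \<Rightarrow> real \<Rightarrow> (('v, 'e) point \<Rightarrow> real) function_space" where
  "Hs G s =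
     (if s = 1 then Htilde_int G 1 \<sqinter>\<^sub>s cont_space G
      else if s = 2 then Htilde_int G 2 \<sqinter>\<^sub>s cont_space G
      else if s < 1 then interp (L2_space G) (Htilde_int G 1 \<sqinter>\<^sub>s cont_space G) s
      else interp (Htilde_int G 1 \<sqinter>\<^sub>s cont_space G) (Htilde_int G 2 \<sqinter>\<^sub>s cont_space G) (s - 1))"

text \<open>
  The sum over the edges incident to \<open>v\<close> of the derivatives of \<open>u\<close> at \<open>v\<close> directed away from
  \<open>v\<close>. A loop at \<open>v\<close> contributes to both sums.
\<close>

definition kirchhoff_sum :: "('v, 'e) metric_graph \<Rightarrow> (('v, 'e) point \<Rightarrow> real) \<Rightarrow> 'v \<Rightarrow> real" where
  "kirchhoff_sum G u v =
     (\<Sum>e | e \<in> edges G \<and> src G e = v. trace_int (len G e) (wderiv (len G e) (restr G u e)) 0) +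
     (\<Sum>e | e \<in> edges G \<and> tgt G e = v.
        - trace_int (len G e) (wderiv (len G e) (restr G u e)) (len G e))"

definition K_space :: "('v, 'e) metric_graph \<Rightarrow> real \<Rightarrow> (('v, 'e) point \<Rightarrow> real) set" where
  "K_space G \<beta> = {u \<in> fs_carrier (Htilde G \<beta>). \<forall>v\<in>verts G. kirchhoff_sum G u v = 0}"

definition holder_enorm :: "('v, 'e) metric_graph \<Rightarrow> real \<Rightarrow> (('v, 'e) point \<Rightarrow> real) \<Rightarrow> ennreal"
  where
  "holder_enorm G \<gamma> \<phi> = (SUP p\<in>points G. ennreal \<bar>\<phi> p\<bar>) +
     (SUP (p, q)\<in>{(p, q). p \<in> points G \<and> q \<in> points G \<and> p \<noteq> q}.
        ennreal (\<bar>\<phi> p - \<phi> q\<bar> / gdist G p q powr \<gamma>))"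

text \<open>
  The infimum makes the norm a function of the almost everywhere class. In a connected graph with
  at least one edge the Hoelder continuous representative is unique on the graph, and the infimum is
  its norm.
\<close>

definition holder_space :: "('v, 'e) metric_graph \<Rightarrow> real \<Rightarrow>
    (('v, 'e) point \<Rightarrow> real) function_space" where
  "holder_space G \<gamma> = \<lparr>
     fs_carrier = {u. \<exists>\<phi>. ae_on_graph G (\<lambda>p. u p = \<phi> p) \<and> holder_enorm G \<gamma> \<phi> < \<infinity>},
     fs_norm = (\<lambda>u. enn2real (INF \<phi>\<in>{\<phi>. ae_on_graph G (\<lambda>p. u p = \<phi> p)}. holder_enorm G \<gamma> \<phi>))\<rparr>"

section \<open>The operator with Kirchhoff vertex conditions and its spectral scale\<close>

definition L0_dom :: "('v, 'e) metric_graph \<Rightarrow> (('v, 'e) point \<Rightarrow> real) set" where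
  "L0_dom G = {u \<in> fs_carrier (Htilde_int G 2). u \<in> cont_space G \<and>
     (\<forall>v\<in>verts G. kirchhoff_sum G u v = 0)}"

text \<open>The value at the vertices, a null set, is irrelevant.\<close>

definition L0 :: "('v, 'e) metric_graph \<Rightarrow> (('v, 'e) point \<Rightarrow> real) \<Rightarrow> (('v, 'e) point \<Rightarrow> real) \<Rightarrow>
    (('v, 'e) point \<Rightarrow> real) \<Rightarrow> ('v, 'e) point \<Rightarrow> real" where
  "L0 G a \<kappa> u p = (case p of
       Vertex v \<Rightarrow> 0
     | Interior e x \<Rightarrow>
         - wderiv (len G e) (\<lambda>y. restr G a e y * wderiv (len G e) (restr G u e) y) x
         + (restr G \<kappa> e x)\<^sup>2 * restr G u e x)"

text \<open>
  An orthonormal basis of \<open>L\<^sub>2\<close> of eigenfunctions \<open>ev k\<close> with eigenvalues \<open>ew k\<close>. The index set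
  \<open>K\<close> is infinite unless the graph has no edges, in which case \<open>L\<^sub>2\<close> is trivial and \<open>K\<close> is empty.
\<close>

definition orthonormal_eigenbasis :: "('v, 'e) metric_graph \<Rightarrow> (('v, 'e) point \<Rightarrow> real) \<Rightarrow>
    (('v, 'e) point \<Rightarrow> real) \<Rightarrow> nat set \<Rightarrow> (nat \<Rightarrow> ('v, 'e) point \<Rightarrow> real) \<Rightarrow> (nat \<Rightarrow> real) \<Rightarrow> bool"
  where
  "orthonormal_eigenbasis G a \<kappa> K ev ew \<longleftrightarrow>
     (\<forall>k\<in>K. ev k \<in> L0_dom G \<and> ae_on_graph G (\<lambda>p. L0 G a \<kappa> (ev k) p = ew k * ev k p)) \<and>
     (\<forall>j\<in>K. \<forall>k\<in>K. L2_inner G (ev j) (ev k) = (if j = k then 1 else 0)) \<and>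
     (\<forall>u\<in>fs_carrier (L2_space G).
        (\<lambda>n. fs_norm (L2_space G) (\<lambda>p. u p - (\<Sum>k | k \<in> K \<and> k < n. L2_inner G u (ev k) * ev k p)))
        \<longlonglongrightarrow> 0)"

definition dotH :: "('v, 'e) metric_graph \<Rightarrow> nat set \<Rightarrow> (nat \<Rightarrow> ('v, 'e) point \<Rightarrow> real) \<Rightarrow>
    (nat \<Rightarrow> real) \<Rightarrow> real \<Rightarrow> (('v, 'e) point \<Rightarrow> real) function_space" where
  "dotH G K ev ew s = \<lparr>
     fs_carrier = {u \<in> fs_carrier (L2_space G).
       (\<lambda>k. ew k powr s * (L2_inner G u (ev k))\<^sup>2) summable_on K},
     fs_norm = (\<lambda>u. sqrt (\<Sum>\<^sub>\<infinity>k\<in>K. ew k powr s * (L2_inner G u (ev k))\<^sup>2))\<rparr>"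

end

theory Submission
  imports Defs
begin

text \<open>
  All spaces are real interpolation spaces. Evaluating the K-functional at \<open>t = 2\<^sup>-\<^sup>j\<close> only, an
  element of \<open>(X\<^sub>0, X\<^sub>1)\<^sub>\<theta>\<close> is a sequence of approximants \<open>\<psi>\<^sub>j \<in> X\<^sub>1\<close> with
  \<open>\<Sum>\<^sub>j 4\<^sup>j\<^sup>\<theta> (\<parallel>\<phi> - \<psi>\<^sub>j\<parallel>\<^sup>2 + 4\<^sup>-\<^sup>j \<parallel>\<psi>\<^sub>j\<parallel>\<^sup>2) < \<infinity>\<close>. If \<open>Y\<^sub>1 \<subseteq> X\<^sub>1\<close> is cut out by finitely many
  functionals \<open>\<tau>\<close> of trace type, \<open>\<tau>(u)\<^sup>2 \<le> C (2\<^sup>j \<parallel>u\<parallel>\<^sub>0\<^sup>2 + 2\<^sup>-\<^sup>j \<parallel>u\<parallel>\<^sub>1\<^sup>2)\<close>, then \<open>\<psi>\<^sub>j\<close> is moved into \<open>Y\<^sub>1\<close>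
  by subtracting \<open>\<tau>(\<psi>\<^sub>j)\<close> times a dual function concentrated within distance \<open>2\<^sup>-\<^sup>j\<close> of the vertex.
  The correction is summable by a discrete Hardy inequality, from one end if \<open>\<theta> < 1/2\<close> and, when
  \<open>\<tau>(\<psi>\<^sub>j) \<rightarrow> \<tau>(\<phi>) = 0\<close>, from the other end if \<open>\<theta> > 1/2\<close>. With \<open>\<tau>\<close> the mismatches of the vertex values
  this relates the decoupled to the coupled scale, and with \<open>\<tau>\<close> the Kirchhoff sums it relates the
  couple \<open>(H\<^sup>1, H\<^sup>2)\<close> to \<open>(H\<^sup>1, D(L\<^sub>0))\<close>. On the spectral side, the scale of \<open>L\<^sub>0\<close> interpolates because it
  is a weighted \<open>\<ell>\<^sup>2\<close> scale, and its integer members are identified with \<open>L\<^sub>2\<close>, \<open>H\<^sup>1\<close> (coercivity of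
  the quadratic form) and \<open>D(L\<^sub>0)\<close> (elliptic regularity).
\<close>

text \<open>The value \<theta> = 1/2 is critical because a trace costs half of the step between the
  two spaces of a couple: trace increments are summable with the weight
  \<open>(4 powr \<theta> / 2) ^ j\<close>, whose ratio is 1 exactly there. With \<theta> = \<beta>
  and \<theta> = \<beta> - 1 this produces the thresholds 1/2 and 3/2. The spectral identification
  at \<beta> = 1/2 survives because there L2 and continuous H^1 are compared only with their
  spectral counterparts, and nothing has to be corrected. Between 1 and 2 the passage from the
  decoupled to the coupled scale has no threshold: vertex values are bounded on H^1, so one
  correction at the fixed scale j = 0 works for all j. A technical obstacle is that
  \<open>wderiv\<close> is an arbitrary choice of representative, hence linear only almost
  everywhere. Calculus is therefore done with pairs \<open>prim l h g\<close> of a continuous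
  function and its derivative, and a space enters interpolation only through the quadratic
  inequality of \<open>quad_space\<close>.\<close>

abbreviation leb :: "real \<Rightarrow> real measure" where
  "leb l \<equiv> lebesgue_on {0..l}"

abbreviation fs_sq :: "'a function_space \<Rightarrow> 'a \<Rightarrow> real" where
  "fs_sq X u \<equiv> (fs_norm X u)\<^sup>2"

section \<open>Square integrable functions on an interval\<close>

definition nsq :: "real \<Rightarrow> (real \<Rightarrow> real) \<Rightarrow> real" where
  "nsq l f = (LINT x|leb l. (f x)\<^sup>2)"

lemma nsq_nonneg [simp]: "0 \<le> nsq l f"
  by (simp add: nsq_def)

lemma finite_measure_Icc: "finite_measure (leb l)"
  by (intro finite_measure_lebesgue_on) (simp add: lmeasurable_cbox)

lemma L2_intD:
  assumes "f \<in> L2_int l"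
  shows "f \<in> borel_measurable (leb l)" "integrable (leb l) (\<lambda>x. (f x)\<^sup>2)"
  using assms by (auto simp: L2_int_def)

lemma L2_int_product:
  assumes f: "f \<in> L2_int l" and g: "g \<in> L2_int l"
  shows "integrable (leb l) (\<lambda>x. f x * g x)"
proof (rule Bochner_Integration.integrable_bound)
  show "integrable (leb l) (\<lambda>x. (f x)\<^sup>2 + (g x)\<^sup>2)"
    using L2_intD[OF f] L2_intD[OF g] by auto
  show "(\<lambda>x. f x * g x) \<in> borel_measurable (leb l)"
    using L2_intD[OF f] L2_intD[OF g] by auto
  have "\<bar>a * b\<bar> \<le> \<bar>a\<^sup>2 + b\<^sup>2\<bar>" for a b :: real
  proof -
    have "0 \<le> (\<bar>a\<bar> - \<bar>b\<bar>)\<^sup>2" by simp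
    then have "2 * (\<bar>a\<bar> * \<bar>b\<bar>) \<le> a\<^sup>2 + b\<^sup>2" by (simp add: power2_diff)
    moreover have "0 \<le> \<bar>a\<bar> * \<bar>b\<bar>" by simp
    ultimately have "\<bar>a\<bar> * \<bar>b\<bar> \<le> a\<^sup>2 + b\<^sup>2" by linarith
    then show ?thesis by (simp add: abs_mult)
  qed
  then show "AE x in leb l. norm (f x * g x) \<le> norm ((f x)\<^sup>2 + (g x)\<^sup>2)"
    by simp
qed

text \<open>Lebesgue measure is complete, so \<open>g\<close> inherits measurability from
  \<open>f\<close> although the exceptional set is merely contained in a null set. This makes the
  spaces closed under almost everywhere equality.\<close>

lemma L2_int_cong_AE:
  assumes f: "f \<in> L2_int l" and eq: "AE x in leb l. f x = g x"
  shows "g \<in> L2_int l"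
proof -
  have N: "negligible {x \<in> {0..l}. f x \<noteq> g x}"
  proof -
    obtain N where N: "{x \<in> {0..l}. f x \<noteq> g x} \<subseteq> N" "N \<in> null_sets (leb l)"
      using eq by (auto elim!: AE_E simp: null_sets_def)
    have "N \<in> null_sets lebesgue"
      using N(2) by (subst (asm) null_sets_restrict_space) auto
    with N(1) show ?thesis using negligible_iff_null_sets negligible_subset by blast
  qed
  have m: "g \<in> borel_measurable (leb l)"
    using L2_intD(1)[OF f] measurable_on_spike[OF _ N, of f "{0..l}" g]
    by (auto simp: measurable_on_iff_borel_measurable)
  have "integrable (leb l) (\<lambda>x. (g x)\<^sup>2)"
    using L2_intD[OF f] m eq
    by (subst integrable_cong_AE[where g = "\<lambda>x. (f x)\<^sup>2"]) auto
  with m show ?thesis by (simp add: L2_int_def)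
qed

lemma nsq_cong_AE:
  assumes f: "f \<in> L2_int l" and eq: "AE x in leb l. f x = g x"
  shows "nsq l g = nsq l f"
  unfolding nsq_def using L2_int_cong_AE[OF assms] L2_intD[OF f] eq
  by (intro integral_cong_AE) (auto dest: L2_intD)

lemma L2_int_bounded_mult:
  assumes f: "f \<in> L2_int l" and b: "b \<in> borel_measurable (leb l)"
    and B: "AE x in leb l. \<bar>b x\<bar> \<le> B"
  shows "(\<lambda>x. b x * f x) \<in> L2_int l" "nsq l (\<lambda>x. b x * f x) \<le> B\<^sup>2 * nsq l f"
proof -
  have le: "AE x in leb l. (b x * f x)\<^sup>2 \<le> B\<^sup>2 * (f x)\<^sup>2"
    using B by eventually_elim
      (simp add: power_mult_distrib mult_right_mono abs_le_square_iff[symmetric] power2_abs)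
  have i: "integrable (leb l) (\<lambda>x. (b x * f x)\<^sup>2)"
  proof (rule Bochner_Integration.integrable_bound)
    show "integrable (leb l) (\<lambda>x. B\<^sup>2 * (f x)\<^sup>2)"
      using L2_intD[OF f] by auto
    show "(\<lambda>x. (b x * f x)\<^sup>2) \<in> borel_measurable (leb l)"
      using L2_intD[OF f] b by auto
    show "AE x in leb l. norm ((b x * f x)\<^sup>2) \<le> norm (B\<^sup>2 * (f x)\<^sup>2)"
      using le by eventually_elim simp
  qed
  show "(\<lambda>x. b x * f x) \<in> L2_int l"
    using i L2_intD[OF f] b by (auto simp: L2_int_def)
  have "nsq l (\<lambda>x. b x * f x) \<le> (LINT x|leb l. B\<^sup>2 * (f x)\<^sup>2)"
    unfolding nsq_def using i le L2_intD[OF f] by (intro integral_mono_AE) auto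
  then show "nsq l (\<lambda>x. b x * f x) \<le> B\<^sup>2 * nsq l f"
    by (simp add: nsq_def)
qed

lemma L2_int_cmult:
  assumes "f \<in> L2_int l" shows "(\<lambda>x. c * f x) \<in> L2_int l"
  using assms by (auto simp: L2_int_def power_mult_distrib)

lemma nsq_cmult: "nsq l (\<lambda>x. c * f x) = c\<^sup>2 * nsq l f"
  by (simp add: nsq_def power_mult_distrib)

lemma L2_int_add:
  assumes f: "f \<in> L2_int l" and g: "g \<in> L2_int l"
  shows "(\<lambda>x. f x + g x) \<in> L2_int l"
    and "nsq l (\<lambda>x. f x + g x) = nsq l f + 2 * (LINT x|leb l. f x * g x) + nsq l g"
proof -
  have eq: "(f x + g x)\<^sup>2 = (f x)\<^sup>2 + 2 * (f x * g x) + (g x)\<^sup>2" for x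
    by (simp add: power2_sum)
  show "(\<lambda>x. f x + g x) \<in> L2_int l"
    unfolding L2_int_def mem_Collect_eq eq
    using L2_intD[OF f] L2_intD[OF g] L2_int_product[OF f g]
    by (auto intro!: Bochner_Integration.integrable_add)
  show "nsq l (\<lambda>x. f x + g x) = nsq l f + 2 * (LINT x|leb l. f x * g x) + nsq l g"
    unfolding nsq_def eq using L2_intD[OF f] L2_intD[OF g] L2_int_product[OF f g]
    by (subst Bochner_Integration.integral_add
        | (intro Bochner_Integration.integrable_add integrable_mult_right; assumption)
        | (subst integral_mult_right_zero) | simp)+
qed

lemma L2_int_diff:
  assumes f: "f \<in> L2_int l" and g: "g \<in> L2_int l"
  shows "(\<lambda>x. f x - g x) \<in> L2_int l"
  using L2_int_add(1)[OF f L2_int_cmult[OF g, of "-1"]] by simp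

lemma L2_int_zero [simp]: "(\<lambda>x. 0) \<in> L2_int l"
  by (simp add: L2_int_def)

lemma L2_int_const [simp]: "(\<lambda>x. c) \<in> L2_int l"
  by (simp add: L2_int_def finite_measure.integrable_const[OF finite_measure_Icc])

lemma L2_int_continuous:
  assumes "continuous_on {0..l} f" shows "f \<in> L2_int l"
  using assms by (auto simp: L2_int_def continuous_imp_measurable_on_sets_lebesgue
      intro!: continuous_imp_integrable_real continuous_intros)

lemma L2_int_integrable:
  assumes "f \<in> L2_int l"
  shows "integrable (leb l) f" "f absolutely_integrable_on {0..l}"
proof -
  show i: "integrable (leb l) f"
    using L2_int_product[OF assms L2_int_const[of 1]] by simp
  then show "f absolutely_integrable_on {0..l}"
    by (simp add: set_integrable_def integrable_restrict_space)
qed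

lemma two_sq_bound: "(a + b)\<^sup>2 \<le> 2 * a\<^sup>2 + 2 * (b::real)\<^sup>2"
proof -
  have "0 \<le> (a - b)\<^sup>2" by simp
  then show ?thesis by (simp add: power2_sum power2_diff)
qed

lemma nsq_mono_AE:
  assumes "f \<in> L2_int l" "g \<in> L2_int l"
    and "AE x in leb l. (f x)\<^sup>2 \<le> (g x)\<^sup>2"
  shows "nsq l f \<le> nsq l g"
  unfolding nsq_def using assms by (intro integral_mono_AE) (auto dest: L2_intD)

lemma nsq_add_le:
  assumes f: "f \<in> L2_int l" and g: "g \<in> L2_int l"
  shows "nsq l (\<lambda>x. f x + g x) \<le> 2 * nsq l f + 2 * nsq l g"
proof -
  have "nsq l (\<lambda>x. f x + g x) \<le> (LINT x|leb l. 2 * (f x)\<^sup>2 + 2 * (g x)\<^sup>2)"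
    unfolding nsq_def using L2_intD(2)[OF L2_int_add(1)[OF f g]] L2_intD[OF f] L2_intD[OF g]
    by (intro integral_mono) (auto simp: two_sq_bound)
  also have "\<dots> = 2 * nsq l f + 2 * nsq l g"
    unfolding nsq_def using L2_intD[OF f] L2_intD[OF g] by (subst Bochner_Integration.integral_add) auto
  finally show ?thesis .
qed

lemma nsq_diff_commute: "nsq l (\<lambda>x. f x - g x) = nsq l (\<lambda>x. g x - f x)"
  by (simp add: nsq_def power2_commute)

lemma nsq_diff_le:
  assumes f: "f \<in> L2_int l" and g: "g \<in> L2_int l"
  shows "nsq l (\<lambda>x. f x - g x) \<le> 2 * nsq l f + 2 * nsq l g"
  using nsq_add_le[OF f L2_int_cmult[OF g, of "-1"]] nsq_cmult[of l "-1" g] by simp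

lemma nsq_eq_0_AE:
  assumes f: "f \<in> L2_int l" and 0: "nsq l f = 0"
  shows "AE x in leb l. f x = 0"
  using integral_nonneg_eq_0_iff_AE[OF L2_intD(2)[OF f]] 0 by (simp add: nsq_def)

text \<open>The discriminant criterion behind Cauchy-Schwarz: evaluate at the minimiser t = -B / C.
  For C = 0 the function of t is affine and bounded below, which forces B = 0.\<close>

lemma quadratic_nonneg_imp:
  assumes "\<And>t. 0 \<le> A + 2 * t * B + t\<^sup>2 * C" "0 \<le> A" "0 \<le> (C::real)"
  shows "B\<^sup>2 \<le> A * C"
proof (cases "C = 0")
  case True
  have "B = 0"
  proof (rule ccontr)
    assume "B \<noteq> 0"
    then show False using assms(1)[of "- (A + 1) / (2 * B)"] True by (simp add: field_simps)
  qed
  then show ?thesis using True by simp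
next
  case False
  then have C: "0 < C" using assms(3) by simp
  have "0 \<le> C * (A + 2 * (- B / C) * B + (- B / C)\<^sup>2 * C)" using assms(1)[of "- B / C"] C by simp
  also have "\<dots> = A * C - B\<^sup>2" using C by (simp add: field_simps power2_eq_square)
  finally show ?thesis by simp
qed

lemma Cauchy_Schwarz_L2_int:
  assumes f: "f \<in> L2_int l" and g: "g \<in> L2_int l"
  shows "(LINT x|leb l. f x * g x)\<^sup>2 \<le> nsq l f * nsq l g"
proof (rule quadratic_nonneg_imp)
  fix t :: real
  have "0 \<le> nsq l (\<lambda>x. f x + t * g x)" by simp
  also have "\<dots> = nsq l f + 2 * (LINT x|leb l. f x * (t * g x)) + t\<^sup>2 * nsq l g"
    by (simp add: L2_int_add(2)[OF f L2_int_cmult[OF g]] nsq_cmult)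
  also have "(LINT x|leb l. f x * (t * g x)) = t * (LINT x|leb l. f x * g x)"
    by (subst integral_mult_right_zero[symmetric]) (simp add: mult.left_commute)
  finally show "0 \<le> nsq l f + 2 * t * (LINT x|leb l. f x * g x) + t\<^sup>2 * nsq l g"
    by simp
qed auto

text \<open>Riesz-Fischer on a finite measure space: an L2 Cauchy sequence is Cauchy in L1, so a
  subsequence converges almost everywhere, and Fatou's lemma carries the Cauchy estimate over to the
  limit.\<close>

lemma L2_int_complete:
  assumes f: "\<And>n. f n \<in> L2_int l"
    and C: "\<And>e. 0 < e \<Longrightarrow> \<exists>N. \<forall>m\<ge>N. \<forall>n\<ge>N. nsq l (\<lambda>x. f m x - f n x) < e"
  obtains g where "g \<in> L2_int l" "(\<lambda>n. nsq l (\<lambda>x. f n x - g x)) \<longlonglongrightarrow> 0"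
proof -
  let ?M = "leb l"
  interpret finite_measure ?M by (rule finite_measure_Icc)
  have d: "(\<lambda>x. f m x - f n x) \<in> L2_int l" for m n by (intro L2_int_diff f)
  have "\<exists>N. \<forall>i\<ge>N. \<forall>j\<ge>N. LINT x|?M. norm (f i x - f j x) < e" if e: "e > 0" for e
  proof -
    \<comment> \<open>The constant converts L2 bounds into L1 bounds; the summand 1 keeps it
      positive when the interval is degenerate.\<close>
    define c where "c = measure ?M {0..l} + 1"
    have c: "0 < c" by (simp add: c_def add_nonneg_pos)
    have "0 < e\<^sup>2 / c" using c e by simp
    from C[OF this] obtain N where
      N: "\<And>m n. m \<ge> N \<Longrightarrow> n \<ge> N \<Longrightarrow> nsq l (\<lambda>x. f m x - f n x) < e\<^sup>2 / c"
      by blast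
    have "LINT x|?M. norm (f i x - f j x) < e" if ij: "i \<ge> N" "j \<ge> N" for i j
    proof -
      have a: "(\<lambda>x. \<bar>f i x - f j x\<bar>) \<in> L2_int l"
        using d[of i j] by (auto simp: L2_int_def)
      have "nsq l (\<lambda>x. \<bar>f i x - f j x\<bar>) = nsq l (\<lambda>x. f i x - f j x)" by (simp add: nsq_def)
      then have "(LINT x|?M. \<bar>f i x - f j x\<bar>)\<^sup>2 \<le> nsq l (\<lambda>x. f i x - f j x) * measure ?M {0..l}"
        using Cauchy_Schwarz_L2_int[OF a L2_int_const[of 1]] by (simp add: nsq_def)
      also have "\<dots> \<le> nsq l (\<lambda>x. f i x - f j x) * c"
        by (intro mult_left_mono) (auto simp: c_def)
      also have "\<dots> < e\<^sup>2" using N[OF ij] c by (simp add: field_simps)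
      finally show ?thesis using e by (simp add: power2_less_imp_less)
    qed
    then show ?thesis by blast
  qed
  then obtain r where r: "strict_mono r" and cau: "AE x in ?M. Cauchy (\<lambda>i. f (r i) x)"
    using cauchy_L1_AE_cauchy_subseq[of ?M f] L2_int_integrable(1)[OF f] by blast
  define g where "g x = lim (\<lambda>i. f (r i) x)" for x
  have lim: "AE x in ?M. (\<lambda>i. f (r i) x) \<longlonglongrightarrow> g x"
    using cau by eventually_elim (simp add: g_def Cauchy_convergent_iff convergent_LIMSEQ_iff)
  have gm [measurable]: "g \<in> borel_measurable ?M"
    unfolding g_def using L2_intD(1)[OF f] by measurable
  have fm [measurable]: "f n \<in> borel_measurable ?M" for n using L2_intD(1)[OF f] .
  \<comment> \<open>Fatou along the subsequence \<open>r\<close>: since \<open>r i \<ge> i\<close>,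
    the Cauchy bound holds for all i \<ge> N.\<close>
  have key: "(\<integral>\<^sup>+x. ennreal ((f m x - g x)\<^sup>2) \<partial>?M) \<le> ennreal e"
    if e: "0 < e" and N: "\<And>m n. m \<ge> N \<Longrightarrow> n \<ge> N \<Longrightarrow> nsq l (\<lambda>x. f m x - f n x) < e" and m: "m \<ge> N" for e N m
  proof -
    have "(\<integral>\<^sup>+x. ennreal ((f m x - g x)\<^sup>2) \<partial>?M) = (\<integral>\<^sup>+x. liminf (\<lambda>i. ennreal ((f m x - f (r i) x)\<^sup>2)) \<partial>?M)"
    proof (rule nn_integral_cong_AE)
      show "AE x in ?M. ennreal ((f m x - g x)\<^sup>2) = liminf (\<lambda>i. ennreal ((f m x - f (r i) x)\<^sup>2))"
        using lim
      proof eventually_elim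
        case (elim x)
        have "(\<lambda>i. ennreal ((f m x - f (r i) x)\<^sup>2)) \<longlonglongrightarrow> ennreal ((f m x - g x)\<^sup>2)"
          by (intro tendsto_ennrealI tendsto_intros elim)
        then show ?case by (metis lim_imp_Liminf trivial_limit_sequentially)
      qed
    qed
    also have "\<dots> \<le> liminf (\<lambda>i. \<integral>\<^sup>+x. ennreal ((f m x - f (r i) x)\<^sup>2) \<partial>?M)"
      by (rule nn_integral_liminf) measurable
    also have "\<dots> \<le> liminf (\<lambda>i::nat. ennreal e)"
    proof (rule Liminf_mono)
      show "\<forall>\<^sub>F i in sequentially. (\<integral>\<^sup>+x. ennreal ((f m x - f (r i) x)\<^sup>2) \<partial>?M) \<le> ennreal e"
        using eventually_ge_at_top[of N]
      proof eventually_elim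
        case (elim i)
        have "r i \<ge> N" using seq_suble[OF r, of i] elim by linarith
        then have "nsq l (\<lambda>x. f m x - f (r i) x) \<le> e" using N[OF m] by (simp add: less_imp_le)
        moreover have "(\<integral>\<^sup>+x. ennreal ((f m x - f (r i) x)\<^sup>2) \<partial>?M) = ennreal (nsq l (\<lambda>x. f m x - f (r i) x))"
          unfolding nsq_def by (intro nn_integral_eq_integral L2_intD(2)[OF d]) auto
        ultimately show ?case by (simp add: ennreal_leI)
      qed
    qed
    also have "\<dots> = ennreal e" by (simp add: Liminf_const)
    finally show ?thesis .
  qed
  have L2: "(\<lambda>x. f m x - g x) \<in> L2_int l" and le: "nsq l (\<lambda>x. f m x - g x) \<le> e"
    if e: "0 < e" and N: "\<And>m n. m \<ge> N \<Longrightarrow> n \<ge> N \<Longrightarrow> nsq l (\<lambda>x. f m x - f n x) < e" and m: "m \<ge> N" for e N m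
  proof -
    note k = key[OF e N m]
    have i: "integrable ?M (\<lambda>x. (f m x - g x)\<^sup>2)"
      using le_less_trans[OF k ennreal_less_top] by (intro integrableI_nonneg) auto
    then show "(\<lambda>x. f m x - g x) \<in> L2_int l" by (simp add: L2_int_def)
    have "ennreal (nsq l (\<lambda>x. f m x - g x)) \<le> ennreal e"
      using k unfolding nsq_def by (subst nn_integral_eq_integral[symmetric]) (auto simp: i)
    then show "nsq l (\<lambda>x. f m x - g x) \<le> e" using e by (simp add: ennreal_le_iff)
  qed
  obtain N1 where "\<And>m n. m \<ge> N1 \<Longrightarrow> n \<ge> N1 \<Longrightarrow> nsq l (\<lambda>x. f m x - f n x) < 1"
    using C[of 1] by auto
  then have "(\<lambda>x. f N1 x - g x) \<in> L2_int l" by (rule L2[of 1 N1, OF zero_less_one]) auto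
  from L2_int_diff[OF f[of N1] this] have g: "g \<in> L2_int l" by simp
  have "(\<lambda>n. nsq l (\<lambda>x. f n x - g x)) \<longlonglongrightarrow> 0"
  proof (rule LIMSEQ_I)
    fix e :: real assume e: "0 < e"
    then have e2: "0 < e / 2" by simp
    obtain N where N: "\<And>m n. m \<ge> N \<Longrightarrow> n \<ge> N \<Longrightarrow> nsq l (\<lambda>x. f m x - f n x) < e / 2"
      using C[OF e2] by blast
    have "norm (nsq l (\<lambda>x. f n x - g x) - 0) < e" if "n \<ge> N" for n
      using le[OF e2 N that] e by simp
    then show "\<exists>no. \<forall>n\<ge>no. norm (nsq l (\<lambda>x. f n x - g x) - 0) < e" by blast
  qed
  with g show ?thesis by (rule that)
qed

section \<open>Primitives of square integrable functions\<close>

text \<open>The pair of the absolutely continuous representative of an H^1 function and its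
  derivative. Phrased through integrals over subintervals, it is exactly linear, is insensitive to
  null sets in \<open>g\<close>, and reads \<open>h\<close> only on [0, l].\<close>

definition prim :: "real \<Rightarrow> (real \<Rightarrow> real) \<Rightarrow> (real \<Rightarrow> real) \<Rightarrow> bool" where
  "prim l h g \<longleftrightarrow> g \<in> L2_int l \<and>
     (\<forall>x y. 0 \<le> x \<and> x \<le> y \<and> y \<le> l \<longrightarrow> (g has_integral h y - h x) {x..y})"

text \<open>Bridge between the Lebesgue integral of the definitions and the gauge integral, in which
  the fundamental theorem of calculus and additivity over intervals are used.\<close>

lemma integral_Icc_eq_LINT:
  assumes "g \<in> L2_int l" "0 \<le> x" "y \<le> l"
  shows "integral {x..y} g = (LINT t|leb l. indicator {x..y} t * g t)"
    "g absolutely_integrable_on {x..y}"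
proof -
  show a: "g absolutely_integrable_on {x..y}"
    using L2_int_integrable(2)[OF assms(1)] assms
    by (intro set_integrable_subset[of lebesgue "{0..l}" g "{x..y}"]) auto
  have "integral {x..y} g = set_lebesgue_integral lebesgue {x..y} g"
    using a by (simp add: set_lebesgue_integral_eq_integral)
  also have "\<dots> = (LINT t|lebesgue. indicator {0..l} t *\<^sub>R (indicator {x..y} t * g t))"
    unfolding set_lebesgue_integral_def using assms
    by (intro Bochner_Integration.integral_cong) (auto simp: indicator_def)
  also have "\<dots> = (LINT t|leb l. indicator {x..y} t * g t)"
    by (subst integral_restrict_space) auto
  finally show "integral {x..y} g = (LINT t|leb l. indicator {x..y} t * g t)" .
qed

lemma LINT_eq_integral_0:
  assumes "g \<in> L2_int l" shows "(LINT t|leb l. g t) = integral {0..l} g"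
  by (intro lebesgue_integral_eq_integral L2_int_integrable assms) auto

text \<open>Cauchy-Schwarz against the indicator of {x..y}, whose square integral is y - x. This is
  the source of the Hoelder exponent 1/2 and of all trace bounds.\<close>

lemma integral_sq_bound:
  assumes g: "g \<in> L2_int l" and xy: "0 \<le> x" "x \<le> y" "y \<le> l"
  shows "(integral {x..y} g)\<^sup>2 \<le> (y - x) * nsq l g"
proof -
  have i: "indicator {x..y} \<in> L2_int l"
  proof -
    have "indicat_real {x..y} \<in> borel_measurable lebesgue"
      by (rule borel_measurable_indicator) simp
    then have "indicat_real {x..y} \<in> borel_measurable (leb l)"
      by (rule measurable_restrict_space1)
    then show ?thesis
      using L2_int_bounded_mult(1)[OF L2_int_const[of 1 l], of "indicator {x..y}" 1] by simp
  qed
  have "nsq l (indicator {x..y}) = (LINT t|leb l. indicator {x..y} t * 1)"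
    unfolding nsq_def by (intro Bochner_Integration.integral_cong) (auto simp: indicator_def)
  also have "\<dots> = y - x"
    using integral_Icc_eq_LINT(1)[OF L2_int_const[of 1 l] xy(1,3)] xy by simp
  finally show ?thesis
    using Cauchy_Schwarz_L2_int[OF i g] integral_Icc_eq_LINT(1)[OF g xy(1,3)] by simp
qed

lemma primD:
  assumes "prim l h g"
  shows "g \<in> L2_int l" "\<And>x y. 0 \<le> x \<Longrightarrow> x \<le> y \<Longrightarrow> y \<le> l \<Longrightarrow> integral {x..y} g = h y - h x"
  using assms by (auto simp: prim_def)

lemma primI:
  assumes g: "g \<in> L2_int l" and "\<And>x y. 0 \<le> x \<Longrightarrow> x \<le> y \<Longrightarrow> y \<le> l \<Longrightarrow> integral {x..y} g = h y - h x"
  shows "prim l h g"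
  unfolding prim_def
proof (intro conjI allI impI g)
  fix x y assume xy: "0 \<le> x \<and> x \<le> y \<and> y \<le> l"
  then have "g integrable_on {x..y}"
    using integral_Icc_eq_LINT(2)[OF g] by (auto simp: absolutely_integrable_on_def)
  then show "(g has_integral h y - h x) {x..y}"
    using assms(2)[of x y] xy by (metis integrable_integral)
qed

lemma prim_indefinite:
  assumes g: "g \<in> L2_int l" shows "prim l (\<lambda>x. c + integral {0..x} g) g"
proof (rule primI[OF g])
  fix x y :: real assume xy: "0 \<le> x" "x \<le> y" "y \<le> l"
  have "g integrable_on {0..y}"
    using integral_Icc_eq_LINT(2)[OF g order_refl xy(3)] by (auto simp: absolutely_integrable_on_def)
  from Henstock_Kurzweil_Integration.integral_combine[OF xy(1,2) this]
  show "integral {x..y} g = c + integral {0..y} g - (c + integral {0..x} g)" by simp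
qed

lemma prim_holder:
  assumes "prim l h g" "x \<in> {0..l}" "y \<in> {0..l}"
  shows "(h y - h x)\<^sup>2 \<le> \<bar>y - x\<bar> * nsq l g"
proof (cases "x \<le> y")
  case True
  then show ?thesis using integral_sq_bound[of g l x y] primD[OF assms(1)] assms by auto
next
  case False
  then show ?thesis using integral_sq_bound[of g l y x] primD[OF assms(1)] assms
    by (auto simp: power2_commute[of "h y"])
qed

lemma prim_continuous:
  assumes p: "prim l h g" shows "continuous_on {0..l} h"
proof (rule continuous_onI)
  fix x e :: real assume x: "x \<in> {0..l}" and e: "0 < e"
  \<comment> \<open>The summand 1 avoids a division by zero when \<open>g\<close> vanishes almost
    everywhere.\<close>
  define d where "d = e\<^sup>2 / (nsq l g + 1)"
  have n: "0 < nsq l g + 1" by (simp add: add_nonneg_pos)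
  have "0 < d" using e n by (simp add: d_def)
  moreover have "dist (h y) (h x) \<le> e" if y: "y \<in> {0..l}" "dist y x < d" for y
  proof -
    have "(h y - h x)\<^sup>2 \<le> \<bar>y - x\<bar> * nsq l g" using prim_holder[OF p x y(1)] .
    also have "\<dots> \<le> d * (nsq l g + 1)" using y(2) by (intro mult_mono) (auto simp: dist_real_def)
    also have "\<dots> = e\<^sup>2" using n by (simp add: d_def)
    finally show ?thesis using e by (simp add: dist_real_def abs_le_square_iff[symmetric])
  qed
  ultimately show "\<exists>d>0. \<forall>x'\<in>{0..l}. dist x' x < d \<longrightarrow> dist (h x') (h x) \<le> e" by blast
qed

lemma prim_L2: "prim l h g \<Longrightarrow> h \<in> L2_int l"
  by (intro L2_int_continuous prim_continuous)

lemma prim_add: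
  assumes "prim l h g" "prim l k f" shows "prim l (\<lambda>x. h x + k x) (\<lambda>x. g x + f x)"
  using assms unfolding prim_def add_diff_add
  by (auto intro!: L2_int_add has_integral_add)

lemma prim_cmult:
  assumes "prim l h g" shows "prim l (\<lambda>x. c * h x) (\<lambda>x. c * g x)"
  using assms unfolding prim_def right_diff_distrib[symmetric]
  by (auto intro!: L2_int_cmult has_integral_mult_right)

lemma prim_diff:
  assumes "prim l h g" "prim l k f" shows "prim l (\<lambda>x. h x - k x) (\<lambda>x. g x - f x)"
  using prim_add[OF assms(1) prim_cmult[OF assms(2), of "-1"]] by simp

lemma prim_const: "prim l (\<lambda>x. c) (\<lambda>x. 0)"
  by (intro primI) auto

lemma L2_int_mult_continuous:
  assumes "continuous_on {0..l} h" "g \<in> L2_int l"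
  shows "(\<lambda>x. h x * g x) \<in> L2_int l"
proof -
  have "bounded (h ` {0..l})"
    by (intro compact_imp_bounded compact_continuous_image assms) auto
  then obtain B where "\<forall>x\<in>{0..l}. \<bar>h x\<bar> \<le> B" by (auto simp: bounded_iff)
  then show ?thesis
    using assms continuous_imp_measurable_on_sets_lebesgue[OF assms(1)]
    by (intro L2_int_bounded_mult(1)[of _ _ _ B] AE_I2) auto
qed

text \<open>
  The defect \<open>\<Phi>\<close> of the product rule satisfies \<open>\<bar>\<Phi> y - \<Phi> x\<bar> \<le> \<epsilon> (V y - V x)\<close> for close points,
  where \<open>V\<close> is a primitive of \<open>\<bar>f\<bar> + \<bar>g\<bar>\<close>; summing over a fine partition gives \<open>\<Phi> = 0\<close>.
\<close>
lemma prim_mult: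
  assumes p: "prim l h g" and q: "prim l k f"
  shows "prim l (\<lambda>x. h x * k x) (\<lambda>x. h x * f x + k x * g x)"
proof (rule primI)
  note g = primD(1)[OF p] and f = primD(1)[OF q]
  note ch = prim_continuous[OF p] and ck = prim_continuous[OF q]
  let ?G = "\<lambda>x. h x * f x + k x * g x"
  show L: "?G \<in> L2_int l"
    by (intro L2_int_add L2_int_mult_continuous ch ck f g)
  have absL: "(\<lambda>x. \<bar>u x\<bar>) \<in> L2_int l" if "u \<in> L2_int l" for u
    using that by (auto simp: L2_int_def)
  have W: "(\<lambda>x. \<bar>f x\<bar> + \<bar>g x\<bar>) \<in> L2_int l"
    by (intro L2_int_add absL f g)
  define V where "V x = 0 + integral {0..x} (\<lambda>x. \<bar>f x\<bar> + \<bar>g x\<bar>)" for x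
  have V: "prim l V (\<lambda>x. \<bar>f x\<bar> + \<bar>g x\<bar>)"
    using prim_indefinite[OF W, of 0] by (simp add: V_def[abs_def])
  define J where "J x = 0 + integral {0..x} ?G" for x
  have J: "prim l J ?G"
    using prim_indefinite[OF L, of 0] by (simp add: J_def[abs_def])
  define \<Phi> where "\<Phi> x = h x * k x - J x" for x
  have step: "\<bar>\<Phi> y - \<Phi> x\<bar> \<le> e * (V y - V x)"
    if xy: "0 \<le> x" "x \<le> y" "y \<le> l" and
       osc: "\<And>s. s \<in> {x..y} \<Longrightarrow> \<bar>h y - h s\<bar> \<le> e \<and> \<bar>k x - k s\<bar> \<le> e" for x y e
  proof -
    \<comment> \<open>Freezing \<open>h\<close> at y and \<open>k\<close> at x makes this integral
      exactly h y * k y - h x * k x, so the defect sees only the oscillation of \<open>h\<close> and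
      \<open>k\<close> on {x..y}.\<close>
    have 1: "((\<lambda>s. h y * f s + k x * g s) has_integral (h y * (k y - k x) + k x * (h y - h x))) {x..y}"
      using p q xy by (intro has_integral_add has_integral_mult_right) (auto simp: prim_def)
    have 2: "(?G has_integral (J y - J x)) {x..y}" using J xy by (auto simp: prim_def)
    have 3: "((\<lambda>s. \<bar>f s\<bar> + \<bar>g s\<bar>) has_integral (V y - V x)) {x..y}" using V xy by (auto simp: prim_def)
    have 4: "((\<lambda>s. (h y * f s + k x * g s) - ?G s) has_integral (\<Phi> y - \<Phi> x)) {x..y}"
      using has_integral_diff[OF 1 2] by (simp add: \<Phi>_def algebra_simps)
    have 5: "((\<lambda>s. e * (\<bar>f s\<bar> + \<bar>g s\<bar>)) has_integral (e * (V y - V x))) {x..y}"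
      by (intro has_integral_mult_right 3)
    have bd: "\<bar>(h y * f s + k x * g s) - ?G s\<bar> \<le> e * (\<bar>f s\<bar> + \<bar>g s\<bar>)" if s: "s \<in> {x..y}" for s
    proof -
      have "(h y * f s + k x * g s) - ?G s = (h y - h s) * f s + (k x - k s) * g s"
        by (simp add: algebra_simps)
      also have "\<bar>\<dots>\<bar> \<le> \<bar>h y - h s\<bar> * \<bar>f s\<bar> + \<bar>k x - k s\<bar> * \<bar>g s\<bar>"
        by (metis abs_mult abs_triangle_ineq)
      also have "\<dots> \<le> e * \<bar>f s\<bar> + e * \<bar>g s\<bar>"
        using osc[OF s] by (intro add_mono mult_right_mono) auto
      finally show ?thesis by (simp add: algebra_simps)
    qed
    have "\<Phi> y - \<Phi> x \<le> e * (V y - V x)"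
      by (rule has_integral_le[OF 4 5]) (use bd in \<open>auto simp: abs_le_iff\<close>)
    moreover have "- (\<Phi> y - \<Phi> x) \<le> e * (V y - V x)"
      by (rule has_integral_le[OF has_integral_neg[OF 4] 5]) (use bd in \<open>auto simp: abs_le_iff\<close>)
    ultimately show ?thesis by (simp add: abs_le_iff)
  qed
  have uh: "uniformly_continuous_on {0..l} h" and uk: "uniformly_continuous_on {0..l} k"
    by (intro compact_uniformly_continuous ch ck; simp)+
  have small: "\<bar>\<Phi> y - \<Phi> x\<bar> \<le> e * (V y - V x)"
    if xy: "0 \<le> x" "x \<le> y" "y \<le> l" and e: "0 < e" for x y e
  proof -
    obtain d1 where d1: "d1 > 0" "\<And>s t. s \<in> {0..l} \<Longrightarrow> t \<in> {0..l} \<Longrightarrow> \<bar>t - s\<bar> < d1 \<Longrightarrow> \<bar>h t - h s\<bar> < e"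
      using uh e unfolding uniformly_continuous_on_def dist_real_def by metis
    obtain d2 where d2: "d2 > 0" "\<And>s t. s \<in> {0..l} \<Longrightarrow> t \<in> {0..l} \<Longrightarrow> \<bar>t - s\<bar> < d2 \<Longrightarrow> \<bar>k t - k s\<bar> < e"
      using uk e unfolding uniformly_continuous_on_def dist_real_def by metis
    obtain n :: nat where n: "(y - x) / min d1 d2 < real n" using reals_Archimedean2 by blast
    have n0: "0 < n" using n xy d1(1) d2(1) by (cases n) (auto simp: field_simps not_less)
    define w where "w = (y - x) / real n"
    define z where "z i = x + real i * w" for i
    have nw: "real n * w = y - x" using n0 by (simp add: w_def)
    have w0: "0 \<le> w" using xy by (simp add: w_def)
    have zb: "z i \<in> {x..y}" if "i \<le> n" for i
    proof -
      have "real i * w \<le> real n * w" using that w0 by (intro mult_right_mono) auto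
      then show ?thesis using w0 nw by (auto simp: z_def)
    qed
    have zs: "z (Suc i) - z i = w" for i by (simp add: z_def distrib_right)
    have "0 < min d1 d2" using d1(1) d2(1) by simp
    then have "y - x < real n * min d1 d2" using n by (simp add: pos_divide_less_eq del: min_less_iff_conj)
    then have zl: "w < min d1 d2"
      using n0 unfolding w_def by (simp add: pos_divide_less_eq mult.commute del: min_less_iff_conj)
    have "\<bar>\<Phi> (z i) - \<Phi> x\<bar> \<le> e * (V (z i) - V x)" if "i \<le> n" for i
      using that
    proof (induction i)
      case 0 then show ?case by (simp add: z_def)
    next
      case (Suc i)
      have zz: "z i \<le> z (Suc i)" using zs[of i] w0 by linarith
      have "\<bar>\<Phi> (z (Suc i)) - \<Phi> (z i)\<bar> \<le> e * (V (z (Suc i)) - V (z i))"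
      proof (rule step)
        show "0 \<le> z i" "z (Suc i) \<le> l" using zb[of i] zb[of "Suc i"] Suc xy by auto
        show "z i \<le> z (Suc i)" by (rule zz)
        fix s assume s: "s \<in> {z i..z (Suc i)}"
        then have s': "s \<in> {0..l}" "\<bar>z (Suc i) - s\<bar> < min d1 d2" "\<bar>z i - s\<bar> < min d1 d2"
          using zb[of i] zb[of "Suc i"] Suc xy zs[of i] zl by auto
        have zi: "z i \<in> {0..l}" "z (Suc i) \<in> {0..l}" using zb[of i] zb[of "Suc i"] Suc xy by auto
        show "\<bar>h (z (Suc i)) - h s\<bar> \<le> e \<and> \<bar>k (z i) - k s\<bar> \<le> e"
          using d1(2)[OF s'(1) zi(2)] d2(2)[OF s'(1) zi(1)] s' by (auto intro: less_imp_le)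
      qed
      moreover have "\<bar>\<Phi> (z i) - \<Phi> x\<bar> \<le> e * (V (z i) - V x)" using Suc by simp
      ultimately show ?case unfolding right_diff_distrib by linarith
    qed
    from this[of n] show ?thesis by (simp add: z_def nw)
  qed
  fix x y assume xy: "0 \<le> x" "x \<le> y" "y \<le> l"
  have "\<bar>\<Phi> y - \<Phi> x\<bar> \<le> 0"
  proof (rule field_le_epsilon)
    fix e :: real assume e: "0 < e"
    have "((\<lambda>s. \<bar>f s\<bar> + \<bar>g s\<bar>) has_integral (V y - V x)) {x..y}" using V xy by (auto simp: prim_def)
    then have V0: "0 \<le> V y - V x" by (rule has_integral_nonneg) auto
    \<comment> \<open>The tolerance is divided by the total variation plus 1, so that the summed
      error stays below e.\<close>
    have "\<bar>\<Phi> y - \<Phi> x\<bar> \<le> e / (V y - V x + 1) * (V y - V x)"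
      using V0 e by (intro small xy) (auto intro: divide_pos_pos)
    also have "\<dots> \<le> e" using V0 e by (simp add: field_simps)
    finally show "\<bar>\<Phi> y - \<Phi> x\<bar> \<le> 0 + e" by simp
  qed
  then have "J y - J x = h y * k y - h x * k x" by (simp add: \<Phi>_def)
  then show "integral {x..y} ?G = h y * k y - h x * k x"
    using primD(2)[OF J xy] by simp
qed

lemma prim_parts:
  assumes p: "prim l h g" and q: "prim l k f" and l: "0 \<le> l"
  shows "(LINT x|leb l. h x * f x) + (LINT x|leb l. k x * g x)
    = h l * k l - h 0 * k 0"
proof -
  note m = prim_mult[OF p q]
  have "(LINT x|leb l. h x * f x) + (LINT x|leb l. k x * g x)
     = (LINT x|leb l. h x * f x + k x * g x)"
    by (rule Bochner_Integration.integral_add[symmetric])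
      (auto intro!: L2_int_product prim_L2[OF p] prim_L2[OF q] primD(1)[OF p] primD(1)[OF q])
  also have "\<dots> = integral {0..l} (\<lambda>x. h x * f x + k x * g x)"
    by (rule LINT_eq_integral_0[OF primD(1)[OF m]])
  also have "\<dots> = h l * k l - h 0 * k 0" using primD(2)[OF m, of 0 l] l by simp
  finally show ?thesis .
qed

section \<open>Lebesgue differentiation, uniqueness of derivatives, traces\<close>

lemma AE_lebesgue_on_negligible:
  assumes "negligible N" "\<And>x. x \<in> {0..l} \<Longrightarrow> x \<notin> N \<Longrightarrow> P x"
  shows "AE x in leb l. P x"
proof -
  have "N \<in> null_sets lebesgue" using assms(1) by (simp add: negligible_iff_null_sets)
  then have "AE x in lebesgue. x \<notin> N" by (rule AE_not_in)
  then have "AE x in lebesgue. x \<in> {0..l} \<longrightarrow> P x"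
    by eventually_elim (use assms(2) in auto)
  then show ?thesis by (subst AE_restrict_space_iff) auto
qed

text \<open>Lebesgue differentiation: at almost every point \<open>g\<close> is the limit of its
  forward averages, each of which is bounded by B in absolute value.\<close>

lemma interval_integrals_le_AE:
  fixes g :: "real \<Rightarrow> real"
  assumes gi: "g integrable_on {0..l}"
    and B: "\<And>x y. 0 \<le> x \<Longrightarrow> x \<le> y \<Longrightarrow> y \<le> l \<Longrightarrow> \<bar>integral {x..y} g\<bar> \<le> B * (y - x)"
  shows "AE x in leb l. \<bar>g x\<bar> \<le> B"
proof -
  define f where "f x = (if x \<in> {0..l} then g x else 0)" for x
  have "f integrable_on UNIV" using gi unfolding f_def integrable_restrict_UNIV .
  then have fi: "f integrable_on cbox a b" for a b
    using integrable_on_subcbox[of f UNIV a b] by auto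
  obtain N where N: "negligible N"
    "\<And>x e. x \<notin> N \<Longrightarrow> 0 < e \<Longrightarrow> \<exists>d>0. \<forall>h. 0 < h \<and> h < d \<longrightarrow>
       norm (integral (cbox x (x + h *\<^sub>R One)) f /\<^sub>R h ^ DIM(real) - f x) < e"
    by (rule integrable_ccontinuous_explicit[of f, OF fi]) (rule that; assumption)
  show ?thesis
  proof (rule AE_lebesgue_on_negligible)
    \<comment> \<open>The right end point is discarded because a forward average needs room inside
      the interval.\<close>
    show "negligible (insert l N)" using N(1) by simp
    fix x assume x: "x \<in> {0..l}" "x \<notin> insert l N"
    show "\<bar>g x\<bar> \<le> B"
    proof (rule field_le_epsilon)
      fix e :: real assume "0 < e"
      with N(2)[of x e] x obtain d where d: "d > 0"
        "\<And>h. 0 < h \<Longrightarrow> h < d \<Longrightarrow> \<bar>integral {x..x+h} f / h - f x\<bar> < e"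
        by (auto simp: divide_inverse mult.commute)
      define h where "h = min (d/2) (l - x)"
      have h: "0 < h" "h < d" "x + h \<le> l" using d x by (auto simp: h_def min_def field_simps)
      have "integral {x..x+h} f = integral {x..x+h} g"
        using x h by (intro Henstock_Kurzweil_Integration.integral_cong) (auto simp: f_def)
      then have "\<bar>integral {x..x+h} f\<bar> \<le> B * h" using B[of x "x+h"] x h by auto
      then have "\<bar>integral {x..x+h} f / h\<bar> \<le> B" using h by (simp add: field_simps)
      moreover have "f x = g x" using x by (simp add: f_def)
      ultimately show "\<bar>g x\<bar> \<le> B + e" using d(2)[OF h(1,2)] by linarith
    qed
  qed
qed

lemma interval_integrals_zero_AE:
  assumes "g \<in> L2_int l" "\<And>x y. 0 \<le> x \<Longrightarrow> x \<le> y \<Longrightarrow> y \<le> l \<Longrightarrow> integral {x..y} g = 0"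
  shows "AE x in leb l. g x = 0"
  using interval_integrals_le_AE[of g l 0] assms L2_int_integrable(2)[OF assms(1)]
  by (simp add: absolutely_integrable_on_def)

lemma prim_unique:
  assumes "prim l h g" "prim l h f" shows "AE x in leb l. g x = f x"
proof -
  have "prim l (\<lambda>x. 0) (\<lambda>x. g x - f x)" using prim_diff[OF assms] by simp
  from interval_integrals_zero_AE[OF primD(1)[OF this] primD(2)[OF this, simplified]]
  show ?thesis by simp
qed

text \<open>The finite exceptional set admits the piecewise polynomial cutoff functions constructed
  at the vertices.\<close>

lemma prim_derivative:
  assumes c: "continuous_on {0..l} h" and g: "g \<in> L2_int l" and S: "finite S"
    and d: "\<And>x. x \<in> {0<..<l} - S \<Longrightarrow> (h has_real_derivative g x) (at x)"
  shows "prim l h g"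
  unfolding prim_def
proof (intro conjI g allI impI)
  fix x y assume xy: "0 \<le> x \<and> x \<le> y \<and> y \<le> l"
  show "(g has_integral h y - h x) {x..y}"
    using xy d
    by (intro fundamental_theorem_of_calculus_interior_strong[OF S])
      (auto simp: has_real_derivative_iff_has_vector_derivative[symmetric]
        intro: continuous_on_subset[OF c])
qed

lemma continuous_AE_eq:
  fixes h k :: "real \<Rightarrow> real"
  assumes "continuous_on {0..l} h" "continuous_on {0..l} k" "0 < l"
    and ae: "AE x in leb l. h x = k x" and x: "x \<in> {0..l}"
  shows "h x = k x"
proof -
  let ?d = "\<lambda>x. h x - k x"
  have c: "continuous_on {0..l} ?d" by (intro continuous_intros assms)
  have "nsq l ?d = nsq l (\<lambda>x. 0)"
    using ae by (intro nsq_cong_AE[symmetric]) (auto simp: L2_int_continuous[OF c] elim: eventually_mono)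
  then have "integral\<^sup>L (leb l) (\<lambda>x. (?d x)\<^sup>2) = 0" by (simp add: nsq_def)
  moreover have "continuous_on {0..l} (\<lambda>x. (?d x)\<^sup>2)" by (intro continuous_intros c)
  ultimately show ?thesis
    using integralL_eq_0_iff[of 0 l "\<lambda>x. (?d x)\<^sup>2"] assms(3) x by auto
qed

text \<open>Continuous representatives on a nondegenerate interval are unique, so the definite
  description in \<open>trace_int\<close> denotes as soon as one exists, at every point of the
  interval and not only at its ends.\<close>

lemma trace_int_eq:
  assumes h: "continuous_on {0..l} h" and ae: "AE x in leb l. f x = h x"
    and l: "0 < l" and x: "x \<in> {0..l}"
  shows "trace_int l f x = h x"
  unfolding trace_int_def
proof (rule the_equality)
  show "\<exists>k. continuous_on {0..l} k \<and> (AE x in leb l. f x = k x) \<and> h x = k x"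
    using h ae by blast
  fix y assume "\<exists>k. continuous_on {0..l} k \<and> (AE x in leb l. f x = k x) \<and> y = k x"
  then obtain k where k: "continuous_on {0..l} k" "AE x in leb l. f x = k x" "y = k x"
    by blast
  have "AE x in leb l. h x = k x" using ae k(2) by eventually_elim simp
  then show "y = h x" using continuous_AE_eq[OF h k(1) l _ x] k(3) by simp
qed

text \<open>Average (h x)^2 <= 2 (h y)^2 + 2 s |g|^2 over y in a window of length s around x. The
  free length s is what later yields a trace inequality at every dyadic scale.\<close>

lemma prim_sup_bound:
  assumes p: "prim l h g" and s: "0 < s" "s \<le> l" and x: "x \<in> {0..l}"
  shows "(h x)\<^sup>2 \<le> 2 / s * nsq l h + 2 * s * nsq l g"
proof -
  \<comment> \<open>Left end of a window of length s that contains x and stays inside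
    [0, l].\<close>
  define c where "c = min x (l - s)"
  have c: "0 \<le> c" "c \<le> x" "x \<le> c + s" "c + s \<le> l" using x s by (auto simp: c_def min_def)
  have ch: "continuous_on {0..l} h" by (rule prim_continuous[OF p])
  have ch2: "continuous_on {0..l} (\<lambda>x. (h x)\<^sup>2)" by (intro continuous_intros ch)
  note L = L2_int_continuous[OF ch2]
  have "((\<lambda>y. (h x)\<^sup>2) has_integral s * (h x)\<^sup>2) {c..c+s}"
    using has_integral_const_real[of "(h x)\<^sup>2" c "c+s"] s by simp
  moreover have "((\<lambda>y. 2 * (h y)\<^sup>2 + 2 * s * nsq l g) has_integral
      (2 * integral {c..c+s} (\<lambda>y. (h y)\<^sup>2) + s * (2 * s * nsq l g))) {c..c+s}"
  proof (intro has_integral_add has_integral_mult_right)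
    have "(\<lambda>y. (h y)\<^sup>2) integrable_on {c..c+s}"
      using integral_Icc_eq_LINT(2)[OF L c(1,4)] by (auto simp: absolutely_integrable_on_def)
    then show "((\<lambda>y. (h y)\<^sup>2) has_integral integral {c..c+s} (\<lambda>y. (h y)\<^sup>2)) {c..c+s}"
      by (rule integrable_integral)
    show "((\<lambda>y. 2 * s * nsq l g) has_integral s * (2 * s * nsq l g)) {c..c+s}"
      using has_integral_const_real[of "2 * s * nsq l g" c "c+s"] s by simp
  qed
  moreover have "(h x)\<^sup>2 \<le> 2 * (h y)\<^sup>2 + 2 * s * nsq l g" if y: "y \<in> {c..c+s}" for y
  proof -
    have "(h x)\<^sup>2 = (h y + (h x - h y))\<^sup>2" by simp
    also have "\<dots> \<le> 2 * (h y)\<^sup>2 + 2 * (h x - h y)\<^sup>2" by (rule two_sq_bound)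
    also have "(h x - h y)\<^sup>2 \<le> \<bar>x - y\<bar> * nsq l g"
      using prim_holder[OF p, of y x] x y c by auto
    also have "\<dots> \<le> s * nsq l g" using y c by (intro mult_right_mono) auto
    finally show ?thesis by simp
  qed
  ultimately have "s * (h x)\<^sup>2 \<le> 2 * integral {c..c+s} (\<lambda>y. (h y)\<^sup>2) + s * (2 * s * nsq l g)"
    by (rule has_integral_le)
  also have "integral {c..c+s} (\<lambda>y. (h y)\<^sup>2) \<le> integral {0..l} (\<lambda>y. (h y)\<^sup>2)"
    using c L2_int_integrable(2)[OF L] integral_Icc_eq_LINT(2)[OF L c(1,4)]
    by (intro integral_subset_le) (auto simp: absolutely_integrable_on_def)
  also have "\<dots> = nsq l h" unfolding nsq_def using LINT_eq_integral_0[OF L] by simp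
  finally show ?thesis using s by (simp add: field_simps)
qed

section \<open>Weak derivatives on an interval\<close>

lemma LINT_cong_L2:
  assumes "f \<in> L2_int l" "AE x in leb l. f x = h x" "g \<in> L2_int l"
  shows "(LINT x|leb l. h x * g x) = (LINT x|leb l. f x * g x)"
  using L2_intD(1)[OF assms(1)] L2_intD(1)[OF L2_int_cong_AE[OF assms(1,2)]] L2_intD(1)[OF assms(3)] assms(2)
  by (intro integral_cong_AE) auto

lemma LINT_L2_tendsto:
  assumes fn: "\<And>n. fn n \<in> L2_int l" and f: "f \<in> L2_int l" and g: "g \<in> L2_int l"
    and lim: "(\<lambda>n. nsq l (\<lambda>x. fn n x - f x)) \<longlonglongrightarrow> 0"
  shows "(\<lambda>n. LINT x|leb l. fn n x * g x) \<longlonglongrightarrow> (LINT x|leb l. f x * g x)"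
proof -
  let ?I = "\<lambda>f. LINT x|leb l. f x * g x"
  have "(\<lambda>n. sqrt (nsq l (\<lambda>x. fn n x - f x) * nsq l g)) \<longlonglongrightarrow> sqrt (0 * nsq l g)"
    by (intro tendsto_intros lim)
  then have 0: "(\<lambda>n. sqrt (nsq l (\<lambda>x. fn n x - f x) * nsq l g)) \<longlonglongrightarrow> 0" by simp
  have "norm (?I (fn n) - ?I f) \<le> sqrt (nsq l (\<lambda>x. fn n x - f x) * nsq l g)" for n
  proof -
    have "?I (fn n) - ?I f = ?I (\<lambda>x. fn n x - f x)"
      by (subst Bochner_Integration.integral_diff[symmetric])
        (auto intro!: L2_int_product fn f g simp: algebra_simps)
    then have "(?I (fn n) - ?I f)\<^sup>2 \<le> nsq l (\<lambda>x. fn n x - f x) * nsq l g"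
      using Cauchy_Schwarz_L2_int[OF L2_int_diff[OF fn f] g] by simp
    then show ?thesis by (simp add: real_le_rsqrt)
  qed
  then have "(\<lambda>n. ?I (fn n) - ?I f) \<longlonglongrightarrow> 0"
    by (intro Lim_null_comparison[OF _ 0]) auto
  then show ?thesis by (simp add: LIM_zero_iff)
qed

lemma prim_weak_deriv:
  assumes p: "prim l h g" and f: "f \<in> L2_int l" "AE x in leb l. f x = h x" and l: "0 < l"
  shows "weak_deriv l f g"
  unfolding weak_deriv_def
proof (intro allI impI; elim conjE exE)
  fix \<phi> \<phi>' :: "real \<Rightarrow> real" and c d
  assume d: "\<forall>x. (\<phi> has_real_derivative \<phi>' x) (at x)" and c': "continuous_on UNIV \<phi>'"
    and cd: "0 < c" "d < l" "\<forall>x. x \<notin> {c..d} \<longrightarrow> \<phi> x = 0"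
  have L: "\<phi>' \<in> L2_int l" by (intro L2_int_continuous continuous_on_subset[OF c']) auto
  have c: "continuous_on {0..l} \<phi>"
    using d by (intro continuous_at_imp_continuous_on) (auto intro: DERIV_isCont)
  have q: "prim l \<phi> \<phi>'"
    using d by (intro prim_derivative[of _ _ _ "{}"] c L) auto
  have z: "\<phi> 0 = 0" "\<phi> l = 0" using cd by auto
  have "(LINT x|leb l. f x * \<phi>' x) = (LINT x|leb l. h x * \<phi>' x)"
    using LINT_cong_L2[OF f L] by simp
  then show "(LINT x|leb l. f x * \<phi>' x) = - (LINT x|leb l. g x * \<phi> x)"
    using prim_parts[OF p q] l z by (simp add: mult.commute[of "\<phi> _"])
qed

text \<open>
  A trapezoid approximating the indicator of \<open>(a, b]\<close>, and its primitive, which is piecewise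
  quadratic and hence admissible in the definition of the weak derivative.
\<close>
definition trapezoid :: "real \<Rightarrow> real \<Rightarrow> real \<Rightarrow> real \<Rightarrow> real" where
  "trapezoid e a b x = (max 0 (x - a) - max 0 (x - a - e) - max 0 (x - b) + max 0 (x - b - e)) / e"

definition trapezoid_prim :: "real \<Rightarrow> real \<Rightarrow> real \<Rightarrow> real \<Rightarrow> real" where
  "trapezoid_prim e a b x = ((max 0 (x - a))\<^sup>2 - (max 0 (x - a - e))\<^sup>2 - (max 0 (x - b))\<^sup>2
     + (max 0 (x - b - e))\<^sup>2) / (2 * e)"

text \<open>The corner x = a is the only delicate point; there the difference quotient at step h is
  bounded by |h|.\<close>

lemma max_sq_deriv: "((\<lambda>x. (max 0 (x - a))\<^sup>2) has_real_derivative 2 * max 0 (x - a)) (at (x::real))"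
proof (cases "x = a")
  case True
  have "((\<lambda>h. (max 0 (a + h - a))\<^sup>2 / h) \<longlongrightarrow> 0) (at 0)"
  proof (rule Lim_null_comparison[of _ "\<lambda>h. \<bar>h\<bar>"])
    show "\<forall>\<^sub>F h in at 0. norm ((max 0 (a + h - a))\<^sup>2 / h) \<le> \<bar>h\<bar>"
      by (intro always_eventually allI) (auto simp: max_def power2_eq_square)
    show "((\<lambda>h. \<bar>h\<bar>) \<longlongrightarrow> 0) (at (0::real))" by (rule tendsto_rabs_zero) (rule tendsto_ident_at)
  qed
  then show ?thesis using True by (simp add: DERIV_def)
next
  case False
  consider "x < a" | "a < x" using False by linarith
  then show ?thesis
  proof cases
    case 1
    have "((\<lambda>x. (max 0 (x - a))\<^sup>2) has_real_derivative 0) (at x)"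
      by (rule has_field_derivative_transform_within_open[of "\<lambda>_. 0" _ _ "{..<a}"]) (use 1 in auto)
    then show ?thesis using 1 by simp
  next
    case 2
    have "((\<lambda>x. (x - a)\<^sup>2) has_real_derivative 2 * (x - a)) (at x)"
      by (auto intro!: derivative_eq_intros)
    then have "((\<lambda>x. (max 0 (x - a))\<^sup>2) has_real_derivative 2 * (x - a)) (at x)"
      by (rule has_field_derivative_transform_within_open[of _ _ _ "{a<..}"]) (use 2 in auto)
    then show ?thesis using 2 by simp
  qed
qed

lemma trapezoid_prim_deriv:
  assumes "0 < e"
  shows "(trapezoid_prim e a b has_real_derivative trapezoid e a b x) (at x)"
proof -
  have "(trapezoid_prim e a b has_real_derivative
      (2 * max 0 (x - a) - 2 * max 0 (x - (a + e)) - 2 * max 0 (x - b) + 2 * max 0 (x - (b + e))) / (2 * e)) (at x)"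
    unfolding trapezoid_prim_def[abs_def] diff_diff_eq
    by (intro DERIV_cdivide DERIV_add DERIV_diff max_sq_deriv)
  also have "(2 * max 0 (x - a) - 2 * max 0 (x - (a + e)) - 2 * max 0 (x - b) + 2 * max 0 (x - (b + e))) / (2 * e)
    = trapezoid e a b x"
    using assms by (simp add: trapezoid_def field_simps)
  finally show ?thesis .
qed

lemma trapezoid_prim_outside:
  assumes "0 < e" "a < b"
  shows "x < a \<Longrightarrow> trapezoid_prim e a b x = 0" "b + e < x \<Longrightarrow> trapezoid_prim e a b x = b - a"
proof -
  show "trapezoid_prim e a b x = 0" if "x < a"
    using assms that by (simp add: trapezoid_prim_def)
  assume "b + e < x"
  then have "trapezoid_prim e a b x = ((x - a)\<^sup>2 - (x - a - e)\<^sup>2 - (x - b)\<^sup>2 + (x - b - e)\<^sup>2) / (2 * e)"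
    using assms by (simp add: trapezoid_prim_def)
  also have "(x - a)\<^sup>2 - (x - a - e)\<^sup>2 - (x - b)\<^sup>2 + (x - b - e)\<^sup>2 = 2 * e * (b - a)"
    by (simp add: power2_eq_square algebra_simps)
  finally show "trapezoid_prim e a b x = b - a" using assms by simp
qed

lemma trapezoid_values:
  assumes "0 < e" "a < b"
  shows "x \<le> a \<Longrightarrow> trapezoid e a b x = 0" "a + e \<le> x \<Longrightarrow> x \<le> b \<Longrightarrow> trapezoid e a b x = 1"
    "b + e \<le> x \<Longrightarrow> trapezoid e a b x = 0"
  using assms by (simp_all add: trapezoid_def)

lemma trapezoid_bound:
  assumes "0 < e" shows "\<bar>trapezoid e a b x\<bar> \<le> 2"
proof -
  have 1: "0 \<le> max 0 u - max 0 (u - e) \<and> max 0 u - max 0 (u - e) \<le> e" for u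
    using assms by (simp add: max_def)
  have "\<bar>max 0 (x - a) - max 0 (x - a - e) - max 0 (x - b) + max 0 (x - b - e)\<bar> \<le> 2 * e"
    using 1[of "x - a"] 1[of "x - b"] by linarith
  then show ?thesis using assms by (simp add: trapezoid_def pos_divide_le_eq)
qed

text \<open>At each fixed x the sequence is eventually constant. The ramps lie to the right of a and
  of b, hence the limit excludes a and includes b.\<close>

lemma trapezoid_lim:
  assumes "a < b"
  shows "(\<lambda>n. trapezoid (1 / real (Suc n)) a b x) \<longlonglongrightarrow> indicator {a<..b} x"
proof (rule tendsto_eventually)
  have ev: "\<forall>\<^sub>F n in sequentially. 1 / real (Suc n) < d" if "0 < d" for d
    using order_tendstoD(2)[OF LIMSEQ_inverse_real_of_nat that] by (simp add: inverse_eq_divide)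
  consider "x \<le> a" | "a < x" "x \<le> b" | "b < x" by linarith
  then show "\<forall>\<^sub>F n in sequentially. trapezoid (1 / real (Suc n)) a b x = indicator {a<..b} x"
  proof cases
    case 1
    then show ?thesis
      using trapezoid_values(1)[OF _ assms] by (intro always_eventually allI) simp
  next
    case 2
    then have "\<forall>\<^sub>F n in sequentially. 1 / real (Suc n) < x - a" by (intro ev) simp
    then show ?thesis
    proof eventually_elim
      case (elim n)
      then show ?case using trapezoid_values(2)[OF _ assms, of "1 / real (Suc n)" x] 2 by simp
    qed
  next
    case 3
    then have "\<forall>\<^sub>F n in sequentially. 1 / real (Suc n) < x - b" by (intro ev) simp
    then show ?thesis
    proof eventually_elim
      case (elim n)
      then show ?case using trapezoid_values(3)[OF _ assms, of "1 / real (Suc n)" x] 3 by simp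
    qed
  qed
qed

lemma trapezoid_integral_lim:
  assumes k: "k \<in> L2_int l" and ab: "0 \<le> a" "a < b" "b \<le> l"
  shows "(\<lambda>n. LINT x|leb l. k x * trapezoid (1 / real (Suc n)) a b x)
    \<longlonglongrightarrow> integral {a..b} k"
proof -
  have m: "trapezoid e a b \<in> borel_measurable (leb l)" for e
    unfolding trapezoid_def[abs_def] divide_inverse
    by (intro continuous_imp_measurable_on_sets_lebesgue continuous_intros) auto
  have i: "(\<lambda>x. indicat_real {a<..b} x) \<in> borel_measurable (leb l)"
    by (intro measurable_restrict_space1 borel_measurable_indicator) simp
  have "(\<lambda>n. LINT x|leb l. k x * trapezoid (1 / real (Suc n)) a b x)
    \<longlonglongrightarrow> (LINT x|leb l. k x * indicator {a<..b} x)"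
  proof (rule integral_dominated_convergence)
    show "integrable (leb l) (\<lambda>x. 2 * \<bar>k x\<bar>)"
      using L2_int_integrable(1)[OF k] by auto
    show "AE x in leb l. norm (k x * trapezoid (1 / real (Suc n)) a b x) \<le> 2 * \<bar>k x\<bar>" for n
      using trapezoid_bound[of "1 / real (Suc n)" a b]
      by (intro AE_I2) (simp add: abs_mult mult.commute[of "\<bar>k _\<bar>"] mult_right_mono)
    show "AE x in leb l. (\<lambda>n. k x * trapezoid (1 / real (Suc n)) a b x)
       \<longlonglongrightarrow> k x * indicator {a<..b} x"
      using ab by (intro AE_I2 tendsto_intros trapezoid_lim)
  qed (use L2_intD(1)[OF k] m i in auto)
  also have "(LINT x|leb l. k x * indicator {a<..b} x)
     = (LINT x|leb l. indicator {a..b} x * k x)"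
  proof (intro integral_cong_AE AE_lebesgue_on_negligible[of "{a}"])
    show "(\<lambda>x. k x * indicat_real {a<..b} x) \<in> borel_measurable (leb l)"
      using L2_intD(1)[OF k] i by auto
    have "indicat_real {a..b} \<in> borel_measurable (leb l)"
      by (intro measurable_restrict_space1 borel_measurable_indicator) simp
    then show "(\<lambda>x. indicat_real {a..b} x * k x) \<in> borel_measurable (leb l)"
      using L2_intD(1)[OF k] by auto
  qed (auto simp: indicator_def)
  also have "\<dots> = integral {a..b} k"
    using integral_Icc_eq_LINT(1)[OF k] ab by simp
  finally show ?thesis .
qed

text \<open>The du Bois-Reymond lemma. Testing with a difference of two normalised trapezoid
  primitives shows that every interior mean value of \<open>k\<close> equals the mean over the
  middle third, which is the constant sought.\<close>

lemma weak_deriv_zero_const: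
  assumes k: "k \<in> L2_int l" and w: "weak_deriv l k (\<lambda>x. 0)" and l: "0 < l"
  shows "\<exists>c. AE x in leb l. k x = c"
proof -
  define c where "c = integral {l/3..2*l/3} k / (l/3)"
  have mean: "integral {a..b} k = c * (b - a)" if ab: "0 < a" "a < b" "b < l" for a b
  proof -
    let ?T = "\<lambda>n a b. LINT x|leb l. k x * trapezoid (1 / real (Suc n)) a b x"
    have cT: "continuous_on UNIV (trapezoid e a b)" for e a b
      unfolding trapezoid_def[abs_def] divide_inverse by (intro continuous_intros)
    have LT: "trapezoid e a b \<in> L2_int l" for e a b
      by (intro L2_int_continuous continuous_on_subset[OF cT]) auto
    have ev: "\<forall>\<^sub>F n in sequentially. 1 / real (Suc n) < min (l - b) (l / 3)"
      using order_tendstoD(2)[OF LIMSEQ_inverse_real_of_nat, of "min (l - b) (l / 3)"] ab l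
      by (simp add: inverse_eq_divide)
    have eq: "\<forall>\<^sub>F n in sequentially. ?T n a b / (b - a) = ?T n (l/3) (2*l/3) / (l/3)"
      using ev
    proof eventually_elim
      case (elim n)
      define e where "e = 1 / real (Suc n)"
      have e: "0 < e" "b + e < l" "2*l/3 + e < l" using elim by (auto simp: e_def)
      \<comment> \<open>Each quotient equals 0 to the left and 1 to the right of its trapezoid, so
        the difference has compact support inside (0, l).\<close>
      let ?\<phi> = "\<lambda>x. trapezoid_prim e a b x / (b - a) - trapezoid_prim e (l/3) (2*l/3) x / (l/3)"
      let ?\<phi>' = "\<lambda>x. trapezoid e a b x / (b - a) - trapezoid e (l/3) (2*l/3) x / (l/3)"
      have "(LINT x|leb l. k x * ?\<phi>' x) = - (LINT x|leb l. 0 * ?\<phi> x)"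
      proof (rule w[unfolded weak_deriv_def, rule_format, of ?\<phi> ?\<phi>'], intro conjI allI)
        fix x show "(?\<phi> has_real_derivative ?\<phi>' x) (at x)"
          by (intro DERIV_diff DERIV_cdivide trapezoid_prim_deriv e)
        show "continuous_on UNIV ?\<phi>'"
          using ab l by (intro continuous_intros cT) auto
        have out: "?\<phi> x = 0" if "x \<notin> {min a (l/3)..max (b + e) (2*l/3 + e)}" for x
        proof -
          have "(x < a \<and> x < l/3) \<or> (b + e < x \<and> 2*l/3 + e < x)"
            using that by (auto simp: not_le)
          then show ?thesis
            using trapezoid_prim_outside[OF e(1) ab(2), of x] trapezoid_prim_outside[OF e(1), of "l/3" "2*l/3" x] l ab
            by auto
        qed
        show "\<exists>c d. 0 < c \<and> d < l \<and> (\<forall>x. x \<notin> {c..d} \<longrightarrow> ?\<phi> x = 0)"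
          by (rule exI[of _ "min a (l/3)"], rule exI[of _ "max (b + e) (2*l/3 + e)"])
            (use out ab l e in auto)
      qed
      then have "(LINT x|leb l. k x * trapezoid e a b x / (b - a)
          - k x * trapezoid e (l/3) (2*l/3) x / (l/3)) = 0"
        by (simp only: right_diff_distrib times_divide_eq_right mult_zero_left) simp
      then have "(LINT x|leb l. k x * trapezoid e a b x / (b - a))
          - (LINT x|leb l. k x * trapezoid e (l/3) (2*l/3) x / (l/3)) = 0"
        using L2_int_product[OF k LT[of e a b]] L2_int_product[OF k LT[of e "l/3" "2*l/3"]]
        by (subst (asm) Bochner_Integration.integral_diff) auto
      then show ?case unfolding e_def integral_divide_zero by simp
    qed
    have "(\<lambda>n. ?T n (l/3) (2*l/3) / (l/3)) \<longlonglongrightarrow> integral {l/3..2*l/3} k / (l/3)"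
      using l by (intro tendsto_divide tendsto_const trapezoid_integral_lim k) auto
    moreover have "(\<lambda>n. ?T n a b / (b - a)) \<longlonglongrightarrow> integral {a..b} k / (b - a)"
      using ab by (intro tendsto_divide tendsto_const trapezoid_integral_lim k) auto
    then have "(\<lambda>n. ?T n (l/3) (2*l/3) / (l/3)) \<longlonglongrightarrow> integral {a..b} k / (b - a)"
      using tendsto_cong[OF eq] by simp
    ultimately have "integral {a..b} k / (b - a) = integral {l/3..2*l/3} k / (l/3)"
      by (rule LIMSEQ_unique[symmetric])
    then have "integral {a..b} k / (b - a) = c" by (simp only: c_def)
    then show ?thesis using ab by (auto simp: field_simps)
  qed
  have p: "prim l (\<lambda>x. (0 + integral {0..x} k) - c * x) (\<lambda>x. k x - c)"
  proof (intro prim_diff prim_indefinite k)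
    show "prim l ((*) c) (\<lambda>x. c)"
      by (rule prim_derivative[of _ _ _ "{}"]) (auto intro!: continuous_intros derivative_eq_intros)
  qed
  let ?D = "\<lambda>x. (0 + integral {0..x} k) - c * x"
  have cl: "closure {0<..<l} = {0..l}" using l by simp
  \<comment> \<open>The mean values are known for interior intervals only; continuity extends
    constancy of \<open>?D\<close> to the end points.\<close>
  have const: "?D x = ?D (l/2)" if "x \<in> {0..l}" for x
  proof (rule continuous_constant_on_closure[of "{0<..<l}" ?D])
    show "continuous_on (closure {0<..<l}) ?D" unfolding cl by (rule prim_continuous[OF p])
    show "x \<in> closure {0<..<l}" using that cl by simp
    fix y assume y: "y \<in> {0<..<l}"
    have P: "prim l (\<lambda>x. 0 + integral {0..x} k) k" by (rule prim_indefinite[OF k])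
    have lt: "?D v - ?D u = 0" if uv: "0 < u" "u < v" "v < l" for u v
      using primD(2)[OF P, of u v] mean[OF uv] uv by (simp add: algebra_simps)
    show "?D y = ?D (l/2)"
    proof (cases y "l/2" rule: linorder_cases)
      case less
      show ?thesis using lt[of y "l/2"] less y by auto
    next
      case greater
      show ?thesis using lt[of "l/2" y] greater y l by auto
    next
      case equal
      show ?thesis by (simp only: equal)
    qed
  qed
  have "AE x in leb l. k x - c = 0"
  proof (rule interval_integrals_zero_AE[OF primD(1)[OF p]])
    fix x y :: real assume "0 \<le> x" "x \<le> y" "y \<le> l"
    then show "integral {x..y} (\<lambda>x. k x - c) = 0"
      using primD(2)[OF p, of x y] const[of x] const[of y] by simp
  qed
  then show ?thesis by auto
qed

text \<open>Subtracting the indefinite integral of \<open>g\<close> from \<open>f\<close> leaves a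
  function with weak derivative 0, which is a constant; the constant is added back to the
  primitive.\<close>

lemma weak_deriv_imp_prim:
  assumes f: "f \<in> L2_int l" and g: "g \<in> L2_int l" and l: "0 < l" and w: "weak_deriv l f g"
  obtains h where "prim l h g" "AE x in leb l. f x = h x"
proof -
  define H where "H x = 0 + integral {0..x} g" for x
  have p: "prim l H g" using prim_indefinite[OF g, of 0] unfolding H_def[abs_def] .
  have w2: "weak_deriv l H g" by (rule prim_weak_deriv[OF p prim_L2[OF p] _ l]) simp
  have k: "(\<lambda>x. f x - H x) \<in> L2_int l" by (rule L2_int_diff[OF f prim_L2[OF p]])
  have "weak_deriv l (\<lambda>x. f x - H x) (\<lambda>x. 0)"
    unfolding weak_deriv_def
  proof (intro allI impI)
    fix \<phi> \<phi>' :: "real \<Rightarrow> real"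
    assume t: "(\<forall>x. (\<phi> has_real_derivative \<phi>' x) (at x)) \<and> continuous_on UNIV \<phi>' \<and>
       (\<exists>c d. 0 < c \<and> d < l \<and> (\<forall>x. x \<notin> {c..d} \<longrightarrow> \<phi> x = 0))"
    from t have c': "continuous_on UNIV \<phi>'" by (elim conjE)
    have L: "\<phi>' \<in> L2_int l" by (intro L2_int_continuous continuous_on_subset[OF c']) simp
    have "(LINT x|leb l. (f x - H x) * \<phi>' x)
      = (LINT x|leb l. f x * \<phi>' x) - (LINT x|leb l. H x * \<phi>' x)"
      unfolding left_diff_distrib
      by (intro Bochner_Integration.integral_diff L2_int_product f prim_L2[OF p] L)
    also have "\<dots> = 0"
      using spec[OF spec[OF w[unfolded weak_deriv_def]], THEN mp, OF t]
        spec[OF spec[OF w2[unfolded weak_deriv_def]], THEN mp, OF t] by simp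
    finally show "(LINT x|leb l. (f x - H x) * \<phi>' x) = - (LINT x|leb l. 0 * \<phi> x)"
      by simp
  qed
  from weak_deriv_zero_const[OF k this l]
  obtain c where c: "AE x in leb l. f x - H x = c" by blast
  have "prim l (\<lambda>x. c + integral {0..x} g) g" by (rule prim_indefinite[OF g])
  moreover have "AE x in leb l. f x = c + integral {0..x} g"
    using c by eventually_elim (simp add: H_def)
  ultimately show ?thesis by (rule that)
qed

text \<open>Weak differentiation is a closed operation in L2, since both sides of its defining
  identity pass to the limit. Pointwise convergence follows from the sup bound with window length l,
  and this is how vertex conditions survive limits.\<close>

lemma prim_limit:
  assumes l: "0 < l" and p: "\<And>n. prim l (h n) (g' n)" and f: "f \<in> L2_int l" and g: "g \<in> L2_int l"
    and lf: "(\<lambda>n. nsq l (\<lambda>x. h n x - f x)) \<longlonglongrightarrow> 0" and lg: "(\<lambda>n. nsq l (\<lambda>x. g' n x - g x)) \<longlonglongrightarrow> 0"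
  obtains k where "prim l k g" "AE x in leb l. f x = k x"
    "\<And>x. x \<in> {0..l} \<Longrightarrow> (\<lambda>n. h n x) \<longlonglongrightarrow> k x"
proof -
  have "weak_deriv l f g"
    unfolding weak_deriv_def
  proof (intro allI impI)
    fix \<phi> \<phi>' :: "real \<Rightarrow> real"
    assume t: "(\<forall>x. (\<phi> has_real_derivative \<phi>' x) (at x)) \<and> continuous_on UNIV \<phi>' \<and>
       (\<exists>c d. 0 < c \<and> d < l \<and> (\<forall>x. x \<notin> {c..d} \<longrightarrow> \<phi> x = 0))"
    note c' = t[THEN conjunct2, THEN conjunct1] and d = t[THEN conjunct1]
    have L': "\<phi>' \<in> L2_int l" by (intro L2_int_continuous continuous_on_subset[OF c']) simp
    have L: "\<phi> \<in> L2_int l"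
      using d by (intro L2_int_continuous continuous_at_imp_continuous_on) (auto intro: DERIV_isCont)
    have eq: "(LINT x|leb l. h n x * \<phi>' x) = - (LINT x|leb l. g' n x * \<phi> x)" for n
    proof -
      have "weak_deriv l (h n) (g' n)" by (rule prim_weak_deriv[OF p prim_L2[OF p] _ l]) simp
      from spec[OF spec[OF this[unfolded weak_deriv_def]], THEN mp, OF t] show ?thesis .
    qed
    have 1: "(\<lambda>n. LINT x|leb l. h n x * \<phi>' x) \<longlonglongrightarrow> (LINT x|leb l. f x * \<phi>' x)"
      by (rule LINT_L2_tendsto[OF prim_L2[OF p] f L' lf])
    have 2: "(\<lambda>n. - (LINT x|leb l. g' n x * \<phi> x)) \<longlonglongrightarrow> - (LINT x|leb l. g x * \<phi> x)"
      by (intro tendsto_minus LINT_L2_tendsto[OF primD(1)[OF p] g L lg])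
    show "(LINT x|leb l. f x * \<phi>' x) = - (LINT x|leb l. g x * \<phi> x)"
      using LIMSEQ_unique[OF 1[unfolded eq] 2] .
  qed
  then obtain k where k: "prim l k g" "AE x in leb l. f x = k x"
    by (rule weak_deriv_imp_prim[OF f g l])
  have "(\<lambda>n. h n x) \<longlonglongrightarrow> k x" if x: "x \<in> {0..l}" for x
  proof -
    have nk: "nsq l (\<lambda>x. h n x - k x) = nsq l (\<lambda>x. h n x - f x)" for n
    proof (rule nsq_cong_AE[OF L2_int_diff[OF prim_L2[OF p] f]])
      show "AE x in leb l. h n x - f x = h n x - k x"
        using k(2) by eventually_elim simp
    qed
    have "(\<lambda>n. 2 / l * nsq l (\<lambda>x. h n x - f x) + 2 * l * nsq l (\<lambda>x. g' n x - g x)) \<longlonglongrightarrow> 2 / l * 0 + 2 * l * 0"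
      by (intro tendsto_intros lf lg)
    then have lim0: "(\<lambda>n. 2 / l * nsq l (\<lambda>x. h n x - f x) + 2 * l * nsq l (\<lambda>x. g' n x - g x)) \<longlonglongrightarrow> 0"
      by simp
    have "(\<lambda>n. (h n x - k x)\<^sup>2) \<longlonglongrightarrow> 0"
    proof (rule Lim_null_comparison[OF always_eventually[OF allI] lim0])
      fix n
      show "norm ((h n x - k x)\<^sup>2) \<le> 2 / l * nsq l (\<lambda>x. h n x - f x) + 2 * l * nsq l (\<lambda>x. g' n x - g x)"
        using prim_sup_bound[OF prim_diff[OF p k(1)] l order_refl x, of n] by (simp add: nk)
    qed
    then have "(\<lambda>n. sqrt ((h n x - k x)\<^sup>2)) \<longlonglongrightarrow> sqrt 0" by (rule tendsto_real_sqrt)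
    then have "(\<lambda>n. h n x - k x) \<longlonglongrightarrow> 0" by (simp add: tendsto_rabs_zero_iff)
    then show ?thesis by (simp add: LIM_zero_iff)
  qed
  with k show ?thesis by (rule that)
qed

text \<open>Geometric increments make the sequence converge uniformly, and the L2 limit identifies
  the continuous limit with \<open>f\<close>. Elements of an interpolation space above the critical
  exponent obtain their traces in this way.\<close>

lemma continuous_rep_of_limit:
  assumes c: "\<And>n. continuous_on {0..l} (h n)" and r: "0 \<le> r" "r < 1"
    and inc: "\<And>n x. x \<in> {0..l} \<Longrightarrow> \<bar>h (Suc n) x - h n x\<bar> \<le> D * r ^ n"
    and f: "f \<in> L2_int l" and lf: "(\<lambda>n. nsq l (\<lambda>x. f x - h n x)) \<longlonglongrightarrow> 0"
  obtains k where "continuous_on {0..l} k" "AE x in leb l. f x = k x"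
    "\<And>n x. x \<in> {0..l} \<Longrightarrow> \<bar>k x - h n x\<bar> \<le> D * r ^ n / (1 - r)"
proof -
  have sum: "(\<Sum>i\<in>{n..<m}. D * r ^ i) \<le> D * r ^ n / (1 - r)" if "0 \<le> D" for n m
  proof (cases "n \<le> m")
    case True
    have "(\<Sum>i\<in>{n..<m}. D * r ^ i) = D * r ^ n * (\<Sum>i<m - n. r ^ i)"
      using True by (simp add: sum_distrib_left sum.atLeastLessThan_shift_0[of _ n m] atLeast0LessThan
        power_add mult.assoc)
    also have "(\<Sum>i<m - n. r ^ i) \<le> (\<Sum>i. r ^ i)"
      using r by (intro sum_le_suminf summable_geometric) auto
    also have "\<dots> = 1 / (1 - r)" using r by (intro suminf_geometric) auto
    finally show ?thesis using that r by (simp add: mult_left_mono)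
  next
    case False then show ?thesis using that r by simp
  qed
  have bd: "\<bar>h m x - h n x\<bar> \<le> D * r ^ n / (1 - r)" if x: "x \<in> {0..l}" and "n \<le> m" for n m x
  proof -
    have D: "0 \<le> D" using inc[OF x, of 0] by simp
    have "h m x - h n x = (\<Sum>i\<in>{n..<m}. h (Suc i) x - h i x)" using sum_Suc_diff'[OF that(2), of "\<lambda>i. h i x"] by simp
    also have "\<bar>\<dots>\<bar> \<le> (\<Sum>i\<in>{n..<m}. D * r ^ i)" by (intro sum_abs[THEN order_trans] sum_mono inc x)
    finally show ?thesis using sum[OF D, of n m] by linarith
  qed
  have r0: "(\<lambda>n. D * r ^ n / (1 - r)) \<longlonglongrightarrow> D * 0 / (1 - r)"
    using r by (intro tendsto_intros LIMSEQ_realpow_zero) auto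
  define k where "k x = lim (\<lambda>n. h n x)" for x
  have lim: "(\<lambda>n. h n x) \<longlonglongrightarrow> k x" if x: "x \<in> {0..l}" for x
  proof -
    have "Cauchy (\<lambda>n. h n x)"
    proof (rule metric_CauchyI)
      fix e :: real assume "0 < e"
      then have "\<forall>\<^sub>F n in sequentially. D * r ^ n / (1 - r) < e / 2"
        using order_tendstoD(2)[OF r0, of "e/2"] by simp
      from eventually_happens[OF this] obtain N where N: "D * r ^ N / (1 - r) < e / 2"
        by auto
      have "dist (h m x) (h n x) < e" if "m \<ge> N" "n \<ge> N" for m n
        using bd[OF x that(1)] bd[OF x that(2)] N unfolding dist_real_def by linarith
      then show "\<exists>M. \<forall>m\<ge>M. \<forall>n\<ge>M. dist (h m x) (h n x) < e" by blast
    qed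
    then show ?thesis unfolding k_def by (simp add: Cauchy_convergent_iff convergent_LIMSEQ_iff)
  qed
  have kb: "\<bar>k x - h n x\<bar> \<le> D * r ^ n / (1 - r)" if x: "x \<in> {0..l}" for n x
  proof (rule LIMSEQ_le_const2)
    show "(\<lambda>m. \<bar>h m x - h n x\<bar>) \<longlonglongrightarrow> \<bar>k x - h n x\<bar>" by (intro tendsto_intros lim x)
    show "\<exists>N. \<forall>m\<ge>N. \<bar>h m x - h n x\<bar> \<le> D * r ^ n / (1 - r)" using bd[OF x] by blast
  qed
  have ul: "uniform_limit {0..l} h k sequentially"
  proof (rule uniform_limitI)
    fix e :: real assume "0 < e"
    then have "\<forall>\<^sub>F n in sequentially. D * r ^ n / (1 - r) < e" using order_tendstoD(2)[OF r0, of e] by simp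
    then show "\<forall>\<^sub>F n in sequentially. \<forall>x\<in>{0..l}. dist (h n x) (k x) < e"
    proof eventually_elim
      case (elim n)
      show ?case
      proof
        fix x assume "x \<in> {0..l}"
        from kb[OF this, of n] elim show "dist (h n x) (k x) < e" unfolding dist_real_def by linarith
      qed
    qed
  qed
  have ck: "continuous_on {0..l} k"
    by (rule uniform_limit_theorem[OF _ ul]) (auto simp: c)
  have kL: "k \<in> L2_int l" by (rule L2_int_continuous[OF ck])
  have dL: "(\<lambda>x. f x - k x) \<in> L2_int l" by (intro L2_int_diff f kL)
  have "nsq l (\<lambda>x. f x - k x) \<le> 0"
  proof (rule LIMSEQ_le_const[of "\<lambda>n. 2 * nsq l (\<lambda>x. f x - h n x) + 2 * ((D * r ^ n / (1 - r))\<^sup>2 * nsq l (\<lambda>x. 1))"])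
    have "(\<lambda>n. 2 * nsq l (\<lambda>x. f x - h n x) + 2 * ((D * r ^ n / (1 - r))\<^sup>2 * nsq l (\<lambda>x. 1)))
      \<longlonglongrightarrow> 2 * 0 + 2 * ((D * 0 / (1 - r))\<^sup>2 * nsq l (\<lambda>x. 1))"
      by (intro tendsto_intros lf r0)
    then show "(\<lambda>n. 2 * nsq l (\<lambda>x. f x - h n x) + 2 * ((D * r ^ n / (1 - r))\<^sup>2 * nsq l (\<lambda>x. 1))) \<longlonglongrightarrow> 0"
      by simp
    have "nsq l (\<lambda>x. f x - k x) \<le> 2 * nsq l (\<lambda>x. f x - h n x) + 2 * ((D * r ^ n / (1 - r))\<^sup>2 * nsq l (\<lambda>x. 1))" for n
    proof -
      have hL: "h n \<in> L2_int l" by (rule L2_int_continuous[OF c])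
      have "nsq l (\<lambda>x. f x - k x) = nsq l (\<lambda>x. (f x - h n x) + (h n x - k x))" by simp
      also have "\<dots> \<le> 2 * nsq l (\<lambda>x. f x - h n x) + 2 * nsq l (\<lambda>x. h n x - k x)"
        by (intro nsq_add_le L2_int_diff f hL kL)
      also have "nsq l (\<lambda>x. h n x - k x) \<le> nsq l (\<lambda>x. D * r ^ n / (1 - r) * 1)"
      proof (intro nsq_mono_AE L2_int_diff hL kL L2_int_cmult L2_int_const AE_I2)
        fix x assume "x \<in> space (leb l)"
        then have "\<bar>h n x - k x\<bar> \<le> D * r ^ n / (1 - r) * 1"
          using kb[of x n] by (simp add: abs_minus_commute)
        then show "(h n x - k x)\<^sup>2 \<le> (D * r ^ n / (1 - r) * 1)\<^sup>2"
          by (metis abs_ge_zero power2_abs power_mono)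
      qed
      also have "\<dots> = (D * r ^ n / (1 - r))\<^sup>2 * nsq l (\<lambda>x. 1)" by (rule nsq_cmult)
      finally show ?thesis by simp
    qed
    then show "\<exists>N. \<forall>n\<ge>N. nsq l (\<lambda>x. f x - k x) \<le> 2 * nsq l (\<lambda>x. f x - h n x) + 2 * ((D * r ^ n / (1 - r))\<^sup>2 * nsq l (\<lambda>x. 1))"
      by blast
  qed
  then have "nsq l (\<lambda>x. f x - k x) = 0" by (simp add: antisym)
  from nsq_eq_0_AE[OF dL this] have "AE x in leb l. f x = k x" by eventually_elim simp
  with ck show ?thesis using kb by (rule that)
qed

section \<open>Lipschitz functions\<close>

text \<open>
  The monotone functions \<open>L x + b x\<close> and \<open>L x - b x\<close> induce Stieltjes measures whose sum is a
  multiple of the Lebesgue measure; the Radon-Nikodym theorem then provides a derivative of \<open>b\<close>.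
\<close>
lemma lipschitz_prim:
  fixes b :: "real \<Rightarrow> real"
  assumes l: "0 < l" and lip: "\<And>x y. x \<in> {0..l} \<Longrightarrow> y \<in> {0..l} \<Longrightarrow> \<bar>b x - b y\<bar> \<le> L * \<bar>x - y\<bar>"
  obtains g where "prim l b g" "AE x in leb l. \<bar>g x\<bar> \<le> L"
proof -
  have L: "0 \<le> L"
  proof -
    have "0 \<le> L * l" using lip[of l 0] l abs_ge_zero[of "b l - b 0"] by simp
    then show ?thesis using l by (simp add: zero_le_mult_iff)
  qed
  \<comment> \<open>Clamping to [0, l] extends \<open>b\<close> to the whole line with the same
    Lipschitz constant.\<close>
  define cl where "cl x = max 0 (min l x)" for x
  have cl: "cl x \<in> {0..l}" "\<bar>cl x - cl y\<bar> \<le> \<bar>x - y\<bar>" for x y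
    using l by (auto simp: cl_def max_def min_def)
  have clid: "cl x = x" if "x \<in> {0..l}" for x using that by (auto simp: cl_def)
  have blip: "\<bar>b (cl x) - b (cl y)\<bar> \<le> L * \<bar>x - y\<bar>" for x y
    using lip[OF cl(1) cl(1), of x y] mult_left_mono[OF cl(2)[of x y] L] by linarith
  define F1 where "F1 x = L * x + b (cl x)" for x
  define F2 where "F2 x = L * x - b (cl x)" for x
  have m1: "F1 x \<le> F1 y" and m2: "F2 x \<le> F2 y" if "x \<le> y" for x y
    using blip[of x y] that by (auto simp: F1_def F2_def abs_le_iff right_diff_distrib abs_if split: if_splits)
  have cb: "continuous_on UNIV (\<lambda>x. b (cl x))"
    by (rule lipschitz_on_continuous_on[of L], rule lipschitz_onI)
      (use blip L in \<open>auto simp: dist_real_def\<close>)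
  have c1: "continuous_on UNIV F1" and c2: "continuous_on UNIV F2"
    unfolding F1_def[abs_def] F2_def[abs_def] by (intro continuous_intros cb)+
  have r1: "continuous (at_right a) F1" and r2: "continuous (at_right a) F2" for a
    using c1 c2 by (auto simp: continuous_on_eq_continuous_at intro: continuous_at_imp_continuous_within)
  let ?M1 = "interval_measure F1" and ?M2 = "interval_measure F2"
  let ?\<mu> = "\<lambda>A. emeasure ?M1 A + emeasure ?M2 A"
  define S where "S = measure_of UNIV (sets borel) ?\<mu>"
  have sS: "sets S = sets borel"
    using sets.sigma_sets_eq[of "borel :: real measure"] by (simp add: S_def sets_measure_of)
  have eS: "emeasure S A = ?\<mu> A" if "A \<in> sets borel" for A
    unfolding S_def
  proof (rule emeasure_measure_of_sigma)
    show "sigma_algebra UNIV (sets (borel :: real measure))"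
      using sets.sigma_algebra_axioms[of "borel :: real measure"] by simp
    show "positive (sets borel) ?\<mu>" by (simp add: positive_def)
    show "countably_additive (sets borel) ?\<mu>"
    proof (rule countably_additiveI)
      fix A :: "nat \<Rightarrow> real set" assume A: "range A \<subseteq> sets borel" "disjoint_family A"
      have "(\<Sum>i. emeasure ?M1 (A i) + emeasure ?M2 (A i)) = (\<Sum>i. emeasure ?M1 (A i)) + (\<Sum>i. emeasure ?M2 (A i))"
        by (rule suminf_add[symmetric]) auto
      also have "\<dots> = emeasure ?M1 (\<Union>i. A i) + emeasure ?M2 (\<Union>i. A i)"
        using A by (simp add: suminf_emeasure)
      finally show "(\<Sum>i. emeasure ?M1 (A i) + emeasure ?M2 (A i)) = emeasure ?M1 (\<Union>i. A i) + emeasure ?M2 (\<Union>i. A i)" .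
    qed
  qed (rule that)
  let ?E = "range (\<lambda>(a, b). {a <.. b::real})"
  have sE: "sets borel = sigma_sets UNIV ?E"
    by (subst borel_sigma_sets_Ioc) (simp add: sets_measure_of)
  \<comment> \<open>On an interval (c, d] the two measures add up to (F1 d - F1 c) + (F2 d - F2 c) =
    2 L (d - c), because the contributions of \<open>b\<close> cancel. These intervals form a
    generator stable under intersection.\<close>
  have Seq: "S = density lborel (\<lambda>_. ennreal (2 * L))"
  proof (rule measure_eqI_generator_eq[where E = ?E and \<Omega> = UNIV and A = "\<lambda>i. {- real i<..real i}"])
    show "Int_stable ?E"
    proof (rule Int_stableI)
      fix u v assume "u \<in> ?E" "v \<in> ?E"
      then obtain a b c d where "u = {a<..b}" "v = {c<..d}" by auto
      then have "u \<inter> v = {max a c<..min b d}" by auto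
      then show "u \<inter> v \<in> ?E" by auto
    qed
    fix X assume "X \<in> ?E"
    then obtain c d where X: "X = {c<..d}" by auto
    show "emeasure S X = emeasure (density lborel (\<lambda>_. ennreal (2 * L))) X"
    proof (cases "c \<le> d")
      case True
      have "emeasure S X = ennreal (F1 d - F1 c) + ennreal (F2 d - F2 c)"
        unfolding X using True eS[of "{c<..d}"] by (simp add: emeasure_interval_measure_Ioc m1 m2 r1 r2)
      also have "\<dots> = ennreal (2 * L * (d - c))"
        using m1[OF True] m2[OF True]
        by (subst ennreal_plus[symmetric]) (auto simp: F1_def F2_def algebra_simps)
      also have "\<dots> = emeasure (density lborel (\<lambda>_. ennreal (2 * L))) X"
        unfolding X using True L by (simp add: emeasure_density_const ennreal_mult)
      finally show ?thesis .
    qed (simp add: X)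
  next
    show "sets S = sigma_sets UNIV ?E" using sS sE by simp
    show "sets (density lborel (\<lambda>_. ennreal (2 * L))) = sigma_sets UNIV ?E" using sE by simp
    show "range (\<lambda>i. {- real i<..real i}) \<subseteq> ?E" by auto
    show "(\<Union>i. {- real i<..real i}) = UNIV"
    proof -
      have "\<exists>i. x \<in> {- real i<..real i}" for x
      proof -
        obtain i where "\<bar>x\<bar> < real i" using reals_Archimedean2 by blast
        then show ?thesis by (intro exI[of _ i]) auto
      qed
      then show ?thesis by blast
    qed
    show "emeasure S {- real i<..real i} \<noteq> \<infinity>" for i
      using eS[of "{- real i<..real i}"]
      by (simp add: emeasure_interval_measure_Ioc m1 m2 r1 r2)
  qed auto
  have "absolutely_continuous lborel ?M1"
    unfolding absolutely_continuous_def
  proof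
    fix N assume N: "N \<in> null_sets (lborel :: real measure)"
    then have Nb: "N \<in> sets borel" by (auto simp: null_sets_def)
    have "emeasure S N = 0" using N by (simp add: Seq emeasure_density_const null_sets_def)
    then have "emeasure ?M1 N = 0" using eS[OF Nb] by simp
    then show "N \<in> null_sets ?M1" using Nb by (simp add: null_sets_def)
  qed
  moreover have "sets ?M1 = sets lborel" by simp
  ultimately obtain f where f: "f \<in> borel_measurable lborel" "density lborel f = ?M1"
    using sigma_finite_measure.Radon_Nikodym[OF lborel.sigma_finite_measure_axioms] by blast
  have int_f: "(\<integral>\<^sup>+t. f t * indicator {x..y} t \<partial>lborel) = ennreal (F1 y - F1 x)" if "x \<le> y" for x y
  proof -
    have "emeasure (density lborel f) {x..y} = ennreal (F1 y - F1 x)"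
      unfolding f(2) using that by (intro emeasure_interval_measure_Icc m1 c1)
    then show ?thesis using f(1) by (simp add: emeasure_density)
  qed
  have fin: "AE t in lborel. f t * indicator {0..l} t \<noteq> \<infinity>"
    using int_f[of 0 l] l f(1) by (intro nn_integral_PInf_AE) auto
  define \<phi> where "\<phi> t = enn2real (f t * indicator {0..l} t)" for t
  have hi: "(\<phi> has_integral F1 y - F1 x) {x..y}" if xy: "0 \<le> x" "x \<le> y" "y \<le> l" for x y
  proof -
    have "(\<integral>\<^sup>+t. ennreal (\<phi> t * indicator {x..y} t) \<partial>lborel) = (\<integral>\<^sup>+t. f t * indicator {x..y} t \<partial>lborel)"
    proof (rule nn_integral_cong_AE)
      show "AE t in lborel. ennreal (\<phi> t * indicator {x..y} t) = f t * indicator {x..y} t"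
        using fin
      proof eventually_elim
        case (elim t)
        then show ?case using xy by (auto simp: \<phi>_def indicator_def less_top)
      qed
    qed
    also have "\<dots> = ennreal (F1 y - F1 x)" by (rule int_f[OF xy(2)])
    finally have "((\<lambda>t. \<phi> t * indicator {x..y} t) has_integral F1 y - F1 x) UNIV"
      using f(1) m1[OF xy(2)] by (intro nn_integral_has_integral) (auto simp: \<phi>_def)
    moreover have "(\<lambda>t. \<phi> t * indicator {x..y} t) = (\<lambda>t. if t \<in> {x..y} then \<phi> t else 0)"
      by (auto simp: indicator_def)
    ultimately show ?thesis by (simp only: has_integral_restrict_UNIV)
  qed
  \<comment> \<open>\<open>F1\<close> is L x + b x on the interval, so its density exceeds the
    derivative of \<open>b\<close> by L.\<close>
  define g where "g t = \<phi> t - L" for t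
  have hg: "(g has_integral b y - b x) {x..y}" if xy: "0 \<le> x" "x \<le> y" "y \<le> l" for x y
  proof -
    have "((\<lambda>t. L) has_integral L * (y - x)) {x..y}"
      using has_integral_const_real[of L x y] xy by (simp add: mult.commute)
    from has_integral_diff[OF hi[OF xy] this]
    show ?thesis unfolding g_def[abs_def] using xy by (simp add: F1_def clid algebra_simps)
  qed
  have gi: "g integrable_on {0..l}" using hg[of 0 l] l by (auto simp: integrable_on_def)
  have bd: "AE x in leb l. \<bar>g x\<bar> \<le> L"
  proof (rule interval_integrals_le_AE[OF gi])
    fix x y :: real assume xy: "0 \<le> x" "x \<le> y" "y \<le> l"
    show "\<bar>integral {x..y} g\<bar> \<le> L * (y - x)"
      using integral_unique[OF hg[OF xy]] lip[of y x] xy by simp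
  qed
  have "g \<in> L2_int l"
    using L2_int_bounded_mult(1)[OF L2_int_const[of 1 l] integrable_imp_measurable[OF gi] bd] by simp
  then have "prim l b g" using hg by (auto simp: prim_def)
  then show ?thesis using bd by (rule that)
qed

text \<open>Quantitative product rule. It is applied with the coefficient \<open>a\<close> to form
  the flux a u', and with 1 / a to recover u' from the flux.\<close>

lemma prim_lipschitz_mult:
  fixes b :: "real \<Rightarrow> real"
  assumes l: "0 < l" and lip: "\<And>x y. x \<in> {0..l} \<Longrightarrow> y \<in> {0..l} \<Longrightarrow> \<bar>b x - b y\<bar> \<le> L * \<bar>x - y\<bar>"
    and B: "\<And>x. x \<in> {0..l} \<Longrightarrow> \<bar>b x\<bar> \<le> B" and p: "prim l h g"
  obtains k where "prim l (\<lambda>x. b x * h x) k" "nsq l k \<le> 2 * B\<^sup>2 * nsq l g + 2 * L\<^sup>2 * nsq l h"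
proof -
  obtain b' where b': "prim l b b'" "AE x in leb l. \<bar>b' x\<bar> \<le> L"
    using lipschitz_prim[OF l lip] by metis
  have Bae: "AE x in leb l. \<bar>b x\<bar> \<le> B" using B by (intro AE_I2) simp
  have 1: "(\<lambda>x. b x * g x) \<in> L2_int l" "nsq l (\<lambda>x. b x * g x) \<le> B\<^sup>2 * nsq l g"
    using L2_int_bounded_mult[OF primD(1)[OF p] L2_intD(1)[OF prim_L2[OF b'(1)]] Bae] by auto
  have 2: "(\<lambda>x. b' x * h x) \<in> L2_int l" "nsq l (\<lambda>x. b' x * h x) \<le> L\<^sup>2 * nsq l h"
    using L2_int_bounded_mult[OF prim_L2[OF p] L2_intD(1)[OF primD(1)[OF b'(1)]] b'(2)] by auto
  have "nsq l (\<lambda>x. b x * g x + b' x * h x) \<le> 2 * B\<^sup>2 * nsq l g + 2 * L\<^sup>2 * nsq l h"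
    using nsq_add_le[OF 1(1) 2(1)] 1(2) 2(2) by linarith
  moreover have "prim l (\<lambda>x. b x * h x) (\<lambda>x. b x * g x + b' x * h x)"
    using prim_mult[OF b'(1) p] by (simp add: mult.commute[of "h _"])
  ultimately show ?thesis by (rule that[rotated])
qed

section \<open>Sobolev functions on an interval\<close>

lemma wderiv_props:
  assumes "g \<in> L2_int l" "weak_deriv l f g"
  shows "wderiv l f \<in> L2_int l" "weak_deriv l f (wderiv l f)"
  using someI[of "\<lambda>g. g \<in> L2_int l \<and> weak_deriv l f g" g] assms by (auto simp: wderiv_def)

lemma sobolev_int_subset_L2: "f \<in> sobolev_int l r \<Longrightarrow> f \<in> L2_int l"
  by (cases r) auto

text \<open>Regarded as a function of the point, \<open>trace_int l f\<close> is the canonical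
  continuous representative; together with \<open>wderiv\<close> it forms a \<open>prim\<close>
  pair.\<close>

lemma sobolev_1D:
  assumes "f \<in> sobolev_int l 1" and l: "0 < l"
  shows "f \<in> L2_int l" "wderiv l f \<in> L2_int l" "prim l (trace_int l f) (wderiv l f)"
    "AE x in leb l. f x = trace_int l f x"
proof -
  obtain g where g: "f \<in> L2_int l" "g \<in> L2_int l" "weak_deriv l f g" using assms(1) by auto
  note w = wderiv_props[OF g(2,3)]
  show "f \<in> L2_int l" "wderiv l f \<in> L2_int l" by fact+
  obtain h where h: "prim l h (wderiv l f)" "AE x in leb l. f x = h x"
    by (rule weak_deriv_imp_prim[OF g(1) w(1) l w(2)])
  have eq: "trace_int l f x = h x" if "x \<in> {0..l}" for x
    by (rule trace_int_eq[OF prim_continuous[OF h(1)] h(2) l that])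
  show "prim l (trace_int l f) (wderiv l f)"
    using h(1) eq by (simp add: prim_def)
  show "AE x in leb l. f x = trace_int l f x"
    using h(2) AE_space by eventually_elim (simp add: eq)
qed

lemma sobolev_1I:
  assumes p: "prim l h g" and eq: "AE x in leb l. f x = h x" and l: "0 < l"
  shows "f \<in> sobolev_int l 1" "AE x in leb l. wderiv l f x = g x"
    "\<And>x. x \<in> {0..l} \<Longrightarrow> trace_int l f x = h x"
proof -
  have eq': "AE x in leb l. h x = f x" using eq by eventually_elim simp
  have f: "f \<in> L2_int l" by (rule L2_int_cong_AE[OF prim_L2[OF p] eq'])
  have w: "weak_deriv l f g" by (rule prim_weak_deriv[OF p f eq l])
  show 1: "f \<in> sobolev_int l 1" using f w primD(1)[OF p] by auto
  show tr: "trace_int l f x = h x" if "x \<in> {0..l}" for x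
    by (rule trace_int_eq[OF prim_continuous[OF p] eq l that])
  have "prim l h (wderiv l f)" using sobolev_1D(3)[OF 1 l] tr by (simp add: prim_def)
  from prim_unique[OF this p] show "AE x in leb l. wderiv l f x = g x" .
qed

text \<open>The recursive definition asks for some weak derivative in H^1. Two weak derivatives
  agree almost everywhere, so the one chosen by \<open>wderiv\<close> has the same
  regularity.\<close>

lemma sobolev_2_iff:
  assumes l: "0 < l"
  shows "f \<in> sobolev_int l 2 \<longleftrightarrow> f \<in> sobolev_int l 1 \<and> wderiv l f \<in> sobolev_int l 1"
proof
  assume "f \<in> sobolev_int l 2"
  then obtain g where g: "f \<in> L2_int l" "g \<in> sobolev_int l 1" "weak_deriv l f g"
    by (auto simp: numeral_2_eq_2)
  have gL: "g \<in> L2_int l" by (rule sobolev_int_subset_L2[OF g(2)])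
  have f1: "f \<in> sobolev_int l 1" using g gL by auto
  obtain h where h: "prim l h g" "AE x in leb l. f x = h x"
    by (rule weak_deriv_imp_prim[OF g(1) gL l g(3)])
  have "AE x in leb l. wderiv l f x = trace_int l g x"
    using sobolev_1I(2)[OF h l] sobolev_1D(4)[OF g(2) l] by eventually_elim simp
  from sobolev_1I(1)[OF sobolev_1D(3)[OF g(2) l] this l] f1
  show "f \<in> sobolev_int l 1 \<and> wderiv l f \<in> sobolev_int l 1" by simp
next
  assume f: "f \<in> sobolev_int l 1 \<and> wderiv l f \<in> sobolev_int l 1"
  then have f1: "f \<in> sobolev_int l 1" and f2: "wderiv l f \<in> sobolev_int l 1" by simp_all
  have "weak_deriv l f (wderiv l f)"
    by (rule prim_weak_deriv[OF sobolev_1D(3)[OF f1 l] sobolev_1D(1)[OF f1 l] sobolev_1D(4)[OF f1 l] l])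
  then show "f \<in> sobolev_int l 2" using sobolev_1D(1)[OF f1 l] f2 by (auto simp: numeral_2_eq_2)
qed

lemma sobolev_2I:
  assumes p: "prim l h g" and q: "prim l g k" and eq: "AE x in leb l. f x = h x" and l: "0 < l"
  shows "f \<in> sobolev_int l 2" "AE x in leb l. wderiv l (wderiv l f) x = k x"
    "\<And>x. x \<in> {0..l} \<Longrightarrow> trace_int l (wderiv l f) x = g x"
  using sobolev_1I[OF p eq l] sobolev_1I[OF q sobolev_1I(2)[OF p eq l] l] by (auto simp: sobolev_2_iff[OF l])

lemma sobolev_int_sq_1: "sobolev_int_sq l 1 f = nsq l f + nsq l (wderiv l f)"
  by (simp add: sobolev_int_sq_def nsq_def)

lemma sobolev_int_sq_2: "sobolev_int_sq l 2 f = nsq l f + nsq l (wderiv l f) + nsq l (wderiv l (wderiv l f))"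
  by (simp add: sobolev_int_sq_def nsq_def numeral_2_eq_2)

lemma nsq_trace:
  assumes "f \<in> sobolev_int l 1" "0 < l"
  shows "nsq l (trace_int l f) = nsq l f"
  by (rule nsq_cong_AE[OF sobolev_1D(1)[OF assms] sobolev_1D(4)[OF assms]])

text \<open>The chosen derivative is linear only almost everywhere, whereas the trace, being a value
  of a unique continuous representative, is linear exactly.\<close>

lemma sobolev_1_lin:
  assumes f: "f \<in> sobolev_int l 1" and g: "g \<in> sobolev_int l 1" and l: "0 < l"
  shows "(\<lambda>x. a * f x + b * g x) \<in> sobolev_int l 1"
    "AE x in leb l. wderiv l (\<lambda>x. a * f x + b * g x) x = a * wderiv l f x + b * wderiv l g x"
    "\<And>x. x \<in> {0..l} \<Longrightarrow> trace_int l (\<lambda>x. a * f x + b * g x) x = a * trace_int l f x + b * trace_int l g x"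
proof -
  note F = sobolev_1D[OF f l] and G = sobolev_1D[OF g l]
  have p: "prim l (\<lambda>x. a * trace_int l f x + b * trace_int l g x) (\<lambda>x. a * wderiv l f x + b * wderiv l g x)"
    by (intro prim_add prim_cmult F G)
  have "AE x in leb l. a * f x + b * g x = a * trace_int l f x + b * trace_int l g x"
    using F(4) G(4) by eventually_elim simp
  from sobolev_1I[OF p this l]
  show "(\<lambda>x. a * f x + b * g x) \<in> sobolev_int l 1"
    "AE x in leb l. wderiv l (\<lambda>x. a * f x + b * g x) x = a * wderiv l f x + b * wderiv l g x"
    "\<And>x. x \<in> {0..l} \<Longrightarrow> trace_int l (\<lambda>x. a * f x + b * g x) x = a * trace_int l f x + b * trace_int l g x"
    by auto
qed

lemma sobolev_2_lin:
  assumes f: "f \<in> sobolev_int l 2" and g: "g \<in> sobolev_int l 2" and l: "0 < l"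
  shows "(\<lambda>x. a * f x + b * g x) \<in> sobolev_int l 2"
    "AE x in leb l. wderiv l (wderiv l (\<lambda>x. a * f x + b * g x)) x
        = a * wderiv l (wderiv l f) x + b * wderiv l (wderiv l g) x"
    "\<And>x. x \<in> {0..l} \<Longrightarrow> trace_int l (wderiv l (\<lambda>x. a * f x + b * g x)) x
        = a * trace_int l (wderiv l f) x + b * trace_int l (wderiv l g) x"
proof -
  have F: "f \<in> sobolev_int l 1" "wderiv l f \<in> sobolev_int l 1" using f by (simp_all only: sobolev_2_iff[OF l])
  have G: "g \<in> sobolev_int l 1" "wderiv l g \<in> sobolev_int l 1" using g by (simp_all only: sobolev_2_iff[OF l])
  let ?u = "\<lambda>x. a * f x + b * g x"
  note A = sobolev_1_lin[OF F(1) G(1) l, where a = a and b = b]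
    and B = sobolev_1_lin[OF F(2) G(2) l, where a = a and b = b]
  have "AE x in leb l. wderiv l ?u x = trace_int l (\<lambda>x. a * wderiv l f x + b * wderiv l g x) x"
    using A(2) sobolev_1D(4)[OF B(1) l] by eventually_elim simp
  note C = sobolev_1I[OF sobolev_1D(3)[OF B(1) l] this l]
  show "?u \<in> sobolev_int l 2" using A(1) C(1) by (simp only: sobolev_2_iff[OF l])
  show "AE x in leb l. wderiv l (wderiv l ?u) x
        = a * wderiv l (wderiv l f) x + b * wderiv l (wderiv l g) x"
    using B(2) C(2) by eventually_elim simp
  show "\<And>x. x \<in> {0..l} \<Longrightarrow> trace_int l (wderiv l ?u) x
        = a * trace_int l (wderiv l f) x + b * trace_int l (wderiv l g) x"
    using C(3) B(3) by simp
qed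

lemma nsq_lin_le:
  assumes "f \<in> L2_int l" "g \<in> L2_int l" "AE x in leb l. u x = a * f x + b * g x"
  shows "nsq l u \<le> 2 * a\<^sup>2 * nsq l f + 2 * b\<^sup>2 * nsq l g"
proof -
  have "AE x in leb l. a * f x + b * g x = u x" using assms(3) by eventually_elim simp
  then have "nsq l u = nsq l (\<lambda>x. a * f x + b * g x)"
    using assms by (intro nsq_cong_AE L2_int_add L2_int_cmult)
  also have "\<dots> \<le> 2 * nsq l (\<lambda>x. a * f x) + 2 * nsq l (\<lambda>x. b * g x)"
    using assms by (intro nsq_add_le L2_int_cmult)
  finally show ?thesis by (simp add: nsq_cmult)
qed

lemma sobolev_int_sq_lin_le:
  assumes f: "f \<in> sobolev_int l r" and g: "g \<in> sobolev_int l r" and l: "0 < l" and r: "r = 1 \<or> r = 2"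
  shows "(\<lambda>x. a * f x + b * g x) \<in> sobolev_int l r"
    "sobolev_int_sq l r (\<lambda>x. a * f x + b * g x)
       \<le> 2 * a\<^sup>2 * sobolev_int_sq l r f + 2 * b\<^sup>2 * sobolev_int_sq l r g"
proof -
  let ?u = "\<lambda>x. a * f x + b * g x"
  have F: "f \<in> sobolev_int l 1" and G: "g \<in> sobolev_int l 1"
    using f g r by (auto simp only: sobolev_2_iff[OF l])
  note F' = sobolev_1D[OF F l] and G' = sobolev_1D[OF G l]
  have 1: "nsq l ?u \<le> 2 * a\<^sup>2 * nsq l f + 2 * b\<^sup>2 * nsq l g"
    by (rule nsq_lin_le[OF F'(1) G'(1)]) simp
  have 2: "nsq l (wderiv l ?u) \<le> 2 * a\<^sup>2 * nsq l (wderiv l f) + 2 * b\<^sup>2 * nsq l (wderiv l g)"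
    by (rule nsq_lin_le[OF F'(2) G'(2) sobolev_1_lin(2)[OF F G l]])
  have 3: "nsq l (wderiv l (wderiv l ?u)) \<le> 2 * a\<^sup>2 * nsq l (wderiv l (wderiv l f)) + 2 * b\<^sup>2 * nsq l (wderiv l (wderiv l g))"
    if "r = 2"
  proof -
    have F2: "wderiv l f \<in> sobolev_int l 1" and G2: "wderiv l g \<in> sobolev_int l 1"
      using f g that by (auto simp only: sobolev_2_iff[OF l])
    show ?thesis
      using f g that by (intro nsq_lin_le[OF sobolev_1D(2)[OF F2 l] sobolev_1D(2)[OF G2 l] sobolev_2_lin(2)[OF _ _ l]]) auto
  qed
  show "?u \<in> sobolev_int l r" using r f g sobolev_1_lin(1)[OF F G l] sobolev_2_lin(1)[OF _ _ l] by auto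
  show "sobolev_int_sq l r ?u \<le> 2 * a\<^sup>2 * sobolev_int_sq l r f + 2 * b\<^sup>2 * sobolev_int_sq l r g"
    using r
  proof
    assume "r = 1" then show ?thesis using 1 2 by (simp add: sobolev_int_sq_1[simplified] algebra_simps)
  next
    assume "r = 2" then show ?thesis using 1 2 3 by (simp add: sobolev_int_sq_2 algebra_simps)
  qed
qed

section \<open>Real interpolation of quadratic spaces\<close>

text \<open>A seminormed linear space reduced to what the interpolation argument uses. The
  inequality follows from (x + y)^2 <= 2 x^2 + 2 y^2 and can be summed over edges directly, which
  would not hold for a triangle inequality between square roots without further work.\<close>

definition quad_space :: "('p \<Rightarrow> real) function_space \<Rightarrow> bool" where
  "quad_space X \<longleftrightarrow> fs_carrier X \<noteq> {} \<and> (\<forall>f. 0 \<le> fs_norm X f) \<and>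
     (\<forall>f\<in>fs_carrier X. \<forall>g\<in>fs_carrier X. \<forall>a b. (\<lambda>p. a * f p + b * g p) \<in> fs_carrier X \<and>
        fs_sq X (\<lambda>p. a * f p + b * g p) \<le> 2 * a\<^sup>2 * fs_sq X f + 2 * b\<^sup>2 * fs_sq X g)"

definition couple :: "('p \<Rightarrow> real) function_space \<Rightarrow> ('p \<Rightarrow> real) function_space \<Rightarrow> bool" where
  "couple X0 X1 \<longleftrightarrow> quad_space X0 \<and> quad_space X1 \<and> X1 \<hookrightarrow> X0"

lemma quad_space_nonneg: "quad_space X \<Longrightarrow> 0 \<le> fs_norm X f"
  by (simp add: quad_space_def)

lemma quad_space_lin:
  assumes "quad_space X" "f \<in> fs_carrier X" "g \<in> fs_carrier X"
  shows "(\<lambda>p. a * f p + b * g p) \<in> fs_carrier X"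
    "fs_sq X (\<lambda>p. a * f p + b * g p) \<le> 2 * a\<^sup>2 * fs_sq X f + 2 * b\<^sup>2 * fs_sq X g"
  using assms unfolding quad_space_def by blast+

lemma quad_space_add:
  assumes "quad_space X" "f \<in> fs_carrier X" "g \<in> fs_carrier X"
  shows "(\<lambda>p. f p + g p) \<in> fs_carrier X"
    "fs_sq X (\<lambda>p. f p + g p) \<le> 2 * fs_sq X f + 2 * fs_sq X g"
  using quad_space_lin[OF assms, of 1 1] by simp_all

lemma quad_space_diff:
  assumes "quad_space X" "f \<in> fs_carrier X" "g \<in> fs_carrier X"
  shows "(\<lambda>p. f p - g p) \<in> fs_carrier X"
    "fs_sq X (\<lambda>p. f p - g p) \<le> 2 * fs_sq X f + 2 * fs_sq X g"
  using quad_space_lin[OF assms, of 1 "-1"] by simp_all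

lemma quad_space_zero:
  assumes "quad_space X" shows "(\<lambda>p. 0) \<in> fs_carrier X" "fs_norm X (\<lambda>p. 0) = 0"
proof -
  obtain f where "f \<in> fs_carrier X" using assms by (auto simp: quad_space_def)
  from quad_space_lin[OF assms this this, of 0 0]
  show "(\<lambda>p. 0) \<in> fs_carrier X" "fs_norm X (\<lambda>p. 0) = 0" by simp_all
qed

text \<open>The factor \<open>2 ^ card I\<close> comes from iterating the two-term bound; it depends
  only on the number of functionals and not on the dyadic scale.\<close>

lemma quad_space_sum:
  assumes q: "quad_space X" and I: "finite I" and e: "\<And>i. i \<in> I \<Longrightarrow> e i \<in> fs_carrier X"
  shows "(\<lambda>p. \<Sum>i\<in>I. c i * e i p) \<in> fs_carrier X \<and>
    fs_sq X (\<lambda>p. \<Sum>i\<in>I. c i * e i p) \<le> 2 ^ card I * (\<Sum>i\<in>I. (c i)\<^sup>2 * fs_sq X (e i))"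
  using I e
proof (induction I)
  case empty
  then show ?case using quad_space_zero[OF q] by simp
next
  case (insert i I)
  let ?s = "\<lambda>p. \<Sum>i\<in>I. c i * e i p"
  have IH: "?s \<in> fs_carrier X" "fs_sq X ?s \<le> 2 ^ card I * (\<Sum>i\<in>I. (c i)\<^sup>2 * fs_sq X (e i))"
    using insert by auto
  have eq: "(\<lambda>p. \<Sum>j\<in>insert i I. c j * e j p) = (\<lambda>p. c i * e i p + 1 * ?s p)"
    using insert by simp
  note L = quad_space_lin[OF q, of "e i" ?s "c i" 1]
  have "fs_sq X (\<lambda>p. c i * e i p + 1 * ?s p) \<le> 2 * (c i)\<^sup>2 * fs_sq X (e i) + 2 * fs_sq X ?s"
    using L(2) insert IH(1) by simp
  also have "\<dots> \<le> 2 ^ Suc (card I) * ((c i)\<^sup>2 * fs_sq X (e i)) + 2 * (2 ^ card I * (\<Sum>i\<in>I. (c i)\<^sup>2 * fs_sq X (e i)))"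
  proof (rule add_mono)
    have "1 * (2 * ((c i)\<^sup>2 * fs_sq X (e i))) \<le> 2 ^ card I * (2 * ((c i)\<^sup>2 * fs_sq X (e i)))"
      by (intro mult_right_mono) auto
    then show "2 * (c i)\<^sup>2 * fs_sq X (e i) \<le> 2 ^ Suc (card I) * ((c i)\<^sup>2 * fs_sq X (e i))"
      by simp
  qed (use IH(2) in simp)
  also have "\<dots> = 2 ^ card (insert i I) * (\<Sum>i\<in>insert i I. (c i)\<^sup>2 * fs_sq X (e i))"
    using insert by (simp add: distrib_left)
  finally show ?case unfolding eq using L(1) insert IH(1) by auto
qed

lemma embedsI_sq:
  assumes "\<And>u. u \<in> fs_carrier E \<Longrightarrow> u \<in> fs_carrier F" and n: "\<And>u. 0 \<le> fs_norm E u"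
    and b: "\<And>u. u \<in> fs_carrier E \<Longrightarrow> fs_sq F u \<le> C * fs_sq E u"
  shows "E \<hookrightarrow> F"
  unfolding embeds_def
proof (intro conjI exI ballI)
  show "fs_carrier E \<subseteq> fs_carrier F" using assms(1) by blast
  fix u assume "u \<in> fs_carrier E"
  then have "fs_sq F u \<le> C * fs_sq E u" by (rule b)
  also have "\<dots> \<le> max C 0 * fs_sq E u" by (intro mult_right_mono) auto
  also have "\<dots> = (sqrt (max C 0) * fs_norm E u)\<^sup>2" by (simp add: power_mult_distrib)
  finally show "fs_norm F u \<le> sqrt (max C 0) * fs_norm E u"
    by (rule power2_le_imp_le) (simp add: n)
qed

lemma embedsD_sq:
  assumes "E \<hookrightarrow> F" "\<And>u. 0 \<le> fs_norm E u" "\<And>u. 0 \<le> fs_norm F u"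
  obtains C where "0 \<le> C" "\<forall>u\<in>fs_carrier E. u \<in> fs_carrier F \<and> fs_sq F u \<le> C * fs_sq E u"
proof -
  obtain c where sub: "fs_carrier E \<subseteq> fs_carrier F"
    and c: "\<And>u. u \<in> fs_carrier E \<Longrightarrow> fs_norm F u \<le> c * fs_norm E u"
    using assms(1) unfolding embeds_def by metis
  have "fs_sq F u \<le> c\<^sup>2 * fs_sq E u" if "u \<in> fs_carrier E" for u
    using power_mono[OF c[OF that] assms(3), of 2] by (simp add: power_mult_distrib)
  then show ?thesis using sub by (intro that[of "c\<^sup>2"]) auto
qed

lemma embeds_trans: "E \<hookrightarrow> F \<Longrightarrow> F \<hookrightarrow> H \<Longrightarrow> (\<And>u. 0 \<le> fs_norm E u) \<Longrightarrow> (\<And>u. 0 \<le> fs_norm F u) \<Longrightarrow>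
    (\<And>u. 0 \<le> fs_norm H u) \<Longrightarrow> E \<hookrightarrow> H"
proof -
  assume 1: "E \<hookrightarrow> F" "F \<hookrightarrow> H" and n: "\<And>u. 0 \<le> fs_norm E u" "\<And>u. 0 \<le> fs_norm F u" "\<And>u. 0 \<le> fs_norm H u"
  obtain C where "0 \<le> C" "\<forall>u\<in>fs_carrier E. u \<in> fs_carrier F \<and> fs_sq F u \<le> C * fs_sq E u"
    by (rule embedsD_sq[OF 1(1) n(1,2)])
  note C = this(1) this(2)[rule_format]
  obtain D where "0 \<le> D" "\<forall>u\<in>fs_carrier F. u \<in> fs_carrier H \<and> fs_sq H u \<le> D * fs_sq F u"
    by (rule embedsD_sq[OF 1(2) n(2,3)])
  note D = this(1) this(2)[rule_format]
  show "E \<hookrightarrow> H"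
  proof (rule embedsI_sq[OF _ n(1)])
    fix u assume u: "u \<in> fs_carrier E"
    note DF = D(2)[OF conjunct1[OF C(2)[OF u]]]
    show "u \<in> fs_carrier H" using DF by simp
    have "fs_sq H u \<le> D * fs_sq F u" using DF by simp
    also have "\<dots> \<le> D * (C * fs_sq E u)" using C(2)[OF u] D(1) by (intro mult_left_mono) auto
    finally show "fs_sq H u \<le> (D * C) * fs_sq E u" by (simp add: mult.assoc)
  qed
qed

section \<open>Couples of spaces and the dyadic form of the K-functional\<close>

lemma coupleD:
  assumes "couple X0 X1"
  shows "quad_space X0" "quad_space X1" "\<And>u. u \<in> fs_carrier X1 \<Longrightarrow> u \<in> fs_carrier X0"
  using assms by (auto simp: couple_def embeds_def)

lemma couple_bound:
  assumes "couple X0 X1"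
  obtains C where "0 \<le> C" "\<forall>u\<in>fs_carrier X1. fs_sq X0 u \<le> C * fs_sq X1 u"
proof -
  have e: "X1 \<hookrightarrow> X0" and q: "quad_space X0" "quad_space X1" using assms by (simp_all add: couple_def)
  obtain C where "0 \<le> C" "\<forall>u\<in>fs_carrier X1. u \<in> fs_carrier X0 \<and> fs_sq X0 u \<le> C * fs_sq X1 u"
    by (rule embedsD_sq[OF e quad_space_nonneg[OF q(2)] quad_space_nonneg[OF q(1)]])
  then show ?thesis by (intro that[of C]) auto
qed

text \<open>The cost at t = 2^-j of the splitting of \<phi> into \<phi> - \<psi> j and \<psi> j, the
  denominator being t^-2.\<close>

definition dyadic_term :: "('p \<Rightarrow> real) function_space \<Rightarrow> ('p \<Rightarrow> real) function_space \<Rightarrow> ('p \<Rightarrow> real)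
    \<Rightarrow> (nat \<Rightarrow> 'p \<Rightarrow> real) \<Rightarrow> nat \<Rightarrow> real" where
  "dyadic_term X0 X1 \<phi> \<psi> j = fs_sq X0 (\<lambda>p. \<phi> p - \<psi> j p) + fs_sq X1 (\<psi> j) / 4 ^ j"

text \<open>
  The K-functional is evaluated at the points \<open>2\<^sup>-\<^sup>j\<close> only, the integral over \<open>t\<close> becoming a sum
  with weights \<open>(4 powr \<theta>)\<^sup>j\<close>.
\<close>
definition dyadic_rep :: "('p \<Rightarrow> real) function_space \<Rightarrow> ('p \<Rightarrow> real) function_space \<Rightarrow> real \<Rightarrow> ('p \<Rightarrow> real)
    \<Rightarrow> (nat \<Rightarrow> 'p \<Rightarrow> real) \<Rightarrow> real \<Rightarrow> bool" where
  "dyadic_rep X0 X1 \<theta> \<phi> \<psi> S \<longleftrightarrow>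
     (\<forall>j. \<psi> j \<in> fs_carrier X1 \<and> (\<lambda>p. \<phi> p - \<psi> j p) \<in> fs_carrier X0) \<and>
     (\<forall>n. (\<Sum>j<n. (4 powr \<theta>) ^ j * dyadic_term X0 X1 \<phi> \<psi> j) \<le> S)"

lemma dyadic_term_nonneg: "0 \<le> dyadic_term X0 X1 \<phi> \<psi> j"
  by (simp add: dyadic_term_def)

lemma dyadic_repD:
  assumes "dyadic_rep X0 X1 \<theta> \<phi> \<psi> S"
  shows "\<psi> j \<in> fs_carrier X1" "(\<lambda>p. \<phi> p - \<psi> j p) \<in> fs_carrier X0"
    "(\<Sum>j<n. (4 powr \<theta>) ^ j * dyadic_term X0 X1 \<phi> \<psi> j) \<le> S"
    "(4 powr \<theta>) ^ j * dyadic_term X0 X1 \<phi> \<psi> j \<le> S" "0 \<le> S"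
proof -
  show "\<psi> j \<in> fs_carrier X1" "(\<lambda>p. \<phi> p - \<psi> j p) \<in> fs_carrier X0"
    and s: "(\<Sum>j<n. (4 powr \<theta>) ^ j * dyadic_term X0 X1 \<phi> \<psi> j) \<le> S" for n
    using assms by (auto simp: dyadic_rep_def)
  have "(4 powr \<theta>) ^ j * dyadic_term X0 X1 \<phi> \<psi> j \<le> (\<Sum>j<Suc j. (4 powr \<theta>) ^ j * dyadic_term X0 X1 \<phi> \<psi> j)"
    by (rule member_le_sum[of j "{..<Suc j}"]) (auto simp: dyadic_term_nonneg)
  then show "(4 powr \<theta>) ^ j * dyadic_term X0 X1 \<phi> \<psi> j \<le> S" using s[of "Suc j"] by linarith
  show "0 \<le> S" using s[of 0] by simp
qed

lemma K_sq_le: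
  assumes "(\<lambda>p. \<phi> p - u p) \<in> fs_carrier X0" "u \<in> fs_carrier X1"
  shows "K_sq X0 X1 t \<phi> \<le> fs_sq X0 (\<lambda>p. \<phi> p - u p) + t\<^sup>2 * fs_sq X1 u"
  unfolding K_sq_def
proof (rule cInf_lower)
  show "bdd_below {fs_sq X0 \<phi>0 + t\<^sup>2 * fs_sq X1 \<phi>1 |\<phi>0 \<phi>1.
      \<phi>0 \<in> fs_carrier X0 \<and> \<phi>1 \<in> fs_carrier X1 \<and> \<phi> = (\<lambda>p. \<phi>0 p + \<phi>1 p)}"
    by (rule bdd_belowI[of _ 0]) auto
  show "fs_sq X0 (\<lambda>p. \<phi> p - u p) + t\<^sup>2 * fs_sq X1 u \<in> {fs_sq X0 \<phi>0 + t\<^sup>2 * fs_sq X1 \<phi>1 |\<phi>0 \<phi>1.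
      \<phi>0 \<in> fs_carrier X0 \<and> \<phi>1 \<in> fs_carrier X1 \<and> \<phi> = (\<lambda>p. \<phi>0 p + \<phi>1 p)}"
    by (rule CollectI, rule exI[of _ "\<lambda>p. \<phi> p - u p"], rule exI[of _ u]) (simp add: assms)
qed

lemma K_sq_near:
  assumes X: "couple X0 X1" and \<phi>: "\<phi> \<in> fs_carrier X0" and e: "0 < e"
  obtains u where "(\<lambda>p. \<phi> p - u p) \<in> fs_carrier X0" "u \<in> fs_carrier X1"
    "fs_sq X0 (\<lambda>p. \<phi> p - u p) + t\<^sup>2 * fs_sq X1 u < K_sq X0 X1 t \<phi> + e"
proof -
  let ?S = "{fs_sq X0 \<phi>0 + t\<^sup>2 * fs_sq X1 \<phi>1 |\<phi>0 \<phi>1.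
      \<phi>0 \<in> fs_carrier X0 \<and> \<phi>1 \<in> fs_carrier X1 \<and> \<phi> = (\<lambda>p. \<phi>0 p + \<phi>1 p)}"
  have "fs_sq X0 \<phi> + t\<^sup>2 * fs_sq X1 (\<lambda>p. 0) \<in> ?S"
    by (rule CollectI, rule exI[of _ \<phi>], rule exI[of _ "\<lambda>p. 0"])
      (simp add: \<phi> quad_space_zero[OF coupleD(2)[OF X]])
  then have ne: "?S \<noteq> {}" by blast
  have "Inf ?S < K_sq X0 X1 t \<phi> + e" using e by (simp add: K_sq_def)
  from cInf_lessD[OF ne this] obtain x where x: "x \<in> ?S" "x < K_sq X0 X1 t \<phi> + e" by auto
  from x(1) obtain \<phi>0 \<phi>1 where d: "x = fs_sq X0 \<phi>0 + t\<^sup>2 * fs_sq X1 \<phi>1" "\<phi>0 \<in> fs_carrier X0"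
    "\<phi>1 \<in> fs_carrier X1" "\<phi> = (\<lambda>p. \<phi>0 p + \<phi>1 p)" by auto
  have "(\<lambda>p. \<phi> p - \<phi>1 p) = \<phi>0" using d(4) by auto
  then show ?thesis using d x(2) by (intro that[of \<phi>1]) auto
qed

lemma K_sq_nonneg:
  assumes "couple X0 X1" "\<phi> \<in> fs_carrier X0" shows "0 \<le> K_sq X0 X1 t \<phi>"
proof (rule field_le_epsilon)
  fix e :: real assume "0 < e"
  from K_sq_near[OF assms this, of t]
  obtain u where "fs_sq X0 (\<lambda>p. \<phi> p - u p) + t\<^sup>2 * fs_sq X1 u < K_sq X0 X1 t \<phi> + e" .
  moreover have "0 \<le> fs_sq X0 (\<lambda>p. \<phi> p - u p) + t\<^sup>2 * fs_sq X1 u" by simp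
  ultimately show "0 \<le> K_sq X0 X1 t \<phi> + e" by linarith
qed

lemma K_sq_mono:
  assumes "couple X0 X1" "\<phi> \<in> fs_carrier X0" and st: "0 \<le> s" "s \<le> t"
  shows "K_sq X0 X1 s \<phi> \<le> K_sq X0 X1 t \<phi>"
proof (rule field_le_epsilon)
  fix e :: real assume "0 < e"
  from K_sq_near[OF assms(1,2) this, of t]
  obtain u where u: "(\<lambda>p. \<phi> p - u p) \<in> fs_carrier X0" "u \<in> fs_carrier X1"
    "fs_sq X0 (\<lambda>p. \<phi> p - u p) + t\<^sup>2 * fs_sq X1 u < K_sq X0 X1 t \<phi> + e" .
  have "s\<^sup>2 * fs_sq X1 u \<le> t\<^sup>2 * fs_sq X1 u"
    using st by (intro mult_right_mono power_mono) auto
  with K_sq_le[OF u(1,2), of s] u(3) show "K_sq X0 X1 s \<phi> \<le> K_sq X0 X1 t \<phi> + e" by linarith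
qed

lemma weight_bounds:
  assumes "0 < \<theta>" "\<theta> < 1" shows "1 < (4::real) powr \<theta>" "(4::real) powr \<theta> < 4"
proof -
  show "1 < (4::real) powr \<theta>" using assms by (intro gr_one_powr) auto
  have "(4::real) powr \<theta> < 4 powr 1" using assms by (intro powr_less_mono) auto
  then show "(4::real) powr \<theta> < 4" by simp
qed

text \<open>Up to constants, these are the masses of the measure t^(-2 \<theta> - 1) dt on the
  dyadic intervals of length 2^-j near 0 and of length 2^j near infinity: growing like 4^(\<theta>
  j) near 0 and decaying like 4^(-\<theta> j) at infinity.\<close>

lemma powr_half_pow:
  shows "((1/2) ^ j) powr (- 2 * \<theta> - 1) * (1/2) ^ j = (4 powr \<theta>) ^ j"
    "((2::real) ^ j) powr (- 2 * \<theta> - 1) * 2 ^ j = (1 / 4 powr \<theta>) ^ j"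
proof -
  have 4: "(4::real) powr \<theta> = 2 powr (2 * \<theta>)"
    using powr_powr[of 2 2 \<theta>] by simp
  have h: "(1/2::real) ^ j = 2 powr (- real j)"
  proof -
    have "2 powr (- real j) = inverse ((2::real) ^ j)" by (simp only: powr_minus) (simp add: powr_realpow)
    then show ?thesis by (simp add: power_one_over inverse_eq_divide)
  qed
  have t: "(2::real) ^ j = 2 powr real j" by (simp add: powr_realpow)
  have "((1/2::real) ^ j) powr (- 2 * \<theta> - 1) * (1/2) ^ j = 2 powr (- real j * (- 2 * \<theta> - 1) + - real j)"
    by (simp only: h powr_powr powr_add)
  also have "- real j * (- 2 * \<theta> - 1) + - real j = (2 * \<theta>) * real j" by (simp add: algebra_simps)
  also have "2 powr ((2 * \<theta>) * real j) = (2 powr (2 * \<theta>)) powr (real j)" by (simp add: powr_powr)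
  also have "\<dots> = (4 powr \<theta>) ^ j" by (simp add: 4 powr_realpow)
  finally show "((1/2::real) ^ j) powr (- 2 * \<theta> - 1) * (1/2) ^ j = (4 powr \<theta>) ^ j" .
  have "((2::real) ^ j) powr (- 2 * \<theta> - 1) * 2 ^ j = 2 powr (real j * (- 2 * \<theta> - 1) + real j)"
    by (simp only: t powr_powr powr_add)
  also have "real j * (- 2 * \<theta> - 1) + real j = (- (2 * \<theta>)) * real j" by (simp add: algebra_simps)
  also have "2 powr ((- (2 * \<theta>)) * real j) = (2 powr (- (2 * \<theta>))) powr (real j)" by (simp add: powr_powr)
  also have "\<dots> = (2 powr (- (2 * \<theta>))) ^ j" by (simp add: powr_realpow)
  also have "2 powr (- (2 * \<theta>)) = 1 / 4 powr \<theta>" unfolding 4 by (simp only: powr_minus inverse_eq_divide)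
  finally show "((2::real) ^ j) powr (- 2 * \<theta> - 1) * 2 ^ j = (1 / 4 powr \<theta>) ^ j" .
qed

lemma dyadic_cover_small:
  assumes "0 < t" "t \<le> 1" obtains j where "(1/2) ^ Suc j < t" "t \<le> (1/2::real) ^ j"
proof -
  define j where "j = (LEAST j. (1/2) ^ Suc j < t)"
  have ex: "\<exists>j. (1/2) ^ Suc j < t"
  proof -
    obtain n where "(1/2::real) ^ n < t" using real_arch_pow_inv[of t "1/2"] assms by auto
    moreover have "(1/2::real) ^ Suc n \<le> (1/2) ^ n" by simp
    ultimately have "(1/2) ^ Suc n < t" by linarith
    then show ?thesis ..
  qed
  have 1: "(1/2) ^ Suc j < t" unfolding j_def by (rule LeastI_ex[OF ex])
  have "t \<le> (1/2) ^ j"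
  proof (cases j)
    case (Suc i)
    then have "\<not> (1/2) ^ Suc i < t" using not_less_Least[of i "\<lambda>j. (1/2) ^ Suc j < t"] by (simp add: j_def)
    then show ?thesis using Suc by simp
  qed (use assms in simp)
  with 1 show ?thesis by (rule that)
qed

lemma dyadic_cover_large:
  assumes "1 < t" obtains j where "2 ^ j < t" "t \<le> (2::real) ^ Suc j"
proof -
  define j where "j = (LEAST j. t \<le> (2::real) ^ Suc j)"
  have ex: "\<exists>j. t \<le> (2::real) ^ Suc j"
  proof -
    obtain n where "t < (2::real) ^ n" using real_arch_pow[of 2 t] by auto
    moreover have "(2::real) ^ n \<le> 2 ^ Suc n" by simp
    ultimately have "t \<le> 2 ^ Suc n" by linarith
    then show ?thesis ..
  qed
  have 1: "t \<le> (2::real) ^ Suc j" unfolding j_def by (rule LeastI_ex[OF ex])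
  have "2 ^ j < t"
  proof (cases j)
    case (Suc i)
    then have "\<not> t \<le> (2::real) ^ Suc i" using not_less_Least[of i "\<lambda>j. t \<le> (2::real) ^ Suc j"] by (simp add: j_def)
    then show ?thesis using Suc by simp
  qed (use assms in simp)
  then show ?thesis using 1 by (rule that)
qed

lemma suminf_ennreal_le:
  assumes "\<And>j. 0 \<le> f j" "\<And>n. (\<Sum>j<n. f j) \<le> S"
  shows "(\<Sum>j. ennreal (f j)) \<le> ennreal S"
proof (rule suminf_le_const)
  fix n show "(\<Sum>j<n. ennreal (f j)) \<le> ennreal S"
    using assms by (simp add: ennreal_leI)
qed simp

lemma geometric_sum_le:
  fixes q :: real assumes "0 \<le> q" "q < 1" shows "(\<Sum>j<n. q ^ j) \<le> 1 / (1 - q)"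
proof -
  have "(\<Sum>j<n. q ^ j) \<le> (\<Sum>j. q ^ j)" using assms by (intro sum_le_suminf summable_geometric) auto
  also have "\<dots> = 1 / (1 - q)" using assms by (intro suminf_geometric) auto
  finally show ?thesis .
qed

text \<open>On (0, 1] the K-functional is bounded by the dyadic terms. For t > 1 the trivial
  splitting bounds it by the X0 norm of \<phi>, against an integrable weight, and that norm is
  controlled by the term j = 0 because X1 embeds into X0.\<close>

lemma interp_sq_le_dyadic:
  assumes X: "couple X0 X1" and \<theta>: "0 < \<theta>" "\<theta> < 1"
  obtains C where "0 \<le> C" "\<forall>\<phi> \<psi> S. dyadic_rep X0 X1 \<theta> \<phi> \<psi> S \<longrightarrow>
    \<phi> \<in> fs_carrier X0 \<and> interp_sq X0 X1 \<theta> \<phi> \<le> ennreal (C * S)"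
proof -
  define w where "w = (4::real) powr \<theta>"
  have w: "1 < w" using weight_bounds(1)[OF \<theta>] by (simp add: w_def)
  obtain c where "0 \<le> c" "\<forall>u\<in>fs_carrier X1. fs_sq X0 u \<le> c * fs_sq X1 u"
    by (rule couple_bound[OF X])
  note c = this(1) this(2)[rule_format]
  \<comment> \<open>The summand w comes from taking the weight at the left end of each interval near
    0, the second summand from the geometric series over the intervals beyond 1.\<close>
  define C where "C = w + (2 + 2 * c) * (1 / (1 - 1 / w))"
  have pos: "0 \<le> 1 / (1 - 1 / w)" using w by simp
  show ?thesis
  proof (rule that[of C], goal_cases)
    case 1
    show "0 \<le> C" using w c pos by (simp add: C_def)
  next
    case 2
    show ?case
    proof (intro allI impI)
    fix \<phi> \<psi> S assume D: "dyadic_rep X0 X1 \<theta> \<phi> \<psi> S"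
    note D' = dyadic_repD[OF D]
    let ?A = "dyadic_term X0 X1 \<phi> \<psi>"
    have "(\<lambda>p. (\<phi> p - \<psi> 0 p) + \<psi> 0 p) \<in> fs_carrier X0"
      by (intro quad_space_add coupleD[OF X] D')
    then have \<phi>: "\<phi> \<in> fs_carrier X0" by simp
    define N where "N = fs_sq X0 \<phi>"
    have "N = fs_sq X0 (\<lambda>p. (\<phi> p - \<psi> 0 p) + \<psi> 0 p)" by (simp add: N_def)
    also have "\<dots> \<le> 2 * fs_sq X0 (\<lambda>p. \<phi> p - \<psi> 0 p) + 2 * fs_sq X0 (\<psi> 0)"
      by (intro quad_space_add coupleD[OF X] D')
    also have "\<dots> \<le> 2 * fs_sq X0 (\<lambda>p. \<phi> p - \<psi> 0 p) + 2 * (c * fs_sq X1 (\<psi> 0))"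
      using c(2)[OF D'(1)] by simp
    also have "\<dots> \<le> (2 + 2 * c) * ?A 0"
      using c(1) by (simp add: dyadic_term_def distrib_left distrib_right)
    also have "\<dots> \<le> (2 + 2 * c) * S" using D'(4)[of 0] c(1) by (intro mult_left_mono) auto
    finally have N: "N \<le> (2 + 2 * c) * S" .
    have N0: "0 \<le> N" by (simp add: N_def)
    define F1 where "F1 j t = ennreal (((1/2) ^ Suc j) powr (- 2 * \<theta> - 1) * ?A j) * indicator {(1/2) ^ Suc j<..(1/2) ^ j} t"
      for j and t :: real
    define F2 where "F2 j t = ennreal ((2 ^ j) powr (- 2 * \<theta> - 1) * N) * indicator {2 ^ j<..2 ^ Suc j} t"
      for j and t :: real
    have pt: "ennreal (t powr (- 2 * \<theta> - 1) * K_sq X0 X1 t \<phi>) * indicator {0<..} t \<le> (\<Sum>j. F1 j t) + (\<Sum>j. F2 j t)" for t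
    proof -
      consider "t \<le> 0" | "0 < t" "t \<le> 1" | "1 < t" by linarith
      then show ?thesis
      proof cases
        case 1 then show ?thesis by simp
      next
        case 2
        obtain j where j: "(1/2) ^ Suc j < t" "t \<le> (1/2) ^ j" using dyadic_cover_small[OF 2] .
        have "K_sq X0 X1 t \<phi> \<le> fs_sq X0 (\<lambda>p. \<phi> p - \<psi> j p) + t\<^sup>2 * fs_sq X1 (\<psi> j)"
          by (intro K_sq_le D')
        also have "\<dots> \<le> ?A j"
        proof -
          have "t\<^sup>2 \<le> ((1/2) ^ j)\<^sup>2" using j(2) 2 by (intro power_mono) auto
          also have "((1/2::real) ^ j)\<^sup>2 = 1 / 4 ^ j" by (simp add: power2_eq_square power_one_over power_mult_distrib[symmetric])
          finally have "t\<^sup>2 * fs_sq X1 (\<psi> j) \<le> 1 / 4 ^ j * fs_sq X1 (\<psi> j)"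
            by (intro mult_right_mono) auto
          then show ?thesis by (simp add: dyadic_term_def)
        qed
        finally have K: "K_sq X0 X1 t \<phi> \<le> ?A j" .
        have "t powr (- 2 * \<theta> - 1) \<le> ((1/2) ^ Suc j) powr (- 2 * \<theta> - 1)"
          using j \<theta> by (intro powr_mono2') auto
        with K have "t powr (- 2 * \<theta> - 1) * K_sq X0 X1 t \<phi> \<le> ((1/2) ^ Suc j) powr (- 2 * \<theta> - 1) * ?A j"
          by (intro mult_mono K_sq_nonneg[OF X \<phi>]) auto
        then have "ennreal (t powr (- 2 * \<theta> - 1) * K_sq X0 X1 t \<phi>) * indicator {0<..} t \<le> F1 j t"
          using j 2 by (simp add: F1_def ennreal_leI)
        also have "\<dots> \<le> (\<Sum>j. F1 j t)" using sum_le_suminf[of "\<lambda>j. F1 j t" "{j}"] by simp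
        finally show ?thesis by (simp add: add_increasing2)
      next
        case 3
        obtain j where j: "2 ^ j < t" "t \<le> 2 ^ Suc j" using dyadic_cover_large[OF 3] .
        have "K_sq X0 X1 t \<phi> \<le> N"
          using K_sq_le[of \<phi> "\<lambda>p. 0" X0 X1 t] \<phi> quad_space_zero[OF coupleD(2)[OF X]] by (simp add: N_def)
        moreover have "t powr (- 2 * \<theta> - 1) \<le> (2 ^ j) powr (- 2 * \<theta> - 1)"
          using j \<theta> by (intro powr_mono2') auto
        ultimately have "t powr (- 2 * \<theta> - 1) * K_sq X0 X1 t \<phi> \<le> (2 ^ j) powr (- 2 * \<theta> - 1) * N"
          by (intro mult_mono K_sq_nonneg[OF X \<phi>]) auto
        then have "ennreal (t powr (- 2 * \<theta> - 1) * K_sq X0 X1 t \<phi>) * indicator {0<..} t \<le> F2 j t"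
          using j 3 by (simp add: F2_def ennreal_leI)
        also have "\<dots> \<le> (\<Sum>j. F2 j t)" using sum_le_suminf[of "\<lambda>j. F2 j t" "{j}"] by simp
        finally show ?thesis by (simp add: add_increasing)
      qed
    qed
    have m: "F1 j \<in> borel_measurable lborel" "F2 j \<in> borel_measurable lborel" for j
      unfolding F1_def[abs_def] F2_def[abs_def] by measurable
    have I1: "(\<integral>\<^sup>+t. F1 j t \<partial>lborel) = ennreal (w * (w ^ j * ?A j))" for j
    proof -
      have "(\<integral>\<^sup>+t. F1 j t \<partial>lborel) = ennreal (((1/2) ^ Suc j) powr (- 2 * \<theta> - 1) * ?A j) * ennreal ((1/2) ^ j - (1/2) ^ Suc j)"
        unfolding F1_def by (subst nn_integral_cmult_indicator) auto
      also have "\<dots> = ennreal ((((1/2) ^ Suc j) powr (- 2 * \<theta> - 1) * (1/2) ^ Suc j) * ?A j)"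
        by (subst ennreal_mult[symmetric]) (auto simp: dyadic_term_nonneg mult_ac)
      also have "\<dots> = ennreal (w * (w ^ j * ?A j))"
        unfolding powr_half_pow(1) by (simp add: w_def mult.assoc)
      finally show ?thesis .
    qed
    have I2: "(\<integral>\<^sup>+t. F2 j t \<partial>lborel) = ennreal ((1 / w) ^ j * N)" for j
    proof -
      have "(\<integral>\<^sup>+t. F2 j t \<partial>lborel) = ennreal ((2 ^ j) powr (- 2 * \<theta> - 1) * N) * ennreal (2 ^ Suc j - 2 ^ j)"
        unfolding F2_def by (subst nn_integral_cmult_indicator) auto
      also have "\<dots> = ennreal (((2 ^ j) powr (- 2 * \<theta> - 1) * 2 ^ j) * N)"
        by (subst ennreal_mult[symmetric]) (auto simp: N0 mult_ac)
      also have "\<dots> = ennreal ((1 / w) ^ j * N)"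
        unfolding powr_half_pow(2) by (simp add: w_def)
      finally show ?thesis .
    qed
    have "interp_sq X0 X1 \<theta> \<phi> \<le> (\<integral>\<^sup>+t. (\<Sum>j. F1 j t) + (\<Sum>j. F2 j t) \<partial>lborel)"
      unfolding interp_sq_def using pt by (intro nn_integral_mono) auto
    also have "\<dots> = (\<Sum>j. ennreal (w * (w ^ j * ?A j))) + (\<Sum>j. ennreal ((1 / w) ^ j * N))"
      using m by (subst nn_integral_add) (auto simp: nn_integral_suminf I1 I2)
    also have "\<dots> \<le> ennreal (w * S) + ennreal (1 / (1 - 1 / w) * N)"
    proof (intro add_mono suminf_ennreal_le)
      show "0 \<le> w * (w ^ j * ?A j)" for j using w by (simp add: dyadic_term_nonneg)
      show "(\<Sum>j<n. w * (w ^ j * ?A j)) \<le> w * S" for n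
        using D'(3)[of n] w by (simp add: sum_distrib_left[symmetric] w_def)
      show "0 \<le> (1 / w) ^ j * N" for j using w N0 by simp
      show "(\<Sum>j<n. (1 / w) ^ j * N) \<le> 1 / (1 - 1 / w) * N" for n
        unfolding sum_distrib_right[symmetric] using w N0
        by (intro mult_right_mono geometric_sum_le) auto
    qed
    also have "\<dots> = ennreal (w * S + 1 / (1 - 1 / w) * N)"
      using w D'(5) N0 pos by (intro ennreal_plus[symmetric]) auto
    also have "\<dots> \<le> ennreal (C * S)"
    proof (rule ennreal_leI)
      have "1 / (1 - 1 / w) * N \<le> 1 / (1 - 1 / w) * ((2 + 2 * c) * S)" using N pos by (rule mult_left_mono)
      then show "w * S + 1 / (1 - 1 / w) * N \<le> C * S" by (simp add: C_def algebra_simps)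
    qed
    finally show "\<phi> \<in> fs_carrier X0 \<and> interp_sq X0 X1 \<theta> \<phi> \<le> ennreal (C * S)" using \<phi> by simp
    qed
  qed
qed

lemma interp_norm_nonneg [simp]: "0 \<le> fs_norm (interp X0 X1 \<theta>) \<phi>"
  by (simp add: interp_def)

lemma interp_norm_sq:
  "fs_sq (interp X0 X1 \<theta>) \<phi> = enn2real (interp_sq X0 X1 \<theta> \<phi>)"
  by (simp add: interp_def)

text \<open>Monotonicity of the K-functional lets the integral over each dyadic interval bound its
  value at 2^-j. The infimum need not be attained, and the strict inequality in the assumption
  provides a budget S - M for near-minimisers.\<close>

lemma dyadic_of_interp:
  assumes X: "couple X0 X1" and \<theta>: "0 < \<theta>" "\<theta> < 1"
    and \<phi>: "\<phi> \<in> fs_carrier (interp X0 X1 \<theta>)" and S: "fs_sq (interp X0 X1 \<theta>) \<phi> < S"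
  obtains \<psi> where "dyadic_rep X0 X1 \<theta> \<phi> \<psi> (2 * 4 powr \<theta> * S)"
proof -
  define w where "w = (4::real) powr \<theta>"
  have w: "1 < w" using weight_bounds(1)[OF \<theta>] by (simp add: w_def)
  define M where "M = fs_sq (interp X0 X1 \<theta>) \<phi>"
  have \<phi>0: "\<phi> \<in> fs_carrier X0" and fin: "interp_sq X0 X1 \<theta> \<phi> < \<infinity>" using \<phi> by (auto simp: interp_def)
  have M: "interp_sq X0 X1 \<theta> \<phi> = ennreal M" using fin by (simp add: M_def interp_norm_sq)
  have M0: "0 \<le> M" by (simp add: M_def)
  let ?K = "\<lambda>j. K_sq X0 X1 ((1/2) ^ j) \<phi>"
  have K0: "0 \<le> ?K j" for j by (rule K_sq_nonneg[OF X \<phi>0])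
  \<comment> \<open>A lower bound for the integrand on (2^-j, 2^(1-j)]: the weight is taken at the
    right end, the K-functional at the left end. Its integral is w^j K_j / (2 w), the origin of the
    constant \<open>2 * 4 powr \<theta>\<close>.\<close>
  define F where "F j t = ennreal ((2 * (1/2) ^ j) powr (- 2 * \<theta> - 1) * ?K j) * indicator {(1/2) ^ j<..2 * (1/2) ^ j} t"
    for j and t :: real
  have IF: "(\<integral>\<^sup>+t. F j t \<partial>lborel) = ennreal (w ^ j * ?K j / (2 * w))" for j
  proof -
    have "(\<integral>\<^sup>+t. F j t \<partial>lborel) = ennreal ((2 * (1/2) ^ j) powr (- 2 * \<theta> - 1) * ?K j) * ennreal (2 * (1/2) ^ j - (1/2) ^ j)"
      unfolding F_def by (subst nn_integral_cmult_indicator) auto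
    also have "\<dots> = ennreal (((2 * (1/2) ^ j) powr (- 2 * \<theta> - 1) * (1/2) ^ j) * ?K j)"
      by (subst ennreal_mult[symmetric]) (auto simp: K0 mult_ac)
    also have "(2 * (1/2) ^ j) powr (- 2 * \<theta> - 1) * (1/2) ^ j = 2 powr (- 2 * \<theta> - 1) * w ^ j"
      using powr_half_pow(1)[of j \<theta>] by (simp add: powr_mult w_def mult.assoc)
    also have "2 powr (- 2 * \<theta> - 1) = 1 / (2 * w)"
      using powr_half_pow(2)[of 1 \<theta>] by (simp add: w_def field_simps)
    finally show ?thesis by (simp add: field_simps)
  qed
  have sumK: "(\<Sum>j<n. w ^ j * ?K j) \<le> 2 * w * M" for n
  proof -
    have pt: "(\<Sum>j<n. F j t) \<le> ennreal (t powr (- 2 * \<theta> - 1) * K_sq X0 X1 t \<phi>) * indicator {0<..} t" for t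
    proof (cases "\<exists>j<n. t \<in> {(1/2) ^ j<..2 * (1/2) ^ j}")
      case False
      then have "(\<Sum>j<n. F j t) = 0" by (intro sum.neutral) (auto simp: F_def indicator_def)
      then show ?thesis by simp
    next
      case True
      then obtain j where j: "j < n" "(1/2) ^ j < t" "t \<le> 2 * (1/2) ^ j" by auto
      have other: "F i t = 0" if "i \<noteq> j" for i
      proof -
        have "t \<notin> {(1/2) ^ i<..2 * (1/2) ^ i}"
        proof (cases "i < j")
          case True
          then have "(1/2::real) ^ j \<le> (1/2) ^ Suc i" by (intro power_decreasing) auto
          then show ?thesis using j(3) by auto
        next
          case False
          then have "(1/2::real) ^ i \<le> (1/2) ^ Suc j" using that by (intro power_decreasing) auto
          then show ?thesis using j(2) by auto
        qed
        then show ?thesis by (simp add: F_def)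
      qed
      have t0: "0 < t" using j(2) by (rule less_trans[rotated]) simp
      have "(\<Sum>i<n. F i t) = (\<Sum>i\<in>{j}. F i t)"
        using j(1) other by (intro sum.mono_neutral_right) auto
      also have "\<dots> = ennreal ((2 * (1/2) ^ j) powr (- 2 * \<theta> - 1) * ?K j)" using j by (simp add: F_def)
      also have "\<dots> \<le> ennreal (t powr (- 2 * \<theta> - 1) * K_sq X0 X1 t \<phi>)"
        using j t0 \<theta> by (intro ennreal_leI mult_mono powr_mono2' K_sq_mono[OF X \<phi>0] K0) auto
      finally show ?thesis using t0 by simp
    qed
    have "(\<integral>\<^sup>+t. (\<Sum>j<n. F j t) \<partial>lborel) \<le> interp_sq X0 X1 \<theta> \<phi>"
      unfolding interp_sq_def using pt by (intro nn_integral_mono) auto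
    moreover have "(\<integral>\<^sup>+t. (\<Sum>j<n. F j t) \<partial>lborel) = (\<Sum>j<n. \<integral>\<^sup>+t. F j t \<partial>lborel)"
      by (rule nn_integral_sum) (simp add: F_def[abs_def])
    ultimately have "(\<Sum>j<n. ennreal (w ^ j * ?K j / (2 * w))) \<le> ennreal M" by (simp add: IF M)
    then have "ennreal (\<Sum>j<n. w ^ j * ?K j / (2 * w)) \<le> ennreal M"
      using w K0 by (subst sum_ennreal[symmetric]) auto
    then have "(\<Sum>j<n. w ^ j * ?K j / (2 * w)) \<le> M" using M0 by (simp add: ennreal_le_iff)
    then show ?thesis using w by (simp add: sum_divide_distrib[symmetric] field_simps)
  qed
  \<comment> \<open>Chosen so that \<open>w ^ j * e j\<close> is (S - M) / 2^j; the weighted errors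
    then add up to at most 2 (S - M).\<close>
  define e where "e j = (S - M) / (w ^ j * 2 ^ j)" for j :: nat
  have SM: "0 < S - M" using S by (simp add: M_def)
  have e: "0 < e j" for j using SM w by (simp add: e_def)
  have "\<exists>u. (\<lambda>p. \<phi> p - u p) \<in> fs_carrier X0 \<and> u \<in> fs_carrier X1 \<and>
     fs_sq X0 (\<lambda>p. \<phi> p - u p) + ((1/2) ^ j)\<^sup>2 * fs_sq X1 u < ?K j + e j" for j
    by (rule K_sq_near[OF X \<phi>0 e, of "(1/2) ^ j" j]) (intro exI conjI)
  then have "\<forall>j. \<exists>u. (\<lambda>p. \<phi> p - u p) \<in> fs_carrier X0 \<and> u \<in> fs_carrier X1 \<and>
     fs_sq X0 (\<lambda>p. \<phi> p - u p) + ((1/2) ^ j)\<^sup>2 * fs_sq X1 u < ?K j + e j" ..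
  from choice[OF this] obtain \<psi> where "\<forall>j. (\<lambda>p. \<phi> p - \<psi> j p) \<in> fs_carrier X0 \<and> \<psi> j \<in> fs_carrier X1 \<and>
     fs_sq X0 (\<lambda>p. \<phi> p - \<psi> j p) + ((1/2) ^ j)\<^sup>2 * fs_sq X1 (\<psi> j) < ?K j + e j" ..
  then have \<psi>: "(\<lambda>p. \<phi> p - \<psi> j p) \<in> fs_carrier X0" "\<psi> j \<in> fs_carrier X1"
     "fs_sq X0 (\<lambda>p. \<phi> p - \<psi> j p) + ((1/2) ^ j)\<^sup>2 * fs_sq X1 (\<psi> j) < ?K j + e j" for j
    by simp_all
  have t: "dyadic_term X0 X1 \<phi> \<psi> j \<le> ?K j + e j" for j
  proof -
    have "((1/2::real) ^ j)\<^sup>2 = 1 / 4 ^ j" by (simp add: power2_eq_square power_one_over power_mult_distrib[symmetric])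
    then show ?thesis using \<psi>(3)[of j] by (simp add: dyadic_term_def)
  qed
  have "(\<Sum>j<n. w ^ j * dyadic_term X0 X1 \<phi> \<psi> j) \<le> 2 * w * S" for n
  proof -
    have "(\<Sum>j<n. w ^ j * dyadic_term X0 X1 \<phi> \<psi> j) \<le> (\<Sum>j<n. w ^ j * ?K j + (S - M) * (1/2) ^ j)"
    proof (rule sum_mono)
      fix j
      have "w ^ j * dyadic_term X0 X1 \<phi> \<psi> j \<le> w ^ j * (?K j + e j)" using t w by (intro mult_left_mono) auto
      also have "\<dots> = w ^ j * ?K j + (S - M) * (1/2) ^ j"
        using w by (simp add: e_def distrib_left power_one_over)
      finally show "w ^ j * dyadic_term X0 X1 \<phi> \<psi> j \<le> w ^ j * ?K j + (S - M) * (1/2) ^ j" .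
    qed
    also have "\<dots> = (\<Sum>j<n. w ^ j * ?K j) + (S - M) * (\<Sum>j<n. (1/2) ^ j)"
      by (simp add: sum.distrib sum_distrib_left)
    also have "\<dots> \<le> 2 * w * M + (S - M) * 2"
      using sumK[of n] geometric_sum_le[of "1/2" n] SM by (intro add_mono mult_left_mono) auto
    also have "\<dots> \<le> 2 * w * M + (S - M) * (2 * w)" using w SM by (intro add_left_mono mult_left_mono) auto
    also have "\<dots> = 2 * w * S" by (simp add: algebra_simps)
    finally show ?thesis .
  qed
  then have "dyadic_rep X0 X1 \<theta> \<phi> \<psi> (2 * w * S)" using \<psi> by (simp add: dyadic_rep_def w_def)
  then show ?thesis using that by (simp add: w_def)
qed

section \<open>Embeddings and transfer in terms of dyadic representations\<close>

lemma le_of_strict_upper: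
  fixes a C M :: real assumes "0 \<le> C" "\<And>S. M < S \<Longrightarrow> a \<le> C * S" shows "a \<le> C * M"
proof (rule field_le_epsilon)
  fix e :: real assume e: "0 < e"
  have "a \<le> C * (M + e / (C + 1))" using e assms(1) by (intro assms(2)) (simp add: divide_pos_pos add_nonneg_pos)
  also have "\<dots> \<le> C * M + e" using e assms(1) by (simp add: field_simps)
  finally show "a \<le> C * M + e" .
qed

text \<open>Replaces an element of the interpolation space by its dyadic representations with
  arbitrary constants S above a multiple of the squared norm. The set A carries side conditions such
  as continuity or Kirchhoff conditions.\<close>

lemma interp_embeds:
  assumes X: "couple X0 X1" and \<theta>: "0 < \<theta>" "\<theta> < 1" and C: "0 \<le> C"
    and b: "\<And>\<phi> \<psi> S. \<phi> \<in> A \<Longrightarrow> dyadic_rep X0 X1 \<theta> \<phi> \<psi> S \<Longrightarrow>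
      \<phi> \<in> fs_carrier Z \<and> fs_sq Z \<phi> \<le> C * S"
  shows "interp X0 X1 \<theta> \<sqinter>\<^sub>s A \<hookrightarrow> Z"
proof (rule embedsI_sq)
  show "0 \<le> fs_norm (interp X0 X1 \<theta> \<sqinter>\<^sub>s A) u" for u by (simp add: fs_inter_def)
  fix u assume "u \<in> fs_carrier (interp X0 X1 \<theta> \<sqinter>\<^sub>s A)"
  then have u: "u \<in> fs_carrier (interp X0 X1 \<theta>)" "u \<in> A" by (auto simp: fs_inter_def)
  let ?M = "fs_sq (interp X0 X1 \<theta>) u"
  have *: "u \<in> fs_carrier Z \<and> fs_sq Z u \<le> (C * (2 * 4 powr \<theta>)) * S" if S: "?M < S" for S
  proof -
    obtain \<psi> where "dyadic_rep X0 X1 \<theta> u \<psi> (2 * 4 powr \<theta> * S)" by (rule dyadic_of_interp[OF X \<theta> u(1) S])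
    from b[OF u(2) this] show ?thesis by (simp add: mult.assoc)
  qed
  show "u \<in> fs_carrier Z" using *[of "?M + 1"] by simp
  have "fs_sq Z u \<le> (C * (2 * 4 powr \<theta>)) * ?M"
    by (rule le_of_strict_upper) (use C * in auto)
  then show "fs_sq Z u \<le> (C * (2 * 4 powr \<theta>)) * fs_sq (interp X0 X1 \<theta> \<sqinter>\<^sub>s A) u"
    by (simp add: fs_inter_def)
qed

lemma embeds_interp:
  assumes X: "couple X0 X1" and \<theta>: "0 < \<theta>" "\<theta> < 1" and C: "0 \<le> C" and n: "\<And>u. 0 \<le> fs_norm Z u"
    and b: "\<And>\<phi> S. \<phi> \<in> fs_carrier Z \<Longrightarrow> fs_sq Z \<phi> < S \<Longrightarrow> \<exists>\<psi>. dyadic_rep X0 X1 \<theta> \<phi> \<psi> (C * S)"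
  shows "Z \<hookrightarrow> interp X0 X1 \<theta>"
proof -
  obtain c where "0 \<le> c" "\<forall>\<phi> \<psi> S. dyadic_rep X0 X1 \<theta> \<phi> \<psi> S \<longrightarrow>
    \<phi> \<in> fs_carrier X0 \<and> interp_sq X0 X1 \<theta> \<phi> \<le> ennreal (c * S)"
    by (rule interp_sq_le_dyadic[OF X \<theta>])
  note c = this(1) this(2)[rule_format]
  show ?thesis
  proof (rule embedsI_sq[OF _ n])
    fix u assume u: "u \<in> fs_carrier Z"
    let ?M = "fs_sq Z u"
    have *: "u \<in> fs_carrier X0 \<and> interp_sq X0 X1 \<theta> u \<le> ennreal ((c * C) * S)" if "?M < S" for S
      using b[OF u that] c(2) by (metis mult.assoc)
    show "u \<in> fs_carrier (interp X0 X1 \<theta>)"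
      using *[of "?M + 1"] by (auto simp: interp_def intro: le_less_trans)
    show "fs_sq (interp X0 X1 \<theta>) u \<le> (c * C) * ?M"
    proof (rule le_of_strict_upper)
      show "0 \<le> c * C" using c(1) C by simp
      fix S assume S: "?M < S"
      then have "0 \<le> S" by (rule less_imp_le[OF le_less_trans[rotated]]) simp
      then show "fs_sq (interp X0 X1 \<theta>) u \<le> c * C * S"
        unfolding interp_norm_sq using *[OF S] c(1) C by (intro enn2real_leI) auto
    qed
  qed
qed

text \<open>The working form of all comparisons: interpolation norms disappear, and only
  approximating sequences have to be modified.\<close>

lemma interp_transfer:
  assumes X: "couple X0 X1" and Y: "couple Y0 Y1" and \<theta>: "0 < \<theta>" "\<theta> < 1" and C: "0 \<le> C"
    and b: "\<And>\<phi> \<psi> S. \<phi> \<in> A \<Longrightarrow> dyadic_rep X0 X1 \<theta> \<phi> \<psi> S \<Longrightarrow> \<exists>\<psi>'. dyadic_rep Y0 Y1 \<theta> \<phi> \<psi>' (C * S)"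
  shows "interp X0 X1 \<theta> \<sqinter>\<^sub>s A \<hookrightarrow> interp Y0 Y1 \<theta>"
proof -
  obtain c where "0 \<le> c" "\<forall>\<phi> \<psi> S. dyadic_rep Y0 Y1 \<theta> \<phi> \<psi> S \<longrightarrow>
    \<phi> \<in> fs_carrier Y0 \<and> interp_sq Y0 Y1 \<theta> \<phi> \<le> ennreal (c * S)"
    by (rule interp_sq_le_dyadic[OF Y \<theta>])
  note c = this(1) this(2)[rule_format]
  show ?thesis
  proof (rule interp_embeds[OF X \<theta>, of "c * C"])
    show "0 \<le> c * C" using c C by simp
    fix \<phi> \<psi> S assume "\<phi> \<in> A" and D: "dyadic_rep X0 X1 \<theta> \<phi> \<psi> S"
    from b[OF this] obtain \<psi>' where "dyadic_rep Y0 Y1 \<theta> \<phi> \<psi>' (C * S)" by blast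
    from c(2)[OF this] have le: "\<phi> \<in> fs_carrier Y0" "interp_sq Y0 Y1 \<theta> \<phi> \<le> ennreal (c * C * S)"
      by (simp_all add: mult.assoc)
    have "0 \<le> c * C * S" using c(1) C dyadic_repD(5)[OF D] by simp
    then show "\<phi> \<in> fs_carrier (interp Y0 Y1 \<theta>) \<and> fs_sq (interp Y0 Y1 \<theta>) \<phi> \<le> c * C * S"
      using le unfolding interp_norm_sq by (auto simp: interp_def intro: le_less_trans intro!: enn2real_leI)
  qed
qed

lemma fs_inter_UNIV [simp]: "E \<sqinter>\<^sub>s UNIV = E"
  by (simp add: fs_inter_def)

lemma interp_mono:
  assumes X: "couple X0 X1" and Y: "couple Y0 Y1" and \<theta>: "0 < \<theta>" "\<theta> < 1"
    and e: "X0 \<hookrightarrow> Y0" "X1 \<hookrightarrow> Y1"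
  shows "interp X0 X1 \<theta> \<hookrightarrow> interp Y0 Y1 \<theta>"
proof -
  note qX = coupleD(1,2)[OF X, THEN quad_space_nonneg] and qY = coupleD(1,2)[OF Y, THEN quad_space_nonneg]
  obtain c where "0 \<le> c" "\<forall>u\<in>fs_carrier X0. u \<in> fs_carrier Y0 \<and> fs_sq Y0 u \<le> c * fs_sq X0 u"
    by (rule embedsD_sq[OF e(1) qX(1) qY(1)])
  note c = this(1) this(2)[rule_format]
  obtain d where "0 \<le> d" "\<forall>u\<in>fs_carrier X1. u \<in> fs_carrier Y1 \<and> fs_sq Y1 u \<le> d * fs_sq X1 u"
    by (rule embedsD_sq[OF e(2) qX(2) qY(2)])
  note d = this(1) this(2)[rule_format]
  have "interp X0 X1 \<theta> \<sqinter>\<^sub>s UNIV \<hookrightarrow> interp Y0 Y1 \<theta>"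
  proof (rule interp_transfer[OF X Y \<theta>, of "c + d"])
    show "0 \<le> c + d" using c d by simp
    fix \<phi> \<psi> S assume D: "dyadic_rep X0 X1 \<theta> \<phi> \<psi> S"
    note D' = dyadic_repD[OF D]
    have t: "dyadic_term Y0 Y1 \<phi> \<psi> j \<le> (c + d) * dyadic_term X0 X1 \<phi> \<psi> j" for j
    proof -
      have "dyadic_term Y0 Y1 \<phi> \<psi> j \<le> c * fs_sq X0 (\<lambda>p. \<phi> p - \<psi> j p) + d * fs_sq X1 (\<psi> j) / 4 ^ j"
        unfolding dyadic_term_def using c(2)[OF D'(2)] d(2)[OF D'(1)] by (intro add_mono divide_right_mono) auto
      also have "\<dots> \<le> (c + d) * dyadic_term X0 X1 \<phi> \<psi> j"
      proof -
        have "0 \<le> d * fs_sq X0 (\<lambda>p. \<phi> p - \<psi> j p)" "0 \<le> c * (fs_sq X1 (\<psi> j) / 4 ^ j)"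
          using c(1) d(1) by simp_all
        then show ?thesis unfolding dyadic_term_def distrib_left distrib_right times_divide_eq_right add_divide_distrib by linarith
      qed
      finally show ?thesis .
    qed
    have "(\<Sum>j<n. (4 powr \<theta>) ^ j * dyadic_term Y0 Y1 \<phi> \<psi> j) \<le> (c + d) * S" for n
    proof -
      have "(\<Sum>j<n. (4 powr \<theta>) ^ j * dyadic_term Y0 Y1 \<phi> \<psi> j) \<le> (\<Sum>j<n. (c + d) * ((4 powr \<theta>) ^ j * dyadic_term X0 X1 \<phi> \<psi> j))"
      proof (rule sum_mono)
        fix j
        have "(4 powr \<theta>) ^ j * dyadic_term Y0 Y1 \<phi> \<psi> j \<le> (4 powr \<theta>) ^ j * ((c + d) * dyadic_term X0 X1 \<phi> \<psi> j)"
          using t by (intro mult_left_mono) auto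
        then show "(4 powr \<theta>) ^ j * dyadic_term Y0 Y1 \<phi> \<psi> j \<le> (c + d) * ((4 powr \<theta>) ^ j * dyadic_term X0 X1 \<phi> \<psi> j)"
          by (simp add: mult_ac)
      qed
      also have "\<dots> \<le> (c + d) * S"
        unfolding sum_distrib_left[symmetric] using D'(3)[of n] c(1) d(1) by (intro mult_left_mono) auto
      finally show ?thesis .
    qed
    then have "dyadic_rep Y0 Y1 \<theta> \<phi> \<psi> ((c + d) * S)"
      using D' c(2) d(2) by (auto simp: dyadic_rep_def)
    then show "\<exists>\<psi>'. dyadic_rep Y0 Y1 \<theta> \<phi> \<psi>' ((c + d) * S)" by blast
  qed
  then show ?thesis by simp
qed

section \<open>Interpolation of subspaces defined by trace functionals\<close>

text \<open>The parameter keeps the factor of the first square close to 1, so that a geometric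
  weight can absorb it.\<close>

lemma young_sq:
  fixes x y \<eta> :: real assumes "0 < \<eta>"
  shows "(x + y)\<^sup>2 \<le> (1 + \<eta>) * x\<^sup>2 + (1 + 1 / \<eta>) * y\<^sup>2"
proof -
  have "0 \<le> (\<eta> * x - y)\<^sup>2 / \<eta>" using assms by simp
  also have "(\<eta> * x - y)\<^sup>2 / \<eta> = \<eta> * x\<^sup>2 - 2 * x * y + (1 / \<eta>) * y\<^sup>2"
    using assms by (simp add: power2_diff power_mult_distrib field_simps power2_eq_square)
  finally show ?thesis by (simp add: power2_sum algebra_simps)
qed

text \<open>A discrete Hardy inequality; the differences of \<open>\<tau>\<close> control \<open>\<tau>\<close> from one of the two ends.\<close>
lemma hardy_small:
  fixes \<tau> :: "nat \<Rightarrow> real"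
  assumes r: "0 < \<rho>" "\<rho> < 1" and d: "\<And>n. (\<Sum>j<n. \<rho> ^ j * (\<tau> (Suc j) - \<tau> j)\<^sup>2) \<le> D" and z: "(\<tau> 0)\<^sup>2 \<le> D"
  shows "(\<Sum>j<n. \<rho> ^ j * (\<tau> j)\<^sup>2) \<le> 2 * (1 + \<rho> * (1 + 2 * \<rho> / (1 - \<rho>))) / (1 - \<rho>) * D"
proof -
  \<comment> \<open>Makes \<rho> (1 + \<eta>) = (1 + \<rho>) / 2 < 1, so that the recursion for the
    weighted squares contracts.\<close>
  define \<eta> where "\<eta> = (1 - \<rho>) / (2 * \<rho>)"
  have \<eta>: "0 < \<eta>" using r by (simp add: \<eta>_def)
  define c where "c = \<rho> * (1 + 1 / \<eta>)"
  have c: "0 \<le> c" using r \<eta> by (simp add: c_def)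
  have q: "\<rho> * (1 + \<eta>) = (1 + \<rho>) / 2" using r by (simp add: \<eta>_def field_simps)
  let ?b = "\<lambda>j. \<rho> ^ j * (\<tau> j)\<^sup>2" and ?d = "\<lambda>j. \<rho> ^ j * (\<tau> (Suc j) - \<tau> j)\<^sup>2"
  have step: "?b (Suc j) \<le> (1 + \<rho>) / 2 * ?b j + c * ?d j" for j
  proof -
    have "(\<tau> (Suc j))\<^sup>2 = (\<tau> j + (\<tau> (Suc j) - \<tau> j))\<^sup>2" by simp
    also have "\<dots> \<le> (1 + \<eta>) * (\<tau> j)\<^sup>2 + (1 + 1 / \<eta>) * (\<tau> (Suc j) - \<tau> j)\<^sup>2" by (rule young_sq[OF \<eta>])
    finally have "\<rho> ^ Suc j * (\<tau> (Suc j))\<^sup>2 \<le> \<rho> ^ Suc j * ((1 + \<eta>) * (\<tau> j)\<^sup>2 + (1 + 1 / \<eta>) * (\<tau> (Suc j) - \<tau> j)\<^sup>2)"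
      using r by (intro mult_left_mono) auto
    also have "\<dots> = (\<rho> * (1 + \<eta>)) * ?b j + c * ?d j" by (simp add: c_def algebra_simps)
    finally show ?thesis unfolding q .
  qed
  define B where "B = (\<Sum>j<n. ?b j)"
  have "B \<le> (\<Sum>j<Suc n. ?b j)" unfolding B_def using r by simp
  also have "\<dots> = ?b 0 + (\<Sum>j<n. ?b (Suc j))" by (rule sum.lessThan_Suc_shift)
  also have "\<dots> \<le> D + (\<Sum>j<n. (1 + \<rho>) / 2 * ?b j + c * ?d j)"
    using z step by (intro add_mono sum_mono) auto
  also have "\<dots> = D + ((1 + \<rho>) / 2 * B + c * (\<Sum>j<n. ?d j))"
    by (simp add: sum.distrib sum_distrib_left B_def)
  also have "\<dots> \<le> D + ((1 + \<rho>) / 2 * B + c * D)"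
    using d[of n] c by (intro add_left_mono mult_left_mono) auto
  finally have "(1 - \<rho>) * B \<le> 2 * (1 + c) * D" by (simp add: field_simps)
  then have "B \<le> 2 * (1 + c) / (1 - \<rho>) * D" using r by (simp add: field_simps)
  moreover have "c = \<rho> * (1 + 2 * \<rho> / (1 - \<rho>))" using r by (simp add: c_def \<eta>_def)
  ultimately show ?thesis by (simp add: B_def)
qed

text \<open>With growing weights the recursion runs backwards: \<tau> j is recovered from \<tau> (j
  + 1), and the vanishing limit takes over the role of the bound on \<tau> 0.\<close>

lemma hardy_large:
  fixes \<tau> :: "nat \<Rightarrow> real"
  assumes r: "1 < \<rho>" and d: "\<And>n. (\<Sum>j<n. \<rho> ^ j * (\<tau> (Suc j) - \<tau> j)\<^sup>2) \<le> D" and z: "\<tau> \<longlonglongrightarrow> 0"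
  shows "(\<Sum>j<n. \<rho> ^ j * (\<tau> j)\<^sup>2) \<le> 2 * \<rho> * (1 + 2 / (\<rho> - 1)) / (\<rho> - 1) * D"
proof -
  define \<eta> where "\<eta> = (\<rho> - 1) / 2"
  have \<eta>: "0 < \<eta>" using r by (simp add: \<eta>_def)
  define c where "c = 1 + 1 / \<eta>"
  have c: "0 \<le> c" using \<eta> by (simp add: c_def)
  define q where "q = (1 + \<eta>) / \<rho>"
  have q: "0 \<le> q" "1 - q = (\<rho> - 1) / (2 * \<rho>)" using r by (auto simp: q_def \<eta>_def field_simps)
  \<comment> \<open>Subtracting \<tau> m makes the last term vanish, so the shifted sum is bounded
    by the sum itself and can be absorbed; the limit in m is taken at the end.\<close>
  have main: "(\<Sum>j<n. \<rho> ^ j * (\<tau> j - \<tau> m)\<^sup>2) \<le> c / (1 - q) * D" if "n \<le> m" for n m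
  proof -
    let ?s = "\<lambda>j. \<tau> j - \<tau> m"
    let ?b = "\<lambda>j. \<rho> ^ j * (?s j)\<^sup>2" and ?d = "\<lambda>j. \<rho> ^ j * (\<tau> (Suc j) - \<tau> j)\<^sup>2"
    have step: "?b j \<le> q * ?b (Suc j) + c * ?d j" for j
    proof -
      have "(?s j)\<^sup>2 = (?s (Suc j) + (\<tau> j - \<tau> (Suc j)))\<^sup>2" by simp
      also have "\<dots> \<le> (1 + \<eta>) * (?s (Suc j))\<^sup>2 + (1 + 1 / \<eta>) * (\<tau> j - \<tau> (Suc j))\<^sup>2" by (rule young_sq[OF \<eta>])
      also have "(\<tau> j - \<tau> (Suc j))\<^sup>2 = (\<tau> (Suc j) - \<tau> j)\<^sup>2" by (rule power2_commute)
      finally have "\<rho> ^ j * (?s j)\<^sup>2 \<le> \<rho> ^ j * ((1 + \<eta>) * (?s (Suc j))\<^sup>2 + c * (\<tau> (Suc j) - \<tau> j)\<^sup>2)"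
        unfolding c_def using r by (intro mult_left_mono) auto
      also have "\<dots> = q * ?b (Suc j) + c * ?d j"
      proof -
        have qr: "q * (\<rho> ^ Suc j * x) = (1 + \<eta>) * (\<rho> ^ j * x)" for x using r by (simp add: q_def)
        show ?thesis unfolding qr by (simp add: algebra_simps)
      qed
      finally show ?thesis .
    qed
    define B where "B = (\<Sum>j<m. ?b j)"
    have "B \<le> (\<Sum>j<m. q * ?b (Suc j) + c * ?d j)" unfolding B_def by (intro sum_mono step)
    also have "\<dots> = q * (\<Sum>j<m. ?b (Suc j)) + c * (\<Sum>j<m. ?d j)" by (simp add: sum.distrib sum_distrib_left)
    also have "\<dots> \<le> q * B + c * (\<Sum>j<m. ?d j)"
    proof (intro add_right_mono mult_left_mono q(1))
      have "?b 0 + (\<Sum>j<m. ?b (Suc j)) = (\<Sum>j<Suc m. ?b j)" by (rule sum.lessThan_Suc_shift[symmetric])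
      also have "\<dots> = B" by (simp add: B_def)
      finally have "?b 0 + (\<Sum>j<m. ?b (Suc j)) = B" .
      moreover have "0 \<le> ?b 0" by simp
      ultimately show "(\<Sum>j<m. ?b (Suc j)) \<le> B" by linarith
    qed
    also have "\<dots> \<le> q * B + c * D" using d[of m] c by (intro add_left_mono mult_left_mono) auto
    finally have "(1 - q) * B \<le> c * D" by (simp add: algebra_simps)
    moreover have "0 < 1 - q" using q(2) r by simp
    ultimately have "B \<le> c / (1 - q) * D" by (simp add: field_simps)
    moreover have "(\<Sum>j<n. ?b j) \<le> B" unfolding B_def using that r by (intro sum_mono2) auto
    ultimately show ?thesis by linarith
  qed
  have "(\<lambda>m. \<Sum>j<n. \<rho> ^ j * (\<tau> j - \<tau> m)\<^sup>2) \<longlonglongrightarrow> (\<Sum>j<n. \<rho> ^ j * (\<tau> j - 0)\<^sup>2)"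
    by (intro tendsto_intros z)
  then have "(\<Sum>j<n. \<rho> ^ j * (\<tau> j - 0)\<^sup>2) \<le> c / (1 - q) * D"
    by (rule LIMSEQ_le_const2) (use main in blast)
  moreover have "c / (1 - q) = 2 * \<rho> * (1 + 2 / (\<rho> - 1)) / (\<rho> - 1)"
    unfolding q(2) by (simp add: c_def \<eta>_def)
  ultimately show ?thesis by simp
qed

text \<open>Consecutive approximants differ by the difference of their errors, which is small in X0,
  while the X1 bound is that of the approximants themselves. Trace inequalities are therefore
  applied to differences.\<close>

lemma dyadic_diff_bounds:
  assumes X: "couple X0 X1" and D: "dyadic_rep X0 X1 \<theta> \<phi> \<psi> S"
  defines "A \<equiv> dyadic_term X0 X1 \<phi> \<psi>" and "v \<equiv> \<lambda>j p. \<psi> (Suc j) p - \<psi> j p"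
  shows "v j \<in> fs_carrier X1" "fs_sq X0 (v j) \<le> 2 * A j + 2 * A (Suc j)"
    "fs_sq X1 (v j) \<le> 4 ^ j * (2 * A j + 8 * A (Suc j))"
proof -
  note D' = dyadic_repD[OF D] and q = coupleD(1,2)[OF X]
  show "v j \<in> fs_carrier X1" unfolding v_def by (intro quad_space_diff q D')
  have "v j = (\<lambda>p. (\<phi> p - \<psi> j p) - (\<phi> p - \<psi> (Suc j) p))" by (auto simp: v_def)
  then have "fs_sq X0 (v j) \<le> 2 * fs_sq X0 (\<lambda>p. \<phi> p - \<psi> j p) + 2 * fs_sq X0 (\<lambda>p. \<phi> p - \<psi> (Suc j) p)"
    using quad_space_diff(2)[OF q(1) D'(2) D'(2), of j "Suc j"] by simp
  also have "\<dots> \<le> 2 * A j + 2 * A (Suc j)" by (simp add: A_def dyadic_term_def)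
  finally show "fs_sq X0 (v j) \<le> 2 * A j + 2 * A (Suc j)" .
  have n: "fs_sq X1 (\<psi> i) \<le> 4 ^ i * A i" for i
    by (simp add: A_def dyadic_term_def distrib_left)
  have "fs_sq X1 (v j) \<le> 2 * fs_sq X1 (\<psi> (Suc j)) + 2 * fs_sq X1 (\<psi> j)"
    unfolding v_def by (intro quad_space_diff q D')
  also have "\<dots> \<le> 2 * (4 ^ Suc j * A (Suc j)) + 2 * (4 ^ j * A j)"
    by (intro add_mono mult_left_mono n) auto
  finally show "fs_sq X1 (v j) \<le> 4 ^ j * (2 * A j + 8 * A (Suc j))" by (simp add: algebra_simps)
qed

text \<open>At scale j the squared trace of a difference is at most c 2^j (4 A_j + 10 A_(j+1)). The
  factor 2^j turns the weight 4^(\<theta> j) into \<open>(4 powr \<theta> / 2) ^ j\<close>; summing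
  10 times both neighbours gives 20.\<close>

lemma dyadic_trace_diff:
  assumes X: "couple X0 X1" and \<theta>: "0 < \<theta>" "\<theta> < 1" and D: "dyadic_rep X0 X1 \<theta> \<phi> \<psi> S" and c: "0 \<le> c"
    and Tb: "\<And>u j. u \<in> fs_carrier X1 \<Longrightarrow> (T u)\<^sup>2 \<le> c * (2 ^ j * fs_sq X0 u + fs_sq X1 u / 2 ^ j)"
    and Td: "\<And>u v. u \<in> fs_carrier X1 \<Longrightarrow> v \<in> fs_carrier X1 \<Longrightarrow> T (\<lambda>p. u p - v p) = T u - T v"
  shows "(\<Sum>j<n. (4 powr \<theta> / 2) ^ j * (T (\<psi> (Suc j)) - T (\<psi> j))\<^sup>2) \<le> 20 * c * S"
    "(4 powr \<theta> / 2) ^ j * (T (\<psi> (Suc j)) - T (\<psi> j))\<^sup>2 \<le> 20 * c * S"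
proof -
  define w where "w = (4::real) powr \<theta>"
  have w: "1 < w" using weight_bounds(1)[OF \<theta>] by (simp add: w_def)
  let ?A = "dyadic_term X0 X1 \<phi> \<psi>"
  note D' = dyadic_repD[OF D] and V = dyadic_diff_bounds[OF X D]
  have A0: "0 \<le> ?A j" for j by (rule dyadic_term_nonneg)
  have t: "(w / 2) ^ j * (T (\<psi> (Suc j)) - T (\<psi> j))\<^sup>2 \<le> 10 * c * (w ^ j * ?A j + w ^ Suc j * ?A (Suc j))" for j
  proof -
    let ?v = "\<lambda>p. \<psi> (Suc j) p - \<psi> j p"
    have "(T (\<psi> (Suc j)) - T (\<psi> j))\<^sup>2 = (T ?v)\<^sup>2" using Td[OF D'(1) D'(1)] by simp
    also have "\<dots> \<le> c * (2 ^ j * fs_sq X0 ?v + fs_sq X1 ?v / 2 ^ j)"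
      by (rule Tb[OF V(1)])
    also have "\<dots> \<le> c * (2 ^ j * (2 * ?A j + 2 * ?A (Suc j)) + 4 ^ j * (2 * ?A j + 8 * ?A (Suc j)) / 2 ^ j)"
      using V(2,3)[of j] c by (intro mult_left_mono add_mono divide_right_mono) auto
    also have "\<dots> = c * 2 ^ j * (4 * ?A j + 10 * ?A (Suc j))"
    proof -
      have "(4::real) ^ j = 2 ^ j * 2 ^ j" by (simp add: power_mult_distrib[symmetric])
      then have e: "4 ^ j * x / 2 ^ j = 2 ^ j * x" for x :: real by simp
      show ?thesis unfolding e by (simp add: algebra_simps)
    qed
    finally have "(w / 2) ^ j * (T (\<psi> (Suc j)) - T (\<psi> j))\<^sup>2 \<le> (w / 2) ^ j * (c * 2 ^ j * (4 * ?A j + 10 * ?A (Suc j)))"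
      using w by (intro mult_left_mono) auto
    also have "\<dots> = c * (w ^ j * (4 * ?A j) + w ^ j * (10 * ?A (Suc j)))"
      by (simp add: power_divide algebra_simps)
    also have "\<dots> \<le> c * (w ^ j * (10 * ?A j) + w ^ Suc j * (10 * ?A (Suc j)))"
      using c w A0[of j] A0[of "Suc j"] by (intro mult_left_mono add_mono mult_mono) auto
    finally show ?thesis by (simp add: algebra_simps)
  qed
  have s: "(\<Sum>j<n. (w / 2) ^ j * (T (\<psi> (Suc j)) - T (\<psi> j))\<^sup>2) \<le> 20 * c * S" for n
  proof -
    have "(\<Sum>j<n. (w / 2) ^ j * (T (\<psi> (Suc j)) - T (\<psi> j))\<^sup>2) \<le> (\<Sum>j<n. 10 * c * (w ^ j * ?A j + w ^ Suc j * ?A (Suc j)))"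
      by (intro sum_mono t)
    also have "\<dots> = 10 * c * ((\<Sum>j<n. w ^ j * ?A j) + (\<Sum>j<n. w ^ Suc j * ?A (Suc j)))"
      by (simp only: sum_distrib_left[symmetric] sum.distrib)
    also have "\<dots> \<le> 10 * c * (S + S)"
    proof (intro mult_left_mono add_mono)
      show "(\<Sum>j<n. w ^ j * ?A j) \<le> S" using D'(3) by (simp add: w_def)
      have "(\<Sum>j<n. w ^ Suc j * ?A (Suc j)) \<le> ?A 0 + (\<Sum>j<n. w ^ Suc j * ?A (Suc j))" using A0 by simp
      also have "\<dots> = (\<Sum>j<Suc n. w ^ j * ?A j)" by (subst sum.lessThan_Suc_shift) simp
      also have "\<dots> \<le> S" unfolding w_def by (rule D'(3))
      finally show "(\<Sum>j<n. w ^ Suc j * ?A (Suc j)) \<le> S" .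
    qed (use c in simp)
    finally show ?thesis by simp
  qed
  then show "(\<Sum>j<n. (4 powr \<theta> / 2) ^ j * (T (\<psi> (Suc j)) - T (\<psi> j))\<^sup>2) \<le> 20 * c * S"
    by (simp add: w_def)
  have "(w / 2) ^ j * (T (\<psi> (Suc j)) - T (\<psi> j))\<^sup>2 \<le> (\<Sum>j<Suc j. (w / 2) ^ j * (T (\<psi> (Suc j)) - T (\<psi> j))\<^sup>2)"
    using w by (intro member_le_sum[of j "{..<Suc j}"]) auto
  then show "(4 powr \<theta> / 2) ^ j * (T (\<psi> (Suc j)) - T (\<psi> j))\<^sup>2 \<le> 20 * c * S"
    using s[of "Suc j"] by (simp add: w_def)
qed

text \<open>The ratio of the trace weights passes through 1 at \<theta> = 1/2, the only exponent
  that neither Hardy inequality covers.\<close>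

lemma half_weight:
  assumes "0 < \<theta>" "\<theta> < 1"
  shows "0 < (4::real) powr \<theta> / 2" "\<theta> < 1/2 \<Longrightarrow> (4::real) powr \<theta> / 2 < 1" "1/2 < \<theta> \<Longrightarrow> 1 < (4::real) powr \<theta> / 2"
proof -
  have h: "(4::real) powr (1/2) = 2" by (simp add: powr_half_sqrt)
  show "0 < (4::real) powr \<theta> / 2" by simp
  show "(4::real) powr \<theta> / 2 < 1" if "\<theta> < 1/2" using powr_less_mono[OF that, of 4] h by simp
  show "1 < (4::real) powr \<theta> / 2" if "1/2 < \<theta>" using powr_less_mono[OF that, of 4] h by simp
qed

text \<open>The dual functions \<open>E i j\<close> have squared norms of order 2^-j in X0 and 2^j
  in X1, so subtracting T times \<open>E i j\<close> adds about T^2 / 2^j to either half of the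
  dyadic term. Summability of this is exactly the Hardy inequality for the weight \<rho>.\<close>

lemma interp_correction:
  fixes T :: "'i \<Rightarrow> ('p \<Rightarrow> real) \<Rightarrow> real"
  assumes X: "couple X0 X1" and Y: "couple X0 Y1" and \<theta>: "0 < \<theta>" "\<theta> < 1" "\<theta> \<noteq> 1/2"
    and I: "finite I" and c: "0 \<le> c" and nY: "\<And>u. fs_norm Y1 u = fs_norm X1 u"
    and Tb: "\<And>i u j. i \<in> I \<Longrightarrow> u \<in> fs_carrier X1 \<Longrightarrow> (T i u)\<^sup>2 \<le> c * (2 ^ j * fs_sq X0 u + fs_sq X1 u / 2 ^ j)"
    and Td: "\<And>i u v. i \<in> I \<Longrightarrow> u \<in> fs_carrier X1 \<Longrightarrow> v \<in> fs_carrier X1 \<Longrightarrow> T i (\<lambda>p. u p - v p) = T i u - T i v"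
    and E: "\<And>i j. i \<in> I \<Longrightarrow> E i j \<in> fs_carrier X1"
      "\<And>i j. i \<in> I \<Longrightarrow> fs_sq X0 (E i j) \<le> c / 2 ^ j" "\<And>i j. i \<in> I \<Longrightarrow> fs_sq X1 (E i j) \<le> c * 2 ^ j"
    and corr: "\<And>u j. u \<in> fs_carrier X1 \<Longrightarrow> (\<lambda>p. u p - (\<Sum>i\<in>I. T i u * E i j p)) \<in> fs_carrier Y1"
    and lim: "\<And>\<phi> \<psi> S i. 1/2 < \<theta> \<Longrightarrow> \<phi> \<in> A \<Longrightarrow> dyadic_rep X0 X1 \<theta> \<phi> \<psi> S \<Longrightarrow> i \<in> I \<Longrightarrow> (\<lambda>j. T i (\<psi> j)) \<longlonglongrightarrow> 0"
  shows "interp X0 X1 \<theta> \<sqinter>\<^sub>s A \<hookrightarrow> interp X0 Y1 \<theta>"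
proof -
  define w where "w = (4::real) powr \<theta>"
  have w: "1 < w" using weight_bounds(1)[OF \<theta>(1,2)] by (simp add: w_def)
  define \<rho> where "\<rho> = w / 2"
  note \<rho> = half_weight[OF \<theta>(1,2), folded w_def \<rho>_def]
  obtain c0 where c0: "0 \<le> c0" "\<forall>u\<in>fs_carrier X1. fs_sq X0 u \<le> c0 * fs_sq X1 u"
    by (rule couple_bound[OF X])
  define H where "H = (if \<theta> < 1/2 then 2 * (1 + \<rho> * (1 + 2 * \<rho> / (1 - \<rho>))) / (1 - \<rho>) else 2 * \<rho> * (1 + 2 / (\<rho> - 1)) / (\<rho> - 1))"
  have H: "0 \<le> H" using \<rho> \<theta>(3) by (auto simp: H_def)
  \<comment> \<open>\<open>20 * c\<close> bounds the trace increments; \<open>c * (c0 + 1)\<close>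
    bounds the first trace, by the trace inequality at scale 0 and the embedding of X1 into
    X0.\<close>
  define d where "d = 20 * c + c * (c0 + 1)"
  have d: "0 \<le> d" using c c0 by (simp add: d_def)
  define M :: real where "M = 2 ^ card I"
  \<comment> \<open>The 2 keeps the original term. The correction enters both halves of the dyadic
    term with a factor 2, hence 4, and is summed over \<open>card I\<close> functionals.\<close>
  define C where "C = 2 + 4 * M * c * (real (card I) * (H * d))"
  show ?thesis
  proof (rule interp_transfer[OF X Y \<theta>(1,2), of C])
    show "0 \<le> C" using c H d by (simp add: C_def M_def)
    fix \<phi> \<psi> S assume \<phi>: "\<phi> \<in> A" and D: "dyadic_rep X0 X1 \<theta> \<phi> \<psi> S"
    note D' = dyadic_repD[OF D]
    let ?A = "dyadic_term X0 X1 \<phi> \<psi>"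
    have \<tau>: "(\<Sum>j<n. \<rho> ^ j * (T i (\<psi> j))\<^sup>2) \<le> H * (d * S)" if i: "i \<in> I" for i n
    proof -
      have diff: "(\<Sum>j<n. \<rho> ^ j * (T i (\<psi> (Suc j)) - T i (\<psi> j))\<^sup>2) \<le> d * S" for n
      proof -
        have "(\<Sum>j<n. \<rho> ^ j * (T i (\<psi> (Suc j)) - T i (\<psi> j))\<^sup>2) \<le> 20 * c * S"
          unfolding \<rho>_def w_def by (rule dyadic_trace_diff[OF X \<theta>(1,2) D c Tb[OF i] Td[OF i]])
        also have "\<dots> \<le> d * S" using c c0 D'(5) by (intro mult_right_mono) (auto simp: d_def)
        finally show ?thesis .
      qed
      show ?thesis
      proof (cases "\<theta> < 1/2")
        case True
        have "(T i (\<psi> 0))\<^sup>2 \<le> c * (2 ^ 0 * fs_sq X0 (\<psi> 0) + fs_sq X1 (\<psi> 0) / 2 ^ 0)"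
          by (rule Tb[OF i D'(1)])
        also have "\<dots> \<le> c * (c0 * fs_sq X1 (\<psi> 0) + fs_sq X1 (\<psi> 0))"
          using c0(2) D'(1)[of 0] c by (intro mult_left_mono) auto
        also have "\<dots> = c * (c0 + 1) * fs_sq X1 (\<psi> 0)" by (simp add: algebra_simps)
        also have "fs_sq X1 (\<psi> 0) \<le> ?A 0" by (simp add: dyadic_term_def)
        also have "?A 0 \<le> S" using D'(4)[of 0] by simp
        finally have "(T i (\<psi> 0))\<^sup>2 \<le> c * (c0 + 1) * S" using c c0 by (simp add: mult_left_mono)
        also have "\<dots> \<le> d * S" using c D'(5) by (intro mult_right_mono) (auto simp: d_def)
        finally show ?thesis using hardy_small[OF \<rho>(1) \<rho>(2)[OF True] diff] True by (simp add: H_def)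
      next
        case False
        then have t: "1/2 < \<theta>" using \<theta>(3) by simp
        show ?thesis using hardy_large[OF \<rho>(3)[OF t] diff lim[OF t \<phi> D i]] False by (simp add: H_def)
      qed
    qed
    define s where "s j = (\<lambda>p. \<Sum>i\<in>I. T i (\<psi> j) * E i j p)" for j
    define \<psi>' where "\<psi>' j = (\<lambda>p. \<psi> j p - s j p)" for j
    have Y1: "\<psi>' j \<in> fs_carrier Y1" for j unfolding \<psi>'_def s_def by (rule corr[OF D'(1)])
    have s1: "s j \<in> fs_carrier X1" "fs_sq X1 (s j) \<le> M * (\<Sum>i\<in>I. (T i (\<psi> j))\<^sup>2 * (c * 2 ^ j))" for j
    proof -
      note Q = quad_space_sum[where e = "\<lambda>i. E i j" and c = "\<lambda>i. T i (\<psi> j)", OF coupleD(2)[OF X] I E(1)]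
      show "s j \<in> fs_carrier X1" using Q by (simp add: s_def)
      have "fs_sq X1 (s j) \<le> M * (\<Sum>i\<in>I. (T i (\<psi> j))\<^sup>2 * fs_sq X1 (E i j))" using Q by (simp add: s_def M_def)
      also have "\<dots> \<le> M * (\<Sum>i\<in>I. (T i (\<psi> j))\<^sup>2 * (c * 2 ^ j))"
        using E(3) by (intro mult_left_mono sum_mono) (auto simp: M_def)
      finally show "fs_sq X1 (s j) \<le> M * (\<Sum>i\<in>I. (T i (\<psi> j))\<^sup>2 * (c * 2 ^ j))" .
    qed
    have s0: "s j \<in> fs_carrier X0" "fs_sq X0 (s j) \<le> M * (\<Sum>i\<in>I. (T i (\<psi> j))\<^sup>2 * (c / 2 ^ j))" for j
    proof -
      have E0: "\<And>i. i \<in> I \<Longrightarrow> E i j \<in> fs_carrier X0" by (intro coupleD(3)[OF X] E(1))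
      note Q = quad_space_sum[where e = "\<lambda>i. E i j" and c = "\<lambda>i. T i (\<psi> j)", OF coupleD(1)[OF X] I E0]
      show "s j \<in> fs_carrier X0" using Q by (simp add: s_def)
      have "fs_sq X0 (s j) \<le> M * (\<Sum>i\<in>I. (T i (\<psi> j))\<^sup>2 * fs_sq X0 (E i j))" using Q by (simp add: s_def M_def)
      also have "\<dots> \<le> M * (\<Sum>i\<in>I. (T i (\<psi> j))\<^sup>2 * (c / 2 ^ j))"
        using E(2) by (intro mult_left_mono sum_mono) (auto simp: M_def)
      finally show "fs_sq X0 (s j) \<le> M * (\<Sum>i\<in>I. (T i (\<psi> j))\<^sup>2 * (c / 2 ^ j))" .
    qed
    have eq: "(\<lambda>p. \<phi> p - \<psi>' j p) = (\<lambda>p. (\<phi> p - \<psi> j p) + s j p)" for j by (auto simp: \<psi>'_def)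
    have X0: "(\<lambda>p. \<phi> p - \<psi>' j p) \<in> fs_carrier X0" for j
      unfolding eq by (intro quad_space_add coupleD[OF X] D' s0)
    have trm: "w ^ j * dyadic_term X0 Y1 \<phi> \<psi>' j \<le> 2 * (w ^ j * ?A j) + 4 * M * c * (\<Sum>i\<in>I. \<rho> ^ j * (T i (\<psi> j))\<^sup>2)" for j
    proof -
      let ?t = "\<Sum>i\<in>I. (T i (\<psi> j))\<^sup>2"
      have aux: "x \<le> 2 * a + 2 * z \<Longrightarrow> y \<le> 2 * b + 2 * z \<Longrightarrow> x + y \<le> 2 * (a + b) + 4 * z" for x y a b z :: real
        by simp
      have "fs_sq X0 (\<lambda>p. \<phi> p - \<psi>' j p) \<le> 2 * fs_sq X0 (\<lambda>p. \<phi> p - \<psi> j p) + 2 * fs_sq X0 (s j)"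
        unfolding eq by (intro quad_space_add coupleD[OF X] D' s0)
      also have "\<dots> \<le> 2 * fs_sq X0 (\<lambda>p. \<phi> p - \<psi> j p) + 2 * (M * (?t * (c / 2 ^ j)))"
        using s0(2)[of j] by (simp add: sum_distrib_right[symmetric] sum_divide_distrib[symmetric])
      finally have a: "fs_sq X0 (\<lambda>p. \<phi> p - \<psi>' j p) \<le> 2 * fs_sq X0 (\<lambda>p. \<phi> p - \<psi> j p) + 2 * (M * (?t * (c / 2 ^ j)))" .
      have "fs_sq Y1 (\<psi>' j) \<le> 2 * fs_sq X1 (\<psi> j) + 2 * fs_sq X1 (s j)"
        unfolding nY \<psi>'_def by (intro quad_space_diff coupleD[OF X] D' s1)
      also have "\<dots> \<le> 2 * fs_sq X1 (\<psi> j) + 2 * (M * (?t * (c * 2 ^ j)))"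
        using s1(2)[of j] by (simp add: sum_distrib_right[symmetric])
      finally have "fs_sq Y1 (\<psi>' j) / 4 ^ j \<le> (2 * fs_sq X1 (\<psi> j) + 2 * (M * (?t * (c * 2 ^ j)))) / 4 ^ j"
        by (rule divide_right_mono) simp
      also have "\<dots> = 2 * (fs_sq X1 (\<psi> j) / 4 ^ j) + 2 * (M * (?t * (c / 2 ^ j)))"
      proof -
        have "(4::real) ^ j = 2 ^ j * 2 ^ j" by (simp add: power_mult_distrib[symmetric])
        then have "2 * (M * (?t * (c * 2 ^ j))) / 4 ^ j = 2 * (M * (?t * (c / 2 ^ j)))" by simp
        then show ?thesis by (simp add: add_divide_distrib)
      qed
      finally have "dyadic_term X0 Y1 \<phi> \<psi>' j \<le> 2 * ?A j + 4 * (M * (?t * (c / 2 ^ j)))"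
        using aux[OF a] by (simp only: dyadic_term_def)
      then have "w ^ j * dyadic_term X0 Y1 \<phi> \<psi>' j \<le> w ^ j * (2 * ?A j + 4 * (M * (?t * (c / 2 ^ j))))"
        using w by (intro mult_left_mono) auto
      also have "\<dots> = 2 * (w ^ j * ?A j) + 4 * M * c * (\<rho> ^ j * ?t)"
        by (simp add: \<rho>_def power_divide distrib_left mult_ac)
      finally show ?thesis by (simp add: sum_distrib_left)
    qed
    have "(\<Sum>j<n. w ^ j * dyadic_term X0 Y1 \<phi> \<psi>' j) \<le> C * S" for n
    proof -
      have "(\<Sum>j<n. w ^ j * dyadic_term X0 Y1 \<phi> \<psi>' j) \<le> (\<Sum>j<n. 2 * (w ^ j * ?A j) + 4 * M * c * (\<Sum>i\<in>I. \<rho> ^ j * (T i (\<psi> j))\<^sup>2))"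
        by (intro sum_mono trm)
      also have "\<dots> = 2 * (\<Sum>j<n. w ^ j * ?A j) + 4 * M * c * (\<Sum>i\<in>I. \<Sum>j<n. \<rho> ^ j * (T i (\<psi> j))\<^sup>2)"
        by (subst sum.swap) (simp only: sum.distrib sum_distrib_left[symmetric])
      also have "\<dots> \<le> 2 * S + 4 * M * c * (\<Sum>i\<in>I. H * (d * S))"
        using D'(3)[of n] c by (intro add_mono mult_left_mono sum_mono \<tau>) (auto simp: w_def M_def)
      also have "\<dots> = C * S" by (simp add: C_def algebra_simps)
      finally show ?thesis .
    qed
    then have "dyadic_rep X0 Y1 \<theta> \<phi> \<psi>' (C * S)" using Y1 X0 by (simp add: dyadic_rep_def w_def)
    then show "\<exists>\<psi>'. dyadic_rep X0 Y1 \<theta> \<phi> \<psi>' (C * S)" by blast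
  qed
qed

section \<open>Interpolation of the spectral scale\<close>

text \<open>A weighted sequence scale seen through coordinates: norms depend on an element only via
  \<open>c u k\<close>. Convergence of expansions enters later, when the scale is compared with
  spaces of functions. The lower bound \<mu> makes the scale decreasing.\<close>

locale eigen_scale =
  fixes V :: "('p \<Rightarrow> real) set" and c :: "('p \<Rightarrow> real) \<Rightarrow> nat \<Rightarrow> real" and K :: "nat set"
    and ev :: "nat \<Rightarrow> 'p \<Rightarrow> real" and ew :: "nat \<Rightarrow> real" and \<mu> :: real
  assumes V_lin: "\<And>u v a b. u \<in> V \<Longrightarrow> v \<in> V \<Longrightarrow> (\<lambda>p. a * u p + b * v p) \<in> V"
    and V_zero: "(\<lambda>p. 0) \<in> V"
    and ev_V: "\<And>k. k \<in> K \<Longrightarrow> ev k \<in> V"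
    and c_lin: "\<And>u v a b k. u \<in> V \<Longrightarrow> v \<in> V \<Longrightarrow> k \<in> K \<Longrightarrow> c (\<lambda>p. a * u p + b * v p) k = a * c u k + b * c v k"
    and c_ev: "\<And>j k. j \<in> K \<Longrightarrow> k \<in> K \<Longrightarrow> c (ev j) k = of_bool (j = k)"
    and mu: "0 < \<mu>" "\<And>k. k \<in> K \<Longrightarrow> \<mu> \<le> ew k"
begin

definition scale :: "real \<Rightarrow> ('p \<Rightarrow> real) function_space" where
  "scale s = \<lparr>fs_carrier = {u \<in> V. (\<lambda>k. ew k powr s * (c u k)\<^sup>2) summable_on K},
     fs_norm = (\<lambda>u. sqrt (\<Sum>\<^sub>\<infinity>k\<in>K. ew k powr s * (c u k)\<^sup>2))\<rparr>"

lemma ew_pos: "k \<in> K \<Longrightarrow> 0 < ew k"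
  using mu by (meson less_le_trans)

lemma scale_norm_sq: "fs_sq (scale s) u = (\<Sum>\<^sub>\<infinity>k\<in>K. ew k powr s * (c u k)\<^sup>2)"
  by (simp add: scale_def infsum_nonneg)

lemma scale_norm_nonneg [simp]: "0 \<le> fs_norm (scale s) u"
  by (simp add: scale_def infsum_nonneg)

lemma scaleI:
  assumes u: "u \<in> V" and b: "\<And>F. finite F \<Longrightarrow> F \<subseteq> K \<Longrightarrow> (\<Sum>k\<in>F. ew k powr s * (c u k)\<^sup>2) \<le> B"
  shows "u \<in> fs_carrier (scale s)" "fs_sq (scale s) u \<le> B"
proof -
  have s: "(\<lambda>k. ew k powr s * (c u k)\<^sup>2) summable_on K"
  proof (rule nonneg_bdd_above_summable_on)
    show "bdd_above (sum (\<lambda>k. ew k powr s * (c u k)\<^sup>2) ` {F. F \<subseteq> K \<and> finite F})"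
      by (rule bdd_aboveI[of _ B]) (use b in auto)
  qed simp
  then show "u \<in> fs_carrier (scale s)" using u by (simp add: scale_def)
  show "fs_sq (scale s) u \<le> B" unfolding scale_norm_sq by (rule infsum_le_finite_sums[OF s b])
qed

lemma scaleD:
  assumes "u \<in> fs_carrier (scale s)"
  shows "u \<in> V" "(\<lambda>k. ew k powr s * (c u k)\<^sup>2) summable_on K"
    "\<And>F. finite F \<Longrightarrow> F \<subseteq> K \<Longrightarrow> (\<Sum>k\<in>F. ew k powr s * (c u k)\<^sup>2) \<le> fs_sq (scale s) u"
proof -
  show "u \<in> V" and s: "(\<lambda>k. ew k powr s * (c u k)\<^sup>2) summable_on K" using assms by (auto simp: scale_def)
  fix F assume "finite F" "F \<subseteq> K"
  then show "(\<Sum>k\<in>F. ew k powr s * (c u k)\<^sup>2) \<le> fs_sq (scale s) u"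
    unfolding scale_norm_sq by (intro finite_sum_le_infsum s) auto
qed

lemma quad_space_scale: "quad_space (scale s)"
  unfolding quad_space_def
proof (intro conjI ballI allI)
  have "(\<Sum>k\<in>F. ew k powr s * (c (\<lambda>p. 0) k)\<^sup>2) \<le> 0" if "F \<subseteq> K" for F
  proof -
    have "c (\<lambda>p. 0) k = 0" if "k \<in> F" for k
      using c_lin[OF V_zero V_zero, of k 0 0] that \<open>F \<subseteq> K\<close> by auto
    then show ?thesis by simp
  qed
  then show "fs_carrier (scale s) \<noteq> {}" using scaleI(1)[OF V_zero, of s 0] by auto
  show "0 \<le> fs_norm (scale s) f" for f by simp
  fix f g a b assume f: "f \<in> fs_carrier (scale s)" and g: "g \<in> fs_carrier (scale s)"
  let ?u = "\<lambda>p. a * f p + b * g p"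
  let ?B = "2 * a\<^sup>2 * fs_sq (scale s) f + 2 * b\<^sup>2 * fs_sq (scale s) g"
  have u: "?u \<in> V" by (intro V_lin scaleD(1)[OF f] scaleD(1)[OF g])
  have b: "(\<Sum>k\<in>F. ew k powr s * (c ?u k)\<^sup>2) \<le> ?B" if F: "finite F" "F \<subseteq> K" for F
  proof -
    have "(\<Sum>k\<in>F. ew k powr s * (c ?u k)\<^sup>2)
      \<le> (\<Sum>k\<in>F. 2 * a\<^sup>2 * (ew k powr s * (c f k)\<^sup>2) + 2 * b\<^sup>2 * (ew k powr s * (c g k)\<^sup>2))"
    proof (rule sum_mono)
      fix k assume "k \<in> F"
      then have "c ?u k = a * c f k + b * c g k" using F by (intro c_lin scaleD(1)[OF f] scaleD(1)[OF g]) auto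
      then have "(c ?u k)\<^sup>2 \<le> 2 * (a * c f k)\<^sup>2 + 2 * (b * c g k)\<^sup>2" using two_sq_bound by simp
      then have "ew k powr s * (c ?u k)\<^sup>2 \<le> ew k powr s * (2 * (a * c f k)\<^sup>2 + 2 * (b * c g k)\<^sup>2)"
        by (intro mult_left_mono) auto
      then show "ew k powr s * (c ?u k)\<^sup>2 \<le> 2 * a\<^sup>2 * (ew k powr s * (c f k)\<^sup>2) + 2 * b\<^sup>2 * (ew k powr s * (c g k)\<^sup>2)"
        by (simp add: power_mult_distrib algebra_simps)
    qed
    also have "\<dots> = 2 * a\<^sup>2 * (\<Sum>k\<in>F. ew k powr s * (c f k)\<^sup>2) + 2 * b\<^sup>2 * (\<Sum>k\<in>F. ew k powr s * (c g k)\<^sup>2)"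
      by (simp add: sum.distrib sum_distrib_left)
    also have "\<dots> \<le> ?B" by (intro add_mono mult_left_mono scaleD(3)[OF f F] scaleD(3)[OF g F]) auto
    finally show ?thesis .
  qed
  show "?u \<in> fs_carrier (scale s)" by (rule scaleI(1)[OF u b])
  show "fs_sq (scale s) ?u \<le> ?B" by (rule scaleI(2)[OF u b])
qed

lemma scale_embeds:
  assumes "s \<le> t" shows "scale t \<hookrightarrow> scale s"
proof (rule embedsI_sq)
  fix u assume u: "u \<in> fs_carrier (scale t)"
  have b: "(\<Sum>k\<in>F. ew k powr s * (c u k)\<^sup>2) \<le> \<mu> powr (s - t) * fs_sq (scale t) u"
    if F: "finite F" "F \<subseteq> K" for F
  proof -
    have "(\<Sum>k\<in>F. ew k powr s * (c u k)\<^sup>2) \<le> (\<Sum>k\<in>F. \<mu> powr (s - t) * (ew k powr t * (c u k)\<^sup>2))"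
    proof (rule sum_mono)
      fix k assume "k \<in> F"
      then have k: "k \<in> K" using F by auto
      have "ew k powr s = ew k powr (s - t) * ew k powr t" by (simp add: powr_add[symmetric])
      also have "\<dots> \<le> \<mu> powr (s - t) * ew k powr t"
        using mu mu(2)[OF k] assms by (intro mult_right_mono powr_mono2') auto
      finally have "ew k powr s * (c u k)\<^sup>2 \<le> (\<mu> powr (s - t) * ew k powr t) * (c u k)\<^sup>2"
        by (intro mult_right_mono) auto
      then show "ew k powr s * (c u k)\<^sup>2 \<le> \<mu> powr (s - t) * (ew k powr t * (c u k)\<^sup>2)" by (simp add: mult.assoc)
    qed
    also have "\<dots> = \<mu> powr (s - t) * (\<Sum>k\<in>F. ew k powr t * (c u k)\<^sup>2)" by (simp add: sum_distrib_left)
    also have "\<dots> \<le> \<mu> powr (s - t) * fs_sq (scale t) u" by (intro mult_left_mono scaleD(3)[OF u F]) auto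
    finally show ?thesis .
  qed
  show "u \<in> fs_carrier (scale s)" by (rule scaleI(1)[OF scaleD(1)[OF u] b])
  show "fs_sq (scale s) u \<le> \<mu> powr (s - t) * fs_sq (scale t) u" by (rule scaleI(2)[OF scaleD(1)[OF u] b])
qed simp

lemma couple_scale: "s \<le> t \<Longrightarrow> couple (scale s) (scale t)"
  by (simp add: couple_def quad_space_scale scale_embeds)

lemma finite_combination:
  assumes "finite F" "F \<subseteq> K"
  shows "(\<lambda>p. \<Sum>k\<in>F. b k * ev k p) \<in> V"
    "j \<in> K \<Longrightarrow> c (\<lambda>p. \<Sum>k\<in>F. b k * ev k p) j = (if j \<in> F then b j else 0)"
proof -
  have "(\<lambda>p. \<Sum>k\<in>F. b k * ev k p) \<in> V \<and> (\<forall>j\<in>K. c (\<lambda>p. \<Sum>k\<in>F. b k * ev k p) j = (if j \<in> F then b j else 0))"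
    using assms
  proof (induction F)
    case empty
    have "c (\<lambda>p. 0) j = 0" if "j \<in> K" for j using c_lin[OF V_zero V_zero that, of 0 0] by simp
    then show ?case using V_zero by simp
  next
    case (insert i F)
    let ?s = "\<lambda>p. \<Sum>k\<in>F. b k * ev k p"
    have eq: "(\<lambda>p. \<Sum>k\<in>insert i F. b k * ev k p) = (\<lambda>p. b i * ev i p + 1 * ?s p)" using insert by simp
    have s: "?s \<in> V" "\<And>j. j \<in> K \<Longrightarrow> c ?s j = (if j \<in> F then b j else 0)" and i: "i \<in> K" using insert by auto
    have "c (\<lambda>p. b i * ev i p + 1 * ?s p) j = (if j \<in> insert i F then b j else 0)" if j: "j \<in> K" for j
      using c_lin[OF ev_V[OF i] s(1) j, of "b i" 1] s(2)[OF j] c_ev[OF i j] insert(2) by auto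
    then show ?case unfolding eq using V_lin[OF ev_V[OF i] s(1), of "b i" 1] by simp
  qed
  then show "(\<lambda>p. \<Sum>k\<in>F. b k * ev k p) \<in> V"
    "j \<in> K \<Longrightarrow> c (\<lambda>p. \<Sum>k\<in>F. b k * ev k p) j = (if j \<in> F then b j else 0)" by auto
qed

lemma finite_combination_in_scale:
  assumes F: "finite F" "F \<subseteq> K"
  shows "(\<lambda>p. \<Sum>k\<in>F. b k * ev k p) \<in> fs_carrier (scale s)"
proof (rule scaleI(1)[OF finite_combination(1)[OF F]])
  fix F' assume F': "finite F'" "F' \<subseteq> K"
  have "(\<Sum>k\<in>F'. ew k powr s * (c (\<lambda>p. \<Sum>k\<in>F. b k * ev k p) k)\<^sup>2) = (\<Sum>k\<in>F'. if k \<in> F then ew k powr s * (b k)\<^sup>2 else 0)"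
    using F' by (intro sum.cong) (auto simp: finite_combination(2)[OF F])
  also have "\<dots> = (\<Sum>k\<in>F' \<inter> F. ew k powr s * (b k)\<^sup>2)" using F'(1) by (simp add: sum.inter_restrict)
  also have "\<dots> \<le> (\<Sum>k\<in>F. ew k powr s * (b k)\<^sup>2)" using F by (intro sum_mono2) auto
  finally show "(\<Sum>k\<in>F'. ew k powr s * (c (\<lambda>p. \<Sum>k\<in>F. b k * ev k p) k)\<^sup>2) \<le> (\<Sum>k\<in>F. ew k powr s * (b k)\<^sup>2)" .
qed

end

text \<open>A growing geometric sum is dominated by its last term, here the largest power of 4 below
  x.\<close>

lemma weight_sum_below:
  fixes x \<theta> :: real
  assumes \<theta>: "0 < \<theta>" "\<theta> < 1" and x: "0 < x"
  shows "(\<Sum>j<n. (4 powr \<theta>) ^ j * of_bool (4 ^ j < x)) \<le> 4 powr \<theta> / (4 powr \<theta> - 1) * x powr \<theta>"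
proof (induction n)
  case 0
  have "0 \<le> 4 powr \<theta> / (4 powr \<theta> - 1)" using weight_bounds(1)[OF \<theta>] by simp
  from mult_nonneg_nonneg[OF this powr_ge_zero[of x \<theta>]] show ?case by simp
next
  case (Suc n)
  define w where "w = (4::real) powr \<theta>"
  have w: "1 < w" using weight_bounds(1)[OF \<theta>] by (simp add: w_def)
  show ?case
  proof (cases "(4::real) ^ n < x")
    case True
    have "(\<Sum>j<Suc n. w ^ j * of_bool (4 ^ j < x)) \<le> (\<Sum>j<Suc n. w ^ j)" using w by (intro sum_mono) auto
    also have "\<dots> = (w ^ Suc n - 1) / (w - 1)" using w by (subst geometric_sum) auto
    also have "\<dots> \<le> w ^ Suc n / (w - 1)" using w by (intro divide_right_mono) auto
    also have "\<dots> = w / (w - 1) * w ^ n" by simp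
    also have "w ^ n = (4 ^ n) powr \<theta>"
      by (simp add: w_def powr_realpow[symmetric] powr_powr mult.commute)
    also have "w / (w - 1) * (4 ^ n) powr \<theta> \<le> w / (w - 1) * x powr \<theta>"
      using True \<theta> w by (intro mult_left_mono powr_mono2) auto
    finally show ?thesis by (simp add: w_def)
  next
    case False
    then show ?thesis using Suc by simp
  qed
qed

text \<open>A decaying geometric sum, of ratio \<open>4 powr \<theta> / 4\<close>, is dominated by
  its first term, attained at the least j with x \<le> 4^j.\<close>

lemma weight_sum_above:
  fixes x \<theta> :: real
  assumes \<theta>: "0 < \<theta>" "\<theta> < 1" and x: "0 < x"
  shows "(\<Sum>j<n. (4 powr \<theta>) ^ j * (x / 4 ^ j * of_bool (x \<le> 4 ^ j))) \<le> 1 / (1 - 4 powr \<theta> / 4) * x powr \<theta>"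
proof (cases "\<exists>j. x \<le> 4 ^ j")
  case False
  then show ?thesis using weight_bounds[OF \<theta>] by simp
next
  case True
  define w where "w = (4::real) powr \<theta> / 4"
  have w: "0 < w" "w < 1" using weight_bounds[OF \<theta>] by (auto simp: w_def)
  define i where "i = (LEAST j. x \<le> 4 ^ j)"
  have i: "x \<le> 4 ^ i" unfolding i_def using True by (rule LeastI_ex)
  have lt: "\<not> x \<le> 4 ^ j" if "j < i" for j using not_less_Least that unfolding i_def by blast
  have "(\<Sum>j<n. (4 powr \<theta>) ^ j * (x / 4 ^ j * of_bool (x \<le> 4 ^ j))) = (\<Sum>j<n. x * (w ^ j * of_bool (x \<le> 4 ^ j)))"
    by (rule sum.cong[OF refl]) (simp add: w_def power_divide)
  also have "\<dots> = x * (\<Sum>j<n. w ^ j * of_bool (x \<le> 4 ^ j))" by (rule sum_distrib_left[symmetric])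
  also have "(\<Sum>j<n. w ^ j * of_bool (x \<le> 4 ^ j)) \<le> (\<Sum>j\<in>{i..<i+n}. w ^ j)"
  proof -
    have "(\<Sum>j<n. w ^ j * of_bool (x \<le> 4 ^ j)) = (\<Sum>j\<in>{j\<in>{..<n}. x \<le> 4 ^ j}. w ^ j)"
      by (simp add: sum.inter_filter[symmetric] of_bool_def if_distrib cong: if_cong)
    also have "\<dots> \<le> (\<Sum>j\<in>{i..<i+n}. w ^ j)"
      using w lt by (intro sum_mono2) (auto simp: not_less[symmetric])
    finally show ?thesis .
  qed
  also have "(\<Sum>j\<in>{i..<i+n}. w ^ j) = w ^ i * (\<Sum>j<n. w ^ j)"
    by (simp add: sum.atLeastLessThan_shift_0[of _ i] sum_distrib_left power_add atLeast0LessThan)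
  also have "w ^ i * (\<Sum>j<n. w ^ j) \<le> w ^ i * (1 / (1 - w))"
    using w by (intro mult_left_mono geometric_sum_le) auto
  finally have "(\<Sum>j<n. (4 powr \<theta>) ^ j * (x / 4 ^ j * of_bool (x \<le> 4 ^ j))) \<le> x * (w ^ i * (1 / (1 - w)))"
    using x by (simp add: mult_left_mono)
  also have "\<dots> \<le> x * (x powr (\<theta> - 1) * (1 / (1 - w)))"
  proof (intro mult_left_mono mult_right_mono)
    have "w = 4 powr (\<theta> - 1)" by (simp add: w_def powr_diff)
    then have "w ^ i = (4 ^ i) powr (\<theta> - 1)" by (simp add: powr_realpow[symmetric] powr_powr mult.commute)
    also have "\<dots> \<le> x powr (\<theta> - 1)" using i x \<theta> by (intro powr_mono2') auto
    finally show "w ^ i \<le> x powr (\<theta> - 1)" .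
  qed (use x w in auto)
  also have "x * (x powr (\<theta> - 1) * (1 / (1 - w))) = 1 / (1 - w) * x powr \<theta>"
    using x by (simp add: powr_diff)
  finally show ?thesis by (simp add: w_def)
qed

lemma sum_infsum:
  fixes f :: "nat \<Rightarrow> 'a \<Rightarrow> real"
  assumes "\<And>j. j < n \<Longrightarrow> f j summable_on K"
  shows "(\<lambda>k. \<Sum>j<n. w j * f j k) summable_on K \<and> (\<Sum>j<n. w j * infsum (f j) K) = infsum (\<lambda>k. \<Sum>j<n. w j * f j k) K"
  using assms
proof (induction n)
  case (Suc n)
  then have IH: "(\<lambda>k. \<Sum>j<n. w j * f j k) summable_on K" "(\<Sum>j<n. w j * infsum (f j) K) = infsum (\<lambda>k. \<Sum>j<n. w j * f j k) K"
    and fn: "f n summable_on K" by auto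
  have wf: "(\<lambda>k. w n * f n k) summable_on K" by (rule summable_on_cmult_right[OF fn])
  show ?case
    using summable_on_add[OF IH(1) wf] infsum_add[OF IH(1) wf] IH(2) by (simp add: infsum_cmult_right')
qed simp

text \<open>Spectral cutoffs are replaced by finite combinations of eigenfunctions up to a
  prescribed error, which keeps them in V even if infinitely many weights lie below the
  cutoff.\<close>

lemma summable_tail:
  fixes g :: "'a \<Rightarrow> real"
  assumes s: "g summable_on R" and n: "\<And>k. k \<in> R \<Longrightarrow> 0 \<le> g k" and e: "0 < e"
  shows "\<exists>F. finite F \<and> F \<subseteq> R \<and> (\<forall>F'. finite F' \<longrightarrow> F' \<subseteq> R - F \<longrightarrow> sum g F' \<le> e)"
proof -
  have "\<exists>F. finite F \<and> F \<subseteq> R \<and> infsum g R - e < sum g F"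
  proof (rule ccontr)
    assume no: "\<not> ?thesis"
    have "sum g F \<le> infsum g R - e" if "finite F" "F \<subseteq> R" for F using no that by (meson not_less)
    from infsum_le_finite_sums[OF s this] show False using e by simp
  qed
  then obtain F where F: "finite F" "F \<subseteq> R" "infsum g R - e < sum g F" by auto
  have "sum g F' \<le> e" if F': "finite F'" "F' \<subseteq> R - F" for F'
  proof -
    have "sum g F + sum g F' = sum g (F \<union> F')" using F F' by (intro sum.union_disjoint[symmetric]) auto
    also have "\<dots> \<le> infsum g R" using F F' n by (intro finite_sum_le_infsum s) auto
    finally show ?thesis using F(3) by linarith
  qed
  then show ?thesis using F(1,2) by blast
qed

context eigen_scale
begin

text \<open>Approximation by spectral cutoff at the level 4^j, where the weights of the two spaces
  balance against t^2 = 4^-j. For one coefficient the sum over j splits at 4^j = ew k, and either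
  part is of order \<open>ew k powr \<theta>\<close>.\<close>

lemma scale_embeds_interp:
  assumes \<theta>: "0 < \<theta>" "\<theta> < 1"
  shows "scale (s + \<theta>) \<hookrightarrow> interp (scale s) (scale (s + 1)) \<theta>"
proof -
  define w where "w = (4::real) powr \<theta>"
  have w: "1 < w" "w < 4" using weight_bounds[OF \<theta>] by (simp_all add: w_def)
  define C1 where "C1 = w / (w - 1)"
  define C2 where "C2 = 1 / (1 - w / 4)"
  have C: "0 \<le> C1" "0 \<le> C2" using w by (auto simp: C1_def C2_def)
  show ?thesis
  proof (rule embeds_interp[OF couple_scale \<theta>, of s "s + 1" "C1 + C2 + 2"])
    show "s \<le> s + 1" "0 \<le> C1 + C2 + 2" using C by auto
    show "0 \<le> fs_norm (scale (s + \<theta>)) u" for u by simp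
    fix \<phi> S assume \<phi>: "\<phi> \<in> fs_carrier (scale (s + \<theta>))" and S: "fs_sq (scale (s + \<theta>)) \<phi> < S"
    define N where "N = fs_sq (scale (s + \<theta>)) \<phi>"
    have N0: "0 \<le> N" "0 < S - N" using S by (auto simp: N_def)
    have \<phi>V: "\<phi> \<in> V" by (rule scaleD(1)[OF \<phi>])
    have \<phi>s: "\<phi> \<in> fs_carrier (scale s)" using scale_embeds[of s "s + \<theta>"] \<phi> \<theta> by (auto simp: embeds_def)
    let ?g = "\<lambda>k. ew k powr s * (c \<phi> k)\<^sup>2"
    let ?R = "\<lambda>j. {k \<in> K. ew k \<le> 4 ^ j}"
    \<comment> \<open>The truncation errors, weighted by \<open>w ^ j\<close>, add up to at most 2
      (S - N), the slack in the strict inequality for S.\<close>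
    define e where "e j = (S - N) / (w ^ j * 2 ^ j)" for j :: nat
    have e: "0 < e j" for j using N0 w by (simp add: e_def)
    have "\<exists>F. finite F \<and> F \<subseteq> ?R j \<and> (\<forall>F'. finite F' \<longrightarrow> F' \<subseteq> ?R j - F \<longrightarrow> sum ?g F' \<le> e j)" for j
      by (rule summable_tail[OF summable_on_subset_banach[OF scaleD(2)[OF \<phi>s]] _ e]) auto
    then have "\<forall>j. \<exists>F. finite F \<and> F \<subseteq> ?R j \<and> (\<forall>F'. finite F' \<longrightarrow> F' \<subseteq> ?R j - F \<longrightarrow> sum ?g F' \<le> e j)" ..
    from choice[OF this] obtain F where
      "\<forall>j. finite (F j) \<and> F j \<subseteq> ?R j \<and> (\<forall>F'. finite F' \<longrightarrow> F' \<subseteq> ?R j - F j \<longrightarrow> sum ?g F' \<le> e j)" ..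
    then have F: "finite (F j)" "F j \<subseteq> ?R j" "\<And>F'. finite F' \<Longrightarrow> F' \<subseteq> ?R j - F j \<Longrightarrow> sum ?g F' \<le> e j" for j
      by blast+
    have FK: "F j \<subseteq> K" for j using F(2) by auto
    define \<psi> where "\<psi> j = (\<lambda>p. \<Sum>k\<in>F j. c \<phi> k * ev k p)" for j
    have \<psi>V: "\<psi> j \<in> V" unfolding \<psi>_def by (rule finite_combination(1)[OF F(1) FK])
    have \<psi>1: "\<psi> j \<in> fs_carrier (scale t)" for j t
      unfolding \<psi>_def by (rule finite_combination_in_scale[OF F(1) FK])
    have \<psi>c: "c (\<psi> j) k = (if k \<in> F j then c \<phi> k else 0)" if "k \<in> K" for j k
      unfolding \<psi>_def by (rule finite_combination(2)[OF F(1) FK that])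
    have \<phi>\<psi>: "(\<lambda>p. \<phi> p - \<psi> j p) \<in> fs_carrier (scale s)" for j
      by (rule quad_space_diff(1)[OF quad_space_scale \<phi>s \<psi>1])
    have \<phi>\<psi>c: "c (\<lambda>p. \<phi> p - \<psi> j p) k = (if k \<in> F j then 0 else c \<phi> k)" if "k \<in> K" for j k
      using c_lin[OF \<phi>V scaleD(1)[OF \<psi>1] that, of 1 "-1" j] \<psi>c[OF that, of j] by simp
    define f where "f j k = ew k powr s * (c (\<lambda>p. \<phi> p - \<psi> j p) k)\<^sup>2 + (1 / 4 ^ j) * (ew k powr (s + 1) * (c (\<psi> j) k)\<^sup>2)" for j k
    have fs: "f j summable_on K" for j
      unfolding f_def[abs_def] by (intro summable_on_add summable_on_cmult_right scaleD(2)[OF \<phi>\<psi>] scaleD(2)[OF \<psi>1])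
    have A: "dyadic_term (scale s) (scale (s + 1)) \<phi> \<psi> j = infsum (f j) K" for j
    proof -
      have "infsum (f j) K = (\<Sum>\<^sub>\<infinity>k\<in>K. ew k powr s * (c (\<lambda>p. \<phi> p - \<psi> j p) k)\<^sup>2)
          + (\<Sum>\<^sub>\<infinity>k\<in>K. (1 / 4 ^ j) * (ew k powr (s + 1) * (c (\<psi> j) k)\<^sup>2))"
        unfolding f_def[abs_def]
        by (rule infsum_add[OF scaleD(2)[OF \<phi>\<psi>] summable_on_cmult_right[OF scaleD(2)[OF \<psi>1]]])
      then show ?thesis unfolding dyadic_term_def scale_norm_sq infsum_cmult_right' by simp
    qed
    \<comment> \<open>The three summands: a frequency above the cutoff is lost entirely, one below
      it is charged to the second space, and one below it but outside the finite set
      \<open>F j\<close> is a truncation error.\<close>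
    have ptw: "f j k \<le> ?g k * of_bool (4 ^ j < ew k) + ?g k * (ew k / 4 ^ j * of_bool (ew k \<le> 4 ^ j)) + ?g k * of_bool (ew k \<le> 4 ^ j \<and> k \<notin> F j)"
      if k: "k \<in> K" for j k
    proof -
      have p: "ew k powr (s + 1) = ew k powr s * ew k" using ew_pos[OF k] by (simp add: powr_add)
      show ?thesis
      proof (cases "k \<in> F j")
        case True
        then have le: "ew k \<le> 4 ^ j" using F(2) by auto
        show ?thesis using True le by (simp add: f_def \<phi>\<psi>c[OF k] \<psi>c[OF k] p mult_ac)
      next
        case False
        have "0 \<le> ?g k * (ew k / 4 ^ j * of_bool (ew k \<le> 4 ^ j))" using ew_pos[OF k] by simp
        then show ?thesis using False by (cases "ew k \<le> 4 ^ j") (auto simp: f_def \<phi>\<psi>c[OF k] \<psi>c[OF k])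
      qed
    qed
    have "(\<Sum>j<n. w ^ j * dyadic_term (scale s) (scale (s + 1)) \<phi> \<psi> j) \<le> (C1 + C2 + 2) * S" for n
    proof -
      have "(\<Sum>j<n. w ^ j * dyadic_term (scale s) (scale (s + 1)) \<phi> \<psi> j) = infsum (\<lambda>k. \<Sum>j<n. w ^ j * f j k) K"
        unfolding A using sum_infsum[of n f K "\<lambda>j. w ^ j"] fs by simp
      also have "\<dots> \<le> (C1 + C2) * N + 2 * (S - N)"
      proof (rule infsum_le_finite_sums)
        show "(\<lambda>k. \<Sum>j<n. w ^ j * f j k) summable_on K" using sum_infsum[of n f K "\<lambda>j. w ^ j"] fs by simp
        fix H assume H: "finite H" "H \<subseteq> K"
        have "(\<Sum>k\<in>H. \<Sum>j<n. w ^ j * f j k) \<le> (\<Sum>k\<in>H. (C1 + C2) * (ew k powr (s + \<theta>) * (c \<phi> k)\<^sup>2)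
            + (\<Sum>j<n. w ^ j * (?g k * of_bool (ew k \<le> 4 ^ j \<and> k \<notin> F j))))"
        proof (rule sum_mono)
          fix k assume "k \<in> H"
          then have k: "k \<in> K" using H by auto
          have "(\<Sum>j<n. w ^ j * f j k) \<le> (\<Sum>j<n. w ^ j * (?g k * of_bool (4 ^ j < ew k) + ?g k * (ew k / 4 ^ j * of_bool (ew k \<le> 4 ^ j)) + ?g k * of_bool (ew k \<le> 4 ^ j \<and> k \<notin> F j)))"
            using w by (intro sum_mono mult_left_mono ptw k) auto
          also have "\<dots> = ?g k * (\<Sum>j<n. w ^ j * of_bool (4 ^ j < ew k)) + ?g k * (\<Sum>j<n. w ^ j * (ew k / 4 ^ j * of_bool (ew k \<le> 4 ^ j)))
             + (\<Sum>j<n. w ^ j * (?g k * of_bool (ew k \<le> 4 ^ j \<and> k \<notin> F j)))"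
            unfolding sum_distrib_left sum.distrib[symmetric] by (intro sum.cong) (auto simp: distrib_left mult_ac)
          also have "\<dots> \<le> ?g k * (C1 * ew k powr \<theta>) + ?g k * (C2 * ew k powr \<theta>)
             + (\<Sum>j<n. w ^ j * (?g k * of_bool (ew k \<le> 4 ^ j \<and> k \<notin> F j)))"
            using weight_sum_below[OF \<theta> ew_pos[OF k], of n] weight_sum_above[OF \<theta> ew_pos[OF k], of n]
            by (intro add_mono mult_left_mono order_refl) (auto simp: w_def C1_def C2_def)
          also have "?g k * (C1 * ew k powr \<theta>) + ?g k * (C2 * ew k powr \<theta>) = (C1 + C2) * (ew k powr (s + \<theta>) * (c \<phi> k)\<^sup>2)"
            by (simp add: powr_add algebra_simps)
          finally show "(\<Sum>j<n. w ^ j * f j k) \<le> (C1 + C2) * (ew k powr (s + \<theta>) * (c \<phi> k)\<^sup>2)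
            + (\<Sum>j<n. w ^ j * (?g k * of_bool (ew k \<le> 4 ^ j \<and> k \<notin> F j)))" .
        qed
        also have "\<dots> = (C1 + C2) * (\<Sum>k\<in>H. ew k powr (s + \<theta>) * (c \<phi> k)\<^sup>2)
            + (\<Sum>j<n. w ^ j * (\<Sum>k\<in>H. ?g k * of_bool (ew k \<le> 4 ^ j \<and> k \<notin> F j)))"
          unfolding sum.distrib sum_distrib_left by (subst (2) sum.swap) simp
        also have "\<dots> \<le> (C1 + C2) * N + (\<Sum>j<n. w ^ j * e j)"
        proof (intro add_mono mult_left_mono sum_mono)
          show "(\<Sum>k\<in>H. ew k powr (s + \<theta>) * (c \<phi> k)\<^sup>2) \<le> N" unfolding N_def by (rule scaleD(3)[OF \<phi> H])
          fix j
          have "(\<Sum>k\<in>H. ?g k * of_bool (ew k \<le> 4 ^ j \<and> k \<notin> F j)) = sum ?g {k\<in>H. ew k \<le> 4 ^ j \<and> k \<notin> F j}"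
            using H(1) by (simp add: sum.inter_filter[symmetric] of_bool_def if_distrib cong: if_cong)
          also have "\<dots> \<le> e j" using H by (intro F(3)) auto
          finally show "(\<Sum>k\<in>H. ?g k * of_bool (ew k \<le> 4 ^ j \<and> k \<notin> F j)) \<le> e j" .
        qed (use C w in auto)
        also have "(\<Sum>j<n. w ^ j * e j) = (S - N) * (\<Sum>j<n. (1/2) ^ j)"
          using w by (simp add: e_def sum_distrib_left power_one_over)
        also have "(S - N) * (\<Sum>j<n. (1/2) ^ j) \<le> (S - N) * 2"
          using geometric_sum_le[of "1/2" n] N0 by (intro mult_left_mono) auto
        finally show "(\<Sum>k\<in>H. \<Sum>j<n. w ^ j * f j k) \<le> (C1 + C2) * N + 2 * (S - N)" by simp
      qed
      also have "\<dots> \<le> (C1 + C2) * S + 2 * S" using C N0 by (intro add_mono mult_left_mono) auto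
      finally show ?thesis by (simp add: algebra_simps)
    qed
    then have "dyadic_rep (scale s) (scale (s + 1)) \<theta> \<phi> \<psi> ((C1 + C2 + 2) * S)"
      using \<psi>1 \<phi>\<psi> by (simp add: dyadic_rep_def w_def)
    then show "\<exists>\<psi>. dyadic_rep (scale s) (scale (s + 1)) \<theta> \<phi> \<psi> ((C1 + C2 + 2) * S)" by blast
  qed
qed

text \<open>For each k a single index suffices: at the scale with 4^j comparable to
  \<open>ew k\<close>, both halves of the dyadic term carry a weight comparable to that of the
  intermediate space.\<close>

lemma interp_embeds_scale:
  assumes \<theta>: "0 < \<theta>" "\<theta> < 1"
  shows "interp (scale s) (scale (s + 1)) \<theta> \<hookrightarrow> scale (s + \<theta>)"
proof -
  define w where "w = (4::real) powr \<theta>"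
  have w: "1 < w" "w < 4" using weight_bounds[OF \<theta>] by (simp_all add: w_def)
  define D where "D = max w (max 1 (\<mu> powr (\<theta> - 1)))"
  have D: "w \<le> D" "1 \<le> D" "\<mu> powr (\<theta> - 1) \<le> D" "0 \<le> D" using w by (auto simp: D_def)
  have "interp (scale s) (scale (s + 1)) \<theta> \<sqinter>\<^sub>s UNIV \<hookrightarrow> scale (s + \<theta>)"
  proof (rule interp_embeds[OF couple_scale \<theta>, of s "s + 1" "2 * D"])
    show "s \<le> s + 1" "0 \<le> 2 * D" using D by auto
    fix \<phi> \<psi> S assume R: "dyadic_rep (scale s) (scale (s + 1)) \<theta> \<phi> \<psi> S"
    note R' = dyadic_repD[OF R]
    have dV: "(\<lambda>p. \<phi> p - \<psi> j p) \<in> V" and \<psi>V: "\<psi> j \<in> V" for j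
      using scaleD(1)[OF R'(2)] scaleD(1)[OF R'(1)] by auto
    have "(\<lambda>p. 1 * (\<phi> p - \<psi> 0 p) + 1 * \<psi> 0 p) \<in> V" by (intro V_lin dV \<psi>V)
    then have \<phi>V: "\<phi> \<in> V" by simp
    have cs: "(c \<phi> k)\<^sup>2 \<le> 2 * (c (\<lambda>p. \<phi> p - \<psi> j p) k)\<^sup>2 + 2 * (c (\<psi> j) k)\<^sup>2" if "k \<in> K" for j k
    proof -
      have "c \<phi> k = c (\<lambda>p. \<phi> p - \<psi> j p) k + c (\<psi> j) k" using c_lin[OF dV[of j] \<psi>V[of j] that, where a = 1 and b = 1] by simp
      then show ?thesis using two_sq_bound by simp
    qed
    define f where "f j k = ew k powr s * (c (\<lambda>p. \<phi> p - \<psi> j p) k)\<^sup>2 + ew k powr (s + 1) * (c (\<psi> j) k)\<^sup>2 / 4 ^ j" for j k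
    have f0: "0 \<le> f j k" for j k by (simp add: f_def)
    \<comment> \<open>With the successor in the exponent, \<open>ew k\<close> lies between 4^J and
      4^(J+1), except that there is no lower estimate when J = 0.\<close>
    define J where "J k = (LEAST j. ew k \<le> 4 ^ Suc j)" for k
    have key: "ew k powr (s + \<theta>) * (c \<phi> k)\<^sup>2 \<le> 2 * D * (w ^ J k * f (J k) k)" if k: "k \<in> K" for k
    proof -
      let ?j = "J k" and ?x = "ew k"
      note x = ew_pos[OF k]
      have ex: "\<exists>j. ?x \<le> 4 ^ Suc j"
      proof -
        obtain n where "?x < 4 ^ n" using real_arch_pow[of 4 ?x] by auto
        moreover have "(4::real) ^ n \<le> 4 ^ Suc n" by simp
        ultimately have "?x \<le> 4 ^ Suc n" by linarith
        then show ?thesis ..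
      qed
      have up: "?x \<le> 4 ^ Suc ?j" unfolding J_def by (rule LeastI_ex[OF ex])
      have "?x powr \<theta> \<le> (4 ^ Suc ?j) powr \<theta>" using up x \<theta> by (intro powr_mono2) auto
      also have "\<dots> = w ^ Suc ?j"
      proof -
        have "((4::real) ^ i) powr \<theta> = w ^ i" for i by (simp add: w_def powr_realpow[symmetric] powr_powr mult.commute)
        then show ?thesis .
      qed
      also have "\<dots> \<le> D * w ^ ?j" using D w by (simp add: mult_right_mono)
      finally have a: "?x powr \<theta> \<le> D * w ^ ?j" .
      have b: "?x powr (\<theta> - 1) \<le> D * (w ^ ?j / 4 ^ ?j)"
      proof (cases ?j)
        case 0
        \<comment> \<open>Here leastness gives no lower bound, and the bound \<mu> on the
          eigenvalues takes its place; hence its appearance in \<open>D\<close>.\<close>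
        have "?x powr (\<theta> - 1) \<le> \<mu> powr (\<theta> - 1)" using mu(1) mu(2)[OF k] \<theta> by (intro powr_mono2') auto
        then show ?thesis using 0 D by simp
      next
        case (Suc i)
        then have "\<not> ?x \<le> 4 ^ Suc i" using not_less_Least[of i "\<lambda>j. ?x \<le> 4 ^ Suc j"] by (simp add: J_def)
        then have lo: "4 ^ ?j \<le> ?x" using Suc by simp
        have "?x powr (\<theta> - 1) \<le> (4 ^ ?j) powr (\<theta> - 1)" using lo \<theta> by (intro powr_mono2') auto
        also have "\<dots> = w ^ ?j / 4 ^ ?j"
        proof -
          have e: "((4::real) ^ i) powr (\<theta> - 1) = (4 powr (\<theta> - 1)) ^ i" for i
            by (simp add: powr_realpow[symmetric] powr_powr mult.commute)
          have q: "(4::real) powr (\<theta> - 1) = w / 4" by (simp add: w_def powr_diff)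
          show ?thesis unfolding e q by (simp add: power_divide)
        qed
        also have "\<dots> \<le> D * (w ^ ?j / 4 ^ ?j)" using mult_right_mono[OF D(2), of "w ^ ?j / 4 ^ ?j"] w by simp
        finally show ?thesis .
      qed
      have "?x powr (s + \<theta>) * (c \<phi> k)\<^sup>2 \<le> ?x powr (s + \<theta>) * (2 * (c (\<lambda>p. \<phi> p - \<psi> ?j p) k)\<^sup>2 + 2 * (c (\<psi> ?j) k)\<^sup>2)"
        by (intro mult_left_mono cs k) auto
      also have "\<dots> = 2 * (?x powr \<theta> * (?x powr s * (c (\<lambda>p. \<phi> p - \<psi> ?j p) k)\<^sup>2)) + 2 * (?x powr (\<theta> - 1) * (?x powr (s + 1) * (c (\<psi> ?j) k)\<^sup>2))"
      proof -
        have "?x powr (s + \<theta>) = ?x powr \<theta> * ?x powr s" by (simp add: powr_add)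
        moreover have "?x powr (s + \<theta>) = ?x powr (\<theta> - 1) * ?x powr (s + 1)" by (simp add: powr_add[symmetric] add.commute)
        ultimately show ?thesis by (simp add: distrib_left mult_ac)
      qed
      also have "\<dots> \<le> 2 * ((D * w ^ ?j) * (?x powr s * (c (\<lambda>p. \<phi> p - \<psi> ?j p) k)\<^sup>2)) + 2 * ((D * (w ^ ?j / 4 ^ ?j)) * (?x powr (s + 1) * (c (\<psi> ?j) k)\<^sup>2))"
        by (intro add_mono mult_left_mono mult_right_mono a b) auto
      also have "\<dots> = 2 * D * (w ^ ?j * f ?j k)" by (simp add: f_def algebra_simps)
      finally show ?thesis .
    qed
    have bnd: "(\<Sum>k\<in>F. ew k powr (s + \<theta>) * (c \<phi> k)\<^sup>2) \<le> 2 * D * S" if F: "finite F" "F \<subseteq> K" for F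
    proof -
      define n where "n = Suc (Max (J ` F))"
      have Jn: "J k < n" if "k \<in> F" for k using F that by (simp add: n_def le_imp_less_Suc)
      have "(\<Sum>k\<in>F. ew k powr (s + \<theta>) * (c \<phi> k)\<^sup>2) \<le> (\<Sum>k\<in>F. 2 * D * (w ^ J k * f (J k) k))"
        using F by (intro sum_mono key) auto
      also have "\<dots> \<le> (\<Sum>k\<in>F. 2 * D * (\<Sum>j<n. w ^ j * f j k))"
      proof (intro sum_mono mult_left_mono)
        fix k assume "k \<in> F"
        then show "w ^ J k * f (J k) k \<le> (\<Sum>j<n. w ^ j * f j k)"
          using Jn w f0 by (intro member_le_sum[of "J k" "{..<n}" "\<lambda>j. w ^ j * f j k"]) auto
      qed (use D in auto)
      also have "\<dots> = 2 * D * (\<Sum>j<n. w ^ j * (\<Sum>k\<in>F. f j k))"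
        unfolding sum_distrib_left by (rule sum.swap)
      also have "\<dots> \<le> 2 * D * (\<Sum>j<n. w ^ j * dyadic_term (scale s) (scale (s + 1)) \<phi> \<psi> j)"
      proof (intro mult_left_mono sum_mono)
        fix j
        show "(\<Sum>k\<in>F. f j k) \<le> dyadic_term (scale s) (scale (s + 1)) \<phi> \<psi> j"
          unfolding f_def dyadic_term_def sum.distrib sum_divide_distrib[symmetric]
          by (intro add_mono divide_right_mono scaleD(3)[OF R'(2) F] scaleD(3)[OF R'(1) F]) auto
      qed (use w D in auto)
      also have "\<dots> \<le> 2 * D * S" using R'(3)[of n] D by (intro mult_left_mono) (auto simp: w_def)
      finally show ?thesis .
    qed
    show "\<phi> \<in> fs_carrier (scale (s + \<theta>)) \<and> fs_sq (scale (s + \<theta>)) \<phi> \<le> 2 * D * S"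
      using scaleI[OF \<phi>V bnd] by auto
  qed
  then show ?thesis by simp
qed

end

text \<open>Otherwise \<open>Htilde_int G 1\<close> is rewritten to \<open>Htilde_int G (Suc 0)\<close>.\<close>
declare One_nat_def [simp del]

section \<open>Topology of a compact metric graph\<close>

locale compact_graph =
  fixes G :: "('v, 'e) metric_graph"
  assumes cpt: "compact_metric_graph G" and conn: "connected_graph G"
begin

abbreviation "ep \<equiv> edge_point G"

lemma fin_E: "finite (edges G)" and fin_V: "finite (verts G)"
  using cpt by (auto simp: compact_metric_graph_def)

lemma edgeD: "e \<in> edges G \<Longrightarrow> 0 < len G e" "e \<in> edges G \<Longrightarrow> src G e \<in> verts G" "e \<in> edges G \<Longrightarrow> tgt G e \<in> verts G"
  using cpt by (auto simp: compact_metric_graph_def)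

text \<open>Paths shorter than this cannot cross a whole edge. The inserted 1 gives a value for
  graphs without edges and yields lmin \<le> 1, which is used to compare powers.\<close>

definition lmin :: real where "lmin = Min (insert 1 (len G ` edges G))"

lemma lmin: "0 < lmin" "lmin \<le> 1" "e \<in> edges G \<Longrightarrow> lmin \<le> len G e"
  using fin_E edgeD(1) by (auto simp: lmin_def)

lemma ep_in_points: "e \<in> edges G \<Longrightarrow> x \<in> {0..len G e} \<Longrightarrow> ep e x \<in> points G"
  using edgeD[of e] by (auto simp: edge_point_def points_def)

lemma ep_Vertex_iff: "ep e x = Vertex v \<longleftrightarrow> (x = 0 \<and> src G e = v) \<or> (x \<noteq> 0 \<and> x = len G e \<and> tgt G e = v)"
  by (auto simp: edge_point_def)

lemma ep_eqD: "ep e x = ep e' x' \<Longrightarrow> x \<noteq> 0 \<Longrightarrow> x \<noteq> len G e \<Longrightarrow> e' = e \<and> x' = x"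
  by (auto simp: edge_point_def split: if_splits)

lemma ep_endpoint: "x = 0 \<or> x = len G e \<Longrightarrow> \<exists>v. ep e x = Vertex v"
  by (auto simp: edge_point_def)

text \<open>
  Two points are \<open>near\<close> when they lie on a common edge or on two edges that share a vertex, with the
  indicated bound on the length of the connecting path.
\<close>
definition near :: "('v, 'e) point \<Rightarrow> ('v, 'e) point \<Rightarrow> real \<Rightarrow> bool" where
  "near p q r \<longleftrightarrow> p = q \<or>
     (\<exists>e x y. e \<in> edges G \<and> x \<in> {0..len G e} \<and> y \<in> {0..len G e} \<and> p = ep e x \<and> q = ep e y \<and> \<bar>x - y\<bar> \<le> r) \<or>
     (\<exists>v e x c e' y c'. e \<in> edges G \<and> x \<in> {0..len G e} \<and> (c = 0 \<or> c = len G e) \<and> p = ep e x \<and> ep e c = Vertex v \<and>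
        e' \<in> edges G \<and> y \<in> {0..len G e'} \<and> (c' = 0 \<or> c' = len G e') \<and> q = ep e' y \<and> ep e' c' = Vertex v \<and>
        \<bar>x - c\<bar> + \<bar>y - c'\<bar> \<le> r)"

lemma path_length_nonneg: "0 \<le> path_length s"
  unfolding path_length_def by (intro sum_list_nonneg) auto

text \<open>A path shorter than every edge meets at most one vertex. Prepending a segment therefore
  either prolongs the motion on the same edge or passes through the vertex already recorded.\<close>

lemma near_path:
  assumes "is_path G p s q" "path_length s < lmin" shows "near p q (path_length s)"
  using assms
proof (induction s arbitrary: p)
  case Nil
  then show ?case by (simp add: near_def)
next
  case (Cons a s)
  obtain e x y where a: "a = (e, x, y)" by (cases a)
  from Cons.prems a have e: "e \<in> edges G" and x: "x \<in> {0..len G e}" and y: "y \<in> {0..len G e}" and p: "p = ep e x"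
    and s: "is_path G (ep e y) s q" by auto
  have L: "path_length (a # s) = \<bar>x - y\<bar> + path_length s" by (simp add: a path_length_def)
  have L0: "path_length s < lmin" using Cons.prems L by simp
  note IH = Cons.IH[OF s L0]
  consider (same) "ep e y = q"
    | (edge) e1 x1 y1 where "e1 \<in> edges G" "x1 \<in> {0..len G e1}" "y1 \<in> {0..len G e1}" "ep e y = ep e1 x1" "q = ep e1 y1" "\<bar>x1 - y1\<bar> \<le> path_length s"
    | (vert) v e1 x1 c1 e2 y2 c2 where "e1 \<in> edges G" "x1 \<in> {0..len G e1}" "c1 = 0 \<or> c1 = len G e1" "ep e y = ep e1 x1" "ep e1 c1 = Vertex v"
        "e2 \<in> edges G" "y2 \<in> {0..len G e2}" "c2 = 0 \<or> c2 = len G e2" "q = ep e2 y2" "ep e2 c2 = Vertex v" "\<bar>x1 - c1\<bar> + \<bar>y2 - c2\<bar> \<le> path_length s"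
    using IH unfolding near_def by (elim disjE exE conjE) blast+
  then show ?case
  proof cases
    case same
    have "\<bar>x - y\<bar> \<le> path_length (a # s)" using L path_length_nonneg[of s] by simp
    then show ?thesis unfolding near_def using e x y p same by blast
  next
    case edge
    show ?thesis
    proof (cases "y = 0 \<or> y = len G e")
      case True
      then obtain v where v: "ep e y = Vertex v" using ep_endpoint by blast
      then have x1: "ep e1 x1 = Vertex v" using edge by simp
      then have c1: "x1 = 0 \<or> x1 = len G e1" by (auto simp: ep_Vertex_iff)
      have "\<bar>x - y\<bar> + \<bar>y1 - x1\<bar> \<le> path_length (a # s)" using L edge(6) by linarith
      then show ?thesis unfolding near_def using e x True p v edge(1,3,5) c1 x1 by blast
    next
      case False
      then have "e1 = e" "x1 = y" using ep_eqD[OF edge(4)] by auto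
      then have "\<bar>x - y1\<bar> \<le> path_length (a # s)" using L edge(6) by linarith
      then show ?thesis unfolding near_def using e x p edge(3,5) \<open>e1 = e\<close> by blast
    qed
  next
    case vert
    show ?thesis
    proof (cases "y = 0 \<or> y = len G e")
      case True
      then obtain v' where v': "ep e y = Vertex v'" using ep_endpoint by blast
      then have x1: "ep e1 x1 = Vertex v'" using vert by simp
      then have c1: "x1 = 0 \<or> x1 = len G e1" by (auto simp: ep_Vertex_iff)
      \<comment> \<open>Both coordinates are ends of \<open>e1\<close>; closer than its length they
        must coincide. This excludes passing from one end of a loop to the other.\<close>
      have "\<bar>x1 - c1\<bar> < lmin" using vert(11) L0 by linarith
      then have "\<bar>x1 - c1\<bar> < len G e1" using lmin(3)[OF vert(1)] by linarith
      then have "x1 = c1" using c1 vert(3) edgeD(1)[OF vert(1)] by auto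
      then have "v' = v" using x1 vert(5) by simp
      have "\<bar>x - y\<bar> + \<bar>y2 - c2\<bar> \<le> path_length (a # s)" using L vert(11) \<open>x1 = c1\<close> by linarith
      then show ?thesis unfolding near_def using e x True p v' \<open>v' = v\<close> vert(6-10) by blast
    next
      case False
      then have "e1 = e" "x1 = y" using ep_eqD[OF vert(4)] by auto
      then have "\<bar>x - c1\<bar> + \<bar>y2 - c2\<bar> \<le> path_length (a # s)" using L vert(11) by linarith
      then show ?thesis unfolding near_def using e x p vert(3,5) \<open>e1 = e\<close> vert(6-10) by blast
    qed
  qed
qed

lemma gdist_less_path:
  assumes "p \<in> points G" "q \<in> points G" "gdist G p q < d"
  shows "\<exists>s. is_path G p s q \<and> path_length s < d"
proof -
  have ne: "{path_length s | s. is_path G p s q} \<noteq> {}"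
    using conn assms by (auto simp: connected_graph_def)
  from cInf_lessD[OF ne] assms(3) show ?thesis unfolding gdist_def by auto
qed

lemma gdist_nonneg:
  assumes "p \<in> points G" "q \<in> points G" shows "0 \<le> gdist G p q"
proof -
  have "{path_length s | s. is_path G p s q} \<noteq> {}"
    using conn assms by (auto simp: connected_graph_def)
  then show ?thesis unfolding gdist_def by (intro cInf_greatest) (auto simp: path_length_nonneg)
qed

lemma gdist_edge_le:
  assumes "e \<in> edges G" "x \<in> {0..len G e}" "y \<in> {0..len G e}"
  shows "gdist G (ep e x) (ep e y) \<le> \<bar>x - y\<bar>"
  unfolding gdist_def
proof (rule cInf_lower)
  have "is_path G (ep e x) [(e, x, y)] (ep e y)" using assms by simp
  moreover have "path_length [(e, x, y)] = \<bar>x - y\<bar>" by (simp add: path_length_def)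
  ultimately show "\<bar>x - y\<bar> \<in> {path_length s | s. is_path G (ep e x) s (ep e y)}" by (metis (mono_tags, lifting) mem_Collect_eq)
  show "bdd_below {path_length s | s. is_path G (ep e x) s (ep e y)}"
    by (rule bdd_belowI[of _ 0]) (auto simp: path_length_nonneg)
qed

lemma finite_uniform_delta:
  assumes "finite A" "\<forall>e\<in>A. \<exists>d>0::real. P e d" "\<forall>e d d'. P e d \<longrightarrow> d' \<le> d \<longrightarrow> P e d'"
  shows "\<exists>d>0. \<forall>e\<in>A. P e d"
  using assms(1,2)
proof (induction A)
  case empty
  show ?case by (rule exI[of _ 1]) simp
next
  case (insert a A)
  then obtain d1 d2 where d: "d1 > 0" "\<forall>e\<in>A. P e d1" "d2 > 0" "P a d2" by auto
  have "\<forall>e\<in>insert a A. P e (min d1 d2)"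
  proof
    fix e assume "e \<in> insert a A"
    then consider "e = a" | "e \<in> A" by auto
    then show "P e (min d1 d2)"
    proof cases
      case 1 then show ?thesis using assms(3)[rule_format, of a d2 "min d1 d2"] d by simp
    next
      case 2 then show ?thesis using assms(3)[rule_format, of e d1 "min d1 d2"] d by simp
    qed
  qed
  then show ?case using d by (intro exI[of _ "min d1 d2"]) simp
qed

lemma continuous_on_graphD:
  assumes "continuous_on_graph G f" and e: "e \<in> edges G"
  shows "continuous_on {0..len G e} (restr G f e)"
proof (rule continuous_onI)
  fix x and \<epsilon> :: real assume x: "x \<in> {0..len G e}" and \<epsilon>: "0 < \<epsilon>"
  obtain \<delta> where \<delta>: "\<delta> > 0" "\<forall>q\<in>points G. gdist G (ep e x) q < \<delta> \<longrightarrow> \<bar>f q - f (ep e x)\<bar> < \<epsilon>"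
    using assms(1) ep_in_points[OF e x] \<epsilon> unfolding continuous_on_graph_def by blast
  have "dist (restr G f e y) (restr G f e x) \<le> \<epsilon>" if y: "y \<in> {0..len G e}" "dist y x < \<delta>" for y
  proof -
    have "gdist G (ep e x) (ep e y) < \<delta>"
      using gdist_edge_le[OF e x y(1)] y(2) by (simp add: dist_real_def abs_minus_commute)
    then have "\<bar>f (ep e y) - f (ep e x)\<bar> < \<epsilon>" using \<delta>(2) ep_in_points[OF e y(1)] by blast
    then show ?thesis by (simp add: restr_def dist_real_def)
  qed
  with \<delta>(1) show "\<exists>d>0. \<forall>x'\<in>{0..len G e}. dist x' x < d \<longrightarrow> dist (restr G f e x') (restr G f e x) \<le> \<epsilon>" by blast
qed

text \<open>In the second case of \<open>near\<close> the comparison goes through the common vertex,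
  one step per edge, which explains the factor 2.\<close>

lemma near_osc:
  assumes n: "near p q r" and B: "0 \<le> B"
    and osc: "\<And>e x y. e \<in> edges G \<Longrightarrow> x \<in> {0..len G e} \<Longrightarrow> y \<in> {0..len G e} \<Longrightarrow> \<bar>x - y\<bar> \<le> r \<Longrightarrow>
      \<bar>restr G f e x - restr G f e y\<bar> \<le> B"
  shows "\<bar>f p - f q\<bar> \<le> 2 * B"
proof -
  consider (same) "p = q"
    | (edge) e x y where "e \<in> edges G" "x \<in> {0..len G e}" "y \<in> {0..len G e}" "p = ep e x" "q = ep e y" "\<bar>x - y\<bar> \<le> r"
    | (vert) v e x c e' y c' where "e \<in> edges G" "x \<in> {0..len G e}" "c = 0 \<or> c = len G e" "p = ep e x" "ep e c = Vertex v"
        "e' \<in> edges G" "y \<in> {0..len G e'}" "c' = 0 \<or> c' = len G e'" "q = ep e' y" "ep e' c' = Vertex v" "\<bar>x - c\<bar> + \<bar>y - c'\<bar> \<le> r"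
    using n unfolding near_def by (elim disjE exE conjE) blast+
  then show ?thesis
  proof cases
    case same then show ?thesis using B by simp
  next
    case edge
    have "\<bar>restr G f e x - restr G f e y\<bar> \<le> B" by (rule osc[OF edge(1,2,3,6)])
    then show ?thesis using B by (simp add: edge(4,5) restr_def)
  next
    case vert
    have c: "c \<in> {0..len G e}" "c' \<in> {0..len G e'}" using vert(3,8) edgeD(1)[OF vert(1)] edgeD(1)[OF vert(6)] by auto
    have "\<bar>x - c\<bar> \<le> r" "\<bar>y - c'\<bar> \<le> r" using vert(11) by linarith+
    with osc[OF vert(1,2) c(1)] osc[OF vert(6,7) c(2)]
    have "\<bar>restr G f e x - restr G f e c\<bar> \<le> B" "\<bar>restr G f e' y - restr G f e' c'\<bar> \<le> B" by blast+
    then show ?thesis by (simp add: vert(4,5,9,10) restr_def)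
  qed
qed

text \<open>Matching at the vertices is built in: all restrictions \<open>restr G f e\<close> read
  the same value of \<open>f\<close> at a vertex. Uniform continuity on the finitely many edges then
  gives a common radius for nearby points.\<close>

lemma continuous_on_graphI:
  assumes c: "\<And>e. e \<in> edges G \<Longrightarrow> continuous_on {0..len G e} (restr G f e)"
  shows "continuous_on_graph G f"
  unfolding continuous_on_graph_def
proof (intro ballI allI impI)
  fix p and \<epsilon> :: real assume p: "p \<in> points G" and \<epsilon>: "0 < \<epsilon>"
  let ?P = "\<lambda>e d. \<forall>x\<in>{0..len G e}. \<forall>y\<in>{0..len G e}. \<bar>x - y\<bar> < d \<longrightarrow> \<bar>restr G f e x - restr G f e y\<bar> \<le> \<epsilon> / 3"
  have "\<forall>e\<in>edges G. \<exists>d>0. ?P e d"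
  proof
    fix e assume e: "e \<in> edges G"
    have uc: "uniformly_continuous_on {0..len G e} (restr G f e)"
      by (rule compact_uniformly_continuous[OF c[OF e]]) simp
    have e3: "0 < \<epsilon> / 3" using \<epsilon> by simp
    have "\<exists>d>0. \<forall>x\<in>{0..len G e}. \<forall>x'\<in>{0..len G e}. dist x' x < d \<longrightarrow> dist (restr G f e x') (restr G f e x) < \<epsilon> / 3"
      using uc[unfolded uniformly_continuous_on_def, THEN spec, of "\<epsilon> / 3"] e3 by (rule mp)
    then obtain d where d: "d > 0"
      "\<forall>x\<in>{0..len G e}. \<forall>x'\<in>{0..len G e}. dist x' x < d \<longrightarrow> dist (restr G f e x') (restr G f e x) < \<epsilon> / 3" by blast
    have "?P e d"
    proof (intro ballI impI)
      fix x y assume "x \<in> {0..len G e}" "y \<in> {0..len G e}" "\<bar>x - y\<bar> < d"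
      then show "\<bar>restr G f e x - restr G f e y\<bar> \<le> \<epsilon> / 3"
        using d(2)[rule_format, of y x] by (simp add: dist_real_def)
    qed
    with d(1) show "\<exists>d>0. ?P e d" by blast
  qed
  moreover have "\<forall>e d d'. ?P e d \<longrightarrow> d' \<le> d \<longrightarrow> ?P e d'" by (meson less_le_trans)
  ultimately obtain d where d: "d > 0" "\<forall>e\<in>edges G. ?P e d"
    using finite_uniform_delta[OF fin_E, of ?P] by blast
  have "\<bar>f q - f p\<bar> < \<epsilon>" if q: "q \<in> points G" "gdist G p q < min d lmin" for q
  proof -
    obtain s where s: "is_path G p s q" "path_length s < min d lmin" using gdist_less_path[OF p q] by blast
    have "near p q (path_length s)" using s by (intro near_path) auto
    then have "\<bar>f p - f q\<bar> \<le> 2 * (\<epsilon> / 3)"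
      using d(2) s(2) \<epsilon> by (rule_tac near_osc[of p q "path_length s"]) auto
    then show ?thesis using \<epsilon> by (simp add: abs_minus_commute)
  qed
  moreover have "0 < min d lmin" using d(1) lmin(1) by simp
  ultimately show "\<exists>\<delta>>0. \<forall>q\<in>points G. gdist G p q < \<delta> \<longrightarrow> \<bar>f q - f p\<bar> < \<epsilon>" by blast
qed

definition glue :: "('v \<Rightarrow> real) \<Rightarrow> ('e \<Rightarrow> real \<Rightarrow> real) \<Rightarrow> ('v, 'e) point \<Rightarrow> real" where
  "glue val h p = (case p of Vertex v \<Rightarrow> val v | Interior e x \<Rightarrow> h e x)"

lemma restr_glue_interior: "x \<noteq> 0 \<Longrightarrow> x \<noteq> len G e \<Longrightarrow> restr G (glue val h) e x = h e x"
  by (simp add: restr_def glue_def edge_point_def)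

lemma restr_glue:
  assumes "h e 0 = val (src G e)" "h e (len G e) = val (tgt G e)"
  shows "restr G (glue val h) e x = h e x"
  using assms by (auto simp: restr_def glue_def edge_point_def)

lemma AE_restr_glue: "AE x in leb (len G e). restr G (glue val h) e x = h e x"
  by (rule AE_lebesgue_on_negligible[of "{0, len G e}"]) (auto simp: restr_glue_interior)

lemma ae_on_graph_restr: "ae_on_graph G (\<lambda>p. u p = f p) \<longleftrightarrow>
    (\<forall>e\<in>edges G. AE x in leb (len G e). restr G u e x = restr G f e x)"
  by (simp add: ae_on_graph_def restr_def)

lemma cont_spaceI:
  assumes "\<And>e. e \<in> edges G \<Longrightarrow> continuous_on {0..len G e} (h e)"
    and "\<And>e. e \<in> edges G \<Longrightarrow> AE x in leb (len G e). restr G u e x = h e x"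
    and "\<And>e. e \<in> edges G \<Longrightarrow> h e 0 = val (src G e)" "\<And>e. e \<in> edges G \<Longrightarrow> h e (len G e) = val (tgt G e)"
  shows "u \<in> cont_space G"
proof -
  have r: "restr G (glue val h) e = h e" if "e \<in> edges G" for e
    using restr_glue[of h e val] assms(3,4)[OF that] by auto
  have "continuous_on_graph G (glue val h)" by (rule continuous_on_graphI) (simp add: r assms(1))
  moreover have "ae_on_graph G (\<lambda>p. u p = glue val h p)" using assms(2) by (simp add: ae_on_graph_restr r)
  ultimately show ?thesis by (auto simp: cont_space_def)
qed

section \<open>Traces and derivatives on single edges\<close>

definition tr :: "(('v, 'e) point \<Rightarrow> real) \<Rightarrow> 'e \<Rightarrow> real \<Rightarrow> real" where
  "tr u e = trace_int (len G e) (restr G u e)"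

definition wd :: "(('v, 'e) point \<Rightarrow> real) \<Rightarrow> 'e \<Rightarrow> real \<Rightarrow> real" where
  "wd u e = wderiv (len G e) (restr G u e)"

definition dtr :: "(('v, 'e) point \<Rightarrow> real) \<Rightarrow> 'e \<Rightarrow> real \<Rightarrow> real" where
  "dtr u e = trace_int (len G e) (wd u e)"

definition wdd :: "(('v, 'e) point \<Rightarrow> real) \<Rightarrow> 'e \<Rightarrow> real \<Rightarrow> real" where
  "wdd u e = wderiv (len G e) (wd u e)"

lemma cont_spaceD:
  assumes "u \<in> cont_space G"
  shows "\<exists>val. \<forall>e\<in>edges G. tr u e 0 = val (src G e) \<and> tr u e (len G e) = val (tgt G e)"
proof -
  obtain f where f: "continuous_on_graph G f" "ae_on_graph G (\<lambda>p. u p = f p)" using assms by (auto simp: cont_space_def)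
  have "tr u e x = restr G f e x" if e: "e \<in> edges G" "x \<in> {0..len G e}" for e x
    unfolding tr_def using f e edgeD(1)[OF e(1)]
    by (intro trace_int_eq continuous_on_graphD) (auto simp: ae_on_graph_restr)
  then have "\<forall>e\<in>edges G. tr u e 0 = f (Vertex (src G e)) \<and> tr u e (len G e) = f (Vertex (tgt G e))"
    using edgeD(1) by (force simp: restr_def edge_point_def)
  then show ?thesis by (intro exI[of _ "\<lambda>v. f (Vertex v)"])
qed

lemma restr_lin: "restr G (\<lambda>p. a * u p + b * v p) e = (\<lambda>x. a * restr G u e x + b * restr G v e x)"
  by (simp add: restr_def)

lemma restr_diff: "restr G (\<lambda>p. u p - v p) e = (\<lambda>x. restr G u e x - restr G v e x)"
  by (simp add: restr_def)

lemma cont_space_lin: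
  assumes "u \<in> cont_space G" "v \<in> cont_space G" shows "(\<lambda>p. a * u p + b * v p) \<in> cont_space G"
proof -
  obtain f g where f: "continuous_on_graph G f" "ae_on_graph G (\<lambda>p. u p = f p)"
    and g: "continuous_on_graph G g" "ae_on_graph G (\<lambda>p. v p = g p)" using assms by (auto simp: cont_space_def)
  have "continuous_on_graph G (\<lambda>p. a * f p + b * g p)"
    unfolding restr_lin by (intro continuous_on_graphI) (auto simp: restr_lin intro!: continuous_intros continuous_on_graphD f g)
  moreover have "ae_on_graph G (\<lambda>p. a * u p + b * v p = a * f p + b * g p)"
    unfolding ae_on_graph_restr restr_lin
  proof
    fix e assume e: "e \<in> edges G"
    have "AE x in leb (len G e). restr G u e x = restr G f e x" "AE x in leb (len G e). restr G v e x = restr G g e x"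
      using f(2) g(2) e by (auto simp: ae_on_graph_restr)
    then show "AE x in leb (len G e). a * restr G u e x + b * restr G v e x = a * restr G f e x + b * restr G g e x"
      by eventually_elim simp
  qed
  ultimately show ?thesis by (auto simp: cont_space_def)
qed

section \<open>Sobolev spaces on the graph\<close>

abbreviation "L2G \<equiv> L2_space G"
abbreviation "H1t \<equiv> Htilde_int G 1"
abbreviation "H2t \<equiv> Htilde_int G 2"
abbreviation "H1C \<equiv> Htilde_int G 1 \<sqinter>\<^sub>s cont_space G"
abbreviation "H2C \<equiv> Htilde_int G 2 \<sqinter>\<^sub>s cont_space G"

lemma L2G_carrier: "u \<in> fs_carrier L2G \<longleftrightarrow> (\<forall>e\<in>edges G. restr G u e \<in> L2_int (len G e))"
  by (simp add: L2_space_def)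

lemma L2_inner_self: "L2_inner G u u = (\<Sum>e\<in>edges G. nsq (len G e) (restr G u e))"
  by (simp add: L2_inner_def nsq_def power2_eq_square)

lemma L2G_norm_sq: "fs_sq L2G u = (\<Sum>e\<in>edges G. nsq (len G e) (restr G u e))"
  by (simp add: L2_space_def L2_inner_self sum_nonneg)

lemma Ht_carrier: "u \<in> fs_carrier (Htilde_int G r) \<longleftrightarrow> (\<forall>e\<in>edges G. restr G u e \<in> sobolev_int (len G e) r)"
  by (simp add: Htilde_int_def)

lemma sobolev_int_sq_nonneg: "0 \<le> sobolev_int_sq l r f"
  by (simp add: sobolev_int_sq_def sum_nonneg)

lemma Ht_norm_sq: "fs_sq (Htilde_int G r) u = (\<Sum>e\<in>edges G. sobolev_int_sq (len G e) r (restr G u e))"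
  by (simp add: Htilde_int_def sum_nonneg sobolev_int_sq_nonneg)

lemma H1t_norm_sq: "fs_sq H1t u = (\<Sum>e\<in>edges G. nsq (len G e) (restr G u e) + nsq (len G e) (wd u e))"
  unfolding Ht_norm_sq sobolev_int_sq_1 wd_def ..

lemma H2t_norm_sq: "fs_sq H2t u
    = (\<Sum>e\<in>edges G. nsq (len G e) (restr G u e) + nsq (len G e) (wd u e) + nsq (len G e) (wdd u e))"
  unfolding Ht_norm_sq sobolev_int_sq_2 wd_def wdd_def ..

lemma fs_inter_simps [simp]: "fs_carrier (E \<sqinter>\<^sub>s S) = fs_carrier E \<inter> S" "fs_norm (E \<sqinter>\<^sub>s S) = fs_norm E"
  by (simp_all add: fs_inter_def)

lemma H1D:
  assumes "u \<in> fs_carrier H1t" "e \<in> edges G"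
  shows "restr G u e \<in> sobolev_int (len G e) 1" "restr G u e \<in> L2_int (len G e)" "wd u e \<in> L2_int (len G e)"
    "prim (len G e) (tr u e) (wd u e)" "AE x in leb (len G e). restr G u e x = tr u e x"
proof -
  show 1: "restr G u e \<in> sobolev_int (len G e) 1" using assms by (simp only: Ht_carrier)
  show "restr G u e \<in> L2_int (len G e)" "wd u e \<in> L2_int (len G e)"
    "prim (len G e) (tr u e) (wd u e)" "AE x in leb (len G e). restr G u e x = tr u e x"
    unfolding tr_def wd_def using sobolev_1D[OF 1 edgeD(1)[OF assms(2)]] by auto
qed

lemma H2D:
  assumes "u \<in> fs_carrier H2t" "e \<in> edges G"
  shows "u \<in> fs_carrier H1t" "wd u e \<in> sobolev_int (len G e) 1" "wdd u e \<in> L2_int (len G e)"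
    "prim (len G e) (dtr u e) (wdd u e)" "AE x in leb (len G e). wd u e x = dtr u e x"
proof -
  have 2: "restr G u e' \<in> sobolev_int (len G e') 2" if "e' \<in> edges G" for e' using assms(1) that by (simp only: Ht_carrier)
  have "restr G u e' \<in> sobolev_int (len G e') 1" if "e' \<in> edges G" for e'
    using 2[OF that] unfolding sobolev_2_iff[OF edgeD(1)[OF that]] by (rule conjunct1)
  then show "u \<in> fs_carrier H1t" by (simp only: Ht_carrier) blast
  show w: "wd u e \<in> sobolev_int (len G e) 1"
    using 2[OF assms(2)] unfolding sobolev_2_iff[OF edgeD(1)[OF assms(2)]] wd_def by (rule conjunct2)
  show "wdd u e \<in> L2_int (len G e)"
    "prim (len G e) (dtr u e) (wdd u e)" "AE x in leb (len G e). wd u e x = dtr u e x"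
    unfolding dtr_def wdd_def using sobolev_1D[OF w edgeD(1)[OF assms(2)]] by auto
qed

lemma H1I:
  assumes "\<And>e. e \<in> edges G \<Longrightarrow> prim (len G e) (h e) (g e)"
    and "\<And>e. e \<in> edges G \<Longrightarrow> AE x in leb (len G e). restr G u e x = h e x"
  shows "u \<in> fs_carrier H1t" "e \<in> edges G \<Longrightarrow> AE x in leb (len G e). wd u e x = g e x"
    "e \<in> edges G \<Longrightarrow> x \<in> {0..len G e} \<Longrightarrow> tr u e x = h e x"
proof -
  have S: "restr G u e \<in> sobolev_int (len G e) 1" if "e \<in> edges G" for e
    by (rule sobolev_1I(1)[OF assms(1)[OF that] assms(2)[OF that] edgeD(1)[OF that]])
  then show "u \<in> fs_carrier H1t" by (simp only: Ht_carrier) blast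
  assume e: "e \<in> edges G"
  show "AE x in leb (len G e). wd u e x = g e x" "x \<in> {0..len G e} \<Longrightarrow> tr u e x = h e x"
    unfolding wd_def tr_def using sobolev_1I(2,3)[OF assms(1)[OF e] assms(2)[OF e] edgeD(1)[OF e]] by auto
qed

lemma H2I:
  assumes "\<And>e. e \<in> edges G \<Longrightarrow> prim (len G e) (h e) (g e)" "\<And>e. e \<in> edges G \<Longrightarrow> prim (len G e) (g e) (k e)"
    and "\<And>e. e \<in> edges G \<Longrightarrow> AE x in leb (len G e). restr G u e x = h e x"
  shows "u \<in> fs_carrier H2t" "e \<in> edges G \<Longrightarrow> AE x in leb (len G e). wdd u e x = k e x"
    "e \<in> edges G \<Longrightarrow> x \<in> {0..len G e} \<Longrightarrow> dtr u e x = g e x"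
proof -
  have S: "restr G u e \<in> sobolev_int (len G e) 2" if "e \<in> edges G" for e
    by (rule sobolev_2I(1)[OF assms(1)[OF that] assms(2)[OF that] assms(3)[OF that] edgeD(1)[OF that]])
  then show "u \<in> fs_carrier H2t" by (simp only: Ht_carrier) blast
  assume e: "e \<in> edges G"
  show "AE x in leb (len G e). wdd u e x = k e x" "x \<in> {0..len G e} \<Longrightarrow> dtr u e x = g e x"
    unfolding wdd_def dtr_def wd_def
    using sobolev_2I(2,3)[OF assms(1)[OF e] assms(2)[OF e] assms(3)[OF e] edgeD(1)[OF e]] by auto
qed

lemma H1_cont_iff:
  assumes u: "u \<in> fs_carrier H1t"
  shows "u \<in> cont_space G \<longleftrightarrow> (\<exists>val. \<forall>e\<in>edges G. tr u e 0 = val (src G e) \<and> tr u e (len G e) = val (tgt G e))"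
proof
  assume "\<exists>val. \<forall>e\<in>edges G. tr u e 0 = val (src G e) \<and> tr u e (len G e) = val (tgt G e)"
  then obtain val where val: "\<forall>e\<in>edges G. tr u e 0 = val (src G e) \<and> tr u e (len G e) = val (tgt G e)" ..
  show "u \<in> cont_space G"
    using val by (intro cont_spaceI[of "tr u" u val, OF prim_continuous[OF H1D(4)[OF u]] H1D(5)[OF u]]) auto
qed (rule cont_spaceD)

lemma H1_lin:
  assumes u: "u \<in> fs_carrier H1t" and v: "v \<in> fs_carrier H1t" and e: "e \<in> edges G"
  shows "AE x in leb (len G e). wd (\<lambda>p. a * u p + b * v p) e x = a * wd u e x + b * wd v e x"
    "x \<in> {0..len G e} \<Longrightarrow> tr (\<lambda>p. a * u p + b * v p) e x = a * tr u e x + b * tr v e x"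
  unfolding wd_def tr_def restr_lin
  using sobolev_1_lin(2,3)[OF H1D(1)[OF u e] H1D(1)[OF v e] edgeD(1)[OF e]] by auto

lemma H2_lin:
  assumes u: "u \<in> fs_carrier H2t" and v: "v \<in> fs_carrier H2t" and e: "e \<in> edges G"
  shows "AE x in leb (len G e). wdd (\<lambda>p. a * u p + b * v p) e x = a * wdd u e x + b * wdd v e x"
    "x \<in> {0..len G e} \<Longrightarrow> dtr (\<lambda>p. a * u p + b * v p) e x = a * dtr u e x + b * dtr v e x"
proof -
  have "restr G u e \<in> sobolev_int (len G e) 2" "restr G v e \<in> sobolev_int (len G e) 2"
    using u v e by (simp_all only: Ht_carrier)
  from sobolev_2_lin(2,3)[OF this edgeD(1)[OF e]]
  show "AE x in leb (len G e). wdd (\<lambda>p. a * u p + b * v p) e x = a * wdd u e x + b * wdd v e x"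
    "x \<in> {0..len G e} \<Longrightarrow> dtr (\<lambda>p. a * u p + b * v p) e x = a * dtr u e x + b * dtr v e x"
    unfolding wdd_def dtr_def wd_def restr_lin by auto
qed

lemma quad_space_inter:
  assumes q: "quad_space X" and S: "(\<lambda>p. 0) \<in> S" "\<And>u v a b. u \<in> fs_carrier X \<Longrightarrow> v \<in> fs_carrier X \<Longrightarrow> u \<in> S \<Longrightarrow> v \<in> S \<Longrightarrow> (\<lambda>p. a * u p + b * v p) \<in> S"
  shows "quad_space (X \<sqinter>\<^sub>s S)"
  unfolding quad_space_def
proof (intro conjI ballI allI)
  show "fs_carrier (X \<sqinter>\<^sub>s S) \<noteq> {}" using S(1) quad_space_zero[OF q] by auto
  show "0 \<le> fs_norm (X \<sqinter>\<^sub>s S) f" for f using quad_space_nonneg[OF q] by simp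
qed (use q S(2) quad_space_lin[OF q] in auto)

lemma quad_L2G: "quad_space L2G"
  unfolding quad_space_def
proof (intro conjI ballI allI)
  have "(\<lambda>p. 0) \<in> fs_carrier L2G" by (simp add: L2G_carrier restr_def)
  then show "fs_carrier L2G \<noteq> {}" by blast
  show "0 \<le> fs_norm L2G f" for f by (simp add: L2_space_def L2_inner_self sum_nonneg)
  fix f g a b assume f: "f \<in> fs_carrier L2G" and g: "g \<in> fs_carrier L2G"
  show "(\<lambda>p. a * f p + b * g p) \<in> fs_carrier L2G"
    using f g unfolding L2G_carrier restr_lin by (auto intro!: L2_int_add L2_int_cmult)
  have "(\<Sum>e\<in>edges G. nsq (len G e) (restr G (\<lambda>p. a * f p + b * g p) e))
    \<le> (\<Sum>e\<in>edges G. 2 * a\<^sup>2 * nsq (len G e) (restr G f e) + 2 * b\<^sup>2 * nsq (len G e) (restr G g e))"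
    unfolding restr_lin using f g by (intro sum_mono nsq_lin_le) (auto simp: L2G_carrier)
  then show "fs_sq L2G (\<lambda>p. a * f p + b * g p) \<le> 2 * a\<^sup>2 * fs_sq L2G f + 2 * b\<^sup>2 * fs_sq L2G g"
    unfolding L2G_norm_sq by (simp add: sum.distrib sum_distrib_left)
qed

lemma quad_Ht:
  assumes r: "r = 1 \<or> r = 2" shows "quad_space (Htilde_int G r)"
  unfolding quad_space_def
proof (intro conjI ballI allI)
  have z: "(\<lambda>x. 0) \<in> sobolev_int l r" if "0 < l" for l
    using r sobolev_1I(1)[OF prim_const[of l 0] _ that] sobolev_2I(1)[OF prim_const[of l 0] prim_const[of l 0] _ that] by auto
  have "(\<lambda>p. 0) \<in> fs_carrier (Htilde_int G r)" by (simp add: Ht_carrier restr_def z edgeD)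
  then show "fs_carrier (Htilde_int G r) \<noteq> {}" by blast
  show "0 \<le> fs_norm (Htilde_int G r) f" for f by (simp add: Htilde_int_def sum_nonneg sobolev_int_sq_nonneg)
  fix f g a b assume f: "f \<in> fs_carrier (Htilde_int G r)" and g: "g \<in> fs_carrier (Htilde_int G r)"
  note S = sobolev_int_sq_lin_le[OF f[unfolded Ht_carrier, rule_format] g[unfolded Ht_carrier, rule_format] edgeD(1) r]
  show "(\<lambda>p. a * f p + b * g p) \<in> fs_carrier (Htilde_int G r)"
    unfolding Ht_carrier restr_lin by (intro ballI S(1))
  have "(\<Sum>e\<in>edges G. sobolev_int_sq (len G e) r (restr G (\<lambda>p. a * f p + b * g p) e))
    \<le> (\<Sum>e\<in>edges G. 2 * a\<^sup>2 * sobolev_int_sq (len G e) r (restr G f e) + 2 * b\<^sup>2 * sobolev_int_sq (len G e) r (restr G g e))"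
    unfolding restr_lin by (intro sum_mono S(2))
  then show "fs_sq (Htilde_int G r) (\<lambda>p. a * f p + b * g p)
      \<le> 2 * a\<^sup>2 * fs_sq (Htilde_int G r) f + 2 * b\<^sup>2 * fs_sq (Htilde_int G r) g"
    unfolding Ht_norm_sq by (simp add: sum.distrib sum_distrib_left)
qed

lemma zero_cont: "(\<lambda>p. 0) \<in> cont_space G"
  by (rule cont_spaceI[of "\<lambda>_ _. 0" _ "\<lambda>_. 0"]) (auto simp: restr_def)

lemma quad_HC: "r = 1 \<or> r = 2 \<Longrightarrow> quad_space (Htilde_int G r \<sqinter>\<^sub>s cont_space G)"
  by (intro quad_space_inter quad_Ht zero_cont cont_space_lin)

lemma H1_norm_mono: "fs_sq L2G u \<le> fs_sq H1t u"
  unfolding L2G_norm_sq H1t_norm_sq by (intro sum_mono) simp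

lemma H2_norm_mono: "fs_sq H1t u \<le> fs_sq H2t u"
  unfolding H1t_norm_sq H2t_norm_sq by (intro sum_mono) simp

lemma H1_subset_L2: "u \<in> fs_carrier H1t \<Longrightarrow> u \<in> fs_carrier L2G"
  using H1D(2) by (auto simp: L2G_carrier)

lemma H2_subset_H1: "u \<in> fs_carrier H2t \<Longrightarrow> u \<in> fs_carrier H1t"
proof -
  assume u: "u \<in> fs_carrier H2t"
  show ?thesis
  proof (cases "edges G = {}")
    case True then show ?thesis by (simp add: Ht_carrier)
  next
    case False
    then obtain e where "e \<in> edges G" by blast
    then show ?thesis by (rule H2D(1)[OF u])
  qed
qed

lemma embeds_subspace: "quad_space X \<Longrightarrow> fs_carrier Y \<subseteq> fs_carrier X \<Longrightarrow> (\<And>u. fs_sq X u \<le> fs_sq Y u) \<Longrightarrow> quad_space Y \<Longrightarrow> Y \<hookrightarrow> X"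
  by (rule embedsI_sq[of _ _ 1]) (auto simp: quad_space_nonneg)

lemma couples:
  "couple L2G H1t" "couple L2G H1C" "couple H1t H2t" "couple H1C H2C"
proof -
  show "couple L2G H1t" unfolding couple_def
    by (intro conjI embeds_subspace quad_L2G quad_Ht subsetI) (auto simp: H1_norm_mono dest: H1_subset_L2)
  show "couple L2G H1C" unfolding couple_def
    by (intro conjI embeds_subspace quad_L2G quad_HC subsetI) (auto simp: H1_norm_mono dest: H1_subset_L2)
  show "couple H1t H2t" unfolding couple_def
    by (intro conjI embeds_subspace quad_Ht subsetI) (auto simp: H2_norm_mono dest: H2_subset_H1)
  show "couple H1C H2C" unfolding couple_def
    by (intro conjI embeds_subspace quad_HC subsetI) (auto simp: H2_norm_mono dest: H2_subset_H1)
qed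

end

section \<open>Cutoff functions at the end points of an interval\<close>

lemma nsq_le_indicator:
  assumes f: "f \<in> L2_int l" and cd: "0 \<le> c" "c \<le> d" "d \<le> l"
    and b: "\<And>x. x \<in> {0..l} \<Longrightarrow> \<bar>f x\<bar> \<le> B * indicator {c..d} x"
  shows "nsq l f \<le> B\<^sup>2 * (d - c)"
proof -
  have m: "indicat_real {c..d} \<in> borel_measurable (leb l)"
    by (intro measurable_restrict_space1 borel_measurable_indicator) simp
  have i: "indicat_real {c..d} \<in> L2_int l"
    using L2_int_bounded_mult(1)[OF L2_int_const[of 1 l] m, of 1] by simp
  have "nsq l (indicator {c..d}) = (LINT t|leb l. indicator {c..d} t * 1)"
    unfolding nsq_def by (intro Bochner_Integration.integral_cong) (auto simp: indicator_def)
  also have "\<dots> = d - c"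
    using integral_Icc_eq_LINT(1)[OF L2_int_const[of 1 l] cd(1,3)] cd by simp
  finally have n: "nsq l (indicator {c..d}) = d - c" .
  have "nsq l f \<le> nsq l (\<lambda>x. B * indicator {c..d} x)"
  proof (intro nsq_mono_AE f L2_int_cmult i AE_I2)
    fix x assume "x \<in> space (leb l)"
    then have "\<bar>f x\<bar> \<le> B * indicator {c..d} x" using b by simp
    then show "(f x)\<^sup>2 \<le> (B * indicator {c..d} x)\<^sup>2" by (metis abs_ge_zero power2_abs power_mono)
  qed
  then show ?thesis by (simp add: nsq_cmult n)
qed

lemma L2_int_indicator_mult:
  assumes "continuous_on {0..l} f" shows "(\<lambda>x. indicat_real {c..d} x * f x) \<in> L2_int l"
proof -
  have m: "indicat_real {c..d} \<in> borel_measurable (leb l)"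
    by (intro measurable_restrict_space1 borel_measurable_indicator) simp
  show ?thesis by (rule L2_int_bounded_mult(1)[OF L2_int_continuous[OF assms] m, of 1]) simp
qed

definition edist :: "real \<Rightarrow> bool \<Rightarrow> real \<Rightarrow> real" where
  "edist l b x = (if b then l - x else x)"

definition esgn :: "bool \<Rightarrow> real" where
  "esgn b = (if b then - 1 else 1)"

text \<open>A hat of width d and height 1 at the selected end, dual to the value there.\<close>

definition bump :: "real \<Rightarrow> real \<Rightarrow> bool \<Rightarrow> real \<Rightarrow> real" where
  "bump l d b x = max 0 (1 - edist l b x / d)"

text \<open>A function with value zero at both end points and derivative one, away from the selected end
  point, there.\<close>
definition kink :: "real \<Rightarrow> real \<Rightarrow> bool \<Rightarrow> real \<Rightarrow> real" where
  "kink l d b x = edist l b x * (bump l d b x)\<^sup>2"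

text \<open>The derivative of \<open>kink\<close>. The square in \<open>kink\<close> makes it
  continuous at the edge of the support, which puts \<open>kink\<close> into H^2.\<close>

definition kink' :: "real \<Rightarrow> real \<Rightarrow> bool \<Rightarrow> real \<Rightarrow> real" where
  "kink' l d b x = esgn b * ((bump l d b x)\<^sup>2 - 2 * (edist l b x / d) * bump l d b x)"

definition esupp :: "real \<Rightarrow> real \<Rightarrow> bool \<Rightarrow> real set" where
  "esupp l d b = {(if b then l - d else 0)..(if b then l else d)}"

lemma edist_deriv: "(edist l b has_real_derivative esgn b) (at x)"
  unfolding edist_def[abs_def] esgn_def by (cases b) (auto intro!: derivative_eq_intros)

lemma edist_cont: "continuous_on S (edist l b)"
  unfolding edist_def[abs_def] by (cases b) (auto intro!: continuous_intros)

lemma edist_cases: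
  assumes "x \<in> {0..l}" shows "0 \<le> edist l b x" "edist l b x \<le> l" "x \<in> esupp l d b \<longleftrightarrow> edist l b x \<le> d"
  using assms by (auto simp: edist_def esupp_def)

lemma bump_cont: "d \<noteq> 0 \<Longrightarrow> continuous_on S (bump l d b)"
  unfolding bump_def[abs_def] by (intro continuous_intros edist_cont) auto

lemma bump_range:
  assumes "0 < d" "x \<in> {0..l}"
  shows "0 \<le> bump l d b x" "bump l d b x \<le> 1" "d \<le> edist l b x \<Longrightarrow> bump l d b x = 0"
    "edist l b x \<le> d \<Longrightarrow> bump l d b x = 1 - edist l b x / d"
  using assms edist_cases(1,2)[OF assms(2), of b] by (auto simp: bump_def max_def field_simps)

lemma bump_deriv_inside:
  assumes "0 < d" "edist l b x < d"
  shows "(bump l d b has_real_derivative - esgn b / d) (at x)"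
proof -
  have "((\<lambda>y. 1 - edist l b y / d) has_real_derivative - esgn b / d) (at x)"
    using assms edist_deriv[of l b x] by (auto intro!: derivative_eq_intros)
  moreover have "open {y. edist l b y < d}"
    by (intro open_Collect_less edist_cont continuous_on_const)
  ultimately show ?thesis
    by (rule has_field_derivative_transform_within_open) (use assms in \<open>auto simp: bump_def field_simps\<close>)
qed

lemma bump_outside:
  assumes "0 < d" "d < edist l b x"
  shows "open {y. d < edist l b y}" "x \<in> {y. d < edist l b y}" "\<And>y. y \<in> {y. d < edist l b y} \<Longrightarrow> 0 = bump l d b y"
  using assms by (auto intro!: open_Collect_less edist_cont simp: bump_def field_simps)

lemma esupp_exception: "edist l b x = d \<longleftrightarrow> x = (if b then l - d else d)"
  by (auto simp: edist_def)

text \<open>The bounds d and 1 / d are the scaling demanded of dual functions for the couple (L2,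
  H^1): with d proportional to 2^-j they become 2^-j and 2^j.\<close>

lemma prim_bump:
  assumes d: "0 < d" "d \<le> l"
  shows "prim l (bump l d b) (\<lambda>x. indicator (esupp l d b) x * (- esgn b / d))"
    "nsq l (bump l d b) \<le> d" "nsq l (\<lambda>x. indicator (esupp l d b) x * (- esgn b / d)) \<le> 1 / d"
proof -
  let ?g = "\<lambda>x. indicator (esupp l d b) x * (- esgn b / d)"
  have L: "?g \<in> L2_int l" unfolding esupp_def by (intro L2_int_indicator_mult continuous_intros)
  show "prim l (bump l d b) ?g"
  proof (rule prim_derivative[of _ _ _ "{if b then l - d else d}"])
    show "continuous_on {0..l} (bump l d b)" using d by (intro bump_cont) simp
    show "?g \<in> L2_int l" by (rule L)
    fix x assume x: "x \<in> {0<..<l} - {if b then l - d else d}"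
    then have x': "x \<in> {0..l}" "edist l b x \<noteq> d" unfolding esupp_exception by auto
    consider "edist l b x < d" | "d < edist l b x" using x' by linarith
    then show "(bump l d b has_real_derivative ?g x) (at x)"
    proof cases
      case 1
      then show ?thesis using bump_deriv_inside[OF d(1) 1] edist_cases(3)[OF x'(1), of d b] by simp
    next
      case 2
      have "(bump l d b has_real_derivative 0) (at x)"
        by (rule has_field_derivative_transform_within_open[OF _ bump_outside[OF d(1) 2]]) auto
      then show ?thesis using edist_cases(3)[OF x'(1), of d b] 2 by simp
    qed
  qed simp
  have s: "0 \<le> (if b then l - d else 0)" "(if b then l - d else 0) \<le> (if b then l else d)" "(if b then l else d) \<le> l"
    "(if b then l else d) - (if b then l - d else 0) = d" using d by auto
  have "nsq l (bump l d b) \<le> 1\<^sup>2 * ((if b then l else d) - (if b then l - d else 0))"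
  proof (rule nsq_le_indicator[OF _ s(1-3)])
    show "bump l d b \<in> L2_int l" using d by (intro L2_int_continuous bump_cont) simp
    fix x assume x: "x \<in> {0..l}"
    show "\<bar>bump l d b x\<bar> \<le> 1 * indicator {(if b then l - d else 0)..(if b then l else d)} x"
      using bump_range[OF d(1) x, of b] edist_cases(3)[OF x, of d b] unfolding esupp_def
      by (cases "edist l b x \<le> d") auto
  qed
  then show "nsq l (bump l d b) \<le> d" using s(4) by simp
  have "nsq l ?g \<le> (1 / d)\<^sup>2 * ((if b then l else d) - (if b then l - d else 0))"
    by (rule nsq_le_indicator[OF L s(1-3)]) (use d in \<open>auto simp: esupp_def esgn_def indicator_def\<close>)
  also have "\<dots> = 1 / d" using d s(4) by (simp add: power2_eq_square)
  finally show "nsq l ?g \<le> 1 / d" .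
qed

text \<open>The function and its first two derivatives are bounded by d, 2 and 6 / d on an interval
  of length d. The last two bounds give the dual scaling for the couple (H^1, H^2).\<close>

lemma prim_kink:
  assumes d: "0 < d" "d \<le> l"
  shows "\<exists>k. prim l (kink l d b) (kink' l d b) \<and> prim l (kink' l d b) k \<and>
    nsq l (kink l d b) \<le> d ^ 3 \<and> nsq l (kink' l d b) \<le> 4 * d \<and> nsq l k \<le> 36 / d"
proof -
  let ?s = "edist l b" and ?B = "bump l d b"
  \<comment> \<open>The second derivative inside the support; the orientation sign occurs twice and
    cancels. Its jump at the edge of the support is harmless in L2.\<close>
  define k where "k x = indicator (esupp l d b) x * (6 * ?s x / d\<^sup>2 - 4 / d)" for x
  have ck: "continuous_on {0..l} (kink l d b)" and ck': "continuous_on {0..l} (kink' l d b)"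
    unfolding kink_def[abs_def] kink'_def[abs_def] using d by (intro continuous_intros edist_cont bump_cont; simp)+
  have Lk: "k \<in> L2_int l" unfolding k_def[abs_def] esupp_def using d
    by (intro L2_int_indicator_mult continuous_intros edist_cont) auto
  let ?S = "{if b then l - d else d}"
  have e2: "esgn b * esgn b = 1" by (simp add: esgn_def)
  have der: "(kink l d b has_real_derivative kink' l d b x) (at x) \<and> (kink' l d b has_real_derivative k x) (at x)"
    if x: "x \<in> {0<..<l} - ?S" for x
  proof -
    have x': "x \<in> {0..l}" "?s x \<noteq> d" using x unfolding esupp_exception by auto
    consider (1) "?s x < d" | (2) "d < ?s x" using x' by linarith
    then show ?thesis
    proof cases
      case 1
      note dB = bump_deriv_inside[OF d(1) 1] and ds = edist_deriv[of l b x]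
      have B: "?B x = 1 - ?s x / d" using bump_range(4)[OF d(1) x'(1), of b] 1 by simp
      have r1: "(kink l d b has_real_derivative kink' l d b x) (at x)"
        unfolding kink_def[abs_def]
        by (rule DERIV_cong[OF DERIV_mult[OF ds DERIV_power[OF dB, of 2]]])
          (simp add: kink'_def algebra_simps)
      have "(kink' l d b has_real_derivative
          esgn b * (2 * ?B x * (- esgn b / d) - (2 * (esgn b / d) * ?B x + (2 * (?s x / d)) * (- esgn b / d)))) (at x)"
        unfolding kink'_def[abs_def]
        by (rule DERIV_cong[OF DERIV_cmult[OF DERIV_diff[OF DERIV_power[OF dB, of 2]
            DERIV_mult[OF DERIV_cmult[OF DERIV_cdivide[OF ds, of d], of 2] dB]], of "esgn b"]])
          (simp add: algebra_simps)
      also have "esgn b * (2 * ?B x * (- esgn b / d) - (2 * (esgn b / d) * ?B x + (2 * (?s x / d)) * (- esgn b / d)))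
         = (esgn b * esgn b) * (2 * (?s x / d) / d - 4 * ?B x / d)"
        by (simp add: algebra_simps)
      also have "\<dots> = 2 * (?s x / d) / d - 4 * (1 - ?s x / d) / d" unfolding e2 B by simp
      also have "\<dots> = 6 * ?s x / d\<^sup>2 - 4 / d" by (simp add: power2_eq_square diff_divide_distrib right_diff_distrib)
      also have "\<dots> = k x" using edist_cases(3)[OF x'(1), of d b] 1 by (simp add: k_def)
      finally show ?thesis using r1 by simp
    next
      case 2
      have z: "?B x = 0" using bump_outside(3)[OF d(1) 2 bump_outside(2)[OF d(1) 2]] by simp
      have "(kink l d b has_real_derivative 0) (at x)"
        by (rule has_field_derivative_transform_within_open[OF _ bump_outside(1,2)[OF d(1) 2]])
          (use bump_outside(3)[OF d(1) 2] in \<open>auto simp: kink_def\<close>)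
      moreover have "(kink' l d b has_real_derivative 0) (at x)"
        by (rule has_field_derivative_transform_within_open[OF _ bump_outside(1,2)[OF d(1) 2]])
          (use bump_outside(3)[OF d(1) 2] in \<open>auto simp: kink'_def\<close>)
      ultimately show ?thesis using edist_cases(3)[OF x'(1), of d b] 2 z by (simp add: k_def kink'_def)
    qed
  qed
  have p1: "prim l (kink l d b) (kink' l d b)"
    by (rule prim_derivative[OF ck L2_int_continuous[OF ck'], of ?S]) (use der in auto)
  have p2: "prim l (kink' l d b) k"
    by (rule prim_derivative[OF ck' Lk, of ?S]) (use der in auto)
  let ?c = "if b then l - d else 0" and ?d = "if b then l else d"
  have s: "0 \<le> ?c" "?c \<le> ?d" "?d \<le> l" "?d - ?c = d" using d by auto
  have sup: "\<bar>kink l d b x\<bar> \<le> d * indicator {?c..?d} x \<and> \<bar>kink' l d b x\<bar> \<le> 2 * indicator {?c..?d} x \<and> \<bar>k x\<bar> \<le> 6 / d * indicator {?c..?d} x"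
    if x: "x \<in> {0..l}" for x
  proof (cases "?s x \<le> d")
    case True
    \<comment> \<open>Rescaling to [0, 1] reduces the bounds to the fixed profile t (1 -
      t)^2.\<close>
    define t where "t = ?s x / d"
    have t: "0 \<le> t" "t \<le> 1" using True d edist_cases(1)[OF x, of b] by (auto simp: t_def)
    have sx: "?s x = d * t" using d by (simp add: t_def)
    have B: "?B x = 1 - t" using bump_range(4)[OF d(1) x True] by (simp add: t_def)
    have i: "indicator {?c..?d} x = (1::real)" using edist_cases(3)[OF x, of d b] True by (simp add: esupp_def)
    have t2: "(1 - t)\<^sup>2 \<le> 1" using t by (simp add: power_le_one)
    have "\<bar>kink l d b x\<bar> = d * (t * (1 - t)\<^sup>2)" using t d by (simp add: kink_def B sx abs_mult)
    also have "\<dots> \<le> d * 1" using t t2 d by (intro mult_left_mono mult_le_one) auto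
    finally have 1: "\<bar>kink l d b x\<bar> \<le> d" by simp
    have tt: "0 \<le> t * (1 - t)" "t * (1 - t) \<le> 1" using t by (auto intro: mult_le_one)
    have "\<bar>kink' l d b x\<bar> = \<bar>(1 - t)\<^sup>2 - 2 * (t * (1 - t))\<bar>"
      by (simp add: kink'_def B t_def[symmetric] abs_mult esgn_def)
    also have "\<dots> \<le> 2" using t2 tt zero_le_power2[of "1 - t"] by linarith
    finally have 2: "\<bar>kink' l d b x\<bar> \<le> 2" .
    have "k x = (6 * t - 4) / d" using edist_cases(3)[OF x, of d b] True d
      by (simp add: k_def sx power2_eq_square diff_divide_distrib)
    then have "\<bar>k x\<bar> = \<bar>6 * t - 4\<bar> / d" using d by simp
    also have "\<dots> \<le> 6 / d" using t d by (intro divide_right_mono) auto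
    finally have "\<bar>k x\<bar> \<le> 6 / d" .
    with 1 2 i show ?thesis by simp
  next
    case False
    then have "?B x = 0" using bump_range(3)[OF d(1) x, of b] by simp
    moreover have "x \<notin> esupp l d b" using edist_cases(3)[OF x, of d b] False by simp
    ultimately show ?thesis using d by (auto simp: kink_def kink'_def k_def indicator_def)
  qed
  have "nsq l (kink l d b) \<le> d\<^sup>2 * (?d - ?c)"
    by (rule nsq_le_indicator[OF L2_int_continuous[OF ck] s(1-3)]) (use sup in blast)
  moreover have "nsq l (kink' l d b) \<le> 2\<^sup>2 * (?d - ?c)"
    by (rule nsq_le_indicator[OF L2_int_continuous[OF ck'] s(1-3)]) (use sup in blast)
  moreover have "nsq l k \<le> (6 / d)\<^sup>2 * (?d - ?c)"
    by (rule nsq_le_indicator[OF Lk s(1-3)]) (use sup in blast)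
  ultimately have "nsq l (kink l d b) \<le> d ^ 3 \<and> nsq l (kink' l d b) \<le> 4 * d \<and> nsq l k \<le> 36 / d"
    unfolding s(4) using d by (simp add: power2_eq_square power3_eq_cube power_divide)
  with p1 p2 show ?thesis by blast
qed

lemma bump_values:
  assumes "0 < d" "d \<le> l"
  shows "bump l d b (if b then l else 0) = 1" "bump l d b (if b then 0 else l) = 0"
    "kink l d b (if b then l else 0) = 0" "kink l d b (if b then 0 else l) = 0"
    "kink' l d b (if b then l else 0) = esgn b" "kink' l d b (if b then 0 else l) = 0"
  using assms by (auto simp: bump_def kink_def kink'_def edist_def field_simps)

text \<open>The sup bound with window length l / 2^j. This is the trace type inequality required of
  the correction functionals.\<close>

lemma prim_trace_bound:
  assumes p: "prim l h g" and l: "0 < l" and x: "x \<in> {0..l}"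
  shows "(h x)\<^sup>2 \<le> (2 / l + 2 * l) * (2 ^ j * nsq l h + nsq l g / 2 ^ j)"
proof -
  have s: "0 < l / 2 ^ j" "l / 2 ^ j \<le> l" using l by (simp_all add: field_simps)
  have "(h x)\<^sup>2 \<le> 2 / (l / 2 ^ j) * nsq l h + 2 * (l / 2 ^ j) * nsq l g" by (rule prim_sup_bound[OF p s x])
  also have "\<dots> = 2 / l * (2 ^ j * nsq l h) + 2 * l * (nsq l g / 2 ^ j)" by simp
  also have "\<dots> \<le> (2 / l + 2 * l) * (2 ^ j * nsq l h) + (2 / l + 2 * l) * (nsq l g / 2 ^ j)"
    using l by (intro add_mono mult_right_mono) auto
  finally show ?thesis by (simp add: distrib_left)
qed

text \<open>Above the critical exponent the squared trace increments are bounded by a multiple of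
  \<open>(4 powr \<theta> / 2) ^ -j\<close>, hence the increments by r^j with r < 1, uniformly in x.
  The map \<open>R\<close> stands for restriction to an edge in the couple (L2, H^1) and for the
  derivative on an edge in the couple (H^1, H^2).\<close>

lemma dyadic_edge_limit:
  fixes R :: "('p \<Rightarrow> real) \<Rightarrow> real \<Rightarrow> real"
  assumes X: "couple X0 X1" and \<theta>: "1/2 < \<theta>" "\<theta> < 1" and D: "dyadic_rep X0 X1 \<theta> \<phi> \<psi> S" and l: "0 < l"
    and R0: "\<And>u. u \<in> fs_carrier X0 \<Longrightarrow> R u \<in> L2_int l \<and> nsq l (R u) \<le> fs_sq X0 u"
    and R1: "\<And>u. u \<in> fs_carrier X1 \<Longrightarrow> R u \<in> sobolev_int l 1 \<and> nsq l (wderiv l (R u)) \<le> fs_sq X1 u"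
    and Rd: "\<And>u v. u \<in> fs_carrier X0 \<Longrightarrow> v \<in> fs_carrier X0 \<Longrightarrow> AE x in leb l. R (\<lambda>p. u p - v p) x = R u x - R v x"
  defines "r \<equiv> 1 / sqrt (4 powr \<theta> / 2)"
  shows "0 < r" "r < 1"
    "\<exists>k. continuous_on {0..l} k \<and> (AE x in leb l. R \<phi> x = k x) \<and>
      (\<forall>j. \<forall>x\<in>{0..l}. \<bar>k x - trace_int l (R (\<psi> j)) x\<bar> \<le> sqrt (20 * (2 / l + 2 * l) * S) * r ^ j / (1 - r))"
proof -
  have \<theta>': "0 < \<theta>" using \<theta> by simp
  define \<rho> where "\<rho> = (4::real) powr \<theta> / 2"
  have \<rho>: "1 < \<rho>" using half_weight(3)[OF \<theta>' \<theta>(2,1)] by (simp add: \<rho>_def)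
  show r: "0 < r" "r < 1" using \<rho> by (auto simp: r_def \<rho>_def[symmetric])
  note D' = dyadic_repD[OF D]
  define c where "c = 2 / l + 2 * l"
  have c: "0 \<le> c" using l by (simp add: c_def)
  let ?tr = "\<lambda>u. trace_int l (R u)"
  have P: "prim l (?tr u) (wderiv l (R u))" and Pae: "AE x in leb l. R u x = ?tr u x"
    if "u \<in> fs_carrier X1" for u
    using sobolev_1D(3,4)[OF conjunct1[OF R1[OF that]] l] by auto
  have inc: "\<bar>?tr (\<psi> (Suc j)) x - ?tr (\<psi> j) x\<bar> \<le> sqrt (20 * c * S) * r ^ j" if x: "x \<in> {0..l}" for j x
  proof -
    have "\<rho> ^ j * (?tr (\<psi> (Suc j)) x - ?tr (\<psi> j) x)\<^sup>2 \<le> 20 * c * S"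
      unfolding \<rho>_def
    proof (rule dyadic_trace_diff(2)[OF X \<theta>' \<theta>(2) D c, of "\<lambda>u. ?tr u x"])
      fix u j assume u: "u \<in> fs_carrier X1"
      have "(?tr u x)\<^sup>2 \<le> c * (2 ^ j * nsq l (?tr u) + nsq l (wderiv l (R u)) / 2 ^ j)"
        unfolding c_def by (rule prim_trace_bound[OF P[OF u] l x])
      also have "nsq l (?tr u) = nsq l (R u)" by (rule nsq_trace[OF conjunct1[OF R1[OF u]] l])
      also have "c * (2 ^ j * nsq l (R u) + nsq l (wderiv l (R u)) / 2 ^ j) \<le> c * (2 ^ j * fs_sq X0 u + fs_sq X1 u / 2 ^ j)"
        using R0[OF coupleD(3)[OF X u]] R1[OF u] c by (intro mult_left_mono add_mono divide_right_mono) auto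
      finally show "(?tr u x)\<^sup>2 \<le> c * (2 ^ j * fs_sq X0 u + fs_sq X1 u / 2 ^ j)" .
    next
      fix u v assume u: "u \<in> fs_carrier X1" and v: "v \<in> fs_carrier X1"
      show "?tr (\<lambda>p. u p - v p) x = ?tr u x - ?tr v x"
      proof (rule trace_int_eq[OF prim_continuous[OF prim_diff[OF P[OF u] P[OF v]]] _ l x])
        show "AE x in leb l. R (\<lambda>p. u p - v p) x = ?tr u x - ?tr v x"
          using Rd[OF coupleD(3)[OF X u] coupleD(3)[OF X v]] Pae[OF u] Pae[OF v] by eventually_elim simp
      qed
    qed
    then have "(?tr (\<psi> (Suc j)) x - ?tr (\<psi> j) x)\<^sup>2 \<le> 20 * c * S / \<rho> ^ j" using \<rho> by (simp add: field_simps)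
    from real_sqrt_le_mono[OF this]
    have "\<bar>?tr (\<psi> (Suc j)) x - ?tr (\<psi> j) x\<bar> \<le> sqrt (20 * c * S / \<rho> ^ j)"
      by (simp only: real_sqrt_abs)
    also have "\<dots> = sqrt (20 * c * S) * r ^ j"
      by (simp only: r_def \<rho>_def[symmetric] real_sqrt_divide real_sqrt_power power_divide power_one times_divide_eq_right mult_1_right)
    finally show ?thesis .
  qed
  have \<phi>: "\<phi> \<in> fs_carrier X0"
    using quad_space_add(1)[OF coupleD(1)[OF X] D'(2)[of 0] coupleD(3)[OF X D'(1)[of 0]]] by simp
  have lim: "(\<lambda>j. nsq l (\<lambda>x. R \<phi> x - ?tr (\<psi> j) x)) \<longlonglongrightarrow> 0"
  proof (rule Lim_null_comparison[OF always_eventually[OF allI]])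
    have "1 < (4::real) powr \<theta>" using weight_bounds(1)[OF \<theta>' \<theta>(2)] .
    then have "(\<lambda>j. S * (1 / 4 powr \<theta>) ^ j) \<longlonglongrightarrow> S * 0"
      by (intro tendsto_intros LIMSEQ_realpow_zero) auto
    then show "(\<lambda>j. S * (1 / 4 powr \<theta>) ^ j) \<longlonglongrightarrow> 0" by simp
    fix j
    have "AE x in leb l. R (\<lambda>p. \<phi> p - \<psi> j p) x = R \<phi> x - ?tr (\<psi> j) x"
      using Rd[OF \<phi> coupleD(3)[OF X D'(1)[of j]]] Pae[OF D'(1)[of j]] by eventually_elim simp
    then have "nsq l (\<lambda>x. R \<phi> x - ?tr (\<psi> j) x) = nsq l (R (\<lambda>p. \<phi> p - \<psi> j p))"
      by (rule nsq_cong_AE[OF conjunct1[OF R0[OF D'(2)]]])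
    also have "\<dots> \<le> fs_sq X0 (\<lambda>p. \<phi> p - \<psi> j p)" using R0[OF D'(2)] by blast
    also have "\<dots> \<le> dyadic_term X0 X1 \<phi> \<psi> j" by (simp add: dyadic_term_def)
    also have "\<dots> \<le> S / (4 powr \<theta>) ^ j" using D'(4)[of j] by (simp add: field_simps)
    finally show "norm (nsq l (\<lambda>x. R \<phi> x - ?tr (\<psi> j) x)) \<le> S * (1 / 4 powr \<theta>) ^ j"
      by (simp add: power_one_over)
  qed
  show "\<exists>k. continuous_on {0..l} k \<and> (AE x in leb l. R \<phi> x = k x) \<and>
      (\<forall>j. \<forall>x\<in>{0..l}. \<bar>k x - ?tr (\<psi> j) x\<bar> \<le> sqrt (20 * (2 / l + 2 * l) * S) * r ^ j / (1 - r))"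
  proof (rule continuous_rep_of_limit[where h = "\<lambda>n. ?tr (\<psi> n)" and f = "R \<phi>" and r = r and D = "sqrt (20 * c * S)" and l = l])
    show "continuous_on {0..l} (?tr (\<psi> n))" for n by (rule prim_continuous[OF P[OF D'(1)]])
    show "0 \<le> r" "r < 1" using r by simp_all
    show "\<bar>?tr (\<psi> (Suc n)) x - ?tr (\<psi> n) x\<bar> \<le> sqrt (20 * c * S) * r ^ n" if "x \<in> {0..l}" for n x
      by (rule inc[OF that])
    show "R \<phi> \<in> L2_int l" using R0[OF \<phi>] by (rule conjunct1)
    show "(\<lambda>n. nsq l (\<lambda>x. R \<phi> x - ?tr (\<psi> n) x)) \<longlonglongrightarrow> 0" by (rule lim)
    fix k assume k: "continuous_on {0..l} k" "AE x in leb l. R \<phi> x = k x"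
      "\<And>n x. x \<in> {0..l} \<Longrightarrow> \<bar>k x - ?tr (\<psi> n) x\<bar> \<le> sqrt (20 * c * S) * r ^ n / (1 - r)"
    have "\<forall>j. \<forall>x\<in>{0..l}. \<bar>k x - ?tr (\<psi> j) x\<bar> \<le> sqrt (20 * (2 / l + 2 * l) * S) * r ^ j / (1 - r)"
      by (intro allI ballI k(3)[unfolded c_def])
    with k(1,2) show ?thesis by (intro exI conjI)
  qed
qed

context compact_graph
begin

section \<open>Vertex conditions\<close>

text \<open>An edge end \<open>(e, b)\<close> is the end \<open>0\<close> or \<open>len e\<close> of the edge \<open>e\<close> according to \<open>b\<close>.\<close>
definition ends :: "('e \<times> bool) set" where "ends = edges G \<times> UNIV"
definition pos :: "'e \<times> bool \<Rightarrow> real" where "pos p = (if snd p then len G (fst p) else 0)"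
definition vt :: "'e \<times> bool \<Rightarrow> 'v" where "vt p = (if snd p then tgt G (fst p) else src G (fst p))"
text \<open>A reference end at each vertex. Continuity means that every end agrees with the
  reference end of its vertex, which turns it into the finitely many linear conditions
  \<open>mis p u = 0\<close>.\<close>

definition rp :: "'v \<Rightarrow> 'e \<times> bool" where "rp v = (SOME q. q \<in> ends \<and> vt q = v)"
definition trp :: "(('v, 'e) point \<Rightarrow> real) \<Rightarrow> 'e \<times> bool \<Rightarrow> real" where "trp u p = tr u (fst p) (pos p)"
definition mis :: "'e \<times> bool \<Rightarrow> (('v, 'e) point \<Rightarrow> real) \<Rightarrow> real" where "mis p u = trp u p - trp u (rp (vt p))"
definition dn :: "(('v, 'e) point \<Rightarrow> real) \<Rightarrow> 'e \<times> bool \<Rightarrow> real" where "dn u p = esgn (snd p) * dtr u (fst p) (pos p)"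
definition single :: "'e \<Rightarrow> (real \<Rightarrow> real) \<Rightarrow> ('v, 'e) point \<Rightarrow> real" where
  "single e0 h = glue (\<lambda>_. 0) (\<lambda>e x. if e = e0 then h x else 0)"
definition hat :: "'e \<times> bool \<Rightarrow> nat \<Rightarrow> ('v, 'e) point \<Rightarrow> real" where
  "hat p j = single (fst p) (bump (len G (fst p)) (len G (fst p) / 2 ^ j) (snd p))"
definition kir :: "'e \<times> bool \<Rightarrow> nat \<Rightarrow> ('v, 'e) point \<Rightarrow> real" where
  "kir p j = single (fst p) (kink (len G (fst p)) (len G (fst p) / 2 ^ j) (snd p))"

lemma fin_ends: "finite ends" by (simp add: ends_def fin_E)

lemma endsD: "p \<in> ends \<Longrightarrow> fst p \<in> edges G" by (auto simp: ends_def)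

lemma pos_in: assumes "p \<in> ends" shows "pos p \<in> {0..len G (fst p)}"
  using edgeD(1)[OF endsD[OF assms]] by (simp add: pos_def)

lemma rp: assumes "p \<in> ends" shows "rp (vt p) \<in> ends" "vt (rp (vt p)) = vt p"
  using someI[of "\<lambda>q. q \<in> ends \<and> vt q = vt p" p] assms by (auto simp: rp_def)

lemma single_H1:
  assumes e0: "e0 \<in> edges G" and p: "prim (len G e0) h g"
  shows "single e0 h \<in> fs_carrier H1t" "fs_sq L2G (single e0 h) = nsq (len G e0) h"
    "fs_sq H1t (single e0 h) = nsq (len G e0) h + nsq (len G e0) g"
    "e \<in> edges G \<Longrightarrow> x \<in> {0..len G e} \<Longrightarrow> tr (single e0 h) e x = (if e = e0 then h x else 0)"
proof -
  let ?h = "\<lambda>e x. if e = e0 then h x else 0" and ?g = "\<lambda>e x. if e = e0 then g x else 0"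
  have P: "prim (len G e) (?h e) (?g e)" for e using p prim_const[of _ 0] by (cases "e = e0") auto
  have A: "AE x in leb (len G e). restr G (single e0 h) e x = ?h e x" for e
    unfolding single_def by (rule AE_restr_glue)
  note I = H1I[of ?h ?g, OF P A]
  show "single e0 h \<in> fs_carrier H1t" by (rule I(1))
  show "tr (single e0 h) e x = (if e = e0 then h x else 0)" if "e \<in> edges G" "x \<in> {0..len G e}" using I(3)[OF that] .
  have n0: "nsq (len G e) (restr G (single e0 h) e) = (if e = e0 then nsq (len G e0) h else 0)" for e
  proof -
    have "AE x in leb (len G e). ?h e x = restr G (single e0 h) e x" using A[of e] by eventually_elim simp
    then have "nsq (len G e) (restr G (single e0 h) e) = nsq (len G e) (?h e)" by (rule nsq_cong_AE[OF prim_L2[OF P]])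
    then show ?thesis by (simp add: nsq_def)
  qed
  have n1: "nsq (len G e) (wd (single e0 h) e) = (if e = e0 then nsq (len G e0) g else 0)" if "e \<in> edges G" for e
  proof -
    have "AE x in leb (len G e). ?g e x = wd (single e0 h) e x" using I(2)[OF that] by eventually_elim simp
    then have "nsq (len G e) (wd (single e0 h) e) = nsq (len G e) (?g e)" by (rule nsq_cong_AE[OF primD(1)[OF P]])
    then show ?thesis by (simp add: nsq_def)
  qed
  show "fs_sq L2G (single e0 h) = nsq (len G e0) h"
    unfolding L2G_norm_sq n0 using e0 fin_E by (simp add: sum.delta')
  show "fs_sq H1t (single e0 h) = nsq (len G e0) h + nsq (len G e0) g"
    unfolding H1t_norm_sq n0 sum.distrib using e0 fin_E by (simp add: n1 sum.delta' cong: sum.cong)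
qed

lemma single_H2:
  assumes e0: "e0 \<in> edges G" and p: "prim (len G e0) h g" and q: "prim (len G e0) g k"
  shows "single e0 h \<in> fs_carrier H2t"
    "fs_sq H2t (single e0 h) = nsq (len G e0) h + nsq (len G e0) g + nsq (len G e0) k"
    "e \<in> edges G \<Longrightarrow> x \<in> {0..len G e} \<Longrightarrow> dtr (single e0 h) e x = (if e = e0 then g x else 0)"
proof -
  let ?h = "\<lambda>e x. if e = e0 then h x else 0" and ?g = "\<lambda>e x. if e = e0 then g x else 0" and ?k = "\<lambda>e x. if e = e0 then k x else 0"
  have P: "prim (len G e) (?h e) (?g e)" for e using p prim_const[of _ 0] by (cases "e = e0") auto
  have Q: "prim (len G e) (?g e) (?k e)" for e using q prim_const[of _ 0] by (cases "e = e0") auto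
  have A: "AE x in leb (len G e). restr G (single e0 h) e x = ?h e x" for e
    unfolding single_def by (rule AE_restr_glue)
  note I = H2I[of ?h ?g ?k, OF P Q A]
  show "single e0 h \<in> fs_carrier H2t" by (rule I(1))
  show "dtr (single e0 h) e x = (if e = e0 then g x else 0)" if "e \<in> edges G" "x \<in> {0..len G e}" using I(3)[OF that] .
  have n2: "nsq (len G e) (wdd (single e0 h) e) = (if e = e0 then nsq (len G e0) k else 0)" if "e \<in> edges G" for e
  proof -
    have "AE x in leb (len G e). ?k e x = wdd (single e0 h) e x" using I(2)[OF that] by eventually_elim simp
    then have "nsq (len G e) (wdd (single e0 h) e) = nsq (len G e) (?k e)" by (rule nsq_cong_AE[OF primD(1)[OF Q]])
    then show ?thesis by (simp add: nsq_def)
  qed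
  have "fs_sq H2t (single e0 h) = fs_sq H1t (single e0 h) + (\<Sum>e\<in>edges G. nsq (len G e) (wdd (single e0 h) e))"
    unfolding H2t_norm_sq H1t_norm_sq sum.distrib by simp
  also have "(\<Sum>e\<in>edges G. nsq (len G e) (wdd (single e0 h) e)) = nsq (len G e0) k"
    using e0 fin_E by (simp add: n2 sum.delta' cong: sum.cong)
  finally show "fs_sq H2t (single e0 h) = nsq (len G e0) h + nsq (len G e0) g + nsq (len G e0) k"
    using single_H1(3)[OF e0 p] by simp
qed

text \<open>One constant for all cutoff functions. The terms absorb d, 1 / d and d^3 for d = len /
  2^j, and 36 is the largest numerical factor, coming from the second derivative of
  \<open>kink\<close>.\<close>

definition cG :: real where "cG = (\<Sum>e\<in>edges G. 36 * (len G e + 1 / len G e + len G e ^ 3))"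

lemma cG: assumes "e \<in> edges G" shows "36 * (len G e + 1 / len G e + len G e ^ 3) \<le> cG" "0 \<le> cG"
proof -
  show "36 * (len G e + 1 / len G e + len G e ^ 3) \<le> cG"
    unfolding cG_def by (rule member_le_sum[OF assms _ fin_E]) (auto dest: edgeD(1))
  show "0 \<le> cG" unfolding cG_def by (intro sum_nonneg) (auto dest: edgeD(1))
qed

lemma cG_nonneg: "0 \<le> cG" unfolding cG_def by (intro sum_nonneg) (auto dest: edgeD(1))

lemma scaled_len:
  assumes "e \<in> edges G" shows "0 < len G e / 2 ^ j" "len G e / 2 ^ j \<le> len G e"
  using edgeD(1)[OF assms] by (simp_all add: field_simps)

text \<open>The support is no longer than the edge and the hat vanishes at the opposite end, so hats
  form a dual family for the traces at all edge ends, also on loops.\<close>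

lemma hat_props:
  assumes p: "p \<in> ends"
  shows "hat p j \<in> fs_carrier H1t" "fs_sq L2G (hat p j) \<le> cG / 2 ^ j" "fs_sq H1t (hat p j) \<le> cG * 2 ^ j"
    "q \<in> ends \<Longrightarrow> trp (hat p j) q = of_bool (q = p)"
proof -
  note e = endsD[OF p]
  let ?l = "len G (fst p)"
  define d where "d = ?l / 2 ^ j"
  have d: "0 < d" "d \<le> ?l" using scaled_len[OF e] by (simp_all add: d_def)
  note B = prim_bump[OF d, of "snd p"]
  note S = single_H1[OF e B(1), folded hat_def[of p j, folded d_def]]
  have l: "0 < ?l" by (rule edgeD(1)[OF e])
  have c: "?l \<le> cG" "1 / ?l + ?l \<le> cG"
  proof -
    have "0 \<le> 1 / ?l" "0 \<le> ?l ^ 3" using l by simp_all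
    then show "?l \<le> cG" "1 / ?l + ?l \<le> cG" using cG(1)[OF e] l unfolding distrib_left by linarith+
  qed
  show "hat p j \<in> fs_carrier H1t" by (rule S(1))
  have "fs_sq L2G (hat p j) \<le> ?l / 2 ^ j" unfolding S(2) d_def[symmetric] by (rule B(2))
  also have "\<dots> \<le> cG / 2 ^ j" using c(1) by (rule divide_right_mono) simp
  finally show "fs_sq L2G (hat p j) \<le> cG / 2 ^ j" .
  have "fs_sq H1t (hat p j) \<le> d + 1 / d" unfolding S(3) using B(2,3) by linarith
  also have "\<dots> \<le> ?l * 2 ^ j + 1 / ?l * 2 ^ j"
  proof (rule add_mono)
    have "?l * 1 \<le> ?l * 2 ^ j" using l by (intro mult_left_mono) auto
    then show "d \<le> ?l * 2 ^ j" using d(2) by simp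
  qed (simp add: d_def)
  also have "\<dots> = (1 / ?l + ?l) * 2 ^ j" by (simp add: distrib_right)
  also have "\<dots> \<le> cG * 2 ^ j" using c(2) by (rule mult_right_mono) simp
  finally show "fs_sq H1t (hat p j) \<le> cG * 2 ^ j" .
  assume q: "q \<in> ends"
  have "trp (hat p j) q = (if fst q = fst p then bump ?l d (snd p) (pos q) else 0)"
    unfolding trp_def by (rule S(4)[OF endsD[OF q] pos_in[OF q]])
  also have "\<dots> = of_bool (q = p)"
    using bump_values(1,2)[OF d, of "snd p"] by (cases "snd p"; cases "snd q") (auto simp: pos_def prod_eq_iff)
  finally show "trp (hat p j) q = of_bool (q = p)" .
qed

text \<open>At scale 0 the hat is affine on its whole edge and its second derivative vanishes. This
  makes the correction at scale 0 usable in H^2.\<close>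

lemma hat0_H2: assumes p: "p \<in> ends" shows "hat p 0 \<in> fs_carrier H2t" "fs_sq H2t (hat p 0) \<le> cG"
proof -
  note e = endsD[OF p]
  let ?l = "len G (fst p)"
  have l: "0 < ?l" by (rule edgeD(1)[OF e])
  let ?h = "bump ?l ?l (snd p)" and ?g = "\<lambda>x::real. - esgn (snd p) / ?l"
  have 1: "prim ?l ?h ?g"
  proof (rule prim_derivative[of _ _ _ "{}"])
    show "continuous_on {0..?l} ?h" using l by (intro bump_cont) simp
    fix x assume x: "x \<in> {0<..<?l} - {}"
    then have "edist ?l (snd p) x < ?l" by (auto simp: edist_def)
    then show "(?h has_real_derivative - esgn (snd p) / ?l) (at x)" by (rule bump_deriv_inside[OF l])
  qed auto
  have 2: "prim ?l ?g (\<lambda>x. 0)" by (rule prim_const)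
  have eq: "hat p 0 = single (fst p) ?h" by (simp add: hat_def)
  show "hat p 0 \<in> fs_carrier H2t" unfolding eq by (rule single_H2(1)[OF e 1 2])
  have "fs_sq H2t (hat p 0) = fs_sq H1t (hat p 0)"
    unfolding eq single_H2(2)[OF e 1 2] single_H1(3)[OF e 1] by (simp add: nsq_def)
  then show "fs_sq H2t (hat p 0) \<le> cG" using hat_props(3)[OF p, of 0] by simp
qed

text \<open>The kinks vanish at both ends, so adding them changes the end derivatives while leaving
  continuity untouched; on the end derivatives they act as a dual family.\<close>

lemma kir_props:
  assumes p: "p \<in> ends"
  shows "kir p j \<in> fs_carrier H2C" "fs_sq H1t (kir p j) \<le> cG / 2 ^ j" "fs_sq H2t (kir p j) \<le> cG * 2 ^ j"
    "q \<in> ends \<Longrightarrow> dn (kir p j) q = of_bool (q = p)"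
proof -
  note e = endsD[OF p]
  let ?l = "len G (fst p)"
  define d where "d = ?l / 2 ^ j"
  have d: "0 < d" "d \<le> ?l" using scaled_len[OF e] by (simp_all add: d_def)
  obtain k where k: "prim ?l (kink ?l d (snd p)) (kink' ?l d (snd p))" "prim ?l (kink' ?l d (snd p)) k"
    "nsq ?l (kink ?l d (snd p)) \<le> d ^ 3" "nsq ?l (kink' ?l d (snd p)) \<le> 4 * d" "nsq ?l k \<le> 36 / d"
    using prim_kink[OF d, of "snd p"] by auto
  note K1 = single_H1[OF e k(1), folded kir_def[of p j, folded d_def]]
  note K2 = single_H2[OF e k(1,2), folded kir_def[of p j, folded d_def]]
  have l: "0 < ?l" by (rule edgeD(1)[OF e])
  have tz: "tr (kir p j) e' (pos (e', b)) = 0" if "e' \<in> edges G" for e' b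
  proof -
    have q: "(e', b) \<in> ends" using that by (simp add: ends_def)
    have "tr (kir p j) e' (pos (e', b)) = (if e' = fst p then kink ?l d (snd p) (pos (e', b)) else 0)"
      using K1(4)[OF that] pos_in[OF q] by simp
    also have "\<dots> = 0"
      using bump_values(3,4)[OF d, of "snd p"] by (cases "snd p"; cases b) (auto simp: pos_def)
    finally show ?thesis .
  qed
  have "kir p j \<in> cont_space G"
    unfolding H1_cont_iff[OF K1(1)] by (rule exI[of _ "\<lambda>_. 0"]) (use tz[of _ False] tz[of _ True] in \<open>auto simp: pos_def\<close>)
  then show "kir p j \<in> fs_carrier H2C" using K2(1) by simp
  have dd: "d ^ 3 \<le> ?l ^ 3 / 2 ^ j"
  proof -
    have "d\<^sup>2 \<le> ?l\<^sup>2" using d by (intro power_mono) auto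
    then have "d * d\<^sup>2 \<le> d * ?l\<^sup>2" using d by (intro mult_left_mono) auto
    then show ?thesis by (simp add: d_def power2_eq_square power3_eq_cube)
  qed
  have c1: "?l ^ 3 + 4 * ?l \<le> cG" and c2: "?l ^ 3 + 4 * ?l + 36 / ?l \<le> cG"
  proof -
    have "0 \<le> 1 / ?l" "0 \<le> ?l ^ 3" using l by simp_all
    moreover have eq: "36 / ?l = 36 * (1 / ?l)" by simp
    ultimately show "?l ^ 3 + 4 * ?l \<le> cG" "?l ^ 3 + 4 * ?l + 36 / ?l \<le> cG"
      using cG(1)[OF e] l unfolding eq distrib_left by linarith+
  qed
  have n1: "fs_sq H1t (kir p j) \<le> (?l ^ 3 + 4 * ?l) / 2 ^ j"
    unfolding K1(3) add_divide_distrib using k(3,4) dd by (simp add: d_def)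
  also have "\<dots> \<le> cG / 2 ^ j" using c1 by (rule divide_right_mono) simp
  finally show "fs_sq H1t (kir p j) \<le> cG / 2 ^ j" .
  have "fs_sq H2t (kir p j) \<le> (?l ^ 3 + 4 * ?l) / 2 ^ j + 36 / d"
    using n1 k(5) unfolding K2(2) K1(3) by linarith
  also have "\<dots> \<le> (?l ^ 3 + 4 * ?l) * 2 ^ j + 36 / ?l * 2 ^ j"
  proof (rule add_mono)
    have "0 \<le> ?l ^ 3 + 4 * ?l" using l by simp
    moreover have "(1::real) \<le> 2 ^ j" by simp
    ultimately have "(?l ^ 3 + 4 * ?l) / 2 ^ j \<le> (?l ^ 3 + 4 * ?l) / 1" "(?l ^ 3 + 4 * ?l) * 1 \<le> (?l ^ 3 + 4 * ?l) * 2 ^ j"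
      by (intro divide_left_mono mult_left_mono; simp)+
    then show "(?l ^ 3 + 4 * ?l) / 2 ^ j \<le> (?l ^ 3 + 4 * ?l) * 2 ^ j" by linarith
  qed (simp add: d_def)
  also have "\<dots> = (?l ^ 3 + 4 * ?l + 36 / ?l) * 2 ^ j" by (simp add: distrib_right)
  also have "\<dots> \<le> cG * 2 ^ j" using c2 by (rule mult_right_mono) simp
  finally show "fs_sq H2t (kir p j) \<le> cG * 2 ^ j" .
  assume q: "q \<in> ends"
  have "dn (kir p j) q = esgn (snd q) * (if fst q = fst p then kink' ?l d (snd p) (pos q) else 0)"
    unfolding dn_def using K2(3)[OF endsD[OF q] pos_in[OF q]] by simp
  also have "\<dots> = of_bool (q = p)"
    using bump_values(5,6)[OF d, of "snd p"] by (cases "snd p"; cases "snd q") (auto simp: pos_def prod_eq_iff esgn_def)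
  finally show "dn (kir p j) q = of_bool (q = p)" .
qed

section \<open>Correction of mismatched vertex values\<close>

lemma tr_sum:
  assumes I: "finite I" and E: "\<And>i. i \<in> I \<Longrightarrow> E i \<in> fs_carrier H1t" and e: "e \<in> edges G" "x \<in> {0..len G e}"
  shows "tr (\<lambda>p. \<Sum>i\<in>I. c i * E i p) e x = (\<Sum>i\<in>I. c i * tr (E i) e x)"
  using I E
proof (induction I)
  case empty
  have "tr (\<lambda>p. 0) e x = 0" using H1I(3)[of "\<lambda>_ _. 0" "\<lambda>_ _. 0" "\<lambda>p. 0", OF prim_const _ e] by (simp add: restr_def)
  then show ?case by simp
next
  case (insert i I)
  have s: "(\<lambda>p. \<Sum>i\<in>I. c i * E i p) \<in> fs_carrier H1t" using quad_space_sum[OF quad_Ht, of 1 I E c] insert by auto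
  show ?case using H1_lin(2)[OF _ s e, of "E i" "c i" 1] insert by simp
qed

lemma dtr_sum:
  assumes I: "finite I" and E: "\<And>i. i \<in> I \<Longrightarrow> E i \<in> fs_carrier H2t" and e: "e \<in> edges G" "x \<in> {0..len G e}"
  shows "dtr (\<lambda>p. \<Sum>i\<in>I. c i * E i p) e x = (\<Sum>i\<in>I. c i * dtr (E i) e x)"
  using I E
proof (induction I)
  case empty
  have "dtr (\<lambda>p. 0) e x = 0" using H2I(3)[of "\<lambda>_ _. 0" "\<lambda>_ _. 0" "\<lambda>_ _. 0" "\<lambda>p. 0", OF prim_const prim_const _ e] by (simp add: restr_def)
  then show ?case by simp
next
  case (insert i I)
  have s: "(\<lambda>p. \<Sum>i\<in>I. c i * E i p) \<in> fs_carrier H2t" using quad_space_sum[OF quad_Ht, of 2 I E c] insert by auto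
  show ?case using H2_lin(2)[OF _ s e, of "E i" "c i" 1] insert by simp
qed

lemma tr_diff: "u \<in> fs_carrier H1t \<Longrightarrow> v \<in> fs_carrier H1t \<Longrightarrow> e \<in> edges G \<Longrightarrow> x \<in> {0..len G e} \<Longrightarrow>
    tr (\<lambda>p. u p - v p) e x = tr u e x - tr v e x"
  using H1_lin(2)[of u v e x 1 "-1"] by simp

lemma mis_diff:
  assumes p: "p \<in> ends" and u: "u \<in> fs_carrier H1t" and v: "v \<in> fs_carrier H1t"
  shows "mis p (\<lambda>p. u p - v p) = mis p u - mis p v"
  using tr_diff[OF u v endsD[OF p] pos_in[OF p]] tr_diff[OF u v endsD[OF rp(1)[OF p]] pos_in[OF rp(1)[OF p]]]
  by (simp add: mis_def trp_def)

lemma cont_iff_mis: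
  assumes u: "u \<in> fs_carrier H1t" shows "u \<in> cont_space G \<longleftrightarrow> (\<forall>p\<in>ends. mis p u = 0)"
proof
  assume "u \<in> cont_space G"
  then obtain val where val: "\<forall>e\<in>edges G. tr u e 0 = val (src G e) \<and> tr u e (len G e) = val (tgt G e)"
    using cont_spaceD by blast
  have "trp u p = val (vt p)" if "p \<in> ends" for p
    using val endsD[OF that] by (auto simp: trp_def pos_def vt_def)
  then show "\<forall>p\<in>ends. mis p u = 0" using rp by (simp add: mis_def)
next
  assume m: "\<forall>p\<in>ends. mis p u = 0"
  have "tr u e 0 = trp u (rp (src G e)) \<and> tr u e (len G e) = trp u (rp (tgt G e))" if "e \<in> edges G" for e
    using m[rule_format, of "(e, False)"] m[rule_format, of "(e, True)"] that
    by (simp add: mis_def ends_def vt_def trp_def pos_def)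
  then show "u \<in> cont_space G" unfolding H1_cont_iff[OF u] by (intro exI[of _ "\<lambda>v. trp u (rp v)"]) simp
qed

text \<open>After the correction every end carries the value of the reference end of its vertex;
  functions that already match are left unchanged.\<close>

definition correct :: "nat \<Rightarrow> (('v, 'e) point \<Rightarrow> real) \<Rightarrow> ('v, 'e) point \<Rightarrow> real" where
  "correct j u = (\<lambda>p. u p - (\<Sum>q\<in>ends. mis q u * hat q j p))"

lemma hat_sum_H1: "(\<lambda>p. \<Sum>q\<in>ends. c q * hat q j p) \<in> fs_carrier H1t"
  using quad_space_sum[OF quad_Ht fin_ends, of 1 "\<lambda>q. hat q j" c] hat_props(1) by auto

lemma correct_H1C:
  assumes u: "u \<in> fs_carrier H1t" shows "correct j u \<in> fs_carrier H1C"
proof -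
  let ?s = "\<lambda>p. \<Sum>q\<in>ends. mis q u * hat q j p"
  have H: "correct j u \<in> fs_carrier H1t"
    unfolding correct_def by (intro quad_space_diff quad_Ht u hat_sum_H1) simp
  have t: "trp (correct j u) p = trp u (rp (vt p))" if p: "p \<in> ends" for p
  proof -
    have "trp (correct j u) p = trp u p - trp ?s p"
      unfolding correct_def trp_def using p by (intro tr_diff u hat_sum_H1 endsD pos_in)
    also have "trp ?s p = (\<Sum>q\<in>ends. mis q u * trp (hat q j) p)"
      unfolding trp_def using p by (intro tr_sum fin_ends hat_props(1) endsD pos_in)
    also have "\<dots> = (\<Sum>q\<in>ends. if q = p then mis q u else 0)"
      using p by (intro sum.cong) (auto simp: hat_props(4))
    also have "\<dots> = mis p u" using p fin_ends by (simp add: sum.delta)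
    finally show ?thesis by (simp add: mis_def)
  qed
  have "\<forall>p\<in>ends. mis p (correct j u) = 0" using t rp by (simp add: mis_def)
  then show ?thesis using H cont_iff_mis[OF H] by simp
qed

definition cT :: real where "cT = (\<Sum>e\<in>edges G. 2 / len G e + 2 * len G e)"

lemma cT: "e \<in> edges G \<Longrightarrow> 2 / len G e + 2 * len G e \<le> cT" and cT_nonneg: "0 \<le> cT"
proof -
  have 0: "0 \<le> 2 / len G e + 2 * len G e" if "e \<in> edges G" for e using edgeD(1)[OF that] by simp
  show "e \<in> edges G \<Longrightarrow> 2 / len G e + 2 * len G e \<le> cT"
    unfolding cT_def by (rule member_le_sum[OF _ _ fin_E]) (use 0 in auto)
  show "0 \<le> cT" unfolding cT_def by (intro sum_nonneg 0)
qed

lemma edge_norm_le: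
  assumes e: "e \<in> edges G"
  shows "nsq (len G e) (restr G u e) \<le> fs_sq L2G u" "nsq (len G e) (wd u e) \<le> fs_sq H1t u"
    "nsq (len G e) (wdd u e) \<le> fs_sq H2t u"
proof -
  show "nsq (len G e) (restr G u e) \<le> fs_sq L2G u"
    unfolding L2G_norm_sq by (rule member_le_sum[OF e _ fin_E]) simp
  have "nsq (len G e) (restr G u e) + nsq (len G e) (wd u e) \<le> fs_sq H1t u"
    unfolding H1t_norm_sq by (rule member_le_sum[OF e _ fin_E]) simp
  then show "nsq (len G e) (wd u e) \<le> fs_sq H1t u" using nsq_nonneg[of "len G e" "restr G u e"] by linarith
  have "nsq (len G e) (restr G u e) + nsq (len G e) (wd u e) + nsq (len G e) (wdd u e) \<le> fs_sq H2t u"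
    unfolding H2t_norm_sq by (rule member_le_sum[OF e _ fin_E]) simp
  then show "nsq (len G e) (wdd u e) \<le> fs_sq H2t u"
    using nsq_nonneg[of "len G e" "restr G u e"] nsq_nonneg[of "len G e" "wd u e"] by linarith
qed

lemma tr_bound:
  assumes u: "u \<in> fs_carrier H1t" and e: "e \<in> edges G" and x: "x \<in> {0..len G e}"
  shows "(tr u e x)\<^sup>2 \<le> cT * (2 ^ j * fs_sq L2G u + fs_sq H1t u / 2 ^ j)"
proof -
  note l = edgeD(1)[OF e]
  have "(tr u e x)\<^sup>2 \<le> (2 / len G e + 2 * len G e) * (2 ^ j * nsq (len G e) (tr u e) + nsq (len G e) (wd u e) / 2 ^ j)"
    by (rule prim_trace_bound[OF H1D(4)[OF u e] l x])
  also have "nsq (len G e) (tr u e) = nsq (len G e) (restr G u e)"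
    unfolding tr_def by (rule nsq_trace[OF H1D(1)[OF u e] l])
  also have "(2 / len G e + 2 * len G e) * (2 ^ j * nsq (len G e) (restr G u e) + nsq (len G e) (wd u e) / 2 ^ j)
    \<le> cT * (2 ^ j * fs_sq L2G u + fs_sq H1t u / 2 ^ j)"
    using l by (intro mult_mono add_mono mult_left_mono divide_right_mono cT[OF e] edge_norm_le[OF e] cT_nonneg add_nonneg_nonneg) auto
  finally show ?thesis .
qed

lemma dtr_bound:
  assumes u: "u \<in> fs_carrier H2t" and e: "e \<in> edges G" and x: "x \<in> {0..len G e}"
  shows "(dtr u e x)\<^sup>2 \<le> cT * (2 ^ j * fs_sq H1t u + fs_sq H2t u / 2 ^ j)"
proof -
  note l = edgeD(1)[OF e]
  have "(dtr u e x)\<^sup>2 \<le> (2 / len G e + 2 * len G e) * (2 ^ j * nsq (len G e) (dtr u e) + nsq (len G e) (wdd u e) / 2 ^ j)"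
    by (rule prim_trace_bound[OF H2D(4)[OF u e] l x])
  also have "nsq (len G e) (dtr u e) = nsq (len G e) (wd u e)"
    unfolding dtr_def by (rule nsq_trace[OF H2D(2)[OF u e] l])
  also have "(2 / len G e + 2 * len G e) * (2 ^ j * nsq (len G e) (wd u e) + nsq (len G e) (wdd u e) / 2 ^ j)
    \<le> cT * (2 ^ j * fs_sq H1t u + fs_sq H2t u / 2 ^ j)"
    using l by (intro mult_mono add_mono mult_left_mono divide_right_mono cT[OF e] edge_norm_le[OF e] cT_nonneg add_nonneg_nonneg) auto
  finally show ?thesis .
qed

lemma mis_bound:
  assumes p: "p \<in> ends" and u: "u \<in> fs_carrier H1t"
  shows "(mis p u)\<^sup>2 \<le> 4 * cT * (2 ^ j * fs_sq L2G u + fs_sq H1t u / 2 ^ j)"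
proof -
  define N where "N = 2 ^ j * fs_sq L2G u + fs_sq H1t u / 2 ^ j"
  have b: "(trp u q)\<^sup>2 \<le> cT * N" if "q \<in> ends" for q
    unfolding trp_def N_def by (rule tr_bound[OF u endsD[OF that] pos_in[OF that]])
  have "(mis p u)\<^sup>2 \<le> 2 * (trp u p)\<^sup>2 + 2 * (trp u (rp (vt p)))\<^sup>2"
    using two_sq_bound[of "trp u p" "- trp u (rp (vt p))"] by (simp add: mis_def)
  also have "\<dots> \<le> 2 * (cT * N) + 2 * (cT * N)"
    by (intro add_mono mult_left_mono b p rp(1)[OF p]) auto
  finally show ?thesis by (simp add: N_def)
qed

section \<open>The coupled and the decoupled scales\<close>

lemma H1C_embeds: "H1C \<hookrightarrow> H1t" "H2C \<hookrightarrow> H2t"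
  by (intro embeds_subspace quad_Ht quad_HC; auto)+

lemma embeds_refl: "E \<hookrightarrow> E"
  unfolding embeds_def by (intro conjI exI[of _ 1]) auto

lemma interp_H1C_embeds:
  assumes "0 < \<theta>" "\<theta> < 1"
  shows "interp L2G H1C \<theta> \<hookrightarrow> interp L2G H1t \<theta>" "interp H1C H2C \<theta> \<hookrightarrow> interp H1t H2t \<theta>"
  using assms by (intro interp_mono couples embeds_refl H1C_embeds; simp)+

lemma dyadic_graph_limit:
  assumes \<theta>: "1/2 < \<theta>" "\<theta> < 1" and D: "dyadic_rep L2G H1t \<theta> \<phi> \<psi> S"
  defines "r \<equiv> 1 / sqrt (4 powr \<theta> / 2)"
  shows "0 < r" "r < 1"
    "e \<in> edges G \<Longrightarrow> \<exists>k. continuous_on {0..len G e} k \<and> (AE x in leb (len G e). restr G \<phi> e x = k x) \<and>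
      (\<forall>j. \<forall>x\<in>{0..len G e}. \<bar>k x - tr (\<psi> j) e x\<bar> \<le> sqrt (20 * cT * S) * r ^ j / (1 - r))"
proof -
  have "1 < (4::real) powr \<theta> / 2" using half_weight(3)[of \<theta>] \<theta> by simp
  then show r: "0 < r" "r < 1" by (simp_all add: r_def)
  assume e: "e \<in> edges G"
  note l = edgeD(1)[OF e]
  have "\<exists>k. continuous_on {0..len G e} k \<and> (AE x in leb (len G e). restr G \<phi> e x = k x) \<and>
      (\<forall>j. \<forall>x\<in>{0..len G e}. \<bar>k x - trace_int (len G e) (restr G (\<psi> j) e) x\<bar> \<le> sqrt (20 * (2 / len G e + 2 * len G e) * S) * r ^ j / (1 - r))"
    unfolding r_def
  proof (rule dyadic_edge_limit(3)[OF couples(1) \<theta> D l, of "\<lambda>u. restr G u e"])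
    show "restr G u e \<in> L2_int (len G e) \<and> nsq (len G e) (restr G u e) \<le> fs_sq L2G u" if "u \<in> fs_carrier L2G" for u
      using that e edge_norm_le(1)[OF e] by (simp add: L2G_carrier)
    show "restr G u e \<in> sobolev_int (len G e) 1 \<and> nsq (len G e) (wderiv (len G e) (restr G u e)) \<le> fs_sq H1t u"
      if "u \<in> fs_carrier H1t" for u
      using H1D(1)[OF that e] edge_norm_le(2)[OF e, of u] unfolding wd_def by (rule conjI)
  qed (simp add: restr_def)
  then obtain k where k: "continuous_on {0..len G e} k" "AE x in leb (len G e). restr G \<phi> e x = k x"
    "\<forall>j. \<forall>x\<in>{0..len G e}. \<bar>k x - tr (\<psi> j) e x\<bar> \<le> sqrt (20 * (2 / len G e + 2 * len G e) * S) * r ^ j / (1 - r)"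
    unfolding tr_def by (elim exE conjE)
  have le: "sqrt (20 * (2 / len G e + 2 * len G e) * S) * r ^ j / (1 - r) \<le> sqrt (20 * cT * S) * r ^ j / (1 - r)" for j
    using r cT[OF e] dyadic_repD(5)[OF D] by (intro divide_right_mono mult_right_mono real_sqrt_le_mono mult_right_mono mult_left_mono) auto
  have "\<forall>j. \<forall>x\<in>{0..len G e}. \<bar>k x - tr (\<psi> j) e x\<bar> \<le> sqrt (20 * cT * S) * r ^ j / (1 - r)"
  proof (intro allI ballI)
    fix j x assume "x \<in> {0..len G e}"
    with k(3) have "\<bar>k x - tr (\<psi> j) e x\<bar> \<le> sqrt (20 * (2 / len G e + 2 * len G e) * S) * r ^ j / (1 - r)" by blast
    then show "\<bar>k x - tr (\<psi> j) e x\<bar> \<le> sqrt (20 * cT * S) * r ^ j / (1 - r)" using le by (rule order_trans)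
  qed
  with k(1,2) show "\<exists>k. continuous_on {0..len G e} k \<and> (AE x in leb (len G e). restr G \<phi> e x = k x) \<and>
      (\<forall>j. \<forall>x\<in>{0..len G e}. \<bar>k x - tr (\<psi> j) e x\<bar> \<le> sqrt (20 * cT * S) * r ^ j / (1 - r))"
    by (intro exI conjI)
qed

lemma geometric_tendsto:
  fixes r D :: real
  assumes "0 < r" "r < 1" shows "(\<lambda>j. D * r ^ j / (1 - r)) \<longlonglongrightarrow> 0"
proof -
  have "(\<lambda>j. D * r ^ j / (1 - r)) \<longlonglongrightarrow> D * 0 / (1 - r)"
    using assms by (intro tendsto_intros LIMSEQ_realpow_zero) auto
  then show ?thesis by simp
qed

lemma tendsto_of_bound:
  fixes a :: real
  assumes "\<And>j. \<bar>a - f j\<bar> \<le> g j" "g \<longlonglongrightarrow> 0" shows "f \<longlonglongrightarrow> a"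
proof -
  have "(\<lambda>j. f j - a) \<longlonglongrightarrow> 0"
    by (rule Lim_null_comparison[OF always_eventually[OF allI] assms(2)]) (use assms(1) in \<open>simp add: abs_minus_commute\<close>)
  then show ?thesis by (simp add: LIM_zero_iff)
qed

lemma dyadic_tr_tendsto:
  assumes \<theta>: "1/2 < \<theta>" "\<theta> < 1" and D: "dyadic_rep L2G H1t \<theta> \<phi> \<psi> S" and e: "e \<in> edges G" and x: "x \<in> {0..len G e}"
  shows "(\<lambda>j. tr (\<psi> j) e x) \<longlonglongrightarrow> tr \<phi> e x"
proof -
  note L = dyadic_graph_limit[OF \<theta> D]
  obtain k where k: "continuous_on {0..len G e} k \<and> (AE x in leb (len G e). restr G \<phi> e x = k x) \<and>
      (\<forall>j. \<forall>x\<in>{0..len G e}. \<bar>k x - tr (\<psi> j) e x\<bar> \<le> sqrt (20 * cT * S) * (1 / sqrt (4 powr \<theta> / 2)) ^ j / (1 - 1 / sqrt (4 powr \<theta> / 2)))"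
    using L(3)[OF e] ..
  have kt: "tr \<phi> e x = k x" unfolding tr_def using k x edgeD(1)[OF e] by (intro trace_int_eq) auto
  show ?thesis unfolding kt
    by (rule tendsto_of_bound[OF _ geometric_tendsto[OF L(1,2)]]) (use k x in blast)
qed

lemma dyadic_rep_mono:
  assumes "dyadic_rep X0 X1 \<theta> \<phi> \<psi> S" "fs_carrier X1 \<subseteq> fs_carrier Y1" "fs_norm Y1 = fs_norm X1"
    "fs_carrier X0 \<subseteq> fs_carrier Y0" "fs_norm Y0 = fs_norm X0"
  shows "dyadic_rep Y0 Y1 \<theta> \<phi> \<psi> S"
  using assms unfolding dyadic_rep_def dyadic_term_def by auto

text \<open>The end values of \<phi> are limits of those of the continuous approximants, so the
  matching of values passes to the limit, and the edgewise continuous representatives fit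
  together.\<close>

lemma dyadic_cont:
  assumes \<theta>: "1/2 < \<theta>" "\<theta> < 1" and D: "dyadic_rep L2G H1C \<theta> \<phi> \<psi> S"
  shows "\<phi> \<in> cont_space G"
proof -
  have D': "dyadic_rep L2G H1t \<theta> \<phi> \<psi> S" by (rule dyadic_rep_mono[OF D]) auto
  have m: "trp \<phi> p = trp \<phi> (rp (vt p))" if p: "p \<in> ends" for p
  proof -
    have "(\<lambda>j. trp (\<psi> j) q) \<longlonglongrightarrow> trp \<phi> q" if "q \<in> ends" for q
      unfolding trp_def by (rule dyadic_tr_tendsto[OF \<theta> D' endsD[OF that] pos_in[OF that]])
    then have l: "(\<lambda>j. trp (\<psi> j) p) \<longlonglongrightarrow> trp \<phi> p" "(\<lambda>j. trp (\<psi> j) (rp (vt p))) \<longlonglongrightarrow> trp \<phi> (rp (vt p))"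
      using p rp(1)[OF p] by auto
    have eq: "trp (\<psi> j) p = trp (\<psi> j) (rp (vt p))" for j
      using dyadic_repD(1)[OF D, of j] p cont_iff_mis[of "\<psi> j"] by (auto simp: mis_def)
    show ?thesis using LIMSEQ_unique[OF l(1)[unfolded eq] l(2)] .
  qed
  have ex: "\<forall>e\<in>edges G. \<exists>k. continuous_on {0..len G e} k \<and> (AE x in leb (len G e). restr G \<phi> e x = k x)"
    using dyadic_graph_limit(3)[OF \<theta> D'] by blast
  from bchoice[OF ex] obtain k where k: "\<forall>e\<in>edges G. continuous_on {0..len G e} (k e) \<and> (AE x in leb (len G e). restr G \<phi> e x = k e x)" ..
  have t: "tr \<phi> e x = k e x" if "e \<in> edges G" "x \<in> {0..len G e}" for e x
    unfolding tr_def using k that edgeD(1) by (intro trace_int_eq) auto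
  show ?thesis
  proof (rule cont_spaceI[of k \<phi> "\<lambda>v. trp \<phi> (rp v)"])
    fix e assume e: "e \<in> edges G"
    show "continuous_on {0..len G e} (k e)" "AE x in leb (len G e). restr G \<phi> e x = k e x" using k e by auto
    have "(e, False) \<in> ends" "(e, True) \<in> ends" using e by (auto simp: ends_def)
    from m[OF this(1)] m[OF this(2)]
    show "k e 0 = trp \<phi> (rp (src G e))" "k e (len G e) = trp \<phi> (rp (tgt G e))"
      using t[OF e] edgeD(1)[OF e] by (auto simp: trp_def pos_def vt_def)
  qed
qed

lemma interp_H1C_cont:
  assumes \<theta>: "1/2 < \<theta>" "\<theta> < 1" and \<phi>: "\<phi> \<in> fs_carrier (interp L2G H1C \<theta>)"
  shows "\<phi> \<in> cont_space G"
proof -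
  have \<theta>0: "0 < \<theta>" using \<theta> by simp
  obtain \<psi> where "dyadic_rep L2G H1C \<theta> \<phi> \<psi> (2 * 4 powr \<theta> * (fs_sq (interp L2G H1C \<theta>) \<phi> + 1))"
    by (rule dyadic_of_interp[OF couples(2) \<theta>0 \<theta>(2) \<phi>]) auto
  then show ?thesis by (rule dyadic_cont[OF \<theta>])
qed

text \<open>The general correction with the mismatches as functionals and the hats as dual
  functions. Below 1/2 no continuity is imposed; above 1/2 continuity of \<phi> is what makes the
  mismatches of the approximants tend to 0.\<close>

lemma interp_H1t_embeds:
  assumes \<theta>: "0 < \<theta>" "\<theta> < 1" "\<theta> \<noteq> 1/2" and A: "1/2 < \<theta> \<Longrightarrow> A \<subseteq> cont_space G"
  shows "interp L2G H1t \<theta> \<sqinter>\<^sub>s A \<hookrightarrow> interp L2G H1C \<theta>"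
proof (rule interp_correction[OF couples(1,2) \<theta> fin_ends, of "cG + 4 * cT" mis hat])
  show "0 \<le> cG + 4 * cT" using cG_nonneg cT_nonneg by simp
  show "fs_norm H1C u = fs_norm H1t u" for u by simp
  fix i assume i: "i \<in> ends"
  show "(mis i u)\<^sup>2 \<le> (cG + 4 * cT) * (2 ^ j * fs_sq L2G u + fs_sq H1t u / 2 ^ j)" if "u \<in> fs_carrier H1t" for u j
  proof -
    have "4 * cT * (2 ^ j * fs_sq L2G u + fs_sq H1t u / 2 ^ j) \<le> (cG + 4 * cT) * (2 ^ j * fs_sq L2G u + fs_sq H1t u / 2 ^ j)"
      using cG_nonneg by (intro mult_right_mono) auto
    then show ?thesis using mis_bound[OF i that, of j] by linarith
  qed
  show "mis i (\<lambda>p. u p - v p) = mis i u - mis i v" if "u \<in> fs_carrier H1t" "v \<in> fs_carrier H1t" for u v by (rule mis_diff[OF i that])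
  fix j
  show "hat i j \<in> fs_carrier H1t" by (rule hat_props(1)[OF i])
  have "cG / 2 ^ j \<le> (cG + 4 * cT) / 2 ^ j" "cG * 2 ^ j \<le> (cG + 4 * cT) * 2 ^ j"
    using cT_nonneg by (auto intro!: divide_right_mono mult_right_mono)
  then show "fs_sq L2G (hat i j) \<le> (cG + 4 * cT) / 2 ^ j" "fs_sq H1t (hat i j) \<le> (cG + 4 * cT) * 2 ^ j"
    using hat_props(2,3)[OF i, of j] by linarith+
next
  show "(\<lambda>p. u p - (\<Sum>i\<in>ends. mis i u * hat i j p)) \<in> fs_carrier H1C" if "u \<in> fs_carrier H1t" for u j
    using correct_H1C[OF that, of j] by (simp only: correct_def)
  fix \<phi> \<psi> S i assume \<theta>2: "1/2 < \<theta>" and \<phi>: "\<phi> \<in> A" and D: "dyadic_rep L2G H1t \<theta> \<phi> \<psi> S" and i: "i \<in> ends"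
  have t: "(\<lambda>j. trp (\<psi> j) q) \<longlonglongrightarrow> trp \<phi> q" if "q \<in> ends" for q
    unfolding trp_def by (rule dyadic_tr_tendsto[OF \<theta>2 \<theta>(2) D endsD[OF that] pos_in[OF that]])
  have "\<phi> \<in> cont_space G" using A[OF \<theta>2] \<phi> by blast
  from cont_spaceD[OF this] obtain val where
    val: "\<forall>e\<in>edges G. tr \<phi> e 0 = val (src G e) \<and> tr \<phi> e (len G e) = val (tgt G e)" ..
  have v: "trp \<phi> q = val (vt q)" if "q \<in> ends" for q
    using val endsD[OF that] by (auto simp: trp_def pos_def vt_def)
  have "(\<lambda>j. mis i (\<psi> j)) \<longlonglongrightarrow> trp \<phi> i - trp \<phi> (rp (vt i))"
    unfolding mis_def using i rp(1)[OF i] by (intro tendsto_diff t)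
  then show "(\<lambda>j. mis i (\<psi> j)) \<longlonglongrightarrow> 0" using v[OF i] v[OF rp(1)[OF i]] rp(2)[OF i] by simp
qed

end

context compact_graph
begin

text \<open>The mismatches are already bounded by the H^1 norm and the full-width hats lie in H^2,
  so one projection is bounded in both spaces. The 8 is twice the 4 of the mismatch bound; the
  exponential factor comes from \<open>quad_space_sum\<close>.\<close>

lemma correct_norm:
  assumes r: "(r = 1 \<and> u \<in> fs_carrier H1t) \<or> (r = 2 \<and> u \<in> fs_carrier H2t)"
  shows "correct 0 u \<in> fs_carrier (Htilde_int G r)"
    "fs_sq (Htilde_int G r) (correct 0 u) \<le> (2 + 2 * (2 ^ card ends * (real (card ends) * (8 * cT * cG)))) * fs_sq (Htilde_int G r) u"
proof -
  let ?X = "Htilde_int G r"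
  have q: "quad_space ?X" using r by (intro quad_Ht) auto
  have uX: "u \<in> fs_carrier ?X" and u1: "u \<in> fs_carrier H1t" using r H2_subset_H1 by auto
  have nle: "fs_sq H1t u \<le> fs_sq ?X u" using r H2_norm_mono by auto
  have h: "hat p 0 \<in> fs_carrier ?X" "fs_sq ?X (hat p 0) \<le> cG" if "p \<in> ends" for p
    using r hat0_H2[OF that] hat_props(1,3)[OF that, of 0] by auto
  let ?s = "\<lambda>p. \<Sum>q\<in>ends. mis q u * hat q 0 p"
  have Q: "?s \<in> fs_carrier ?X" "fs_sq ?X ?s \<le> 2 ^ card ends * (\<Sum>q\<in>ends. (mis q u)\<^sup>2 * fs_sq ?X (hat q 0))"
    using quad_space_sum[where e = "\<lambda>q. hat q 0" and c = "\<lambda>q. mis q u", OF q fin_ends h(1)] by auto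
  have m: "(mis q u)\<^sup>2 \<le> 8 * cT * fs_sq ?X u" if "q \<in> ends" for q
  proof -
    have "(mis q u)\<^sup>2 \<le> 4 * cT * (fs_sq L2G u + fs_sq H1t u)" using mis_bound[OF that u1, of 0] by simp
    also have "\<dots> \<le> 4 * cT * (fs_sq ?X u + fs_sq ?X u)"
      using H1_norm_mono[of u] nle cT_nonneg by (intro mult_left_mono add_mono) auto
    finally show ?thesis by simp
  qed
  have "(\<Sum>q\<in>ends. (mis q u)\<^sup>2 * fs_sq ?X (hat q 0)) \<le> (\<Sum>q\<in>ends. (8 * cT * fs_sq ?X u) * cG)"
    using cT_nonneg by (intro sum_mono mult_mono m h(2)) auto
  also have "\<dots> = real (card ends) * (8 * cT * cG) * fs_sq ?X u" by simp
  finally have "fs_sq ?X ?s \<le> 2 ^ card ends * (real (card ends) * (8 * cT * cG) * fs_sq ?X u)"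
    using Q(2) by (meson mult_left_mono order_trans zero_le_numeral zero_le_power)
  moreover have "fs_sq ?X (correct 0 u) \<le> 2 * fs_sq ?X u + 2 * fs_sq ?X ?s"
    unfolding correct_def by (rule quad_space_diff(2)[OF q uX Q(1)])
  ultimately show "fs_sq ?X (correct 0 u) \<le> (2 + 2 * (2 ^ card ends * (real (card ends) * (8 * cT * cG)))) * fs_sq ?X u"
    by (simp add: distrib_right)
  show "correct 0 u \<in> fs_carrier ?X" unfolding correct_def by (rule quad_space_diff(1)[OF q uX Q(1)])
qed

text \<open>
  On \<open>H\<^sup>1\<close> the vertex values are bounded, so that subtracting the mismatches is a bounded projection
  onto the continuous functions in both spaces of the couple.
\<close>
lemma interp_H2t_embeds:
  assumes \<theta>: "0 < \<theta>" "\<theta> < 1"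
  shows "interp H1t H2t \<theta> \<sqinter>\<^sub>s cont_space G \<hookrightarrow> interp H1C H2C \<theta>"
proof -
  define P where "P = 2 + 2 * (2 ^ card ends * (real (card ends) * (8 * cT * cG)))"
  have P: "0 \<le> P" using cT_nonneg cG_nonneg by (simp add: P_def)
  show ?thesis
  proof (rule interp_transfer[OF couples(3,4) \<theta> P])
    fix \<phi> \<psi> S assume \<phi>: "\<phi> \<in> cont_space G" and D: "dyadic_rep H1t H2t \<theta> \<phi> \<psi> S"
    note D' = dyadic_repD[OF D]
    have \<psi>1: "\<psi> j \<in> fs_carrier H1t" for j by (rule H2_subset_H1[OF D'(1)])
    have \<phi>1: "\<phi> \<in> fs_carrier H1t"
      using quad_space_add(1)[OF coupleD(1)[OF couples(3)] D'(2)[of 0] \<psi>1[of 0]] by simp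
    \<comment> \<open>As \<phi> is continuous it has no mismatches and is fixed by the correction,
      so the new error is the corrected old error and the bound in H^1 applies to it.\<close>
    have eq: "(\<lambda>p. \<phi> p - correct 0 (\<psi> j) p) = correct 0 (\<lambda>p. \<phi> p - \<psi> j p)" for j
    proof
      fix p
      have "mis q (\<lambda>p. \<phi> p - \<psi> j p) = - mis q (\<psi> j)" if "q \<in> ends" for q
        using mis_diff[OF that \<phi>1 \<psi>1] \<phi> cont_iff_mis[OF \<phi>1] that by simp
      then have "(\<Sum>q\<in>ends. mis q (\<lambda>p. \<phi> p - \<psi> j p) * hat q 0 p) = - (\<Sum>q\<in>ends. mis q (\<psi> j) * hat q 0 p)"
        by (simp add: sum_negf)
      then show "\<phi> p - correct 0 (\<psi> j) p = correct 0 (\<lambda>p. \<phi> p - \<psi> j p) p" by (simp add: correct_def)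
    qed
    have c: "correct 0 (\<psi> j) \<in> fs_carrier H2C" for j
      using correct_norm(1)[of 2 "\<psi> j"] D'(1) correct_H1C[OF \<psi>1, of 0 j] by simp
    have d: "correct 0 (\<lambda>p. \<phi> p - \<psi> j p) \<in> fs_carrier H1C" for j by (rule correct_H1C[OF D'(2)])
    have t: "dyadic_term H1C H2C \<phi> (\<lambda>j. correct 0 (\<psi> j)) j \<le> P * dyadic_term H1t H2t \<phi> \<psi> j" for j
    proof -
      have "fs_sq H1t (correct 0 (\<lambda>p. \<phi> p - \<psi> j p)) \<le> P * fs_sq H1t (\<lambda>p. \<phi> p - \<psi> j p)"
        unfolding P_def using D'(2) by (intro correct_norm(2)) auto
      moreover have "fs_sq H2t (correct 0 (\<psi> j)) / 4 ^ j \<le> P * fs_sq H2t (\<psi> j) / 4 ^ j"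
        unfolding P_def using D'(1) by (intro divide_right_mono correct_norm(2)) auto
      ultimately show ?thesis unfolding dyadic_term_def eq by (simp add: distrib_left)
    qed
    have "(\<Sum>j<n. (4 powr \<theta>) ^ j * dyadic_term H1C H2C \<phi> (\<lambda>j. correct 0 (\<psi> j)) j) \<le> P * S" for n
    proof -
      have "(\<Sum>j<n. (4 powr \<theta>) ^ j * dyadic_term H1C H2C \<phi> (\<lambda>j. correct 0 (\<psi> j)) j)
        \<le> (\<Sum>j<n. (4 powr \<theta>) ^ j * (P * dyadic_term H1t H2t \<phi> \<psi> j))"
        using t by (intro sum_mono mult_left_mono) auto
      also have "\<dots> = P * (\<Sum>j<n. (4 powr \<theta>) ^ j * dyadic_term H1t H2t \<phi> \<psi> j)"
        unfolding sum_distrib_left by (intro sum.cong) (auto simp: mult_ac)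
      also have "\<dots> \<le> P * S" using D'(3)[of n] P by (rule mult_left_mono)
      finally show ?thesis .
    qed
    then have "dyadic_rep H1C H2C \<theta> \<phi> (\<lambda>j. correct 0 (\<psi> j)) (P * S)"
      using c d unfolding dyadic_rep_def eq by simp
    then show "\<exists>\<psi>'. dyadic_rep H1C H2C \<theta> \<phi> \<psi>' (P * S)" by blast
  qed
qed

section \<open>Kirchhoff conditions\<close>

text \<open>The Kirchhoff conditions separated from the regularity requirement in
  \<open>K_space\<close>, so that they can be intersected with any space.\<close>

definition Kset :: "(('v, 'e) point \<Rightarrow> real) set" where
  "Kset = {u. \<forall>v\<in>verts G. kirchhoff_sum G u v = 0}"

abbreviation "DK \<equiv> H2C \<sqinter>\<^sub>s Kset"

text \<open>Indexing by edge ends merges the two sums of the definition; a loop contributes two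
  distinct ends at its vertex.\<close>

lemma kirchhoff_ends: "kirchhoff_sum G u v = (\<Sum>p | p \<in> ends \<and> vt p = v. dn u p)"
proof -
  let ?A = "{e \<in> edges G. src G e = v}" and ?B = "{e \<in> edges G. tgt G e = v}"
  have eq: "{p. p \<in> ends \<and> vt p = v} = (\<lambda>e. (e, False)) ` ?A \<union> (\<lambda>e. (e, True)) ` ?B"
    by (auto simp: ends_def vt_def split: if_splits)
  have "(\<Sum>p | p \<in> ends \<and> vt p = v. dn u p) = (\<Sum>p\<in>(\<lambda>e. (e, False)) ` ?A. dn u p) + (\<Sum>p\<in>(\<lambda>e. (e, True)) ` ?B. dn u p)"
    unfolding eq using fin_E by (intro sum.union_disjoint) auto
  also have "\<dots> = (\<Sum>e\<in>?A. dn u (e, False)) + (\<Sum>e\<in>?B. dn u (e, True))"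
    by (subst (1 2) sum.reindex) (auto simp: inj_on_def)
  finally show ?thesis by (simp add: kirchhoff_sum_def dn_def esgn_def pos_def dtr_def wd_def)
qed

lemma dn_diff: "p \<in> ends \<Longrightarrow> u \<in> fs_carrier H2t \<Longrightarrow> w \<in> fs_carrier H2t \<Longrightarrow> dn (\<lambda>p. a * u p + b * w p) p = a * dn u p + b * dn w p"
proof -
  assume p: "p \<in> ends" and u: "u \<in> fs_carrier H2t" and w: "w \<in> fs_carrier H2t"
  show ?thesis unfolding dn_def H2_lin(2)[OF u w endsD[OF p] pos_in[OF p]] by (simp add: algebra_simps)
qed

lemma kirchhoff_lin:
  assumes "u \<in> fs_carrier H2t" "w \<in> fs_carrier H2t"
  shows "kirchhoff_sum G (\<lambda>p. a * u p + b * w p) v = a * kirchhoff_sum G u v + b * kirchhoff_sum G w v"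
proof -
  have "kirchhoff_sum G (\<lambda>p. a * u p + b * w p) v = (\<Sum>p | p \<in> ends \<and> vt p = v. a * dn u p + b * dn w p)"
    unfolding kirchhoff_ends by (intro sum.cong refl dn_diff assms) auto
  then show ?thesis unfolding kirchhoff_ends by (simp add: sum.distrib sum_distrib_left)
qed

lemma kirchhoff_zero: "kirchhoff_sum G (\<lambda>p. 0) v = 0"
  using kirchhoff_lin[OF quad_space_zero(1)[OF quad_Ht] quad_space_zero(1)[OF quad_Ht], of 0 0 v] by simp

lemma quad_DK: "quad_space DK"
  by (intro quad_space_inter quad_HC) (auto simp: Kset_def kirchhoff_lin kirchhoff_zero)

lemma couple_DK: "couple H1C DK"
  unfolding couple_def
  by (intro conjI quad_HC quad_DK embeds_subspace subsetI) (auto simp: H2_norm_mono dest: H2_subset_H1)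

lemma kirchhoff_bound:
  assumes u: "u \<in> fs_carrier H2t"
  shows "(kirchhoff_sum G u v)\<^sup>2 \<le> (real (card ends))\<^sup>2 * cT * (2 ^ j * fs_sq H1t u + fs_sq H2t u / 2 ^ j)"
proof -
  let ?N = "2 ^ j * fs_sq H1t u + fs_sq H2t u / 2 ^ j" and ?A = "{p. p \<in> ends \<and> vt p = v}"
  have fA: "finite ?A" "card ?A \<le> card ends" using fin_ends by (auto intro: card_mono)
  have N: "0 \<le> cT * ?N" using cT_nonneg by simp
  have d: "(dn u p)\<^sup>2 \<le> cT * ?N" if "p \<in> ?A" for p
  proof -
    have "(dn u p)\<^sup>2 = (dtr u (fst p) (pos p))\<^sup>2" by (simp add: dn_def esgn_def power_mult_distrib)
    also have "\<dots> \<le> cT * ?N" using that by (intro dtr_bound[OF u] endsD pos_in) auto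
    finally show ?thesis .
  qed
  have "(kirchhoff_sum G u v)\<^sup>2 \<le> (\<Sum>p\<in>?A. (dn u p)\<^sup>2) * real (card ?A)"
    unfolding kirchhoff_ends by (rule sum_squared_le_sum_of_squares)
  also have "\<dots> \<le> (\<Sum>p\<in>?A. cT * ?N) * real (card ?A)" by (intro mult_right_mono sum_mono d) auto
  also have "\<dots> = (real (card ?A))\<^sup>2 * (cT * ?N)" by (simp add: power2_eq_square)
  also have "\<dots> \<le> (real (card ends))\<^sup>2 * (cT * ?N)" using fA N by (intro mult_right_mono power_mono) auto
  finally show ?thesis by (simp add: mult.assoc)
qed

lemma kirchhoff_kir:
  assumes p: "p \<in> ends" shows "kirchhoff_sum G (kir p j) v = of_bool (vt p = v)"
proof -
  have "kirchhoff_sum G (kir p j) v = (\<Sum>q | q \<in> ends \<and> vt q = v. if q = p then 1 else 0)"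
    unfolding kirchhoff_ends by (intro sum.cong refl) (auto simp: kir_props(4)[OF p])
  then show ?thesis using p fin_ends by (simp add: sum.delta')
qed

text \<open>The edge limit applied with \<open>R\<close> the weak derivative. That operator is
  linear only almost everywhere, which is why the edge limit asks for no more.\<close>

lemma dyadic_dtr_tendsto:
  assumes \<theta>: "1/2 < \<theta>" "\<theta> < 1" and D: "dyadic_rep H1C H2C \<theta> \<phi> \<psi> S" and e: "e \<in> edges G" and x: "x \<in> {0..len G e}"
  shows "(\<lambda>j. dtr (\<psi> j) e x) \<longlonglongrightarrow> dtr \<phi> e x"
proof -
  note l = edgeD(1)[OF e]
  define r where "r = 1 / sqrt (4 powr \<theta> / 2)"
  define c where "c = sqrt (20 * (2 / len G e + 2 * len G e) * S)"
  have "1 < (4::real) powr \<theta> / 2" using half_weight(3)[of \<theta>] \<theta> by simp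
  then have r: "0 < r" "r < 1" by (simp_all add: r_def)
  have "\<exists>k. continuous_on {0..len G e} k \<and> (AE x in leb (len G e). wd \<phi> e x = k x) \<and>
      (\<forall>j. \<forall>x\<in>{0..len G e}. \<bar>k x - trace_int (len G e) (wd (\<psi> j) e) x\<bar> \<le> c * r ^ j / (1 - r))"
    unfolding r_def c_def
  proof (rule dyadic_edge_limit(3)[OF couples(4) \<theta> D l, of "\<lambda>u. wd u e"])
    show "wd u e \<in> L2_int (len G e) \<and> nsq (len G e) (wd u e) \<le> fs_sq H1C u" if "u \<in> fs_carrier H1C" for u
      using that H1D(3)[of u e] e edge_norm_le(2)[OF e, of u] by simp
    show "wd u e \<in> sobolev_int (len G e) 1 \<and> nsq (len G e) (wderiv (len G e) (wd u e)) \<le> fs_sq H2C u"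
      if "u \<in> fs_carrier H2C" for u
      using that H2D(2)[of u e] e edge_norm_le(3)[OF e, of u] by (simp add: wdd_def)
    fix u v assume "u \<in> fs_carrier H1C" "v \<in> fs_carrier H1C"
    then show "AE x in leb (len G e). wd (\<lambda>p. u p - v p) e x = wd u e x - wd v e x"
      using H1_lin(1)[of u v e 1 "-1"] e by simp
  qed
  then obtain k where k: "continuous_on {0..len G e} k \<and> (AE x in leb (len G e). wd \<phi> e x = k x) \<and>
      (\<forall>j. \<forall>x\<in>{0..len G e}. \<bar>k x - dtr (\<psi> j) e x\<bar> \<le> c * r ^ j / (1 - r))" unfolding dtr_def ..
  have kt: "dtr \<phi> e x = k x" unfolding dtr_def using k x l by (intro trace_int_eq) auto
  show ?thesis unfolding kt
    by (rule tendsto_of_bound[OF _ geometric_tendsto[OF r]]) (use k x in blast)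
qed

lemma dyadic_kirchhoff_tendsto:
  assumes \<theta>: "1/2 < \<theta>" "\<theta> < 1" and D: "dyadic_rep H1C H2C \<theta> \<phi> \<psi> S"
  shows "(\<lambda>j. kirchhoff_sum G (\<psi> j) v) \<longlonglongrightarrow> kirchhoff_sum G \<phi> v"
  unfolding kirchhoff_ends dn_def
  by (intro tendsto_sum tendsto_mult tendsto_const dyadic_dtr_tendsto[OF \<theta> D] endsD pos_in) auto

text \<open>One functional per vertex, its Kirchhoff sum, with a kink at the reference end as dual
  function: it has Kirchhoff sum 1 there and 0 at all other vertices, and does not disturb
  continuity.\<close>

lemma interp_kirchhoff_embeds:
  assumes \<theta>: "0 < \<theta>" "\<theta> < 1" "\<theta> \<noteq> 1/2" and A: "1/2 < \<theta> \<Longrightarrow> A \<subseteq> Kset"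
  shows "interp H1C H2C \<theta> \<sqinter>\<^sub>s A \<hookrightarrow> interp H1C DK \<theta>"
proof -
  define c where "c = cG + (real (card ends))\<^sup>2 * cT"
  have c: "0 \<le> c" "cG \<le> c" "(real (card ends))\<^sup>2 * cT \<le> c" using cG_nonneg cT_nonneg by (simp_all add: c_def)
  let ?I = "vt ` ends" and ?E = "\<lambda>v. kir (rp v)"
  have rpv: "rp v \<in> ends" "vt (rp v) = v" if "v \<in> ?I" for v using rp that by auto
  show ?thesis
  proof (rule interp_correction[OF couples(4) couple_DK \<theta> _ c(1), of ?I "\<lambda>v u. kirchhoff_sum G u v" ?E])
    show "finite ?I" using fin_ends by simp
    show "fs_norm DK u = fs_norm H2C u" for u by simp
    fix v assume v: "v \<in> ?I"
    note p = rpv(1)[OF v]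
    show "(kirchhoff_sum G u v)\<^sup>2 \<le> c * (2 ^ j * fs_sq H1C u + fs_sq H2C u / 2 ^ j)" if "u \<in> fs_carrier H2C" for u j
    proof -
      have "(real (card ends))\<^sup>2 * cT * (2 ^ j * fs_sq H1t u + fs_sq H2t u / 2 ^ j)
        \<le> c * (2 ^ j * fs_sq H1t u + fs_sq H2t u / 2 ^ j)"
        using c(3) by (intro mult_right_mono) auto
      then show ?thesis using kirchhoff_bound[of u v j] that by simp
    qed
    show "kirchhoff_sum G (\<lambda>p. u p - w p) v = kirchhoff_sum G u v - kirchhoff_sum G w v"
      if "u \<in> fs_carrier H2C" "w \<in> fs_carrier H2C" for u w
      using kirchhoff_lin[of u w 1 "-1" v] that by simp
    fix j
    show "kir (rp v) j \<in> fs_carrier H2C" by (rule kir_props(1)[OF p])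
    have "cG / 2 ^ j \<le> c / 2 ^ j" "cG * 2 ^ j \<le> c * 2 ^ j" using c by (auto intro!: divide_right_mono mult_right_mono)
    then show "fs_sq H1C (kir (rp v) j) \<le> c / 2 ^ j" "fs_sq H2C (kir (rp v) j) \<le> c * 2 ^ j"
      using kir_props(2,3)[OF p, of j] unfolding fs_inter_simps by linarith+
  next
    fix u j assume u: "u \<in> fs_carrier H2C"
    let ?s = "\<lambda>p. \<Sum>v\<in>?I. kirchhoff_sum G u v * kir (rp v) j p"
    have k2: "kir (rp v) j \<in> fs_carrier H2C" if "v \<in> ?I" for v by (rule kir_props(1)[OF rpv(1)[OF that]])
    have q2: "quad_space H2C" by (rule quad_HC) simp
    have s: "?s \<in> fs_carrier H2C"
      using quad_space_sum[where e = "\<lambda>v. kir (rp v) j" and c = "\<lambda>v. kirchhoff_sum G u v", OF q2 finite_imageI[OF fin_ends] k2] by blast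
    have "kirchhoff_sum G (\<lambda>p. u p - ?s p) w = 0" if w: "w \<in> verts G" for w
    proof -
      have "kirchhoff_sum G (\<lambda>p. u p - ?s p) w = kirchhoff_sum G u w - kirchhoff_sum G ?s w"
        using kirchhoff_lin[of u ?s 1 "-1" w] u s by simp
      also have "kirchhoff_sum G ?s w = (\<Sum>v\<in>?I. kirchhoff_sum G u v * kirchhoff_sum G (kir (rp v) j) w)"
      proof -
        have "dn ?s p = (\<Sum>v\<in>?I. kirchhoff_sum G u v * dn (kir (rp v) j) p)" if p: "p \<in> ends" for p
        proof -
          have "dtr ?s (fst p) (pos p) = (\<Sum>v\<in>?I. kirchhoff_sum G u v * dtr (kir (rp v) j) (fst p) (pos p))"
            using k2 p by (intro dtr_sum finite_imageI fin_ends endsD pos_in) auto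
          then show ?thesis by (simp add: dn_def sum_distrib_left mult_ac)
        qed
        then have "kirchhoff_sum G ?s w = (\<Sum>p | p \<in> ends \<and> vt p = w. \<Sum>v\<in>?I. kirchhoff_sum G u v * dn (kir (rp v) j) p)"
          unfolding kirchhoff_ends[of ?s] by (intro sum.cong refl) auto
        also have "\<dots> = (\<Sum>v\<in>?I. kirchhoff_sum G u v * kirchhoff_sum G (kir (rp v) j) w)"
          unfolding kirchhoff_ends[of "kir _ j"] sum_distrib_left by (rule sum.swap)
        finally show ?thesis .
      qed
      also have "\<dots> = (\<Sum>v\<in>?I. if v = w then kirchhoff_sum G u v else 0)"
        by (intro sum.cong refl) (use rpv in \<open>auto simp: kirchhoff_kir\<close>)
      also have "\<dots> = (if w \<in> ?I then kirchhoff_sum G u w else 0)" using fin_ends by (simp add: sum.delta)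
      also have "\<dots> = kirchhoff_sum G u w"
      \<comment> \<open>A vertex without incident edges is outside the index set, but its Kirchhoff
        sum is empty and hence 0.\<close>
      proof (cases "w \<in> ?I")
        case False
        then have e: "{p. p \<in> ends \<and> vt p = w} = {}" by (auto simp: image_iff)
        show ?thesis using False unfolding kirchhoff_ends e by simp
      qed simp
      finally show ?thesis by simp
    qed
    then show "(\<lambda>p. u p - ?s p) \<in> fs_carrier DK"
      using quad_space_diff(1)[OF q2 u s] by (simp add: Kset_def)
  next
    fix \<phi> \<psi> S v assume \<theta>2: "1/2 < \<theta>" and \<phi>: "\<phi> \<in> A" and D: "dyadic_rep H1C H2C \<theta> \<phi> \<psi> S" and v: "v \<in> ?I"
    have "v \<in> verts G" using v edgeD endsD by (auto simp: vt_def)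
    then have "kirchhoff_sum G \<phi> v = 0" using A[OF \<theta>2] \<phi> by (auto simp: Kset_def)
    then show "(\<lambda>j. kirchhoff_sum G (\<psi> j) v) \<longlonglongrightarrow> 0" using dyadic_kirchhoff_tendsto[OF \<theta>2 \<theta>(2) D, of v] by simp
  qed
qed

lemma interp_DK_embeds: "0 < \<theta> \<Longrightarrow> \<theta> < 1 \<Longrightarrow> interp H1C DK \<theta> \<hookrightarrow> interp H1C H2C \<theta>"
  by (intro interp_mono couples couple_DK embeds_refl embeds_subspace quad_HC quad_DK) auto

lemma interp_DK_kirchhoff:
  assumes \<theta>: "1/2 < \<theta>" "\<theta> < 1" and \<phi>: "\<phi> \<in> fs_carrier (interp H1C DK \<theta>)"
  shows "\<phi> \<in> Kset"
proof -
  have \<theta>0: "0 < \<theta>" using \<theta> by simp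
  obtain \<psi> where D: "dyadic_rep H1C DK \<theta> \<phi> \<psi> (2 * 4 powr \<theta> * (fs_sq (interp H1C DK \<theta>) \<phi> + 1))"
    by (rule dyadic_of_interp[OF couple_DK \<theta>0 \<theta>(2) \<phi>]) auto
  have D': "dyadic_rep H1C H2C \<theta> \<phi> \<psi> (2 * 4 powr \<theta> * (fs_sq (interp H1C DK \<theta>) \<phi> + 1))"
    by (rule dyadic_rep_mono[OF D]) auto
  have "kirchhoff_sum G \<phi> v = 0" if v: "v \<in> verts G" for v
  proof -
    have "kirchhoff_sum G (\<psi> j) v = 0" for j using dyadic_repD(1)[OF D, of j] v by (simp add: Kset_def)
    then have "(\<lambda>j. 0) \<longlonglongrightarrow> kirchhoff_sum G \<phi> v" using dyadic_kirchhoff_tendsto[OF \<theta> D', of v] by simp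
    then show ?thesis using LIMSEQ_unique tendsto_const by blast
  qed
  then show ?thesis by (simp add: Kset_def)
qed

section \<open>Hoelder continuity\<close>

text \<open>Connectedness excludes isolated vertices as soon as there is an edge: a path from p to
  the midpoint of an edge either is empty or starts on an edge through p.\<close>

lemma point_on_edge:
  assumes ne: "edges G \<noteq> {}" and p: "p \<in> points G"
  shows "\<exists>e\<in>edges G. \<exists>x\<in>{0..len G e}. p = ep e x"
proof -
  obtain e where e: "e \<in> edges G" using ne by blast
  define m where "m = len G e / 2"
  have m: "0 < m" "m < len G e" using edgeD(1)[OF e] by (simp_all add: m_def)
  have q: "ep e m \<in> points G" using m by (intro ep_in_points[OF e]) auto
  obtain s where s: "is_path G p s (ep e m)" using conn p q by (auto simp: connected_graph_def)
  show ?thesis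
  proof (cases s)
    case Nil
    then show ?thesis using s e m by (intro bexI[of _ e] bexI[of _ m]) auto
  next
    case (Cons a t)
    obtain e1 x1 y1 where a: "a = (e1, x1, y1)" by (cases a) auto
    show ?thesis using s unfolding Cons a by (intro bexI[of _ e1] bexI[of _ x1]) auto
  qed
qed

text \<open>Close points are joined through at most one vertex, which costs 2 * 2^\<gamma> <= 4; for
  distances of at least \<open>lmin\<close> the sup bound gives 2 / lmin. One more M accounts for
  the sup norm itself, whence 5 + 2 / lmin.\<close>

lemma holder_of_edges:
  assumes M: "0 \<le> M" and \<gamma>: "0 < \<gamma>" "\<gamma> \<le> 1"
    and ae: "\<And>e. e \<in> edges G \<Longrightarrow> AE x in leb (len G e). restr G u e x = k e x"
    and val: "\<And>e. e \<in> edges G \<Longrightarrow> k e 0 = val (src G e)" "\<And>e. e \<in> edges G \<Longrightarrow> k e (len G e) = val (tgt G e)"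
    and sup: "\<And>e x. e \<in> edges G \<Longrightarrow> x \<in> {0..len G e} \<Longrightarrow> \<bar>k e x\<bar> \<le> M"
    and hol: "\<And>e x y. e \<in> edges G \<Longrightarrow> x \<in> {0..len G e} \<Longrightarrow> y \<in> {0..len G e} \<Longrightarrow> \<bar>k e x - k e y\<bar> \<le> M * \<bar>x - y\<bar> powr \<gamma>"
  shows "u \<in> fs_carrier (holder_space G \<gamma>) \<and> fs_norm (holder_space G \<gamma>) u \<le> (5 + 2 / lmin) * M"
proof -
  have C0: "0 \<le> (4 + 2 / lmin) * M" "0 \<le> (5 + 2 / lmin) * M" using M lmin(1) by simp_all
  have "\<exists>f. ae_on_graph G (\<lambda>p. u p = f p) \<and> holder_enorm G \<gamma> f \<le> ennreal ((5 + 2 / lmin) * M)"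
  proof (cases "edges G = {}")
    case True
    have "ae_on_graph G (\<lambda>p. u p = 0)" using True by (simp add: ae_on_graph_def)
    moreover have "holder_enorm G \<gamma> (\<lambda>p. 0) \<le> 0 + 0"
      unfolding holder_enorm_def by (intro add_mono SUP_least) auto
    ultimately show ?thesis by (intro exI[of _ "\<lambda>p. 0"]) auto
  next
    case ne: False
    let ?f = "glue val k"
    have r: "restr G ?f e = k e" if "e \<in> edges G" for e using restr_glue[of k e val] val that by auto
    have 1: "ae_on_graph G (\<lambda>p. u p = ?f p)" unfolding ae_on_graph_restr using ae r by simp
    have bd: "\<bar>?f p\<bar> \<le> M" if p: "p \<in> points G" for p
    proof -
      obtain e x where ex: "e \<in> edges G" "x \<in> {0..len G e}" "p = ep e x" using point_on_edge[OF ne p] by blast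
      have "?f p = k e x" using r[OF ex(1)] ex(3) by (simp add: restr_def fun_eq_iff)
      then show ?thesis using sup ex by simp
    qed
    have q: "\<bar>?f p - ?f q\<bar> / gdist G p q powr \<gamma> \<le> (4 + 2 / lmin) * M" if p: "p \<in> points G" and q: "q \<in> points G" for p q
    proof -
      let ?d = "gdist G p q"
      have d0: "0 \<le> ?d" by (rule gdist_nonneg[OF p q])
      consider "?d = 0" | "0 < ?d" "?d < lmin" | "lmin \<le> ?d" using d0 by linarith
      then show ?thesis
      proof cases
        \<comment> \<open>The case p = q is included; the quotient is then 0 by the convention on
          division by zero.\<close>
        case 1 then show ?thesis using C0 by simp
      next
        case 2
        \<comment> \<open>The distance is an infimum of path lengths, so a path of length below
          twice the distance is taken.\<close>
        then have "?d < min lmin (2 * ?d)" by simp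
        from gdist_less_path[OF p q this] obtain s where s: "is_path G p s q" "path_length s < min lmin (2 * ?d)" by blast
        have n: "near p q (path_length s)" using s by (intro near_path) auto
        have "\<bar>?f p - ?f q\<bar> \<le> 2 * (M * (2 * ?d) powr \<gamma>)"
        proof (rule near_osc[OF n])
          show "0 \<le> M * (2 * ?d) powr \<gamma>" using M by simp
          fix e x y assume e: "e \<in> edges G" "x \<in> {0..len G e}" "y \<in> {0..len G e}" "\<bar>x - y\<bar> \<le> path_length s"
          have "\<bar>restr G ?f e x - restr G ?f e y\<bar> \<le> M * \<bar>x - y\<bar> powr \<gamma>" unfolding r[OF e(1)] by (rule hol[OF e(1-3)])
          also have "\<dots> \<le> M * (2 * ?d) powr \<gamma>"
            using e(4) s(2) \<gamma> M by (intro mult_left_mono powr_mono2) auto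
          finally show "\<bar>restr G ?f e x - restr G ?f e y\<bar> \<le> M * (2 * ?d) powr \<gamma>" .
        qed
        also have "(2 * ?d) powr \<gamma> = 2 powr \<gamma> * ?d powr \<gamma>" using d0 by (simp add: powr_mult)
        also have "2 * (M * (2 powr \<gamma> * ?d powr \<gamma>)) \<le> 2 * (M * (2 * ?d powr \<gamma>))"
        proof -
          have "2 powr \<gamma> \<le> (2::real) powr 1" using \<gamma> by (intro powr_mono) auto
          then show ?thesis using M by (intro mult_left_mono mult_right_mono) auto
        qed
        finally have "\<bar>?f p - ?f q\<bar> \<le> (4 * M) * ?d powr \<gamma>" by (simp add: mult_ac)
        then have "\<bar>?f p - ?f q\<bar> / ?d powr \<gamma> \<le> 4 * M" using 2 by (simp add: pos_divide_le_eq)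
        also have "\<dots> \<le> (4 + 2 / lmin) * M" using M lmin(1) by (intro mult_right_mono) auto
        finally show ?thesis .
      next
        case 3
        have "lmin powr 1 \<le> lmin powr \<gamma>" using lmin \<gamma> by (intro powr_mono') auto
        also have "\<dots> \<le> ?d powr \<gamma>" using 3 lmin(1) \<gamma> by (intro powr_mono2) auto
        finally have l: "lmin \<le> ?d powr \<gamma>" using lmin(1) by simp
        have "\<bar>?f p - ?f q\<bar> \<le> 2 * M" using bd[OF p] bd[OF q] by linarith
        then have "\<bar>?f p - ?f q\<bar> / ?d powr \<gamma> \<le> 2 * M / lmin" using l lmin(1) M by (intro frac_le) auto
        also have "\<dots> \<le> (4 + 2 / lmin) * M" using M by (simp add: distrib_right)
        finally show ?thesis .
      qed
    qed
    have "holder_enorm G \<gamma> ?f \<le> ennreal M + ennreal ((4 + 2 / lmin) * M)"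
      unfolding holder_enorm_def
    proof (intro add_mono SUP_least)
      show "ennreal \<bar>?f p\<bar> \<le> ennreal M" if "p \<in> points G" for p using bd[OF that] by (rule ennreal_leI)
      fix z assume z: "z \<in> {(p, q). p \<in> points G \<and> q \<in> points G \<and> p \<noteq> q}"
      obtain p q where zz: "z = (p, q)" by (cases z)
      have "ennreal (\<bar>?f p - ?f q\<bar> / gdist G p q powr \<gamma>) \<le> ennreal ((4 + 2 / lmin) * M)"
        using z zz by (intro ennreal_leI q) auto
      then show "(case z of (p, q) \<Rightarrow> ennreal (\<bar>?f p - ?f q\<bar> / gdist G p q powr \<gamma>)) \<le> ennreal ((4 + 2 / lmin) * M)"
        by (simp add: zz)
    qed
    also have "\<dots> = ennreal (M + (4 + 2 / lmin) * M)" using M C0 by (intro ennreal_plus[symmetric]) auto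
    also have "M + (4 + 2 / lmin) * M = (5 + 2 / lmin) * M" by (simp add: algebra_simps)
    finally show ?thesis using 1 by blast
  qed
  then obtain f where f: "ae_on_graph G (\<lambda>p. u p = f p)" "holder_enorm G \<gamma> f \<le> ennreal ((5 + 2 / lmin) * M)" by blast
  have "u \<in> fs_carrier (holder_space G \<gamma>)"
    using f le_less_trans[OF f(2) ennreal_less_top] by (auto simp: holder_space_def)
  moreover have "(INF \<phi>\<in>{\<phi>. ae_on_graph G (\<lambda>p. u p = \<phi> p)}. holder_enorm G \<gamma> \<phi>) \<le> ennreal ((5 + 2 / lmin) * M)"
    by (rule INF_lower2[of f]) (simp_all add: f)
  then have "fs_norm (holder_space G \<gamma>) u \<le> (5 + 2 / lmin) * M"
    unfolding holder_space_def using C0(2) by (simp add: enn2real_leI)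
  ultimately show ?thesis ..
qed

lemma holder_norm_nonneg: "0 \<le> fs_norm (holder_space G \<gamma>) u"
  by (simp add: holder_space_def)

lemma H1_sup_bound:
  assumes "u \<in> fs_carrier H1t" "e \<in> edges G" "x \<in> {0..len G e}"
  shows "\<bar>tr u e x\<bar> \<le> sqrt (2 * cT) * fs_norm H1t u"
proof -
  have "(tr u e x)\<^sup>2 \<le> cT * (fs_sq L2G u + fs_sq H1t u)" using tr_bound[OF assms, of 0] by simp
  also have "\<dots> \<le> cT * (fs_sq H1t u + fs_sq H1t u)"
    using H1_norm_mono[of u] cT_nonneg by (intro mult_left_mono) auto
  finally have "sqrt ((tr u e x)\<^sup>2) \<le> sqrt (2 * cT * fs_sq H1t u)" by (intro real_sqrt_le_mono) simp
  also have "\<dots> = sqrt (2 * cT) * fs_norm H1t u"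
    using quad_space_nonneg[OF quad_Ht, of 1 u] by (simp only: real_sqrt_mult real_sqrt_abs) simp
  finally show ?thesis by simp
qed

lemma H1_osc_bound:
  assumes "u \<in> fs_carrier H1t" "e \<in> edges G" "x \<in> {0..len G e}" "y \<in> {0..len G e}"
  shows "(tr u e x - tr u e y)\<^sup>2 \<le> \<bar>x - y\<bar> * fs_sq H1t u"
proof -
  have "(tr u e x - tr u e y)\<^sup>2 \<le> \<bar>x - y\<bar> * nsq (len G e) (wd u e)"
    by (rule prim_holder[OF H1D(4)[OF assms(1,2)] assms(4,3)])
  also have "\<dots> \<le> \<bar>x - y\<bar> * fs_sq H1t u" by (intro mult_left_mono edge_norm_le(2)[OF assms(2)]) simp
  finally show ?thesis .
qed

lemma H1C_embeds_holder: "H1C \<hookrightarrow> holder_space G (1/2)"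
proof (rule embedsI_sq)
  show n: "0 \<le> fs_norm H1C u" for u using quad_space_nonneg[OF quad_Ht, of 1 u] by simp
  fix u assume "u \<in> fs_carrier H1C"
  then have u: "u \<in> fs_carrier H1t" "u \<in> cont_space G" by auto
  obtain val where val: "\<forall>e\<in>edges G. tr u e 0 = val (src G e) \<and> tr u e (len G e) = val (tgt G e)"
    using cont_spaceD[OF u(2)] ..
  define M where "M = (sqrt (2 * cT) + 1) * fs_norm H1t u"
  have n1: "0 \<le> fs_norm H1t u" using n by simp
  have M: "0 \<le> M" using n1 cT_nonneg by (simp add: M_def)
  have "u \<in> fs_carrier (holder_space G (1/2)) \<and> fs_norm (holder_space G (1/2)) u \<le> (5 + 2 / lmin) * M"
  proof (rule holder_of_edges[OF M _ _ H1D(5)[OF u(1)]])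
    fix e assume e: "e \<in> edges G"
    show "tr u e 0 = val (src G e)" "tr u e (len G e) = val (tgt G e)" using val e by auto
    fix x assume x: "x \<in> {0..len G e}"
    show "\<bar>tr u e x\<bar> \<le> M" using H1_sup_bound[OF u(1) e x] n1 by (simp add: M_def distrib_right)
    fix y assume y: "y \<in> {0..len G e}"
    have "sqrt ((tr u e x - tr u e y)\<^sup>2) \<le> sqrt (\<bar>x - y\<bar> * fs_sq H1t u)"
      by (intro real_sqrt_le_mono H1_osc_bound u e x y)
    then have "\<bar>tr u e x - tr u e y\<bar> \<le> fs_norm H1t u * \<bar>x - y\<bar> powr (1/2)"
      using n1 by (simp add: real_sqrt_mult powr_half_sqrt mult.commute)
    also have "\<dots> \<le> M * \<bar>x - y\<bar> powr (1/2)" using n1 cT_nonneg by (intro mult_right_mono) (auto simp: M_def distrib_right)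
    finally show "\<bar>tr u e x - tr u e y\<bar> \<le> M * \<bar>x - y\<bar> powr (1/2)" .
  qed auto
  then show "u \<in> fs_carrier (holder_space G (1/2))"
    and "fs_sq (holder_space G (1/2)) u \<le> ((5 + 2 / lmin) * (sqrt (2 * cT) + 1))\<^sup>2 * fs_sq H1C u"
    using power_mono[OF _ holder_norm_nonneg, of "1/2" u "(5 + 2 / lmin) * M" 2]
    by (auto simp: M_def power_mult_distrib)
qed

text \<open>For two points choose the scale 2^-j comparable to their distance. The representative is
  within order r^j of the j-th approximant, and the approximant itself oscillates by at most its H^1
  norm times the square root of the distance; both are of order |x - y|^\<gamma>.\<close>

lemma interp_embeds_holder:
  assumes \<beta>: "1/2 < \<beta>" "\<beta> < 1"
  shows "interp L2G H1C \<beta> \<hookrightarrow> holder_space G (\<beta> - 1/2)"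
proof -
  have \<beta>0: "0 < \<beta>" using \<beta> by simp
  define r where "r = 1 / sqrt (4 powr \<beta> / 2)"
  have "1 < (4::real) powr \<beta> / 2" using half_weight(3)[of \<beta>] \<beta> by simp
  then have r: "0 < r" "r < 1" by (simp_all add: r_def)
  define \<gamma> where "\<gamma> = \<beta> - 1/2"
  have \<gamma>: "0 < \<gamma>" "\<gamma> \<le> 1" using \<beta> by (simp_all add: \<gamma>_def)
  \<comment> \<open>Dividing distances on an edge by \<open>Lm\<close> brings them into (0, 1],
    where a dyadic scale exists.\<close>
  define Lm where "Lm = 1 + (\<Sum>e\<in>edges G. len G e)"
  have Lm: "1 \<le> Lm" "e \<in> edges G \<Longrightarrow> len G e \<le> Lm" for e
  proof -
    have p: "0 \<le> len G e" if "e \<in> edges G" for e using edgeD(1)[OF that] by simp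
    show "1 \<le> Lm" unfolding Lm_def using p by (simp add: sum_nonneg)
    show "e \<in> edges G \<Longrightarrow> len G e \<le> Lm"
      using member_le_sum[of e "edges G" "len G"] p fin_E by (fastforce simp: Lm_def)
  qed
  define B where "B = sqrt (20 * cT) / (1 - r)"
  have B: "0 \<le> B" using r cT_nonneg by (simp add: B_def)
  \<comment> \<open>The first term serves the sup bound. The other two serve the Hoelder bound: an
    approximation error at each of the two points and the oscillation of the approximant, doubled
    since \<rho> is at most 2 |x - y|^\<gamma>.\<close>
  define H where "H = sqrt (2 * cT) + 4 * B + 2 * sqrt Lm"
  have H: "0 \<le> H" using B Lm cT_nonneg by (simp add: H_def)
  \<comment> \<open>r = 2^-\<gamma>, and the growth of the squared H^1 norms of the approximants
    times the distance 2^-j has the ratio r^2: both error sources decay at the same rate.\<close>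
  have pr: "r ^ j = ((1/2) ^ j) powr \<gamma>" "(4 / 4 powr \<beta>) ^ j * (1/2) ^ j = (((1/2) ^ j) powr \<gamma>)\<^sup>2" for j
  proof -
    have r2: "r = (1/2) powr \<gamma>"
    proof -
      have "(4::real) powr \<beta> / 2 = 2 powr (2 * \<gamma>)"
        using powr_powr[of 2 2 \<beta>] by (simp add: \<gamma>_def powr_diff right_diff_distrib)
      then have "sqrt (4 powr \<beta> / 2) = 2 powr \<gamma>" by (simp add: powr_half_sqrt[symmetric] powr_powr)
      then show ?thesis by (simp add: r_def powr_divide)
    qed
    have c: "((1/2::real) ^ j) powr \<gamma> = ((1/2) powr \<gamma>) ^ j"
      by (simp add: powr_realpow[symmetric] powr_powr mult.commute)
    show "r ^ j = ((1/2) ^ j) powr \<gamma>" unfolding c r2 ..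
    have "r\<^sup>2 = 2 / 4 powr \<beta>" by (simp add: r_def power_divide)
    then have "4 / 4 powr \<beta> * (1/2) = r\<^sup>2" by simp
    then show "(4 / 4 powr \<beta>) ^ j * (1/2) ^ j = (((1/2) ^ j) powr \<gamma>)\<^sup>2"
      unfolding c r2[symmetric] power_mult_distrib[symmetric] by (simp add: power_mult[symmetric] mult.commute)
  qed
  have "interp L2G H1C \<beta> \<sqinter>\<^sub>s UNIV \<hookrightarrow> holder_space G (\<beta> - 1/2)"
  proof (rule interp_embeds[OF couples(2) \<beta>0 \<beta>(2), of "((5 + 2 / lmin) * H)\<^sup>2"])
    show "0 \<le> ((5 + 2 / lmin) * H)\<^sup>2" by simp
    fix \<phi> \<psi> S assume D: "dyadic_rep L2G H1C \<beta> \<phi> \<psi> S"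
    note D' = dyadic_repD[OF D]
    have Dt: "dyadic_rep L2G H1t \<beta> \<phi> \<psi> S" by (rule dyadic_rep_mono[OF D]) auto
    have S: "0 \<le> S" by (rule D'(5))
    have \<psi>: "\<psi> j \<in> fs_carrier H1t" for j using D'(1) by simp
    have "\<forall>e\<in>edges G. \<exists>k. continuous_on {0..len G e} k \<and> (AE x in leb (len G e). restr G \<phi> e x = k x) \<and>
      (\<forall>j. \<forall>x\<in>{0..len G e}. \<bar>k x - tr (\<psi> j) e x\<bar> \<le> sqrt (20 * cT * S) * r ^ j / (1 - r))"
      unfolding r_def by (intro ballI dyadic_graph_limit(3)[OF \<beta> Dt])
    from bchoice[OF this] obtain k where k: "\<forall>e\<in>edges G. continuous_on {0..len G e} (k e) \<and> (AE x in leb (len G e). restr G \<phi> e x = k e x) \<and>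
      (\<forall>j. \<forall>x\<in>{0..len G e}. \<bar>k e x - tr (\<psi> j) e x\<bar> \<le> sqrt (20 * cT * S) * r ^ j / (1 - r))" ..
    have kb: "\<bar>k e x - tr (\<psi> j) e x\<bar> \<le> B * sqrt S * r ^ j" if "e \<in> edges G" "x \<in> {0..len G e}" for e x j
      using k that by (simp add: B_def real_sqrt_mult)
    have kt: "tr \<phi> e x = k e x" if "e \<in> edges G" "x \<in> {0..len G e}" for e x
      unfolding tr_def using k that edgeD(1)[OF that(1)] by (intro trace_int_eq) auto
    obtain val where val: "\<forall>e\<in>edges G. tr \<phi> e 0 = val (src G e) \<and> tr \<phi> e (len G e) = val (tgt G e)"
      using cont_spaceD[OF dyadic_cont[OF \<beta> D]] ..
    have N1: "fs_sq H1t (\<psi> j) \<le> (4 / 4 powr \<beta>) ^ j * S" for j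
    proof -
      have "fs_sq H1t (\<psi> j) / 4 ^ j \<le> dyadic_term L2G H1C \<phi> \<psi> j" by (simp add: dyadic_term_def)
      also have "\<dots> \<le> S / (4 powr \<beta>) ^ j" using D'(4)[of j] by (simp add: pos_le_divide_eq mult.commute)
      finally show ?thesis by (simp add: power_divide pos_divide_le_eq mult.commute)
    qed
    define M where "M = H * sqrt S"
    have M: "0 \<le> M" using H S by (simp add: M_def)
    have "\<phi> \<in> fs_carrier (holder_space G \<gamma>) \<and> fs_norm (holder_space G \<gamma>) \<phi> \<le> (5 + 2 / lmin) * M"
    proof (rule holder_of_edges[OF M \<gamma>, of \<phi> k val])
      fix e assume e: "e \<in> edges G"
      show "AE x in leb (len G e). restr G \<phi> e x = k e x" using k e by blast
      have z: "0 \<in> {0..len G e}" "len G e \<in> {0..len G e}" using edgeD(1)[OF e] by auto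
      show "k e 0 = val (src G e)" "k e (len G e) = val (tgt G e)" using val e kt[OF e z(1)] kt[OF e z(2)] by auto
      fix x assume x: "x \<in> {0..len G e}"
      show "\<bar>k e x\<bar> \<le> M"
      proof -
        have "fs_sq H1t (\<psi> 0) \<le> S" using N1[of 0] by simp
        then have "fs_norm H1t (\<psi> 0) \<le> sqrt S" by (rule real_le_rsqrt)
        then have "sqrt (2 * cT) * fs_norm H1t (\<psi> 0) \<le> sqrt (2 * cT) * sqrt S" using cT_nonneg by (intro mult_left_mono) auto
        then have "\<bar>k e x\<bar> \<le> (sqrt (2 * cT) + B) * sqrt S"
          using H1_sup_bound[OF \<psi>[of 0] e x] kb[OF e x, of 0] by (simp add: distrib_right)
        also have "\<dots> \<le> M" unfolding M_def H_def using B S Lm by (intro mult_right_mono) auto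
        finally show ?thesis .
      qed
      fix y assume y: "y \<in> {0..len G e}"
      show "\<bar>k e x - k e y\<bar> \<le> M * \<bar>x - y\<bar> powr \<gamma>"
      proof (cases "x = y")
        case False
        define d where "d = \<bar>x - y\<bar> / Lm"
        have d: "0 < d" "d \<le> 1" "d \<le> \<bar>x - y\<bar>"
        proof -
          show "0 < d" using False Lm(1) by (simp add: d_def)
          have "\<bar>x - y\<bar> \<le> Lm" using x y Lm(2)[OF e] by auto
          then show "d \<le> 1" using Lm(1) by (simp add: d_def pos_divide_le_eq)
          have "\<bar>x - y\<bar> * 1 \<le> \<bar>x - y\<bar> * Lm" using Lm(1) by (intro mult_left_mono) auto
          then show "d \<le> \<bar>x - y\<bar>" using Lm(1) by (simp add: d_def pos_divide_le_eq)
        qed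
        obtain j where j: "(1/2) ^ Suc j < d" "d \<le> (1/2) ^ j" using dyadic_cover_small[OF d(1,2)] .
        define \<rho> where "\<rho> = ((1/2) ^ j) powr \<gamma>"
        have \<rho>: "0 \<le> \<rho>" "\<rho> \<le> 2 * \<bar>x - y\<bar> powr \<gamma>"
        proof -
          show "0 \<le> \<rho>" by (simp add: \<rho>_def)
          have "(1/2) ^ j \<le> 2 * d" using j(1) by simp
          then have "\<rho> \<le> (2 * \<bar>x - y\<bar>) powr \<gamma>" unfolding \<rho>_def using d(3) \<gamma> by (intro powr_mono2) auto
          also have "\<dots> = 2 powr \<gamma> * \<bar>x - y\<bar> powr \<gamma>" by (simp add: powr_mult)
          also have "\<dots> \<le> 2 powr 1 * \<bar>x - y\<bar> powr \<gamma>" using \<gamma> by (intro mult_right_mono powr_mono) auto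
          finally show "\<rho> \<le> 2 * \<bar>x - y\<bar> powr \<gamma>" by simp
        qed
        have "(tr (\<psi> j) e x - tr (\<psi> j) e y)\<^sup>2 \<le> \<bar>x - y\<bar> * fs_sq H1t (\<psi> j)"
          by (rule H1_osc_bound[OF \<psi> e x y])
        also have "\<dots> \<le> (Lm * (1/2) ^ j) * ((4 / 4 powr \<beta>) ^ j * S)"
        proof (intro mult_mono N1)
          have "\<bar>x - y\<bar> = Lm * d" using Lm(1) by (simp add: d_def)
          also have "\<dots> \<le> Lm * (1/2) ^ j" using j(2) Lm(1) by (intro mult_left_mono) auto
          finally show "\<bar>x - y\<bar> \<le> Lm * (1/2) ^ j" .
        qed (use Lm(1) in auto)
        also have "\<dots> = Lm * S * \<rho>\<^sup>2" unfolding \<rho>_def pr(2)[symmetric] by (simp add: mult_ac)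
        finally have "sqrt ((tr (\<psi> j) e x - tr (\<psi> j) e y)\<^sup>2) \<le> sqrt (Lm * S * \<rho>\<^sup>2)" by (rule real_sqrt_le_mono)
        then have t: "\<bar>tr (\<psi> j) e x - tr (\<psi> j) e y\<bar> \<le> sqrt Lm * sqrt S * \<rho>"
          using \<rho>(1) by (simp add: real_sqrt_mult)
        have kx: "\<bar>k e x - tr (\<psi> j) e x\<bar> \<le> B * sqrt S * \<rho>" "\<bar>k e y - tr (\<psi> j) e y\<bar> \<le> B * sqrt S * \<rho>"
          using kb[OF e x, of j] kb[OF e y, of j] unfolding pr(1) \<rho>_def by auto
        have "\<bar>k e x - k e y\<bar> \<le> B * sqrt S * \<rho> + B * sqrt S * \<rho> + sqrt Lm * sqrt S * \<rho>"
          using t kx by linarith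
        also have "\<dots> = (2 * B + sqrt Lm) * sqrt S * \<rho>" by (simp add: algebra_simps)
        also have "\<dots> \<le> (2 * B + sqrt Lm) * sqrt S * (2 * \<bar>x - y\<bar> powr \<gamma>)"
          using \<rho>(2) B Lm S by (intro mult_left_mono) auto
        also have "\<dots> = ((4 * B + 2 * sqrt Lm) * sqrt S) * \<bar>x - y\<bar> powr \<gamma>" by (simp add: algebra_simps)
        also have "\<dots> \<le> M * \<bar>x - y\<bar> powr \<gamma>"
          unfolding M_def H_def using S cT_nonneg by (intro mult_right_mono) auto
        finally show ?thesis .
      qed simp
    qed
    then have a: "\<phi> \<in> fs_carrier (holder_space G \<gamma>)" "fs_norm (holder_space G \<gamma>) \<phi> \<le> ((5 + 2 / lmin) * H) * sqrt S"
      by (simp_all add: M_def mult.assoc)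
    have "fs_sq (holder_space G \<gamma>) \<phi> \<le> (((5 + 2 / lmin) * H) * sqrt S)\<^sup>2"
      by (rule power_mono[OF a(2) holder_norm_nonneg])
    also have "\<dots> = ((5 + 2 / lmin) * H)\<^sup>2 * S" using S by (simp add: power_mult_distrib)
    finally show "\<phi> \<in> fs_carrier (holder_space G (\<beta> - 1/2)) \<and> fs_sq (holder_space G (\<beta> - 1/2)) \<phi> \<le> ((5 + 2 / lmin) * H)\<^sup>2 * S"
      using a(1) by (simp add: \<gamma>_def)
  qed
  then show ?thesis by simp
qed

end

section \<open>Symmetric forms and completeness\<close>

text \<open>Used for the L2 inner product and for the energy form, so that orthogonality of finite
  sums and Bessel's inequality are obtained for both from the same argument.\<close>

locale sym_form =
  fixes W :: "('p \<Rightarrow> real) set" and B :: "('p \<Rightarrow> real) \<Rightarrow> ('p \<Rightarrow> real) \<Rightarrow> real"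
  assumes W_lin: "\<And>u v a b. u \<in> W \<Longrightarrow> v \<in> W \<Longrightarrow> (\<lambda>p. a * u p + b * v p) \<in> W"
    and W_zero: "(\<lambda>p. 0) \<in> W"
    and B_lin: "\<And>u v w a b. u \<in> W \<Longrightarrow> v \<in> W \<Longrightarrow> w \<in> W \<Longrightarrow> B (\<lambda>p. a * u p + b * v p) w = a * B u w + b * B v w"
    and B_sym: "\<And>u v. B u v = B v u"
    and B_nonneg: "\<And>u. u \<in> W \<Longrightarrow> 0 \<le> B u u"
begin

lemma B_sum:
  assumes "finite F" "\<And>k. k \<in> F \<Longrightarrow> f k \<in> W" "w \<in> W"
  shows "(\<lambda>p. \<Sum>k\<in>F. b k * f k p) \<in> W \<and> B (\<lambda>p. \<Sum>k\<in>F. b k * f k p) w = (\<Sum>k\<in>F. b k * B (f k) w)"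
  using assms(1,2)
proof (induction F)
  case empty
  show ?case using W_zero B_lin[OF W_zero W_zero assms(3), of 0 0] by simp
next
  case (insert i F)
  have i: "f i \<in> W" and IH: "(\<lambda>p. \<Sum>k\<in>F. b k * f k p) \<in> W" "B (\<lambda>p. \<Sum>k\<in>F. b k * f k p) w = (\<Sum>k\<in>F. b k * B (f k) w)"
    using insert by auto
  have eq: "(\<lambda>p. \<Sum>k\<in>insert i F. b k * f k p) = (\<lambda>p. b i * f i p + 1 * (\<Sum>k\<in>F. b k * f k p))" using insert by simp
  show ?case unfolding eq
    using W_lin[OF i IH(1), of "b i" 1] B_lin[OF i IH(1) assms(3), of "b i" 1] IH(2) insert(1,2) by simp
qed

lemma B_orthogonal:
  assumes F: "finite F" and f: "\<And>k. k \<in> F \<Longrightarrow> f k \<in> W"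
    and o: "\<And>j k. j \<in> F \<Longrightarrow> k \<in> F \<Longrightarrow> B (f j) (f k) = (if j = k then w k else 0)"
  shows "B (\<lambda>p. \<Sum>k\<in>F. b k * f k p) (\<lambda>p. \<Sum>k\<in>F. b k * f k p) = (\<Sum>k\<in>F. w k * (b k)\<^sup>2)"
proof -
  let ?s = "\<lambda>p. \<Sum>k\<in>F. b k * f k p"
  have s: "?s \<in> W" using B_sum[OF F f W_zero] by simp
  have "B ?s ?s = (\<Sum>k\<in>F. b k * B ?s (f k))" using B_sum[OF F f s] B_sym by simp
  also have "\<dots> = (\<Sum>k\<in>F. b k * (w k * b k))"
  proof (intro sum.cong refl)
    fix k assume k: "k \<in> F"
    have "B ?s (f k) = (\<Sum>j\<in>F. if j = k then w k * b k else 0)"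
    proof -
      have "B ?s (f k) = (\<Sum>j\<in>F. b j * B (f j) (f k))" using B_sum[OF F f f[OF k], where b = b] by simp
      also have "\<dots> = (\<Sum>j\<in>F. if j = k then w k * b k else 0)" by (intro sum.cong refl) (simp add: o k)
      finally show ?thesis .
    qed
    then show "b k * B ?s (f k) = b k * (w k * b k)" using F k by simp
  qed
  finally show ?thesis by (simp add: power2_eq_square mult_ac)
qed

text \<open>The distance of u to the span in the form is nonnegative. The weights \<open>w k\<close>
  are 1 for the inner product and the eigenvalues for the energy form, for which the L2 normalised
  eigenfunctions are still orthogonal.\<close>

lemma bessel:
  assumes F: "finite F" and f: "\<And>k. k \<in> F \<Longrightarrow> f k \<in> W"
    and o: "\<And>j k. j \<in> F \<Longrightarrow> k \<in> F \<Longrightarrow> B (f j) (f k) = (if j = k then w k else 0)"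
    and u: "u \<in> W" and c: "\<And>k. k \<in> F \<Longrightarrow> B u (f k) = w k * c k"
  shows "(\<Sum>k\<in>F. w k * (c k)\<^sup>2) \<le> B u u"
proof -
  let ?s = "\<lambda>p. \<Sum>k\<in>F. c k * f k p" and ?n = "\<Sum>k\<in>F. w k * (c k)\<^sup>2"
  have s: "?s \<in> W" using B_sum[OF F f W_zero] by simp
  have "B ?s u = (\<Sum>k\<in>F. c k * B (f k) u)" using B_sum[OF F f u, where b = c] by simp
  also have "\<dots> = ?n"
  proof (intro sum.cong refl)
    fix k assume "k \<in> F"
    then have "B (f k) u = w k * c k" using c B_sym[of u "f k"] by simp
    then show "c k * B (f k) u = w k * (c k)\<^sup>2" by (simp add: power2_eq_square)
  qed
  finally have us: "B ?s u = ?n" .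
  have ss: "B ?s ?s = ?n" by (rule B_orthogonal[OF F f o])
  let ?d = "\<lambda>p. 1 * u p + (-1) * ?s p"
  have d: "?d \<in> W" by (rule W_lin[OF u s])
  have "B ?d ?d = B u ?d - B ?s ?d" using B_lin[OF u s d, of 1 "-1"] by simp
  also have "\<dots> = (B u u - ?n) - (?n - ?n)"
    using B_lin[OF u s u, of 1 "-1"] B_lin[OF u s s, of 1 "-1"] B_sym[of u ?d] B_sym[of ?s ?d] B_sym[of u ?s] us ss by simp
  finally show ?thesis using B_nonneg[OF d] by simp
qed

end

lemma edge_complete:
  assumes l: "0 < l" and p: "\<And>n. prim l (h n) (g n)" and f: "f \<in> L2_int l"
    and lf: "(\<lambda>n. nsq l (\<lambda>x. h n x - f x)) \<longlonglongrightarrow> 0"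
    and C: "\<And>e. 0 < e \<Longrightarrow> \<exists>N. \<forall>m\<ge>N. \<forall>n\<ge>N. nsq l (\<lambda>x. g m x - g n x) < e"
  shows "\<exists>k g'. prim l k g' \<and> (AE x in leb l. f x = k x) \<and>
    (\<lambda>n. nsq l (\<lambda>x. g n x - g' x)) \<longlonglongrightarrow> 0 \<and> (\<forall>x\<in>{0..l}. (\<lambda>n. h n x) \<longlonglongrightarrow> k x)"
proof -
  obtain g' where g': "g' \<in> L2_int l" "(\<lambda>n. nsq l (\<lambda>x. g n x - g' x)) \<longlonglongrightarrow> 0"
    by (rule L2_int_complete[OF primD(1)[OF p] C])
  obtain k where k: "prim l k g'" "AE x in leb l. f x = k x" "\<And>x. x \<in> {0..l} \<Longrightarrow> (\<lambda>n. h n x) \<longlonglongrightarrow> k x"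
    by (rule prim_limit[OF l p f g'(1) lf g'(2)]) blast
  have "\<forall>x\<in>{0..l}. (\<lambda>n. h n x) \<longlonglongrightarrow> k x" using k(3) by simp
  then show ?thesis using k(1,2) g'(2) by blast
qed

context compact_graph
begin

definition cauchy_in :: "(('v, 'e) point \<Rightarrow> real) function_space \<Rightarrow> (nat \<Rightarrow> ('v, 'e) point \<Rightarrow> real) \<Rightarrow> bool" where
  "cauchy_in X f \<longleftrightarrow> (\<forall>n. f n \<in> fs_carrier X) \<and>
     (\<forall>e>0. \<exists>N. \<forall>m\<ge>N. \<forall>n\<ge>N. fs_sq X (\<lambda>p. f m p - f n p) < e)"

text \<open>Completeness in the form suited to expansions: partial sums are Cauchy in X, and their
  limit is already known from L2 convergence, so it only remains to place that limit in X.\<close>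

definition L2_closed :: "(('v, 'e) point \<Rightarrow> real) function_space \<Rightarrow> bool" where
  "L2_closed X \<longleftrightarrow> (\<forall>f u. cauchy_in X f \<and> u \<in> fs_carrier L2G \<and> (\<lambda>n. fs_sq L2G (\<lambda>p. f n p - u p)) \<longlonglongrightarrow> 0 \<longrightarrow>
     u \<in> fs_carrier X \<and> (\<lambda>n. fs_sq X (\<lambda>p. f n p - u p)) \<longlonglongrightarrow> 0)"

lemma L2_closed_L2G: "L2_closed L2G"
  by (simp add: L2_closed_def)

lemma nsq_edge_le:
  assumes "e \<in> edges G"
  shows "nsq (len G e) (restr G u e) \<le> fs_sq L2G u" "nsq (len G e) (wd u e) \<le> fs_sq H1t u"
    "nsq (len G e) (wdd u e) \<le> fs_sq H2t u"
proof -
  show "nsq (len G e) (restr G u e) \<le> fs_sq L2G u" unfolding L2G_norm_sq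
    by (rule member_le_sum[OF assms]) (simp_all add: fin_E)
  have "nsq (len G e) (restr G u e) + nsq (len G e) (wd u e) \<le> fs_sq H1t u" unfolding H1t_norm_sq
    by (rule member_le_sum[OF assms]) (simp_all add: fin_E)
  then show "nsq (len G e) (wd u e) \<le> fs_sq H1t u" using nsq_nonneg[of "len G e" "restr G u e"] by linarith
  have "nsq (len G e) (restr G u e) + nsq (len G e) (wd u e) + nsq (len G e) (wdd u e) \<le> fs_sq H2t u" unfolding H2t_norm_sq
    by (rule member_le_sum[OF assms]) (simp_all add: fin_E)
  then show "nsq (len G e) (wdd u e) \<le> fs_sq H2t u"
    using nsq_nonneg[of "len G e" "restr G u e"] nsq_nonneg[of "len G e" "wd u e"] by linarith
qed

lemma wd_diff:
  assumes u: "u \<in> fs_carrier H1t" and v: "v \<in> fs_carrier H1t" and e: "e \<in> edges G"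
  shows "AE x in leb (len G e). wd u e x - wd v e x = wd (\<lambda>p. u p - v p) e x"
    "nsq (len G e) (\<lambda>x. wd u e x - wd v e x) = nsq (len G e) (wd (\<lambda>p. u p - v p) e)"
proof -
  have "AE x in leb (len G e). wd (\<lambda>p. u p - v p) e x = wd u e x - wd v e x"
    using H1_lin(1)[OF u v e, of 1 "-1"] by simp
  then show ae: "AE x in leb (len G e). wd u e x - wd v e x = wd (\<lambda>p. u p - v p) e x"
    by eventually_elim simp
  show "nsq (len G e) (\<lambda>x. wd u e x - wd v e x) = nsq (len G e) (wd (\<lambda>p. u p - v p) e)"
    by (rule nsq_cong_AE[OF L2_int_diff[OF H1D(3)[OF u e] H1D(3)[OF v e]] ae, symmetric])
qed

lemma wdd_diff:
  assumes u: "u \<in> fs_carrier H2t" and v: "v \<in> fs_carrier H2t" and e: "e \<in> edges G"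
  shows "nsq (len G e) (\<lambda>x. wdd u e x - wdd v e x) = nsq (len G e) (wdd (\<lambda>p. u p - v p) e)"
proof -
  have "AE x in leb (len G e). wdd (\<lambda>p. u p - v p) e x = wdd u e x - wdd v e x"
    using H2_lin(1)[OF u v e, of 1 "-1"] by simp
  then have ae: "AE x in leb (len G e). wdd u e x - wdd v e x = wdd (\<lambda>p. u p - v p) e x"
    by eventually_elim simp
  show ?thesis
    by (rule nsq_cong_AE[OF L2_int_diff[OF H2D(3)[OF u e] H2D(3)[OF v e]] ae, symmetric])
qed

text \<open>Closedness of the weak derivative on each edge, combined with completeness of L2 for the
  derivatives. The pointwise convergence of traces is recorded for passing to the limit in vertex
  conditions.\<close>

lemma H1_limit:
  assumes c: "cauchy_in H1t f" and u: "u \<in> fs_carrier L2G" and lim: "(\<lambda>n. fs_sq L2G (\<lambda>p. f n p - u p)) \<longlonglongrightarrow> 0"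
  shows "u \<in> fs_carrier H1t" "(\<lambda>n. fs_sq H1t (\<lambda>p. f n p - u p)) \<longlonglongrightarrow> 0"
    "e \<in> edges G \<Longrightarrow> x \<in> {0..len G e} \<Longrightarrow> (\<lambda>n. tr (f n) e x) \<longlonglongrightarrow> tr u e x"
proof -
  have f: "f n \<in> fs_carrier H1t" for n using c by (simp add: cauchy_in_def)
  have L0: "(\<lambda>n. nsq (len G e) (restr G (\<lambda>p. f n p - u p) e)) \<longlonglongrightarrow> 0" if e: "e \<in> edges G" for e
    by (rule tendsto_sandwich[OF _ _ tendsto_const lim]) (simp_all add: nsq_edge_le(1)[OF e])
  have "\<exists>k g'. prim (len G e) k g' \<and> (AE x in leb (len G e). restr G u e x = k x) \<and>
    (\<lambda>n. nsq (len G e) (\<lambda>x. wd (f n) e x - g' x)) \<longlonglongrightarrow> 0 \<and> (\<forall>x\<in>{0..len G e}. (\<lambda>n. tr (f n) e x) \<longlonglongrightarrow> k x)"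
    if e: "e \<in> edges G" for e
  proof (rule edge_complete[OF edgeD(1)[OF e] H1D(4)[OF f e]])
    show ur: "restr G u e \<in> L2_int (len G e)" using u e by (simp add: L2G_carrier)
    have "nsq (len G e) (\<lambda>x. tr (f n) e x - restr G u e x) = nsq (len G e) (restr G (\<lambda>p. f n p - u p) e)" for n
    proof -
      have "AE x in leb (len G e). restr G (f n) e x - restr G u e x = tr (f n) e x - restr G u e x"
        using H1D(5)[OF f e] by eventually_elim simp
      from nsq_cong_AE[OF L2_int_diff[OF H1D(2)[OF f e] ur] this] show ?thesis by (simp add: restr_diff)
    qed
    then show "(\<lambda>n. nsq (len G e) (\<lambda>x. tr (f n) e x - restr G u e x)) \<longlonglongrightarrow> 0" using L0[OF e] by simp
    fix d :: real assume "0 < d"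
    then obtain N where N: "\<forall>m\<ge>N. \<forall>n\<ge>N. fs_sq H1t (\<lambda>p. f m p - f n p) < d" using c by (auto simp: cauchy_in_def)
    have "nsq (len G e) (\<lambda>x. wd (f m) e x - wd (f n) e x) < d" if "N \<le> m" "N \<le> n" for m n
      using nsq_edge_le(2)[OF e, of "\<lambda>p. f m p - f n p"] N[rule_format, OF that] unfolding wd_diff(2)[OF f f e] by linarith
    then show "\<exists>N. \<forall>m\<ge>N. \<forall>n\<ge>N. nsq (len G e) (\<lambda>x. wd (f m) e x - wd (f n) e x) < d" by blast
  qed
  then have "\<forall>e\<in>edges G. \<exists>k g'. prim (len G e) k g' \<and> (AE x in leb (len G e). restr G u e x = k x) \<and>
    (\<lambda>n. nsq (len G e) (\<lambda>x. wd (f n) e x - g' x)) \<longlonglongrightarrow> 0 \<and> (\<forall>x\<in>{0..len G e}. (\<lambda>n. tr (f n) e x) \<longlonglongrightarrow> k x)" by blast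
  then obtain k g where kg: "\<forall>e\<in>edges G. prim (len G e) (k e) (g e) \<and> (AE x in leb (len G e). restr G u e x = k e x) \<and>
    (\<lambda>n. nsq (len G e) (\<lambda>x. wd (f n) e x - g e x)) \<longlonglongrightarrow> 0 \<and> (\<forall>x\<in>{0..len G e}. (\<lambda>n. tr (f n) e x) \<longlonglongrightarrow> k e x)"
    unfolding bchoice_iff by (elim exE)
  have k: "prim (len G e) (k e) (g e)" "AE x in leb (len G e). restr G u e x = k e x"
    "(\<lambda>n. nsq (len G e) (\<lambda>x. wd (f n) e x - g e x)) \<longlonglongrightarrow> 0"
    "x \<in> {0..len G e} \<Longrightarrow> (\<lambda>n. tr (f n) e x) \<longlonglongrightarrow> k e x" if "e \<in> edges G" for e x
    using kg that by simp_all
  note I = H1I[of k g u, OF k(1,2)]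
  show uH: "u \<in> fs_carrier H1t" by (rule I(1)) simp_all
  show "e \<in> edges G \<Longrightarrow> x \<in> {0..len G e} \<Longrightarrow> (\<lambda>n. tr (f n) e x) \<longlonglongrightarrow> tr u e x" using k(4) I(3)[of e x] by simp
  have "(\<lambda>n. nsq (len G e) (wd (\<lambda>p. f n p - u p) e)) \<longlonglongrightarrow> 0" if e: "e \<in> edges G" for e
  proof -
    have "nsq (len G e) (\<lambda>x. wd (f n) e x - wd u e x) = nsq (len G e) (\<lambda>x. wd (f n) e x - g e x)" for n
    proof (rule nsq_cong_AE)
      show "(\<lambda>x. wd (f n) e x - g e x) \<in> L2_int (len G e)" by (intro L2_int_diff H1D(3)[OF f e] primD(1)[OF k(1)[OF e]])
      have "AE x in leb (len G e). wd u e x = g e x" by (rule I(2)) (simp_all add: e)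
      then show "AE x in leb (len G e). wd (f n) e x - g e x = wd (f n) e x - wd u e x" by eventually_elim simp
    qed
    then show ?thesis using k(3)[OF e] wd_diff(2)[OF f uH e] by simp
  qed
  then have "(\<lambda>n. \<Sum>e\<in>edges G. nsq (len G e) (restr G (\<lambda>p. f n p - u p) e) + nsq (len G e) (wd (\<lambda>p. f n p - u p) e)) \<longlonglongrightarrow> (\<Sum>e\<in>edges G. 0 + 0)"
    by (intro tendsto_sum tendsto_add L0)
  then show "(\<lambda>n. fs_sq H1t (\<lambda>p. f n p - u p)) \<longlonglongrightarrow> 0" unfolding H1t_norm_sq by simp
qed

lemma H2_limit:
  assumes c: "cauchy_in H2t f" and u: "u \<in> fs_carrier L2G" and lim: "(\<lambda>n. fs_sq L2G (\<lambda>p. f n p - u p)) \<longlonglongrightarrow> 0"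
  shows "u \<in> fs_carrier H2t" "(\<lambda>n. fs_sq H2t (\<lambda>p. f n p - u p)) \<longlonglongrightarrow> 0"
    "e \<in> edges G \<Longrightarrow> x \<in> {0..len G e} \<Longrightarrow> (\<lambda>n. dtr (f n) e x) \<longlonglongrightarrow> dtr u e x" "cauchy_in H1t f"
proof -
  have f: "f n \<in> fs_carrier H2t" for n using c by (simp add: cauchy_in_def)
  have f1: "f n \<in> fs_carrier H1t" for n by (rule H2_subset_H1[OF f])
  show c1: "cauchy_in H1t f" unfolding cauchy_in_def
  proof (intro conjI allI impI)
    fix d :: real assume "0 < d"
    then obtain N where N: "\<forall>m\<ge>N. \<forall>n\<ge>N. fs_sq H2t (\<lambda>p. f m p - f n p) < d" using c by (auto simp: cauchy_in_def)
    have "fs_sq H1t (\<lambda>p. f m p - f n p) < d" if "N \<le> m" "N \<le> n" for m n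
      using N[rule_format, OF that] H2_norm_mono[of "\<lambda>p. f m p - f n p"] by linarith
    then show "\<exists>N. \<forall>m\<ge>N. \<forall>n\<ge>N. fs_sq H1t (\<lambda>p. f m p - f n p) < d" by blast
  qed (rule f1)
  note u1 = H1_limit[OF c1 u lim]
  have L1: "(\<lambda>n. nsq (len G e) (wd (\<lambda>p. f n p - u p) e)) \<longlonglongrightarrow> 0" if e: "e \<in> edges G" for e
    by (rule tendsto_sandwich[OF _ _ tendsto_const u1(2)]) (simp_all add: nsq_edge_le(2)[OF e])
  have "\<exists>k g'. prim (len G e) k g' \<and> (AE x in leb (len G e). wd u e x = k x) \<and>
    (\<lambda>n. nsq (len G e) (\<lambda>x. wdd (f n) e x - g' x)) \<longlonglongrightarrow> 0 \<and> (\<forall>x\<in>{0..len G e}. (\<lambda>n. dtr (f n) e x) \<longlonglongrightarrow> k x)"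
    if e: "e \<in> edges G" for e
  proof (rule edge_complete[OF edgeD(1)[OF e] H2D(4)[OF f e]])
    show ur: "wd u e \<in> L2_int (len G e)" by (rule H1D(3)[OF u1(1) e])
    have "nsq (len G e) (\<lambda>x. dtr (f n) e x - wd u e x) = nsq (len G e) (wd (\<lambda>p. f n p - u p) e)" for n
    proof -
      have "AE x in leb (len G e). wd (f n) e x - wd u e x = dtr (f n) e x - wd u e x"
        using H2D(5)[OF f e] by eventually_elim simp
      from nsq_cong_AE[OF L2_int_diff[OF H1D(3)[OF f1 e] ur] this] show ?thesis unfolding wd_diff(2)[OF f1 u1(1) e] .
    qed
    then show "(\<lambda>n. nsq (len G e) (\<lambda>x. dtr (f n) e x - wd u e x)) \<longlonglongrightarrow> 0" using L1[OF e] by simp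
    fix d :: real assume "0 < d"
    then obtain N where N: "\<forall>m\<ge>N. \<forall>n\<ge>N. fs_sq H2t (\<lambda>p. f m p - f n p) < d" using c by (auto simp: cauchy_in_def)
    have "nsq (len G e) (\<lambda>x. wdd (f m) e x - wdd (f n) e x) < d" if "N \<le> m" "N \<le> n" for m n
      using nsq_edge_le(3)[OF e, of "\<lambda>p. f m p - f n p"] N[rule_format, OF that] unfolding wdd_diff[OF f f e] by linarith
    then show "\<exists>N. \<forall>m\<ge>N. \<forall>n\<ge>N. nsq (len G e) (\<lambda>x. wdd (f m) e x - wdd (f n) e x) < d" by blast
  qed
  then have "\<forall>e\<in>edges G. \<exists>k g'. prim (len G e) k g' \<and> (AE x in leb (len G e). wd u e x = k x) \<and>
    (\<lambda>n. nsq (len G e) (\<lambda>x. wdd (f n) e x - g' x)) \<longlonglongrightarrow> 0 \<and> (\<forall>x\<in>{0..len G e}. (\<lambda>n. dtr (f n) e x) \<longlonglongrightarrow> k x)" by blast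
  then obtain k g where kg: "\<forall>e\<in>edges G. prim (len G e) (k e) (g e) \<and> (AE x in leb (len G e). wd u e x = k e x) \<and>
    (\<lambda>n. nsq (len G e) (\<lambda>x. wdd (f n) e x - g e x)) \<longlonglongrightarrow> 0 \<and> (\<forall>x\<in>{0..len G e}. (\<lambda>n. dtr (f n) e x) \<longlonglongrightarrow> k e x)"
    unfolding bchoice_iff by (elim exE)
  have k: "prim (len G e) (k e) (g e)" "AE x in leb (len G e). wd u e x = k e x"
    "(\<lambda>n. nsq (len G e) (\<lambda>x. wdd (f n) e x - g e x)) \<longlonglongrightarrow> 0"
    "x \<in> {0..len G e} \<Longrightarrow> (\<lambda>n. dtr (f n) e x) \<longlonglongrightarrow> k e x" if "e \<in> edges G" for e x
    using kg that by simp_all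
  have W: "wd u e \<in> sobolev_int (len G e) 1" "AE x in leb (len G e). wdd u e x = g e x"
    "x \<in> {0..len G e} \<Longrightarrow> dtr u e x = k e x" if e: "e \<in> edges G" for e x
    unfolding wdd_def dtr_def using sobolev_1I[OF k(1)[OF e] k(2)[OF e] edgeD(1)[OF e]] by auto
  have "restr G u e \<in> sobolev_int (len G e) 2" if e: "e \<in> edges G" for e
    unfolding sobolev_2_iff[OF edgeD(1)[OF e]] using H1D(1)[OF u1(1) e] W(1)[OF e] by (simp add: wd_def)
  then show uH: "u \<in> fs_carrier H2t" by (simp only: Ht_carrier) blast
  show "e \<in> edges G \<Longrightarrow> x \<in> {0..len G e} \<Longrightarrow> (\<lambda>n. dtr (f n) e x) \<longlonglongrightarrow> dtr u e x" using k(4) W(3)[of e x] by simp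
  have "(\<lambda>n. nsq (len G e) (wdd (\<lambda>p. f n p - u p) e)) \<longlonglongrightarrow> 0" if e: "e \<in> edges G" for e
  proof -
    have "nsq (len G e) (\<lambda>x. wdd (f n) e x - wdd u e x) = nsq (len G e) (\<lambda>x. wdd (f n) e x - g e x)" for n
    proof (rule nsq_cong_AE)
      show "(\<lambda>x. wdd (f n) e x - g e x) \<in> L2_int (len G e)" by (intro L2_int_diff H2D(3)[OF f e] primD(1)[OF k(1)[OF e]])
      show "AE x in leb (len G e). wdd (f n) e x - g e x = wdd (f n) e x - wdd u e x"
        using W(2)[OF e] by eventually_elim simp
    qed
    then show ?thesis using k(3)[OF e] wdd_diff[OF f uH e] by simp
  qed
  then have "(\<lambda>n. \<Sum>e\<in>edges G. nsq (len G e) (wdd (\<lambda>p. f n p - u p) e)) \<longlonglongrightarrow> (\<Sum>e\<in>edges G. 0)"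
    by (intro tendsto_sum)
  then have "(\<lambda>n. fs_sq H1t (\<lambda>p. f n p - u p) + (\<Sum>e\<in>edges G. nsq (len G e) (wdd (\<lambda>p. f n p - u p) e))) \<longlonglongrightarrow> 0 + 0"
    using u1(2) by (intro tendsto_add) simp_all
  then show "(\<lambda>n. fs_sq H2t (\<lambda>p. f n p - u p)) \<longlonglongrightarrow> 0" unfolding H1t_norm_sq H2t_norm_sq by (simp add: sum.distrib)
qed

lemma limit_cont:
  assumes f: "\<And>n. f n \<in> fs_carrier H1C" and u: "u \<in> fs_carrier H1t"
    and t: "\<And>e x. e \<in> edges G \<Longrightarrow> x \<in> {0..len G e} \<Longrightarrow> (\<lambda>n. tr (f n) e x) \<longlonglongrightarrow> tr u e x"
  shows "u \<in> cont_space G"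
  unfolding cont_iff_mis[OF u]
proof
  fix p assume p: "p \<in> ends"
  have l: "(\<lambda>n. trp (f n) q) \<longlonglongrightarrow> trp u q" if "q \<in> ends" for q
    unfolding trp_def by (rule t[OF endsD[OF that] pos_in[OF that]])
  have "(\<lambda>n. mis p (f n)) \<longlonglongrightarrow> mis p u" unfolding mis_def by (intro tendsto_diff l rp p)
  moreover have "mis p (f n) = 0" for n using f[of n] cont_iff_mis[of "f n"] p by simp
  ultimately have "(\<lambda>n. 0) \<longlonglongrightarrow> mis p u" by simp
  then show "mis p u = 0" using LIMSEQ_unique tendsto_const by blast
qed

lemma L2_closed_H1C: "L2_closed H1C"
  unfolding L2_closed_def
proof (intro allI impI)
  fix f u assume A: "cauchy_in H1C f \<and> u \<in> fs_carrier L2G \<and> (\<lambda>n. fs_sq L2G (\<lambda>p. f n p - u p)) \<longlonglongrightarrow> 0"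
  then have c: "cauchy_in H1t f" and f: "f n \<in> fs_carrier H1C" for n by (auto simp: cauchy_in_def)
  note L = H1_limit[OF c conjunct1[OF conjunct2[OF A]] conjunct2[OF conjunct2[OF A]]]
  have "u \<in> cont_space G" by (rule limit_cont[OF f L(1) L(3)])
  then show "u \<in> fs_carrier H1C \<and> (\<lambda>n. fs_sq H1C (\<lambda>p. f n p - u p)) \<longlonglongrightarrow> 0" using L(1,2) by simp
qed

lemma L2_closed_DK: "L2_closed DK"
  unfolding L2_closed_def
proof (intro allI impI)
  fix f u assume A: "cauchy_in DK f \<and> u \<in> fs_carrier L2G \<and> (\<lambda>n. fs_sq L2G (\<lambda>p. f n p - u p)) \<longlonglongrightarrow> 0"
  then have c: "cauchy_in H2t f" and f: "f n \<in> fs_carrier DK" for n by (auto simp: cauchy_in_def)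
  have f1: "f n \<in> fs_carrier H1C" for n using f[of n] H2_subset_H1 by simp
  note A' = conjunct1[OF conjunct2[OF A]] conjunct2[OF conjunct2[OF A]]
  note L = H2_limit[OF c A']
  note L1 = H1_limit[OF L(4) A']
  have "u \<in> cont_space G" by (rule limit_cont[OF f1 L1(1) L1(3)])
  moreover have "kirchhoff_sum G u v = 0" if v: "v \<in> verts G" for v
  proof -
    have "(\<lambda>n. kirchhoff_sum G (f n) v) \<longlonglongrightarrow> kirchhoff_sum G u v"
      unfolding kirchhoff_ends dn_def by (intro tendsto_sum tendsto_mult tendsto_const L(3) endsD pos_in) auto
    moreover have "kirchhoff_sum G (f n) v = 0" for n using f[of n] v by (simp add: Kset_def)
    ultimately have "(\<lambda>n. 0) \<longlonglongrightarrow> kirchhoff_sum G u v" by simp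
    then show ?thesis using LIMSEQ_unique tendsto_const by blast
  qed
  ultimately show "u \<in> fs_carrier DK \<and> (\<lambda>n. fs_sq DK (\<lambda>p. f n p - u p)) \<longlonglongrightarrow> 0" using L(1,2) by (simp add: Kset_def)
qed

end

section \<open>The form and the strong operator\<close>

lemma weighted_LINT:
  assumes f: "f \<in> L2_int l" and b: "b \<in> borel_measurable (leb l)"
    and B: "AE x in leb l. \<alpha> \<le> b x \<and> b x \<le> M" and \<alpha>: "0 \<le> \<alpha>"
  shows "(\<lambda>x. b x * f x) \<in> L2_int l" "nsq l (\<lambda>x. b x * f x) \<le> M\<^sup>2 * nsq l f"
    "\<alpha> * nsq l f \<le> (LINT x|leb l. b x * f x * f x)" "(LINT x|leb l. b x * f x * f x) \<le> M * nsq l f"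
proof -
  have "AE x in leb l. \<bar>b x\<bar> \<le> M" using B by eventually_elim (use \<alpha> in auto)
  note m = L2_int_bounded_mult[OF f b this]
  show bf: "(\<lambda>x. b x * f x) \<in> L2_int l" and "nsq l (\<lambda>x. b x * f x) \<le> M\<^sup>2 * nsq l f" by (fact m)+
  have i: "integrable (leb l) (\<lambda>x. b x * f x * f x)" by (rule L2_int_product[OF bf f])
  have j: "integrable (leb l) (\<lambda>x. c * (f x)\<^sup>2)" for c using L2_intD(2)[OF f] by simp
  have "(LINT x|leb l. \<alpha> * (f x)\<^sup>2) \<le> (LINT x|leb l. b x * f x * f x)"
  proof (rule integral_mono_AE[OF j i])
    show "AE x in leb l. \<alpha> * (f x)\<^sup>2 \<le> b x * f x * f x"
      using B by eventually_elim (auto simp: power2_eq_square mult.assoc intro!: mult_right_mono)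
  qed
  then show "\<alpha> * nsq l f \<le> (LINT x|leb l. b x * f x * f x)" by (simp add: nsq_def)
  have "(LINT x|leb l. b x * f x * f x) \<le> (LINT x|leb l. M * (f x)\<^sup>2)"
  proof (rule integral_mono_AE[OF i j])
    show "AE x in leb l. b x * f x * f x \<le> M * (f x)\<^sup>2"
      using B by eventually_elim (auto simp: power2_eq_square mult.assoc intro!: mult_right_mono)
  qed
  then show "(LINT x|leb l. b x * f x * f x) \<le> M * nsq l f" by (simp add: nsq_def)
qed

lemma LINT_lin:
  assumes f: "f \<in> L2_int l" and g: "g \<in> L2_int l" and h: "h \<in> L2_int l"
    and k: "AE x in leb l. k x = a * f x + b * g x"
  shows "(LINT x|leb l. k x * h x) = a * (LINT x|leb l. f x * h x) + b * (LINT x|leb l. g x * h x)"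
proof -
  have s: "(\<lambda>x. a * f x + b * g x) \<in> L2_int l" by (intro L2_int_add L2_int_cmult f g)
  have k': "AE x in leb l. a * f x + b * g x = k x" using k by eventually_elim simp
  have "(LINT x|leb l. k x * h x) = (LINT x|leb l. (a * f x + b * g x) * h x)"
    by (rule LINT_cong_L2[OF s k' h])
  also have "\<dots> = (LINT x|leb l. a * (f x * h x) + b * (g x * h x))" by (simp add: algebra_simps)
  also have "\<dots> = (LINT x|leb l. a * (f x * h x)) + (LINT x|leb l. b * (g x * h x))"
    using L2_int_product[OF f h] L2_int_product[OF g h] by (intro Bochner_Integration.integral_add) auto
  finally show ?thesis by simp
qed

lemma prim_cong_AE:
  assumes p: "prim l h g" and ae: "AE x in leb l. g x = f x" shows "prim l h f"
proof (rule primI)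
  note g = primD(1)[OF p]
  show f: "f \<in> L2_int l" by (rule L2_int_cong_AE[OF g ae])
  fix x y assume xy: "0 \<le> x" "x \<le> y" "y \<le> l"
  have "indicat_real {x..y} \<in> borel_measurable lebesgue"
    by (rule borel_measurable_indicator) simp
  then have "indicat_real {x..y} \<in> borel_measurable (leb l)"
    by (rule measurable_restrict_space1)
  then have i: "indicat_real {x..y} \<in> L2_int l"
    using L2_int_bounded_mult(1)[OF L2_int_const[of 1 l], of "indicator {x..y}" 1] by simp
  have "integral {x..y} f = (LINT t|leb l. f t * indicator {x..y} t)"
    using integral_Icc_eq_LINT(1)[OF f xy(1,3)] by (simp add: mult.commute)
  also have "\<dots> = (LINT t|leb l. g t * indicator {x..y} t)" by (rule LINT_cong_L2[OF g ae i])
  also have "\<dots> = h y - h x"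
    using integral_Icc_eq_LINT(1)[OF g xy(1,3)] primD(2)[OF p xy] by (simp add: mult.commute)
  finally show "integral {x..y} f = h y - h x" .
qed

lemma prim_cong: "prim l h g \<Longrightarrow> (\<And>x. x \<in> {0..l} \<Longrightarrow> h x = k x) \<Longrightarrow> prim l k g"
  by (auto simp: prim_def)

text \<open>One pair of constants bounds both \<open>a\<close> and \<kappa>^2 from below and above,
  so that the form is compared with the H^1 norm directly by \<alpha> and M.\<close>

locale elliptic = compact_graph G for G :: "('v, 'e) metric_graph" +
  fixes a \<kappa> :: "('v, 'e) point \<Rightarrow> real" and \<alpha> M L :: real
  assumes al: "0 < \<alpha>"
    and A_lip: "\<And>e x y. e \<in> edges G \<Longrightarrow> x \<in> {0..len G e} \<Longrightarrow> y \<in> {0..len G e} \<Longrightarrow> \<bar>restr G a e x - restr G a e y\<bar> \<le> L * \<bar>x - y\<bar>"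
    and A_bd: "\<And>e x. e \<in> edges G \<Longrightarrow> x \<in> {0..len G e} \<Longrightarrow> \<alpha> \<le> restr G a e x \<and> restr G a e x \<le> M"
    and Q_meas: "\<And>e. e \<in> edges G \<Longrightarrow> (\<lambda>x. (restr G \<kappa> e x)\<^sup>2) \<in> borel_measurable (leb (len G e))"
    and Q_bd: "\<And>e. e \<in> edges G \<Longrightarrow> AE x in leb (len G e). \<alpha> \<le> (restr G \<kappa> e x)\<^sup>2 \<and> (restr G \<kappa> e x)\<^sup>2 \<le> M"
begin

abbreviation "A \<equiv> restr G a"
abbreviation "Q \<equiv> \<lambda>e x. (restr G \<kappa> e x)\<^sup>2"

lemma A_meas: assumes e: "e \<in> edges G" shows "A e \<in> borel_measurable (leb (len G e))"
proof -
  obtain g where "prim (len G e) (A e) g" "AE x in leb (len G e). \<bar>g x\<bar> \<le> L"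
    by (rule lipschitz_prim[OF edgeD(1)[OF e] A_lip[OF e]])
  from prim_L2[OF this(1)] show ?thesis by (rule L2_intD(1))
qed

lemma A_ae: "e \<in> edges G \<Longrightarrow> AE x in leb (len G e). \<alpha> \<le> A e x \<and> A e x \<le> M"
  by (rule AE_lebesgue_on_negligible[of "{}"]) (simp_all add: A_bd)

lemmas A_mult = weighted_LINT[OF _ A_meas A_ae less_imp_le[OF al]]
  and Q_mult = weighted_LINT[OF _ Q_meas Q_bd less_imp_le[OF al]]

definition form :: "(('v, 'e) point \<Rightarrow> real) \<Rightarrow> (('v, 'e) point \<Rightarrow> real) \<Rightarrow> real" where
  "form u w = (\<Sum>e\<in>edges G. (LINT x|leb (len G e). A e x * wd u e x * wd w e x)
     + (LINT x|leb (len G e). Q e x * restr G u e x * restr G w e x))"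

lemma form_coercive: assumes u: "u \<in> fs_carrier H1t" shows "\<alpha> * fs_sq H1t u \<le> form u u"
  unfolding form_def H1t_norm_sq sum_distrib_left
proof (rule sum_mono)
  fix e assume e: "e \<in> edges G"
  show "\<alpha> * (nsq (len G e) (restr G u e) + nsq (len G e) (wd u e))
    \<le> (LINT x|leb (len G e). A e x * wd u e x * wd u e x) + (LINT x|leb (len G e). Q e x * restr G u e x * restr G u e x)"
    using A_mult(3)[OF H1D(3)[OF u e] e e] Q_mult(3)[OF H1D(2)[OF u e] e e] by (simp add: algebra_simps)
qed

lemma form_bounded: assumes u: "u \<in> fs_carrier H1t" shows "form u u \<le> M * fs_sq H1t u"
  unfolding form_def H1t_norm_sq sum_distrib_left
proof (rule sum_mono)
  fix e assume e: "e \<in> edges G"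
  show "(LINT x|leb (len G e). A e x * wd u e x * wd u e x) + (LINT x|leb (len G e). Q e x * restr G u e x * restr G u e x)
    \<le> M * (nsq (len G e) (restr G u e) + nsq (len G e) (wd u e))"
    using A_mult(4)[OF H1D(3)[OF u e] e e] Q_mult(4)[OF H1D(2)[OF u e] e e] by (simp add: algebra_simps)
qed

lemma form_sym: "sym_form (fs_carrier H1t) form"
proof
  show "(\<lambda>p. a * u p + b * v p) \<in> fs_carrier H1t" if "u \<in> fs_carrier H1t" "v \<in> fs_carrier H1t" for u v a b
    using quad_space_lin(1)[OF quad_Ht[of 1]] that by simp
  show "(\<lambda>p. 0) \<in> fs_carrier H1t" using quad_space_zero(1)[OF quad_Ht[of 1]] by simp
  show "form u v = form v u" for u v by (simp add: form_def mult_ac)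
  show "0 \<le> form u u" if "u \<in> fs_carrier H1t" for u
    using form_coercive[OF that] al by (meson mult_nonneg_nonneg less_imp_le zero_le_power2 order_trans)
  fix u v w b c assume u: "u \<in> fs_carrier H1t" and v: "v \<in> fs_carrier H1t" and w: "w \<in> fs_carrier H1t"
  let ?s = "\<lambda>p. b * u p + c * v p"
  have "(LINT x|leb (len G e). A e x * wd ?s e x * wd w e x) + (LINT x|leb (len G e). Q e x * restr G ?s e x * restr G w e x)
    = b * ((LINT x|leb (len G e). A e x * wd u e x * wd w e x) + (LINT x|leb (len G e). Q e x * restr G u e x * restr G w e x))
    + c * ((LINT x|leb (len G e). A e x * wd v e x * wd w e x) + (LINT x|leb (len G e). Q e x * restr G v e x * restr G w e x))"
    if e: "e \<in> edges G" for e
  proof -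
    have "AE x in leb (len G e). A e x * wd ?s e x = b * (A e x * wd u e x) + c * (A e x * wd v e x)"
      using H1_lin(1)[OF u v e, of b c] by eventually_elim (simp add: algebra_simps)
    note 1 = LINT_lin[OF A_mult(1)[OF H1D(3)[OF u e] e e] A_mult(1)[OF H1D(3)[OF v e] e e] H1D(3)[OF w e] this]
    have "AE x in leb (len G e). Q e x * restr G ?s e x = b * (Q e x * restr G u e x) + c * (Q e x * restr G v e x)"
      unfolding restr_lin by (simp add: algebra_simps)
    note 2 = LINT_lin[OF Q_mult(1)[OF H1D(2)[OF u e] e e] Q_mult(1)[OF H1D(2)[OF v e] e e] H1D(2)[OF w e] this]
    show ?thesis unfolding 1 2 by (simp add: algebra_simps)
  qed
  then show "form ?s w = b * form u w + c * form v w"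
    unfolding form_def sum_distrib_left sum.distrib[symmetric] by (intro sum.cong refl)
qed

lemma inner_sym: "sym_form (fs_carrier L2G) (L2_inner G)"
proof
  show "(\<lambda>p. a * u p + b * v p) \<in> fs_carrier L2G" if "u \<in> fs_carrier L2G" "v \<in> fs_carrier L2G" for u v a b
    using quad_space_lin(1)[OF quad_L2G] that by simp
  show "(\<lambda>p. 0) \<in> fs_carrier L2G" using quad_space_zero(1)[OF quad_L2G] by simp
  show "L2_inner G u v = L2_inner G v u" for u v by (simp add: L2_inner_def mult_ac)
  show "0 \<le> L2_inner G u u" for u by (simp add: L2_inner_self sum_nonneg)
  fix u v w b c assume u: "u \<in> fs_carrier L2G" and v: "v \<in> fs_carrier L2G" and w: "w \<in> fs_carrier L2G"
  have "(LINT x|leb (len G e). restr G (\<lambda>p. b * u p + c * v p) e x * restr G w e x)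
    = b * (LINT x|leb (len G e). restr G u e x * restr G w e x) + c * (LINT x|leb (len G e). restr G v e x * restr G w e x)"
    if e: "e \<in> edges G" for e
    using u v w e by (intro LINT_lin) (simp_all add: L2G_carrier restr_lin)
  then show "L2_inner G (\<lambda>p. b * u p + c * v p) w = b * L2_inner G u w + c * L2_inner G v w"
    unfolding L2_inner_def by (simp add: sum.distrib sum_distrib_left)
qed

text \<open>\<open>strong u F\<close> says that \<open>u\<close> is in the domain of \<open>L\<^sub>0\<close> and \<open>L\<^sub>0 u = F\<close> almost everywhere.\<close>

definition strong :: "(('v, 'e) point \<Rightarrow> real) \<Rightarrow> (('v, 'e) point \<Rightarrow> real) \<Rightarrow> bool" where
  "strong u F \<longleftrightarrow> u \<in> fs_carrier DK \<and> F \<in> fs_carrier L2G \<and>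
     (\<forall>e\<in>edges G. prim (len G e) (\<lambda>x. A e x * dtr u e x) (\<lambda>x. Q e x * restr G u e x - restr G F e x))"

lemma strong_lin:
  assumes "strong u F" "strong v H" shows "strong (\<lambda>p. b * u p + c * v p) (\<lambda>p. b * F p + c * H p)"
proof -
  have u: "u \<in> fs_carrier H2t" and v: "v \<in> fs_carrier H2t" using assms by (auto simp: strong_def)
  have "(\<lambda>p. b * u p + c * v p) \<in> fs_carrier DK" "(\<lambda>p. b * F p + c * H p) \<in> fs_carrier L2G"
    using assms by (auto simp: strong_def simp del: fs_inter_simps intro!: quad_space_lin(1)[OF quad_DK] quad_space_lin(1)[OF quad_L2G])
  moreover have "prim (len G e) (\<lambda>x. A e x * dtr (\<lambda>p. b * u p + c * v p) e x)
      (\<lambda>x. Q e x * restr G (\<lambda>p. b * u p + c * v p) e x - restr G (\<lambda>p. b * F p + c * H p) e x)" if e: "e \<in> edges G" for e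
  proof -
    have "prim (len G e) (\<lambda>x. b * (A e x * dtr u e x) + c * (A e x * dtr v e x))
      (\<lambda>x. b * (Q e x * restr G u e x - restr G F e x) + c * (Q e x * restr G v e x - restr G H e x))"
      using assms e by (intro prim_add prim_cmult) (auto simp: strong_def)
    from prim_cong[OF this, of "\<lambda>x. A e x * dtr (\<lambda>p. b * u p + c * v p) e x"]
    show ?thesis unfolding restr_lin by (simp add: H2_lin(2)[OF u v e] algebra_simps)
  qed
  ultimately show ?thesis by (simp add: strong_def)
qed

lemma strong_zero: "strong (\<lambda>p. 0) (\<lambda>p. 0)"
proof -
  have d: "dtr (\<lambda>p. 0) e x = 0" if "e \<in> edges G" "x \<in> {0..len G e}" for e x
    using H2_lin(2)[OF quad_space_zero(1)[OF quad_Ht] quad_space_zero(1)[OF quad_Ht] that, of 0 0] by simp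
  have "prim (len G e) (\<lambda>x. A e x * dtr (\<lambda>p. 0) e x) (\<lambda>x. 0)" if e: "e \<in> edges G" for e
    by (rule prim_cong[OF prim_const[of _ 0]]) (simp add: d e)
  then show ?thesis using quad_space_zero(1)[OF quad_DK] quad_space_zero(1)[OF quad_L2G]
    by (simp add: strong_def restr_def del: fs_inter_simps)
qed

lemma strong_sum:
  assumes "finite F" "\<And>k. k \<in> F \<Longrightarrow> strong (f k) (g k)"
  shows "strong (\<lambda>p. \<Sum>k\<in>F. b k * f k p) (\<lambda>p. \<Sum>k\<in>F. b k * g k p)"
  using assms
proof (induction F)
  case empty
  then show ?case using strong_zero by simp
next
  case (insert i F)
  have "strong (\<lambda>p. b i * f i p + 1 * (\<Sum>k\<in>F. b k * f k p)) (\<lambda>p. b i * g i p + 1 * (\<Sum>k\<in>F. b k * g k p))"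
    using insert by (intro strong_lin) auto
  then show ?case using insert(1,2) by simp
qed

text \<open>Green's formula. Since \<open>a\<close> and \<open>w\<close> are single valued at a
  vertex, the boundary terms collected there are a(v) w(v) times the Kirchhoff sum of
  \<open>u\<close>; this is where continuity and the Kirchhoff condition are paired.\<close>

lemma strong_form:
  assumes s: "strong u F" and w: "w \<in> fs_carrier H1C"
  shows "form u w = L2_inner G F w"
proof -
  have u: "u \<in> fs_carrier H2t" and K: "u \<in> Kset" and F: "F \<in> fs_carrier L2G" using s by (auto simp: strong_def)
  have w1: "w \<in> fs_carrier H1t" and wc: "w \<in> cont_space G" using w by auto
  note u1 = H2_subset_H1[OF u]
  obtain val where val: "\<forall>e\<in>edges G. tr w e 0 = val (src G e) \<and> tr w e (len G e) = val (tgt G e)"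
    using cont_spaceD[OF wc] by (elim exE)
  let ?b = "\<lambda>p. a (Vertex (vt p)) * val (vt p) * dn u p"
  have E: "(LINT x|leb (len G e). A e x * wd u e x * wd w e x) + (LINT x|leb (len G e). Q e x * restr G u e x * restr G w e x)
    = (LINT x|leb (len G e). restr G F e x * restr G w e x) - (?b (e, False) + ?b (e, True))" if e: "e \<in> edges G" for e
  proof -
    let ?l = "len G e" and ?g = "\<lambda>x. Q e x * restr G u e x - restr G F e x"
    have l: "0 < ?l" by (rule edgeD(1)[OF e])
    have p: "prim ?l (\<lambda>x. A e x * dtr u e x) ?g" using s e by (simp add: strong_def)
    have FL: "restr G F e \<in> L2_int ?l" using F e by (simp add: L2G_carrier)
    note q = H1D(4)[OF w1 e]
    have parts: "(LINT x|leb ?l. A e x * dtr u e x * wd w e x) + (LINT x|leb ?l. tr w e x * ?g x)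
      = A e ?l * dtr u e ?l * tr w e ?l - A e 0 * dtr u e 0 * tr w e 0"
      using prim_parts[OF p q] l by simp
    have "AE x in leb ?l. A e x * dtr u e x = A e x * wd u e x" using H2D(5)[OF u e] by eventually_elim simp
    note 1 = LINT_cong_L2[OF prim_L2[OF p] this H1D(3)[OF w1 e]]
    have "AE x in leb ?l. tr w e x = restr G w e x" using H1D(5)[OF w1 e] by eventually_elim simp
    note 2 = LINT_cong_L2[OF prim_L2[OF q] this primD(1)[OF p]]
    have 3: "(LINT x|leb ?l. ?g x * restr G w e x)
      = 1 * (LINT x|leb ?l. Q e x * restr G u e x * restr G w e x) + (-1) * (LINT x|leb ?l. restr G F e x * restr G w e x)"
      by (rule LINT_lin[OF Q_mult(1)[OF H1D(2)[OF u1 e] e e] FL H1D(2)[OF w1 e]]) simp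
    have 4: "(LINT x|leb ?l. ?g x * restr G w e x) = (LINT x|leb ?l. restr G w e x * ?g x)"
      by (simp add: mult.commute)
    have 5: "A e 0 = a (Vertex (src G e))" "A e ?l = a (Vertex (tgt G e))" using l by (simp_all add: restr_def edge_point_def)
    have 6: "?b (e, False) + ?b (e, True) = A e 0 * dtr u e 0 * tr w e 0 - A e ?l * dtr u e ?l * tr w e ?l"
      using val e unfolding 5 by (simp add: vt_def dn_def pos_def esgn_def)
    show ?thesis using parts 1 2 3 4 6 by linarith
  qed
  have "(\<Sum>e\<in>edges G. ?b (e, False) + ?b (e, True)) = (\<Sum>p\<in>ends. ?b p)"
    unfolding ends_def sum.cartesian_product' by (simp add: UNIV_bool add.commute)
  also have "\<dots> = (\<Sum>v\<in>verts G. \<Sum>p | p \<in> ends \<and> vt p = v. ?b p)"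
    by (rule sum.group[symmetric], rule fin_ends, rule fin_V) (auto simp: vt_def ends_def edgeD)
  also have "\<dots> = (\<Sum>v\<in>verts G. a (Vertex v) * val v * kirchhoff_sum G u v)"
    unfolding kirchhoff_ends sum_distrib_left by (intro sum.cong refl) auto
  also have "\<dots> = 0" using K by (simp add: Kset_def)
  finally have z: "(\<Sum>e\<in>edges G. ?b (e, False) + ?b (e, True)) = 0" .
  have "form u w = (\<Sum>e\<in>edges G. (LINT x|leb (len G e). restr G F e x * restr G w e x) - (?b (e, False) + ?b (e, True)))"
    unfolding form_def by (intro sum.cong refl E)
  then show ?thesis unfolding L2_inner_def sum_subtractf z by simp
qed

end

section \<open>Elliptic regularity and the spectral scale\<close>

context elliptic
begin

lemma nsq_dtr:
  assumes u: "u \<in> fs_carrier H2t" and e: "e \<in> edges G" shows "nsq (len G e) (dtr u e) = nsq (len G e) (wd u e)"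
  by (rule nsq_cong_AE[OF H1D(3)[OF H2_subset_H1[OF u] e] H2D(5)[OF u e]])

lemma flux_prim:
  assumes u: "u \<in> fs_carrier H2t" and e: "e \<in> edges G"
  shows "\<exists>k. prim (len G e) (\<lambda>x. A e x * dtr u e x) k \<and>
    nsq (len G e) k \<le> 2 * M\<^sup>2 * nsq (len G e) (wdd u e) + 2 * L\<^sup>2 * nsq (len G e) (wd u e)"
proof -
  have "\<bar>A e x\<bar> \<le> M" if "x \<in> {0..len G e}" for x using A_bd[OF e that] al by auto
  from prim_lipschitz_mult[OF edgeD(1)[OF e] A_lip[OF e] this H2D(4)[OF u e]] show ?thesis
    unfolding nsq_dtr[OF u e] by blast
qed

text \<open>Turns an almost everywhere identity for \<open>L0\<close> into the statement that the
  flux a u' has the derivative it should. The value assigned by \<open>L0\<close> at vertices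
  concerns a null set.\<close>

lemma L0_strong:
  assumes u: "u \<in> L0_dom G" and F: "F \<in> fs_carrier L2G" and ae: "ae_on_graph G (\<lambda>p. L0 G a \<kappa> u p = F p)"
  shows "strong u F"
proof -
  have uD: "u \<in> fs_carrier DK" using u by (auto simp: L0_dom_def Kset_def)
  then have u2: "u \<in> fs_carrier H2t" by simp
  have "prim (len G e) (\<lambda>x. A e x * dtr u e x) (\<lambda>x. Q e x * restr G u e x - restr G F e x)" if e: "e \<in> edges G" for e
  proof -
    obtain k where k: "prim (len G e) (\<lambda>x. A e x * dtr u e x) k" using flux_prim[OF u2 e] by blast
    have "AE y in leb (len G e). A e y * wd u e y = A e y * dtr u e y" using H2D(5)[OF u2 e] by eventually_elim simp
    note w = sobolev_1I(2)[OF k this edgeD(1)[OF e]]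
    have i: "AE x in leb (len G e). ep e x = Interior e x"
      by (rule AE_lebesgue_on_negligible[of "{0, len G e}"]) (auto simp: edge_point_def)
    have l: "AE x in leb (len G e). L0 G a \<kappa> u (ep e x) = F (ep e x)" using ae e by (simp add: ae_on_graph_def)
    have "AE x in leb (len G e). k x = Q e x * restr G u e x - restr G F e x"
      using w i l
    proof eventually_elim
      case (elim x)
      have "F (ep e x) = restr G F e x" by (simp add: restr_def)
      then have "- wderiv (len G e) (\<lambda>y. A e y * wd u e y) x + Q e x * restr G u e x = restr G F e x"
        using elim(2,3) by (simp add: L0_def wd_def)
      then show ?case using elim(1) by simp
    qed
    then show ?thesis by (rule prim_cong_AE[OF k])
  qed
  then show ?thesis using uD F by (simp add: strong_def)
qed

text \<open>The flux of a function in H^2 is again in H^1 because \<open>a\<close> is Lipschitz, so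
  F can be read off edge by edge and glued together with arbitrary vertex values.\<close>

lemma strong_exists:
  assumes u: "u \<in> fs_carrier DK"
  shows "\<exists>F. strong u F \<and> fs_sq L2G F \<le> (4 * M\<^sup>2 + 4 * L\<^sup>2) * fs_sq H2t u"
proof -
  have u2: "u \<in> fs_carrier H2t" using u by simp
  note u1 = H2_subset_H1[OF u2]
  have "\<forall>e\<in>edges G. \<exists>k. prim (len G e) (\<lambda>x. A e x * dtr u e x) k \<and>
    nsq (len G e) k \<le> 2 * M\<^sup>2 * nsq (len G e) (wdd u e) + 2 * L\<^sup>2 * nsq (len G e) (wd u e)"
    using flux_prim[OF u2] by simp
  then obtain k where "\<forall>e\<in>edges G. prim (len G e) (\<lambda>x. A e x * dtr u e x) (k e) \<and>
    nsq (len G e) (k e) \<le> 2 * M\<^sup>2 * nsq (len G e) (wdd u e) + 2 * L\<^sup>2 * nsq (len G e) (wd u e)"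
    unfolding bchoice_iff by (elim exE)
  then have k: "prim (len G e) (\<lambda>x. A e x * dtr u e x) (k e)"
    "nsq (len G e) (k e) \<le> 2 * M\<^sup>2 * nsq (len G e) (wdd u e) + 2 * L\<^sup>2 * nsq (len G e) (wd u e)" if "e \<in> edges G" for e
    using that by simp_all
  define g where "g e x = Q e x * restr G u e x - k e x" for e x
  let ?F = "glue (\<lambda>v. 0) g"
  have gL: "g e \<in> L2_int (len G e)" if e: "e \<in> edges G" for e
    unfolding g_def[abs_def] by (intro L2_int_diff Q_mult(1)[OF H1D(2)[OF u1 e] e e] primD(1)[OF k(1)[OF e]])
  have ae: "AE x in leb (len G e). g e x = restr G ?F e x" for e
    using AE_restr_glue[where e = e and val = "\<lambda>v. 0" and h = g] by eventually_elim simp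
  have FL: "?F \<in> fs_carrier L2G" unfolding L2G_carrier using L2_int_cong_AE[OF gL ae] by simp
  have "prim (len G e) (\<lambda>x. A e x * dtr u e x) (\<lambda>x. Q e x * restr G u e x - restr G ?F e x)" if e: "e \<in> edges G" for e
  proof (rule prim_cong_AE[OF k(1)[OF e]])
    show "AE x in leb (len G e). k e x = Q e x * restr G u e x - restr G ?F e x"
      using ae[of e] by eventually_elim (simp add: g_def)
  qed
  then have s: "strong u ?F" using u FL by (simp add: strong_def)
  have "nsq (len G e) (restr G ?F e) \<le> (4 * M\<^sup>2 + 4 * L\<^sup>2) * (nsq (len G e) (restr G u e) + nsq (len G e) (wd u e) + nsq (len G e) (wdd u e))"
    if e: "e \<in> edges G" for e
  proof -
    have "nsq (len G e) (restr G ?F e) = nsq (len G e) (g e)" by (rule nsq_cong_AE[OF gL[OF e] ae])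
    also have "\<dots> \<le> 2 * nsq (len G e) (\<lambda>x. Q e x * restr G u e x) + 2 * nsq (len G e) (k e)"
      unfolding g_def[abs_def] by (rule nsq_diff_le[OF Q_mult(1)[OF H1D(2)[OF u1 e] e e] primD(1)[OF k(1)[OF e]]])
    also have "\<dots> \<le> 2 * (M\<^sup>2 * nsq (len G e) (restr G u e)) + 2 * (2 * M\<^sup>2 * nsq (len G e) (wdd u e) + 2 * L\<^sup>2 * nsq (len G e) (wd u e))"
      using Q_mult(2)[OF H1D(2)[OF u1 e] e e] k(2)[OF e] by (intro add_mono mult_left_mono) auto
    also have "\<dots> \<le> (4 * M\<^sup>2 + 4 * L\<^sup>2) * (nsq (len G e) (restr G u e) + nsq (len G e) (wd u e) + nsq (len G e) (wdd u e))"
    proof -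
      have "0 \<le> M\<^sup>2 * nsq (len G e) (restr G u e)" "0 \<le> L\<^sup>2 * nsq (len G e) (restr G u e)" "0 \<le> M\<^sup>2 * nsq (len G e) (wd u e)"
        "0 \<le> L\<^sup>2 * nsq (len G e) (wdd u e)" by simp_all
      then show ?thesis by (simp add: algebra_simps)
    qed
    finally show ?thesis .
  qed
  then have "fs_sq L2G ?F \<le> (4 * M\<^sup>2 + 4 * L\<^sup>2) * fs_sq H2t u"
    unfolding L2G_norm_sq H2t_norm_sq sum_distrib_left by (intro sum_mono)
  then show ?thesis using s by blast
qed

text \<open>Test the equation with u itself and combine coercivity with 2 \<alpha> (F, u) <= |F|^2 +
  \<alpha>^2 |u|^2; the last term is absorbed by the coercive side.\<close>

lemma strong_energy:
  assumes s: "strong u F" shows "\<alpha>\<^sup>2 * fs_sq H1t u \<le> fs_sq L2G F"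
proof -
  have uD: "u \<in> fs_carrier H2t" "u \<in> cont_space G" and F: "F \<in> fs_carrier L2G" using s by (auto simp: strong_def)
  note u1 = H2_subset_H1[OF uD(1)]
  have "2 * \<alpha> * (LINT x|leb (len G e). restr G F e x * restr G u e x)
    \<le> nsq (len G e) (restr G F e) + \<alpha>\<^sup>2 * nsq (len G e) (restr G u e)" if e: "e \<in> edges G" for e
  proof -
    have f: "restr G F e \<in> L2_int (len G e)" using F e by (simp add: L2G_carrier)
    note add = L2_int_add(2)[OF f L2_int_cmult[OF H1D(2)[OF u1 e], of "-\<alpha>"]]
    have "(LINT x|leb (len G e). restr G F e x * (- \<alpha> * restr G u e x))
      = - \<alpha> * (LINT x|leb (len G e). restr G F e x * restr G u e x)"
      by (subst integral_mult_right_zero[symmetric]) (simp add: mult_ac)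
    then have "nsq (len G e) (\<lambda>x. restr G F e x + - \<alpha> * restr G u e x)
      = nsq (len G e) (restr G F e) - 2 * \<alpha> * (LINT x|leb (len G e). restr G F e x * restr G u e x) + \<alpha>\<^sup>2 * nsq (len G e) (restr G u e)"
      unfolding add nsq_cmult by simp
    then show ?thesis using nsq_nonneg[of "len G e" "\<lambda>x. restr G F e x + - \<alpha> * restr G u e x"] by linarith
  qed
  then have "2 * \<alpha> * L2_inner G F u \<le> fs_sq L2G F + \<alpha>\<^sup>2 * fs_sq L2G u"
    unfolding L2_inner_def L2G_norm_sq sum_distrib_left sum.distrib[symmetric] by (intro sum_mono)
  moreover have "L2_inner G F u = form u u" using strong_form[OF s, of u] u1 uD(2) by simp
  moreover have "2 * \<alpha> * (\<alpha> * fs_sq H1t u) \<le> 2 * \<alpha> * form u u" using form_coercive[OF u1] al by (intro mult_left_mono) auto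
  moreover have "\<alpha>\<^sup>2 * fs_sq L2G u \<le> \<alpha>\<^sup>2 * fs_sq H1t u" by (intro mult_left_mono H1_norm_mono) simp
  ultimately show ?thesis by (simp add: power2_eq_square)
qed

text \<open>Regularity by division: u' is 1 / a times the flux, the flux has derivative \<kappa>^2 u
  - F, and 1 / a is Lipschitz with constant L / \<alpha>^2.\<close>

lemma strong_wdd:
  assumes s: "strong u F" and e: "e \<in> edges G"
  shows "nsq (len G e) (wdd u e) \<le> 4 / \<alpha>\<^sup>2 * nsq (len G e) (restr G F e)
    + (4 * M\<^sup>2 / \<alpha>\<^sup>2 + 2 * (L / \<alpha>\<^sup>2)\<^sup>2 * M\<^sup>2) * (nsq (len G e) (restr G u e) + nsq (len G e) (wd u e))"
proof -
  let ?l = "len G e" and ?g = "\<lambda>x. Q e x * restr G u e x - restr G F e x"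
  have u: "u \<in> fs_carrier H2t" and F: "restr G F e \<in> L2_int ?l" using s e by (auto simp: strong_def L2G_carrier)
  note u1 = H2_subset_H1[OF u]
  have p: "prim ?l (\<lambda>x. A e x * dtr u e x) ?g" using s e by (simp add: strong_def)
  have pos: "\<alpha> \<le> A e x" "0 < A e x" if "x \<in> {0..?l}" for x using A_bd[OF e that] al by auto
  have lip: "\<bar>1 / A e x - 1 / A e y\<bar> \<le> L / \<alpha>\<^sup>2 * \<bar>x - y\<bar>" if "x \<in> {0..?l}" "y \<in> {0..?l}" for x y
  proof -
    have "\<bar>1 / A e x - 1 / A e y\<bar> = \<bar>A e x - A e y\<bar> / (A e x * A e y)"
      using pos(2)[OF that(1)] pos(2)[OF that(2)] by (simp add: diff_frac_eq abs_mult abs_minus_commute)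
    also have "\<dots> \<le> L * \<bar>x - y\<bar> / (\<alpha> * \<alpha>)"
      using A_lip[OF e that] pos[OF that(1)] pos[OF that(2)] al by (intro frac_le mult_mono) auto
    finally show ?thesis by (simp add: power2_eq_square)
  qed
  have bd: "\<bar>1 / A e x\<bar> \<le> 1 / \<alpha>" if "x \<in> {0..?l}" for x using pos[OF that] al by (simp add: frac_le)
  obtain k where k: "prim ?l (\<lambda>x. 1 / A e x * (A e x * dtr u e x)) k"
    "nsq ?l k \<le> 2 * (1 / \<alpha>)\<^sup>2 * nsq ?l ?g + 2 * (L / \<alpha>\<^sup>2)\<^sup>2 * nsq ?l (\<lambda>x. A e x * dtr u e x)"
    by (rule prim_lipschitz_mult[OF edgeD(1)[OF e] lip bd p])
  have "prim ?l (dtr u e) k" by (rule prim_cong[OF k(1)]) (use pos(2) in force)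
  from prim_unique[OF H2D(4)[OF u e] this] have "nsq ?l k = nsq ?l (wdd u e)" by (rule nsq_cong_AE[OF H2D(3)[OF u e]])
  moreover have "nsq ?l ?g \<le> 2 * (M\<^sup>2 * nsq ?l (restr G u e)) + 2 * nsq ?l (restr G F e)"
    using nsq_diff_le[OF Q_mult(1)[OF H1D(2)[OF u1 e] e e] F] Q_mult(2)[OF H1D(2)[OF u1 e] e e] by linarith
  then have "2 * (1 / \<alpha>)\<^sup>2 * nsq ?l ?g \<le> 2 * (1 / \<alpha>)\<^sup>2 * (2 * (M\<^sup>2 * nsq ?l (restr G u e)) + 2 * nsq ?l (restr G F e))"
    by (intro mult_left_mono) auto
  moreover have "2 * (L / \<alpha>\<^sup>2)\<^sup>2 * nsq ?l (\<lambda>x. A e x * dtr u e x) \<le> 2 * (L / \<alpha>\<^sup>2)\<^sup>2 * (M\<^sup>2 * nsq ?l (wd u e))"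
    using A_mult(2)[OF prim_L2[OF H2D(4)[OF u e]] e e] unfolding nsq_dtr[OF u e] by (intro mult_left_mono) auto
  ultimately have "nsq ?l (wdd u e) \<le> 2 * (1 / \<alpha>)\<^sup>2 * (2 * (M\<^sup>2 * nsq ?l (restr G u e)) + 2 * nsq ?l (restr G F e))
    + 2 * (L / \<alpha>\<^sup>2)\<^sup>2 * (M\<^sup>2 * nsq ?l (wd u e))" using k(2) by linarith
  also have "\<dots> = 4 / \<alpha>\<^sup>2 * nsq ?l (restr G F e) + (4 * M\<^sup>2 / \<alpha>\<^sup>2 * nsq ?l (restr G u e) + 2 * (L / \<alpha>\<^sup>2)\<^sup>2 * M\<^sup>2 * nsq ?l (wd u e))"
    by (simp add: power_one_over algebra_simps)
  also have "\<dots> \<le> 4 / \<alpha>\<^sup>2 * nsq ?l (restr G F e)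
    + (4 * M\<^sup>2 / \<alpha>\<^sup>2 + 2 * (L / \<alpha>\<^sup>2)\<^sup>2 * M\<^sup>2) * (nsq ?l (restr G u e) + nsq ?l (wd u e))"
  proof -
    have "0 \<le> 4 * M\<^sup>2 / \<alpha>\<^sup>2 * nsq ?l (wd u e)" "0 \<le> 2 * (L / \<alpha>\<^sup>2)\<^sup>2 * M\<^sup>2 * nsq ?l (restr G u e)" by simp_all
    then show ?thesis by (simp add: distrib_left distrib_right)
  qed
  finally show ?thesis .
qed

lemma strong_estimate:
  "\<exists>C\<ge>0. \<forall>u F. strong u F \<longrightarrow> fs_sq H2t u \<le> C * fs_sq L2G F"
proof -
  define D where "D = 4 * M\<^sup>2 / \<alpha>\<^sup>2 + 2 * (L / \<alpha>\<^sup>2)\<^sup>2 * M\<^sup>2"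
  have D: "0 \<le> D" by (simp add: D_def)
  have "fs_sq H2t u \<le> (4 / \<alpha>\<^sup>2 + (1 + D) * (1 / \<alpha>\<^sup>2)) * fs_sq L2G F" if s: "strong u F" for u F
  proof -
    have "fs_sq H2t u = fs_sq H1t u + (\<Sum>e\<in>edges G. nsq (len G e) (wdd u e))"
      unfolding H1t_norm_sq H2t_norm_sq by (simp add: sum.distrib)
    also have "(\<Sum>e\<in>edges G. nsq (len G e) (wdd u e)) \<le> 4 / \<alpha>\<^sup>2 * fs_sq L2G F + D * fs_sq H1t u"
      unfolding H1t_norm_sq L2G_norm_sq sum_distrib_left sum.distrib[symmetric] D_def by (intro sum_mono strong_wdd[OF s])
    finally have 1: "fs_sq H2t u \<le> 4 / \<alpha>\<^sup>2 * fs_sq L2G F + (1 + D) * fs_sq H1t u" by (simp add: algebra_simps)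
    have "fs_sq H1t u \<le> 1 / \<alpha>\<^sup>2 * fs_sq L2G F" using strong_energy[OF s] al by (simp add: field_simps)
    then have "(1 + D) * fs_sq H1t u \<le> (1 + D) * (1 / \<alpha>\<^sup>2 * fs_sq L2G F)" using D by (intro mult_left_mono) auto
    then show ?thesis using 1 by (simp add: distrib_right mult.assoc)
  qed
  moreover have "0 \<le> 4 / \<alpha>\<^sup>2 + (1 + D) * (1 / \<alpha>\<^sup>2)" using D by simp
  ultimately show ?thesis by blast
qed

end

section \<open>The integer members of the spectral scale\<close>

locale spectral = elliptic G a \<kappa> \<alpha> M L for G :: "('v, 'e) metric_graph" and a \<kappa> :: "('v, 'e) point \<Rightarrow> real" and \<alpha> M L :: real +
  fixes K :: "nat set" and ev :: "nat \<Rightarrow> ('v, 'e) point \<Rightarrow> real" and ew :: "nat \<Rightarrow> real"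
  assumes basis: "orthonormal_eigenbasis G a \<kappa> K ev ew"
begin

lemma basisD:
  assumes "k \<in> K"
  shows "ev k \<in> fs_carrier DK" "ev k \<in> fs_carrier H1C" "ev k \<in> fs_carrier L2G" "strong (ev k) (\<lambda>p. ew k * ev k p)"
proof -
  have d: "ev k \<in> L0_dom G" "ae_on_graph G (\<lambda>p. L0 G a \<kappa> (ev k) p = ew k * ev k p)"
    using basis assms by (auto simp: orthonormal_eigenbasis_def)
  show DK: "ev k \<in> fs_carrier DK" using d(1) by (auto simp: L0_dom_def Kset_def)
  then show "ev k \<in> fs_carrier H1C" using H2_subset_H1 by auto
  then show L: "ev k \<in> fs_carrier L2G" using H1_subset_L2 by auto
  have "(\<lambda>p. ew k * ev k p + 0 * ev k p) \<in> fs_carrier L2G" by (rule quad_space_lin(1)[OF quad_L2G L L])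
  then have "(\<lambda>p. ew k * ev k p) \<in> fs_carrier L2G" by simp
  then show "strong (ev k) (\<lambda>p. ew k * ev k p)" by (rule L0_strong[OF d(1) _ d(2)])
qed

lemma orthonormal: "j \<in> K \<Longrightarrow> k \<in> K \<Longrightarrow> L2_inner G (ev j) (ev k) = (if j = k then 1 else 0)"
  using basis by (simp add: orthonormal_eigenbasis_def)

interpretation I: sym_form "fs_carrier L2G" "L2_inner G" by (rule inner_sym)
interpretation Fm: sym_form "fs_carrier H1t" form by (rule form_sym)

lemma inner_cmult: "u \<in> fs_carrier L2G \<Longrightarrow> w \<in> fs_carrier L2G \<Longrightarrow> L2_inner G (\<lambda>p. b * u p) w = b * L2_inner G u w"
  using I.B_lin[of u u w b 0] by simp

lemma form_ev: "k \<in> K \<Longrightarrow> u \<in> fs_carrier H1C \<Longrightarrow> form u (ev k) = ew k * L2_inner G u (ev k)"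
proof -
  assume k: "k \<in> K" and u: "u \<in> fs_carrier H1C"
  have "form u (ev k) = L2_inner G (\<lambda>p. ew k * ev k p) u" using strong_form[OF basisD(4)[OF k] u] Fm.B_sym by simp
  also have "\<dots> = ew k * L2_inner G u (ev k)"
    using inner_cmult[OF basisD(3)[OF k], of u] u H1_subset_L2 I.B_sym by simp
  finally show ?thesis .
qed

lemma form_orthogonal: "j \<in> K \<Longrightarrow> k \<in> K \<Longrightarrow> form (ev j) (ev k) = (if j = k then ew k else 0)"
  using form_ev[of k "ev j"] basisD(2)[of j] orthonormal by simp

lemma orthonormal_sub: "F \<subseteq> K \<Longrightarrow> j \<in> F \<Longrightarrow> k \<in> F \<Longrightarrow> L2_inner G (ev j) (ev k) = (if j = k then 1 else 0)"
  and form_orthogonal_sub: "F \<subseteq> K \<Longrightarrow> j \<in> F \<Longrightarrow> k \<in> F \<Longrightarrow> form (ev j) (ev k) = (if j = k then ew k else 0)"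
  by (rule orthonormal form_orthogonal; blast)+

lemma ew_ge: "k \<in> K \<Longrightarrow> \<alpha> \<le> ew k"
proof -
  assume k: "k \<in> K"
  have "1 = fs_sq L2G (ev k)" using orthonormal[OF k k] by (simp add: L2G_norm_sq L2_inner_self)
  also have "\<dots> \<le> fs_sq H1t (ev k)" by (rule H1_norm_mono)
  finally have "\<alpha> * 1 \<le> \<alpha> * fs_sq H1t (ev k)" using al by (intro mult_left_mono) auto
  also have "\<dots> \<le> form (ev k) (ev k)" using basisD(2)[OF k] by (intro form_coercive) simp
  finally show ?thesis using form_orthogonal[OF k k] by simp
qed

sublocale es: eigen_scale "fs_carrier L2G" "\<lambda>u k. L2_inner G u (ev k)" K ev ew \<alpha>
proof
  show "L2_inner G (\<lambda>p. b * u p + d * v p) (ev k) = b * L2_inner G u (ev k) + d * L2_inner G v (ev k)"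
    if "u \<in> fs_carrier L2G" "v \<in> fs_carrier L2G" "k \<in> K" for u v b d k
    by (rule I.B_lin[OF that(1,2) basisD(3)[OF that(3)]])
  show "L2_inner G (ev j) (ev k) = of_bool (j = k)" if "j \<in> K" "k \<in> K" for j k
    using orthonormal[OF that] by simp
qed (use I.W_lin I.W_zero basisD(3) al ew_ge in auto)

lemma dotH_scale: "dotH G K ev ew s = es.scale s"
  by (simp add: dotH_def es.scale_def)

lemma L2_norm_commute: "fs_norm L2G (\<lambda>p. f p - g p) = fs_norm L2G (\<lambda>p. g p - f p)"
proof -
  have "fs_sq L2G (\<lambda>p. f p - g p) = fs_sq L2G (\<lambda>p. g p - f p)"
    unfolding L2G_norm_sq restr_diff by (intro sum.cong refl nsq_diff_commute)
  then show ?thesis using quad_space_nonneg[OF quad_L2G] by (simp add: power2_eq_iff_nonneg)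
qed

text \<open>The bound for finite combinations makes the partial sums of the expansion Cauchy in X.
  They converge to u in L2 by the basis property, so closedness puts u into X with the limiting
  estimate.\<close>

lemma scale_embeds_closed:
  assumes q: "quad_space X" and cl: "L2_closed X" and C: "0 \<le> C"
    and b: "\<And>F b. finite F \<Longrightarrow> F \<subseteq> K \<Longrightarrow> (\<lambda>p. \<Sum>k\<in>F. b k * ev k p) \<in> fs_carrier X \<and>
      fs_sq X (\<lambda>p. \<Sum>k\<in>F. b k * ev k p) \<le> C * (\<Sum>k\<in>F. ew k powr s * (b k)\<^sup>2)"
  shows "es.scale s \<hookrightarrow> X"
proof (rule embedsI_sq)
  fix u assume u: "u \<in> fs_carrier (es.scale s)"
  define t where "t k = ew k powr s * (L2_inner G u (ev k))\<^sup>2" for k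
  define N where "N = fs_sq (es.scale s) u"
  \<comment> \<open>Initial segments of the index set, because the basis property is convergence in
    the order of the natural numbers.\<close>
  let ?F = "\<lambda>n. {k. k \<in> K \<and> k < n}"
  define S where "S n p = (\<Sum>k\<in>?F n. L2_inner G u (ev k) * ev k p)" for n p
  have F: "finite (?F n)" "?F n \<subseteq> K" for n by auto
  have uL: "u \<in> fs_carrier L2G" by (rule es.scaleD(1)[OF u])
  have t0: "0 \<le> t k" for k by (simp add: t_def)
  have tN: "sum t (?F n) \<le> N" for n unfolding t_def N_def by (rule es.scaleD(3)[OF u F])
  have SX: "S n \<in> fs_carrier X" and SN: "fs_sq X (S n) \<le> C * N" for n
  proof -
    note B = b[OF F[of n], of "\<lambda>k. L2_inner G u (ev k)", folded S_def t_def]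
    show "S n \<in> fs_carrier X" using B by (simp add: S_def[abs_def])
    have "fs_sq X (S n) \<le> C * sum t (?F n)" using B by (simp add: S_def[abs_def])
    also have "\<dots> \<le> C * N" using tN C by (intro mult_left_mono)
    finally show "fs_sq X (S n) \<le> C * N" .
  qed
  have inc: "sum t (?F n) - sum t (?F m) = sum t (?F n - ?F m)" "S n p - S m p = (\<Sum>k\<in>?F n - ?F m. L2_inner G u (ev k) * ev k p)"
    if "m \<le> n" for m n p
  proof -
    have "?F m \<subseteq> ?F n" using that by auto
    then show "sum t (?F n) - sum t (?F m) = sum t (?F n - ?F m)" "S n p - S m p = (\<Sum>k\<in>?F n - ?F m. L2_inner G u (ev k) * ev k p)"
      unfolding S_def by (simp_all add: sum_diff)
  qed
  \<comment> \<open>Both orders of subtraction are estimated, since symmetry of the norm under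
    negation is not among the properties of \<open>quad_space\<close>; the second uses the negated
    coefficients.\<close>
  have D: "fs_sq X (\<lambda>p. S n p - S m p) \<le> C * (sum t (?F n) - sum t (?F m)) \<and>
      fs_sq X (\<lambda>p. S m p - S n p) \<le> C * (sum t (?F n) - sum t (?F m))" if mn: "m \<le> n" for m n
  proof -
    have F': "finite (?F n - ?F m)" "?F n - ?F m \<subseteq> K" by auto
    have 2: "S m p - S n p = (\<Sum>k\<in>?F n - ?F m. (- L2_inner G u (ev k)) * ev k p)" for p
      using inc(2)[OF mn, of p] by (simp add: sum_negf)
    show ?thesis unfolding inc(1)[OF mn]
      using b[OF F', of "\<lambda>k. L2_inner G u (ev k)"] b[OF F', of "\<lambda>k. - L2_inner G u (ev k)"]
      unfolding inc(2)[OF mn] 2 t_def by simp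
  qed
  have "incseq (\<lambda>n. sum t (?F n))" using t0 by (intro incseq_SucI sum_mono2) auto
  then obtain l where "(\<lambda>n. sum t (?F n)) \<longlonglongrightarrow> l" by (rule incseq_convergent[of _ N]) (use tN in simp_all)
  then have Ca: "Cauchy (\<lambda>n. sum t (?F n))" by (rule LIMSEQ_imp_Cauchy)
  have "cauchy_in X S" unfolding cauchy_in_def
  proof (intro conjI allI impI)
    fix d :: real assume d: "0 < d"
    then have "0 < d / (C + 1)" using C by simp
    then obtain n0 where n0: "\<forall>m\<ge>n0. \<forall>n\<ge>n0. dist (sum t (?F m)) (sum t (?F n)) < d / (C + 1)"
      using Ca unfolding Cauchy_def by blast
    have *: "C * (sum t (?F n) - sum t (?F m)) < d" if "n0 \<le> m" "n0 \<le> n" for m n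
    proof -
      have "sum t (?F n) - sum t (?F m) \<le> d / (C + 1)" using n0[rule_format, OF that] by (simp add: dist_real_def)
      then have "C * (sum t (?F n) - sum t (?F m)) \<le> C * (d / (C + 1))" using C by (intro mult_left_mono)
      also have "\<dots> < d" using C d by (simp add: field_simps)
      finally show ?thesis .
    qed
    have "fs_sq X (\<lambda>p. S m p - S n p) < d" if mn: "n0 \<le> m" "n0 \<le> n" for m n
    proof (cases "m \<le> n")
      case True then show ?thesis using D[of m n] *[OF mn] by linarith
    next
      case False then show ?thesis using D[of n m] *[OF mn(2,1)] by linarith
    qed
    then show "\<exists>n0. \<forall>m\<ge>n0. \<forall>n\<ge>n0. fs_sq X (\<lambda>p. S m p - S n p) < d" by blast
  qed (rule SX)
  moreover have "(\<lambda>n. fs_sq L2G (\<lambda>p. S n p - u p)) \<longlonglongrightarrow> 0"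
  proof -
    have "(\<lambda>n. fs_norm L2G (\<lambda>p. u p - S n p)) \<longlonglongrightarrow> 0"
      using basis uL unfolding orthonormal_eigenbasis_def S_def by blast
    from tendsto_power[OF this, of 2] show ?thesis by (simp add: L2_norm_commute[of _ u])
  qed
  ultimately have uX: "u \<in> fs_carrier X" and lim: "(\<lambda>n. fs_sq X (\<lambda>p. S n p - u p)) \<longlonglongrightarrow> 0"
    using cl uL unfolding L2_closed_def by blast+
  have "fs_sq X u \<le> 2 * (C * N) + 2 * fs_sq X (\<lambda>p. S n p - u p)" for n
  proof -
    have "fs_sq X u \<le> 2 * fs_sq X (S n) + 2 * fs_sq X (\<lambda>p. S n p - u p)"
      using quad_space_lin(2)[OF q SX[of n] quad_space_diff(1)[OF q SX[of n] uX], of 1 "-1"] by simp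
    then show ?thesis using SN[of n] by linarith
  qed
  moreover have "(\<lambda>n. 2 * (C * N) + 2 * fs_sq X (\<lambda>p. S n p - u p)) \<longlonglongrightarrow> 2 * (C * N) + 2 * 0"
    by (intro tendsto_intros lim)
  ultimately have "fs_sq X u \<le> 2 * (C * N) + 2 * 0" by (intro LIMSEQ_le_const) blast+
  then show "fs_sq X u \<le> 2 * C * fs_sq (es.scale s) u" by (simp add: N_def)
  show "u \<in> fs_carrier X" by (rule uX)
qed simp

lemma embeds_scale_bessel:
  assumes q: "quad_space X" and s: "fs_carrier X \<subseteq> fs_carrier L2G"
    and b: "\<And>u F. u \<in> fs_carrier X \<Longrightarrow> finite F \<Longrightarrow> F \<subseteq> K \<Longrightarrow>
      (\<Sum>k\<in>F. ew k powr s * (L2_inner G u (ev k))\<^sup>2) \<le> C * fs_sq X u"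
  shows "X \<hookrightarrow> es.scale s"
proof (rule embedsI_sq)
  fix u assume u: "u \<in> fs_carrier X"
  then have uL: "u \<in> fs_carrier L2G" using s by auto
  show "u \<in> fs_carrier (es.scale s)" "fs_sq (es.scale s) u \<le> C * fs_sq X u"
    by (rule es.scaleI[OF uL b[OF u]]; assumption)+
qed (rule quad_space_nonneg[OF q])

lemma scale_0: "es.scale 0 \<cong> L2G"
  unfolding fs_iso_def
proof
  have e0: "ew k powr 0 = 1" if "k \<in> K" for k using es.ew_pos[OF that] by simp
  show "es.scale 0 \<hookrightarrow> L2G"
  proof (rule scale_embeds_closed[OF quad_L2G L2_closed_L2G, of 1])
    fix F b assume F: "finite F" "F \<subseteq> K"
    have "fs_sq L2G (\<lambda>p. \<Sum>k\<in>F. b k * ev k p) = (\<Sum>k\<in>F. 1 * (b k)\<^sup>2)"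
      unfolding L2G_norm_sq L2_inner_self[symmetric] using F basisD(3) orthonormal_sub[OF F(2)] by (intro I.B_orthogonal[where f = ev]) auto
    also have "\<dots> = 1 * (\<Sum>k\<in>F. ew k powr 0 * (b k)\<^sup>2)" by (simp only: mult_1 cong: sum.cong) (intro sum.cong refl, simp only: e0[OF subsetD[OF F(2)]] mult_1)
    finally show "(\<lambda>p. \<Sum>k\<in>F. b k * ev k p) \<in> fs_carrier L2G \<and>
      fs_sq L2G (\<lambda>p. \<Sum>k\<in>F. b k * ev k p) \<le> 1 * (\<Sum>k\<in>F. ew k powr 0 * (b k)\<^sup>2)"
      using es.finite_combination(1)[OF F] by simp
  qed simp
  show "L2G \<hookrightarrow> es.scale 0"
  proof (rule embeds_scale_bessel[OF quad_L2G, where C = 1])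
    fix u F assume u: "u \<in> fs_carrier L2G" and F: "finite F" "F \<subseteq> K"
    have "(\<Sum>k\<in>F. ew k powr 0 * (L2_inner G u (ev k))\<^sup>2) = (\<Sum>k\<in>F. 1 * (L2_inner G u (ev k))\<^sup>2)"
      by (intro sum.cong refl arg_cong2[where f = "(*)"] e0 subsetD[OF F(2)])
    also have "\<dots> \<le> L2_inner G u u" using F basisD(3) orthonormal_sub[OF F(2)] u by (intro I.bessel[where f = ev]) auto
    finally show "(\<Sum>k\<in>F. ew k powr 0 * (L2_inner G u (ev k))\<^sup>2) \<le> 1 * fs_sq L2G u"
      by (simp add: L2G_norm_sq L2_inner_self)
  qed simp
qed

text \<open>In eigenfunction coordinates the energy form is the weighted sum with the eigenvalues.
  Coercivity gives the constant 1 / \<alpha> in one direction; Bessel's inequality and boundedness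
  of the form give M in the other.\<close>

lemma scale_1: "es.scale 1 \<cong> H1C"
  unfolding fs_iso_def
proof
  have q: "quad_space H1C" by (rule quad_HC) simp
  have e1: "ew k powr 1 = ew k" if "k \<in> K" for k using es.ew_pos[OF that] by simp
  have evH: "ev k \<in> fs_carrier H1t" if "k \<in> K" for k using basisD(2)[OF that] by simp
  show "es.scale 1 \<hookrightarrow> H1C"
  proof (rule scale_embeds_closed[OF q L2_closed_H1C, of "1 / \<alpha>"])
    fix F b assume F: "finite F" "F \<subseteq> K"
    let ?s = "\<lambda>p. \<Sum>k\<in>F. b k * ev k p"
    have s: "?s \<in> fs_carrier H1C" using F basisD(2) by (intro conjunct1[OF quad_space_sum[OF q]]) auto
    have "\<alpha> * fs_sq H1t ?s \<le> form ?s ?s" using s by (intro form_coercive) simp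
    also have "\<dots> = (\<Sum>k\<in>F. ew k * (b k)\<^sup>2)" using F evH form_orthogonal_sub[OF F(2)] by (intro Fm.B_orthogonal[where f = ev]) auto
    also have "\<dots> = (\<Sum>k\<in>F. ew k powr 1 * (b k)\<^sup>2)" using F e1 by (intro sum.cong) auto
    finally have "fs_sq H1t ?s \<le> 1 / \<alpha> * (\<Sum>k\<in>F. ew k powr 1 * (b k)\<^sup>2)"
      using al by (simp add: pos_le_divide_eq mult.commute)
    then show "?s \<in> fs_carrier H1C \<and> fs_sq H1C ?s \<le> 1 / \<alpha> * (\<Sum>k\<in>F. ew k powr 1 * (b k)\<^sup>2)"
      using s by simp
  qed (use al in simp)
  show "H1C \<hookrightarrow> es.scale 1"
  proof (rule embeds_scale_bessel[OF q, where C = M])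
    show "fs_carrier H1C \<subseteq> fs_carrier L2G" using H1_subset_L2 by auto
    fix u F assume u: "u \<in> fs_carrier H1C" and F: "finite F" "F \<subseteq> K"
    have "(\<Sum>k\<in>F. ew k powr 1 * (L2_inner G u (ev k))\<^sup>2) = (\<Sum>k\<in>F. ew k * (L2_inner G u (ev k))\<^sup>2)"
      using F e1 by (intro sum.cong) auto
    also have "\<dots> \<le> form u u" using F evH form_orthogonal_sub[OF F(2)] form_ev[OF _ u] u by (intro Fm.bessel[where f = ev]) auto
    also have "\<dots> \<le> M * fs_sq H1t u" using u by (intro form_bounded) simp
    finally show "(\<Sum>k\<in>F. ew k powr 1 * (L2_inner G u (ev k))\<^sup>2) \<le> M * fs_sq H1C u" by simp
  qed
qed

text \<open>L0 multiplies coefficients by the eigenvalues, so the weighted sum with exponent 2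
  measures L0 u in L2. Elliptic regularity bounds H^2 by it, and the explicit formula for L0 u gives
  the converse.\<close>

lemma scale_2: "es.scale 2 \<cong> DK"
  unfolding fs_iso_def
proof
  have e2: "ew k powr 2 = (ew k)\<^sup>2" if "k \<in> K" for k using es.ew_pos[OF that] by simp
  obtain C where C: "0 \<le> C" "\<forall>u F. strong u F \<longrightarrow> fs_sq H2t u \<le> C * fs_sq L2G F" using strong_estimate by (elim exE conjE)
  show "es.scale 2 \<hookrightarrow> DK"
  proof (rule scale_embeds_closed[OF quad_DK L2_closed_DK C(1)])
    fix F b assume F: "finite F" "F \<subseteq> K"
    let ?s = "\<lambda>p. \<Sum>k\<in>F. b k * ev k p" and ?f = "\<lambda>p. \<Sum>k\<in>F. (b k * ew k) * ev k p"
    have "strong ?s (\<lambda>p. \<Sum>k\<in>F. b k * (ew k * ev k p))" using F basisD(4) by (intro strong_sum) auto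
    then have s: "strong ?s ?f" by (simp add: mult.assoc)
    have "fs_sq L2G ?f = (\<Sum>k\<in>F. 1 * (b k * ew k)\<^sup>2)"
      unfolding L2G_norm_sq L2_inner_self[symmetric] using F basisD(3) orthonormal_sub[OF F(2)] by (intro I.B_orthogonal[where f = ev]) auto
    also have "\<dots> = (\<Sum>k\<in>F. ew k powr 2 * (b k)\<^sup>2)" using F e2 by (intro sum.cong) (auto simp: power_mult_distrib)
    finally have "fs_sq H2t ?s \<le> C * (\<Sum>k\<in>F. ew k powr 2 * (b k)\<^sup>2)" using C(2)[rule_format, OF s] by simp
    then show "?s \<in> fs_carrier DK \<and> fs_sq DK ?s \<le> C * (\<Sum>k\<in>F. ew k powr 2 * (b k)\<^sup>2)"
      using s by (simp add: strong_def)
  qed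
  show "DK \<hookrightarrow> es.scale 2"
  proof (rule embeds_scale_bessel[OF quad_DK, where C = "4 * M\<^sup>2 + 4 * L\<^sup>2"])
    show "fs_carrier DK \<subseteq> fs_carrier L2G" using H2_subset_H1 H1_subset_L2 by auto
    fix u F assume u: "u \<in> fs_carrier DK" and F: "finite F" "F \<subseteq> K"
    obtain f where f: "strong u f" "fs_sq L2G f \<le> (4 * M\<^sup>2 + 4 * L\<^sup>2) * fs_sq H2t u"
      using strong_exists[OF u] by (elim exE conjE)
    have fL: "f \<in> fs_carrier L2G" using f(1) by (simp add: strong_def)
    have u1: "u \<in> fs_carrier H1C" using u H2_subset_H1 by simp
    have c: "L2_inner G f (ev k) = ew k * L2_inner G u (ev k)" if "k \<in> K" for k
      using strong_form[OF f(1) basisD(2)[OF that]] form_ev[OF that u1] by simp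
    have "(\<Sum>k\<in>F. ew k powr 2 * (L2_inner G u (ev k))\<^sup>2) = (\<Sum>k\<in>F. 1 * (ew k * L2_inner G u (ev k))\<^sup>2)"
      using F e2 by (intro sum.cong) (auto simp: power_mult_distrib)
    also have "\<dots> \<le> L2_inner G f f" using F basisD(3) orthonormal_sub[OF F(2)] fL c by (intro I.bessel[where f = ev]) auto
    also have "\<dots> = fs_sq L2G f" by (simp add: L2G_norm_sq L2_inner_self)
    finally show "(\<Sum>k\<in>F. ew k powr 2 * (L2_inner G u (ev k))\<^sup>2) \<le> (4 * M\<^sup>2 + 4 * L\<^sup>2) * fs_sq DK u" using f(2) by simp
  qed
qed

end

section \<open>Combination of the comparisons into the displayed isomorphisms\<close>

lemma embeds_inter: "X \<hookrightarrow> Y \<Longrightarrow> fs_carrier X \<subseteq> S \<Longrightarrow> X \<hookrightarrow> Y \<sqinter>\<^sub>s S"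
  by (auto simp: embeds_def fs_inter_def)

lemma embeds_inter_mono: "X \<hookrightarrow> Y \<Longrightarrow> X \<sqinter>\<^sub>s S \<hookrightarrow> Y \<sqinter>\<^sub>s S"
  by (auto simp: embeds_def fs_inter_def)

lemma fs_iso_inter: "X \<cong> Y \<Longrightarrow> X \<sqinter>\<^sub>s S \<cong> Y \<sqinter>\<^sub>s S"
  by (simp add: fs_iso_def embeds_inter_mono)

lemma fs_iso_refl: "X \<cong> X"
  unfolding fs_iso_def embeds_def by (intro conjI exI[of _ 1]) auto

lemma fs_iso_trans:
  assumes "X \<cong> Y" "Y \<cong> Z" and "\<And>u. 0 \<le> fs_norm X u" "\<And>u. 0 \<le> fs_norm Y u" "\<And>u. 0 \<le> fs_norm Z u"
  shows "X \<cong> Z"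
  using assms(1,2) unfolding fs_iso_def by (intro conjI embeds_trans[of X Y Z] embeds_trans[of Z Y X] assms(3-5)) simp_all

lemma interp_iso:
  assumes "couple X0 X1" "couple Y0 Y1" "0 < \<theta>" "\<theta> < 1" "X0 \<cong> Y0" "X1 \<cong> Y1"
  shows "interp X0 X1 \<theta> \<cong> interp Y0 Y1 \<theta>"
  using assms by (simp add: fs_iso_def interp_mono)

context compact_graph
begin

lemma norms_nonneg [simp]: "0 \<le> fs_norm L2G u" "0 \<le> fs_norm H1t u" "0 \<le> fs_norm H2t u"
  using quad_space_nonneg[OF quad_L2G, of u] quad_space_nonneg[OF quad_Ht[of 1], of u] quad_space_nonneg[OF quad_Ht[of 2], of u]
  by simp_all

lemma Hs_Htilde_small: assumes "0 < \<beta>" "\<beta> < 1/2" shows "Hs G \<beta> \<cong> Htilde G \<beta>"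
proof -
  have "interp L2G H1t \<beta> \<sqinter>\<^sub>s UNIV \<hookrightarrow> interp L2G H1C \<beta>" using assms by (intro interp_H1t_embeds) auto
  then show ?thesis using assms interp_H1C_embeds(1)[of \<beta>] by (simp add: Hs_def Htilde_def fs_iso_def fs_inter_UNIV)
qed

lemma Hs_Htilde_cont:
  assumes "1/2 < \<beta>" "\<beta> \<le> 2" shows "Hs G \<beta> \<cong> Htilde G \<beta> \<sqinter>\<^sub>s cont_space G"
proof -
  consider "\<beta> < 1" | "\<beta> = 1 \<or> \<beta> = 2" | "1 < \<beta>" "\<beta> < 2" using assms by linarith
  then show ?thesis
  proof cases
    case 1
    have "interp L2G H1t \<beta> \<sqinter>\<^sub>s cont_space G \<hookrightarrow> interp L2G H1C \<beta>" using assms 1 by (intro interp_H1t_embeds) auto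
    moreover have "interp L2G H1C \<beta> \<hookrightarrow> interp L2G H1t \<beta> \<sqinter>\<^sub>s cont_space G"
      using assms 1 interp_H1C_cont[of \<beta>] by (intro embeds_inter interp_H1C_embeds) auto
    ultimately show ?thesis using 1 assms by (simp add: Hs_def Htilde_def fs_iso_def)
  next
    case 2
    then show ?thesis by (auto simp: Hs_def Htilde_def fs_iso_refl)
  next
    case 3
    have "interp H1t H2t (\<beta> - 1) \<sqinter>\<^sub>s cont_space G \<hookrightarrow> interp H1C H2C (\<beta> - 1)" using 3 by (intro interp_H2t_embeds) auto
    moreover have "interp H1C H2C (\<beta> - 1) \<hookrightarrow> interp H1t H2t (\<beta> - 1) \<sqinter>\<^sub>s cont_space G"
      using 3 by (intro embeds_inter interp_H1C_embeds) (auto simp: interp_def)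
    ultimately show ?thesis using 3 by (simp add: Hs_def Htilde_def fs_iso_def)
  qed
qed

lemma K_space_eq: "K_space G \<beta> = fs_carrier (Htilde G \<beta>) \<inter> Kset"
  by (auto simp: K_space_def Kset_def)

lemma interp_DK_iso:
  assumes \<theta>: "0 < \<theta>" "\<theta> < 1/2" shows "interp H1C DK \<theta> \<cong> interp H1C H2C \<theta>"
proof -
  have "interp H1C H2C \<theta> \<sqinter>\<^sub>s UNIV \<hookrightarrow> interp H1C DK \<theta>" using \<theta> by (intro interp_kirchhoff_embeds) auto
  then show ?thesis using \<theta> interp_DK_embeds[of \<theta>] by (simp add: fs_iso_def fs_inter_UNIV)
qed

text \<open>Above 1/2 the Kirchhoff sums of the approximants converge, so the conditions hold for
  the limit. Membership in the decoupled space, which is part of \<open>K_space\<close>, comes from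
  the chain of embeddings.\<close>

lemma interp_DK_iso_Kirchhoff:
  assumes \<theta>: "1/2 < \<theta>" "\<theta> < 1" shows "interp H1C DK \<theta> \<cong> interp H1C H2C \<theta> \<sqinter>\<^sub>s K_space G (\<theta> + 1)"
proof -
  have \<theta>0: "0 < \<theta>" using \<theta> by simp
  have t: "Htilde G (\<theta> + 1) = interp H1t H2t \<theta>" using \<theta> by (simp add: Htilde_def)
  have "fs_carrier (interp H1C DK \<theta>) \<subseteq> fs_carrier (interp H1C H2C \<theta>)"
    using interp_DK_embeds[OF \<theta>0 \<theta>(2)] unfolding embeds_def by (rule conjunct1)
  also have "\<dots> \<subseteq> fs_carrier (Htilde G (\<theta> + 1))"
    using interp_H1C_embeds(2)[OF \<theta>0 \<theta>(2)] unfolding embeds_def t by (rule conjunct1)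
  finally have "fs_carrier (interp H1C DK \<theta>) \<subseteq> K_space G (\<theta> + 1)"
    unfolding K_space_eq using interp_DK_kirchhoff[OF \<theta>] by auto
  then have "interp H1C DK \<theta> \<hookrightarrow> interp H1C H2C \<theta> \<sqinter>\<^sub>s K_space G (\<theta> + 1)" by (rule embeds_inter[OF interp_DK_embeds[OF \<theta>0 \<theta>(2)]])
  moreover have "interp H1C H2C \<theta> \<sqinter>\<^sub>s K_space G (\<theta> + 1) \<hookrightarrow> interp H1C DK \<theta>"
    using \<theta> by (intro interp_kirchhoff_embeds) (auto simp: K_space_eq)
  ultimately show ?thesis by (simp add: fs_iso_def)
qed

text \<open>Compactness of each edge and positivity of \<open>a\<close> give a positive minimum per
  edge, and there are finitely many edges.\<close>

lemma elliptic_exists: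
  assumes \<kappa>: "\<kappa> \<in> Linf G" "0 < \<kappa>\<^sub>0" "ae_on_graph G (\<lambda>p. \<kappa>\<^sub>0 \<le> \<kappa> p)"
    and a: "lipschitz_on_graph G a" "\<forall>p\<in>points G. 0 < a p"
  shows "\<exists>\<alpha> M L. elliptic G a \<kappa> \<alpha> M L"
proof -
  obtain L0 where L0: "\<forall>p\<in>points G. \<forall>q\<in>points G. \<bar>a p - a q\<bar> \<le> L0 * gdist G p q"
    using a(1) unfolding lipschitz_on_graph_def by (elim exE)
  define L where "L = max 0 L0"
  have lip: "\<bar>restr G a e x - restr G a e y\<bar> \<le> L * \<bar>x - y\<bar>"
    if e: "e \<in> edges G" "x \<in> {0..len G e}" "y \<in> {0..len G e}" for e x y
  proof -
    have p: "ep e x \<in> points G" "ep e y \<in> points G" using e by (simp_all only: ep_in_points)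
    have "\<bar>restr G a e x - restr G a e y\<bar> \<le> L0 * gdist G (ep e x) (ep e y)"
      using L0 p by (simp add: restr_def)
    also have "\<dots> \<le> L * gdist G (ep e x) (ep e y)" using gdist_nonneg[OF p] by (intro mult_right_mono) (auto simp: L_def)
    also have "\<dots> \<le> L * \<bar>x - y\<bar>" by (intro mult_left_mono gdist_edge_le[OF e]) (simp add: L_def)
    finally show ?thesis .
  qed
  have ex: "\<exists>m. \<exists>n. 0 < m \<and> (\<forall>x\<in>{0..len G e}. m \<le> restr G a e x \<and> restr G a e x \<le> n)" if e: "e \<in> edges G" for e
  proof -
    have c: "continuous_on {0..len G e} (restr G a e)"
      by (rule lipschitz_prim[OF edgeD(1)[OF e] lip[OF e]]) (auto intro: prim_continuous)
    have ne: "{0..len G e} \<noteq> {}" using edgeD(1)[OF e] by simp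
    obtain x where x: "x \<in> {0..len G e}" "\<forall>y\<in>{0..len G e}. restr G a e x \<le> restr G a e y"
      using continuous_attains_inf[OF compact_Icc ne c] by blast
    obtain z where z: "z \<in> {0..len G e}" "\<forall>y\<in>{0..len G e}. restr G a e y \<le> restr G a e z"
      using continuous_attains_sup[OF compact_Icc ne c] by blast
    have "0 < restr G a e x" using a(2) ep_in_points[OF e x(1)] by (simp add: restr_def)
    then show ?thesis using x(2) z(2) by blast
  qed
  then have "\<forall>e\<in>edges G. \<exists>m. \<exists>n. 0 < m \<and> (\<forall>x\<in>{0..len G e}. m \<le> restr G a e x \<and> restr G a e x \<le> n)" by blast
  then obtain m n where mn: "\<forall>e\<in>edges G. 0 < m e \<and> (\<forall>x\<in>{0..len G e}. m e \<le> restr G a e x \<and> restr G a e x \<le> n e)"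
    unfolding bchoice_iff by (elim exE)
  have mea: "restr G \<kappa> e \<in> borel_measurable (leb (len G e))" if "e \<in> edges G" for e using \<kappa>(1) that by (simp add: Linf_def)
  obtain B where B: "ae_on_graph G (\<lambda>p. \<bar>\<kappa> p\<bar> \<le> B)" using \<kappa>(1) by (auto simp: Linf_def)
  \<comment> \<open>Inserting \<open>\<kappa>\<^sub>0\<^sup>2\<close> makes \<alpha> a bound for the
    potential too and keeps the set nonempty when there are no edges.\<close>
  define \<alpha> where "\<alpha> = Min (insert (\<kappa>\<^sub>0\<^sup>2) (m ` edges G))"
  define M where "M = Max (insert (B\<^sup>2) (n ` edges G))"
  have al: "0 < \<alpha>" "\<alpha> \<le> \<kappa>\<^sub>0\<^sup>2" "e \<in> edges G \<Longrightarrow> \<alpha> \<le> m e" for e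
    using \<kappa>(2) mn fin_E by (auto simp: \<alpha>_def)
  have M: "B\<^sup>2 \<le> M" "e \<in> edges G \<Longrightarrow> n e \<le> M" for e using fin_E by (auto simp: M_def)
  have "elliptic G a \<kappa> \<alpha> M L"
  proof (unfold_locales)
    show "0 < \<alpha>" by (rule al)
    fix e assume e: "e \<in> edges G"
    show "(\<lambda>x. (restr G \<kappa> e x)\<^sup>2) \<in> borel_measurable (leb (len G e))" using mea[OF e] by simp
    have "AE x in leb (len G e). \<kappa>\<^sub>0 \<le> restr G \<kappa> e x" "AE x in leb (len G e). \<bar>restr G \<kappa> e x\<bar> \<le> B"
      using \<kappa>(3) B e by (auto simp: ae_on_graph_def restr_def)
    then show "AE x in leb (len G e). \<alpha> \<le> (restr G \<kappa> e x)\<^sup>2 \<and> (restr G \<kappa> e x)\<^sup>2 \<le> M"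
    proof eventually_elim
      case (elim x)
      have "\<kappa>\<^sub>0\<^sup>2 \<le> (restr G \<kappa> e x)\<^sup>2" using elim(1) \<kappa>(2) by (intro power_mono) auto
      moreover have "\<bar>restr G \<kappa> e x\<bar>\<^sup>2 \<le> B\<^sup>2" using elim(2) by (intro power_mono) auto
      ultimately show ?case using al(2) M(1) by simp
    qed
    fix x assume x: "x \<in> {0..len G e}"
    show "\<alpha> \<le> restr G a e x \<and> restr G a e x \<le> M"
      using mn e x al(3)[OF e] M(2)[OF e] by force
    fix y assume "y \<in> {0..len G e}"
    then show "\<bar>restr G a e x - restr G a e y\<bar> \<le> L * \<bar>x - y\<bar>" by (rule lip[OF e x])
  qed
  then show ?thesis by blast
qed

end

context spectral
begin

text \<open>Both sides interpolate the same couple up to isomorphism, without any correction of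
  traces. Hence no exponent in (0, 1) is exceptional, and \<beta> = 1/2 is included.\<close>

lemma dotH_Hs_small:
  assumes \<beta>: "0 < \<beta>" "\<beta> < 1" shows "dotH G K ev ew \<beta> \<cong> Hs G \<beta>"
proof -
  have "es.scale \<beta> \<cong> interp (es.scale 0) (es.scale 1) \<beta>"
    using es.scale_embeds_interp[OF \<beta>, of 0] es.interp_embeds_scale[OF \<beta>, of 0] by (simp add: fs_iso_def)
  moreover have "interp (es.scale 0) (es.scale 1) \<beta> \<cong> interp L2G H1C \<beta>"
    using \<beta> by (intro interp_iso es.couple_scale couples scale_0 scale_1) auto
  ultimately have "es.scale \<beta> \<cong> interp L2G H1C \<beta>" by (rule fs_iso_trans) simp_all
  then show ?thesis using \<beta> by (simp add: dotH_scale Hs_def)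
qed

lemma dotH_interp_DK:
  assumes \<beta>: "1 < \<beta>" "\<beta> < 2" shows "dotH G K ev ew \<beta> \<cong> interp H1C DK (\<beta> - 1)"
proof -
  have \<theta>: "0 < \<beta> - 1" "\<beta> - 1 < 1" using \<beta> by auto
  have "es.scale \<beta> \<cong> interp (es.scale 1) (es.scale 2) (\<beta> - 1)"
    using es.scale_embeds_interp[OF \<theta>, of 1] es.interp_embeds_scale[OF \<theta>, of 1] by (simp add: fs_iso_def)
  moreover have "interp (es.scale 1) (es.scale 2) (\<beta> - 1) \<cong> interp H1C DK (\<beta> - 1)"
    using \<theta> by (intro interp_iso es.couple_scale couple_DK scale_1 scale_2) auto
  ultimately have "es.scale \<beta> \<cong> interp H1C DK (\<beta> - 1)" by (rule fs_iso_trans) simp_all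
  then show ?thesis by (simp add: dotH_scale)
qed

text \<open>Past \<beta> = 1 the second space is the operator domain, but for \<beta> - 1 < 1/2 the
  Kirchhoff conditions leave no trace in the interpolation space.\<close>

lemma dotH_Hs:
  assumes \<beta>: "1/2 < \<beta>" "\<beta> < 3/2" shows "dotH G K ev ew \<beta> \<cong> Hs G \<beta>"
proof -
  consider "\<beta> < 1" | "\<beta> = 1" | "1 < \<beta>" by linarith
  then show ?thesis
  proof cases
    case 1 then show ?thesis using \<beta> by (intro dotH_Hs_small) auto
  next
    case 2 then show ?thesis using scale_1 by (simp add: dotH_scale Hs_def)
  next
    case 3
    have "dotH G K ev ew \<beta> \<cong> interp H1C H2C (\<beta> - 1)"
      by (rule fs_iso_trans[OF dotH_interp_DK interp_DK_iso]) (use 3 \<beta> in \<open>simp_all add: dotH_scale\<close>)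
    then show ?thesis using 3 \<beta> by (simp add: Hs_def)
  qed
qed

lemma dotH_Hs_Kirchhoff:
  assumes \<beta>: "3/2 < \<beta>" "\<beta> \<le> 2" shows "dotH G K ev ew \<beta> \<cong> Hs G \<beta> \<sqinter>\<^sub>s K_space G \<beta>"
proof (cases "\<beta> = 2")
  case True
  have "Hs G 2 \<sqinter>\<^sub>s K_space G 2 = DK" by (auto simp: Hs_def Htilde_def K_space_eq fs_inter_def)
  then show ?thesis using scale_2 True by (simp add: dotH_scale)
next
  case False
  have "dotH G K ev ew \<beta> \<cong> interp H1C H2C (\<beta> - 1) \<sqinter>\<^sub>s K_space G (\<beta> - 1 + 1)"
    by (rule fs_iso_trans[OF dotH_interp_DK interp_DK_iso_Kirchhoff]) (use False \<beta> in \<open>simp_all add: dotH_scale\<close>)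
  then show ?thesis using False \<beta> by (simp add: Hs_def)
qed

text \<open>From \<beta> = 1 on, the scale embeds into continuous H^1, whose exponent 1/2 is used
  for all larger \<beta>; below 1 the interpolation space is treated directly.\<close>

lemma dotH_embeds_holder:
  assumes \<beta>: "1/2 < \<beta>" shows "dotH G K ev ew \<beta> \<hookrightarrow> holder_space G (if \<beta> \<le> 1 then \<beta> - 1/2 else 1/2)"
proof (cases "\<beta> < 1")
  case True
  have "dotH G K ev ew \<beta> \<hookrightarrow> interp L2G H1C \<beta>"
    using dotH_Hs_small[of \<beta>] \<beta> True by (simp add: fs_iso_def Hs_def)
  from embeds_trans[OF this interp_embeds_holder[OF \<beta> True]] show ?thesis
    using True by (simp add: dotH_scale holder_norm_nonneg)
next
  case False
  have "es.scale \<beta> \<hookrightarrow> es.scale 1" using False by (intro es.scale_embeds) simp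
  moreover have "es.scale 1 \<hookrightarrow> H1C" using scale_1 by (simp add: fs_iso_def)
  ultimately have "es.scale \<beta> \<hookrightarrow> H1C" by (rule embeds_trans) simp_all
  from embeds_trans[OF this H1C_embeds_holder] have "es.scale \<beta> \<hookrightarrow> holder_space G (1/2)" by (simp add: holder_norm_nonneg)
  moreover have "(if \<beta> \<le> 1 then \<beta> - 1/2 else 1/2) = 1/2" using False by auto
  ultimately show ?thesis by (simp only: dotH_scale)
qed

end

theorem theorem4p1:
  fixes G :: "('v, 'e) metric_graph"
    and a \<kappa> :: "('v, 'e) point \<Rightarrow> real"
    and \<kappa>\<^sub>0 \<beta> :: real
    and K :: "nat set"
    and ev :: "nat \<Rightarrow> ('v, 'e) point \<Rightarrow> real"
    and ew :: "nat \<Rightarrow> real"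
  assumes "compact_metric_graph G"
    and "connected_graph G"
    and "\<kappa> \<in> Linf G"
    and "0 < \<kappa>\<^sub>0"
    and "ae_on_graph G (\<lambda>p. \<kappa>\<^sub>0 \<le> \<kappa> p)"
    and "lipschitz_on_graph G a"
    and "\<forall>p\<in>points G. 0 < a p"
    and "orthonormal_eigenbasis G a \<kappa> K ev ew"
    and "0 < \<beta>" "\<beta> \<le> 2" "\<beta> \<noteq> 3/2"
  shows "dotH G K ev ew (1/2) \<cong> Hs G (1/2) \<and>
    (\<beta> < 1/2 \<longrightarrow> dotH G K ev ew \<beta> \<cong> Hs G \<beta> \<and> Hs G \<beta> \<cong> Htilde G \<beta>) \<and>
    (1/2 < \<beta> \<and> \<beta> < 3/2 \<longrightarrow>
      dotH G K ev ew \<beta> \<cong> Hs G \<beta> \<and> Hs G \<beta> \<cong> Htilde G \<beta> \<sqinter>\<^sub>s cont_space G) \<and>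
    (3/2 < \<beta> \<longrightarrow>
      dotH G K ev ew \<beta> \<cong> Hs G \<beta> \<sqinter>\<^sub>s K_space G \<beta> \<and>
      Hs G \<beta> \<sqinter>\<^sub>s K_space G \<beta> \<cong> Htilde G \<beta> \<sqinter>\<^sub>s cont_space G \<sqinter>\<^sub>s K_space G \<beta>) \<and>
    (1/2 < \<beta> \<longrightarrow>
      dotH G K ev ew \<beta> \<hookrightarrow> holder_space G (if \<beta> \<le> 1 then \<beta> - 1/2 else 1/2))"
proof -
  interpret compact_graph G by unfold_locales (fact assms)+
  obtain \<alpha> M L where "elliptic G a \<kappa> \<alpha> M L" using elliptic_exists[OF assms(3-7)] by (elim exE)
  then interpret elliptic G a \<kappa> \<alpha> M L .
  interpret spectral G a \<kappa> \<alpha> M L K ev ew by unfold_locales (fact assms)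
  show ?thesis
    using assms(9,10) by (intro conjI impI dotH_Hs_small dotH_Hs Hs_Htilde_small Hs_Htilde_cont dotH_Hs_Kirchhoff
      fs_iso_inter dotH_embeds_holder) auto
qed

end
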